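(* For a connected signed quiver $Q^\sigma$ the following three conditions are equivalent: (i) $Q^\sigma$ is finite; (ii) $\widetilde{Q}$ is finite (i.e. the quiver $\widetilde{Q}$ has finitely many isomorphism classes of indecomposable representations); (iii) $Q^\sigma$ is either a finite quiver (with $\sigma=0$ and no twins), or is one of the following signed quivers on a chain of $n$ vertices $1,\dots,n$ with exactly one arrow, of arbitrary direction, between $k$ and $k+1$ for each $1\le k\le n-1$ and no other arrows: - $B_n$: $\sigma(n)=+1$, all other vertices and all arrows are unsigned, no twins; - $B_{n,+}$: $n-1$ and $n$ are twins, the arrow between them has sign $+1$, everything else is unsigned; - $C_n$: $\sigma(n)=-1$, all other vertices and all arrows are unsigned, no twins; - $C_{n,-}$: $n-1$ and $n$ are twins, the arrow between them has sign $-1$, everything else is unsigned.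
   Context: $\mathbf{k}$ is an algebraically closed field of characteristic $0$; vector spaces are finite-dimensional. A quiver $Q$ is a finite oriented graph with vertex set $Q_0$ and arrow set $Q_1$; $t\varphi,h\varphi$ are the tail and head of an arrow $\varphi$. A representation $V$ assigns a $\mathbf{k}$-space $V(i)$ to each vertex and a linear map $V(\varphi):V(t\varphi)\to V(h\varphi)$ to each arrow. A quiver is finite if it has finitely many isomorphism classes of indecomposable representations. Signed quiver: a signed quiver $Q^\sigma$ is a quiver $Q$ with a function $\sigma:Q_0\sqcup Q_1\to\{-1,0,1\}$ and a choice of $m\ge 0$ disjoint pairs $\{i,i^*\}$ of distinct vertices, called twins. A vertex or arrow is called signed if its $\sigma$ is nonzero, unsigned otherwise. Axioms: (1) twins are unsigned; (2) a non-loop arrow is signed iff its two endpoints are twins of each other; (3) a loop is signed iff its vertex is signed. $Q^\sigma$ is connected if the underlying graph of $Q$ is connected. An ordinary quiver is regarded as a signed quiver with $\sigma=0$ and no twins. Associated symmetric quiver $\widetilde{Q}$: add to $Q$ a new vertex $j^*$ for each unsigned vertex $j$ that is not in a twin pair, and a new arrow $\varphi^*:(h\varphi)^*\to(t\varphi)^*$ for each unsigned arrow $\varphi$ of $Q$. The involution $*$ exchanges $i\leftrightarrow i^*$ and $\varphi\leftrightarrow\varphi^*$ and fixes signed vertices and signed arrows; new vertices and arrows have $\sigma=0$. Dual representation: for $\varphi\in\widetilde{Q}_1$ let $s_\varphi=-1$ if exactly one of $\sigma(\varphi)=-1$, $\sigma(h\varphi)=-1$ holds, and $s_\varphi=1$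 otherwise. Put $V^*(i)=(V(i^* ))^*$, $V^*(\varphi)=s_\varphi V(\varphi^* )^*$. A signed form on spaces $V(i)$ is a collection of isomorphisms $J_i:V(i)\to(V(i^* ))^*$ with $J_{i^*}=(J_i)^*$ if $i\ne i^*$ and $(J_i)^*=\sigma(i)J_i$ if $i=i^*$. A representation $V$ of $\widetilde{Q}$ is symmetric with respect to $J$ if $(J_i)$ is an isomorphism $V\to V^*$. A nonzero symmetric representation is indecomposable (as a symmetric representation) if it is not isomorphic to a direct sum of two nonzero symmetric representations. The signed quiver $Q^\sigma$ is called finite if there are finitely many isomorphism classes of indecomposable symmetric representations of $\widetilde{Q}$. In the list, $n\ge1$ for $B_n,C_n$ and $n\ge2$ for $B_{n,+},C_{n,-}$. *)

theory Defs
  imports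
    "Graph_Theory.Digraph_Component"
    "Jordan_Normal_Form.Matrix"
    "HOL-Computational_Algebra.Polynomial"
begin

section \<open>Quivers and their representations\<close>

text \<open>
  A quiver is a \<^locale>\<open>fin_digraph\<close>; loops and multiple arrows are allowed.

  A finite-dimensional space is taken to be a coordinate space \<open>k\<^sup>n\<close>, so a representation assigns a
  dimension to each vertex and a matrix to each arrow. The dual of \<open>k\<^sup>n\<close> is \<open>k\<^sup>n\<close> via the dual
  basis: the dual of a linear map is the transpose, and the canonical map to the double dual is the
  identity. Values outside the vertices and arrows of the quiver are irrelevant and are ignored by
  isomorphism.
\<close>

record ('v, 'a, 'k) qrep =
  vdim :: "'v \<Rightarrow> nat"
  amap :: "'a \<Rightarrow> 'k mat"

definition is_rep :: "('v, 'a) pre_digraph \<Rightarrow> ('v, 'a, 'k) qrep \<Rightarrow> bool" where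
  "is_rep Q V \<longleftrightarrow>
     (\<forall>a\<in>arcs Q. amap V a \<in> carrier_mat (vdim V (head Q a)) (vdim V (tail Q a)))"

definition rep_isomorphism ::
    "('v, 'a) pre_digraph \<Rightarrow> ('v, 'a, 'k :: field) qrep \<Rightarrow> ('v, 'a, 'k) qrep \<Rightarrow> ('v \<Rightarrow> 'k mat) \<Rightarrow> bool"
  where
  "rep_isomorphism Q V W g \<longleftrightarrow>
     is_rep Q V \<and> is_rep Q W \<and>
     (\<forall>i\<in>verts Q. g i \<in> carrier_mat (vdim W i) (vdim V i) \<and> invertible_mat (g i)) \<and>
     (\<forall>a\<in>arcs Q. g (head Q a) * amap V a = amap W a * g (tail Q a))"

definition rep_iso ::
    "('v, 'a) pre_digraph \<Rightarrow> ('v, 'a, 'k :: field) qrep \<Rightarrow> ('v, 'a, 'k) qrep \<Rightarrow> bool" where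
  "rep_iso Q V W \<longleftrightarrow> (\<exists>g. rep_isomorphism Q V W g)"

definition nonzero_rep :: "('v, 'a) pre_digraph \<Rightarrow> ('v, 'a, 'k) qrep \<Rightarrow> bool" where
  "nonzero_rep Q V \<longleftrightarrow> (\<exists>i\<in>verts Q. vdim V i \<noteq> 0)"

definition mat_dsum :: "'k :: zero mat \<Rightarrow> 'k mat \<Rightarrow> 'k mat" where
  "mat_dsum A B =
     four_block_mat A (0\<^sub>m (dim_row A) (dim_col B)) (0\<^sub>m (dim_row B) (dim_col A)) B"

definition rep_dsum ::
    "('v, 'a, 'k :: zero) qrep \<Rightarrow> ('v, 'a, 'k) qrep \<Rightarrow> ('v, 'a, 'k) qrep" where
  "rep_dsum V W =
     \<lparr>vdim = (\<lambda>i. vdim V i + vdim W i), amap = (\<lambda>a. mat_dsum (amap V a) (amap W a))\<rparr>"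

definition indecomposable_rep ::
    "('v, 'a) pre_digraph \<Rightarrow> ('v, 'a, 'k :: field) qrep \<Rightarrow> bool" where
  "indecomposable_rep Q V \<longleftrightarrow>
     is_rep Q V \<and> nonzero_rep Q V \<and>
     \<not> (\<exists>W W'. is_rep Q W \<and> nonzero_rep Q W \<and> is_rep Q W' \<and> nonzero_rep Q W' \<and>
              rep_iso Q V (rep_dsum W W'))"

definition finite_quiver :: "'k :: field itself \<Rightarrow> ('v, 'a) pre_digraph \<Rightarrow> bool" where
  "finite_quiver _ Q \<longleftrightarrow>
     finite ({V :: ('v, 'a, 'k) qrep. indecomposable_rep Q V} // {(V, W). rep_iso Q V W})"

section \<open>Signed quivers\<close>

text \<open>
  The function \<open>\<sigma>\<close> on the disjoint union of vertices and arrows is split into its two components.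
  A twin pair is a two-element set of vertices.
\<close>

record ('v, 'a) signed_quiver =
  quiver :: "('v, 'a) pre_digraph"
  vsign :: "'v \<Rightarrow> int"
  asign :: "'a \<Rightarrow> int"
  twins :: "'v set set"

locale signed_quiver =
  fixes S :: "('v, 'a) signed_quiver"
  assumes fin_digraph: "fin_digraph (quiver S)"
    and vsign_range: "i \<in> verts (quiver S) \<Longrightarrow> vsign S i \<in> {-1, 0, 1}"
    and asign_range: "a \<in> arcs (quiver S) \<Longrightarrow> asign S a \<in> {-1, 0, 1}"
    and twins_pairs: "P \<in> twins S \<Longrightarrow> P \<subseteq> verts (quiver S) \<and> card P = 2"
    and twins_disjoint: "P \<in> twins S \<Longrightarrow> P' \<in> twins S \<Longrightarrow> P \<noteq> P' \<Longrightarrow> P \<inter> P' = {}"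
    and twins_unsigned: "P \<in> twins S \<Longrightarrow> i \<in> P \<Longrightarrow> vsign S i = 0"
    and nonloop_signed_iff:
      "a \<in> arcs (quiver S) \<Longrightarrow> tail (quiver S) a \<noteq> head (quiver S) a \<Longrightarrow>
         asign S a \<noteq> 0 \<longleftrightarrow> {tail (quiver S) a, head (quiver S) a} \<in> twins S"
    and loop_signed_iff:
      "a \<in> arcs (quiver S) \<Longrightarrow> tail (quiver S) a = head (quiver S) a \<Longrightarrow>
         asign S a \<noteq> 0 \<longleftrightarrow> vsign S (tail (quiver S) a) \<noteq> 0"

definition unsigned_quiver :: "('v, 'a) signed_quiver \<Rightarrow> bool" where
  "unsigned_quiver S \<longleftrightarrow>
     (\<forall>i\<in>verts (quiver S). vsign S i = 0) \<and> (\<forall>a\<in>arcs (quiver S). asign S a = 0) \<and> twins S = {}"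

section \<open>The associated symmetric quiver\<close>

text \<open>
  Old vertices and arrows are tagged \<^const>\<open>Inl\<close>; \<^term>\<open>Inr j\<close> is the new vertex \<open>j\<^sup>*\<close> and
  \<^term>\<open>Inr a\<close> the new arrow \<open>a\<^sup>*\<close>.
\<close>

fun vstar :: "('v, 'a) signed_quiver \<Rightarrow> 'v + 'v \<Rightarrow> 'v + 'v" where
  "vstar S (Inl i) =
     (if vsign S i \<noteq> 0 then Inl i
      else if i \<in> \<Union> (twins S) then Inl (THE j. {i, j} \<in> twins S)
      else Inr i)"
| "vstar S (Inr i) = Inl i"

fun astar :: "('v, 'a) signed_quiver \<Rightarrow> 'a + 'a \<Rightarrow> 'a + 'a" where
  "astar S (Inl a) = (if asign S a \<noteq> 0 then Inl a else Inr a)"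
| "astar S (Inr a) = Inl a"

definition sym_quiver :: "('v, 'a) signed_quiver \<Rightarrow> ('v + 'v, 'a + 'a) pre_digraph" where
  "sym_quiver S =
     \<lparr>verts = Inl ` verts (quiver S) \<union>
              Inr ` {j \<in> verts (quiver S). vsign S j = 0 \<and> j \<notin> \<Union> (twins S)},
      arcs = Inl ` arcs (quiver S) \<union> Inr ` {a \<in> arcs (quiver S). asign S a = 0},
      tail = case_sum (\<lambda>a. Inl (tail (quiver S) a)) (\<lambda>a. vstar S (Inl (head (quiver S) a))),
      head = case_sum (\<lambda>a. Inl (head (quiver S) a)) (\<lambda>a. vstar S (Inl (tail (quiver S) a)))\<rparr>"

definition sym_vsign :: "('v, 'a) signed_quiver \<Rightarrow> 'v + 'v \<Rightarrow> int" where
  "sym_vsign S = case_sum (vsign S) (\<lambda>_. 0)"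

definition sym_asign :: "('v, 'a) signed_quiver \<Rightarrow> 'a + 'a \<Rightarrow> int" where
  "sym_asign S = case_sum (asign S) (\<lambda>_. 0)"

section \<open>Symmetric representations\<close>

definition dual_sign :: "('v, 'a) signed_quiver \<Rightarrow> 'a + 'a \<Rightarrow> int" where
  "dual_sign S a =
     (if (sym_asign S a = -1) \<noteq> (sym_vsign S (head (sym_quiver S) a) = -1) then -1 else 1)"

definition dual_rep ::
    "('v, 'a) signed_quiver \<Rightarrow> ('v + 'v, 'a + 'a, 'k :: field) qrep \<Rightarrow> ('v + 'v, 'a + 'a, 'k) qrep"
  where
  "dual_rep S V =
     \<lparr>vdim = (\<lambda>i. vdim V (vstar S i)),
      amap = (\<lambda>a. of_int (dual_sign S a) \<cdot>\<^sub>m transpose_mat (amap V (astar S a)))\<rparr>"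

definition signed_form ::
    "('v, 'a) signed_quiver \<Rightarrow> ('v + 'v \<Rightarrow> nat) \<Rightarrow> ('v + 'v \<Rightarrow> 'k :: field mat) \<Rightarrow> bool" where
  "signed_form S d J \<longleftrightarrow>
     (\<forall>i\<in>verts (sym_quiver S).
        J i \<in> carrier_mat (d (vstar S i)) (d i) \<and> invertible_mat (J i) \<and>
        (if vstar S i = i then transpose_mat (J i) = of_int (sym_vsign S i) \<cdot>\<^sub>m J i
         else J (vstar S i) = transpose_mat (J i)))"

type_synonym ('v, 'a, 'k) symrep =
  "('v + 'v, 'a + 'a, 'k) qrep \<times> ('v + 'v \<Rightarrow> 'k mat)"

definition is_symrep :: "('v, 'a) signed_quiver \<Rightarrow> ('v, 'a, 'k :: field) symrep \<Rightarrow> bool" where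
  "is_symrep S = (\<lambda>(V, J).
     is_rep (sym_quiver S) V \<and> signed_form S (vdim V) J \<and>
     rep_isomorphism (sym_quiver S) V (dual_rep S V) J)"

text \<open>
  An isomorphism of symmetric representations is an isomorphism \<open>g\<close> of representations carrying one
  form to the other, i.e.\ \<open>J\<^sub>i = (g\<^sub>i\<^sub>*)\<^sup>* J'\<^sub>i g\<^sub>i\<close>.
\<close>

definition symrep_iso ::
    "('v, 'a) signed_quiver \<Rightarrow> ('v, 'a, 'k :: field) symrep \<Rightarrow> ('v, 'a, 'k) symrep \<Rightarrow> bool" where
  "symrep_iso S = (\<lambda>(V, J) (V', J').
     is_symrep S (V, J) \<and> is_symrep S (V', J') \<and>
     (\<exists>g. rep_isomorphism (sym_quiver S) V V' g \<and>
          (\<forall>i\<in>verts (sym_quiver S). J i = transpose_mat (g (vstar S i)) * J' i * g i)))"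

definition symrep_dsum ::
    "('v, 'a, 'k :: zero) symrep \<Rightarrow> ('v, 'a, 'k) symrep \<Rightarrow> ('v, 'a, 'k) symrep" where
  "symrep_dsum = (\<lambda>(V, J) (V', J'). (rep_dsum V V', \<lambda>i. mat_dsum (J i) (J' i)))"

definition indecomposable_symrep ::
    "('v, 'a) signed_quiver \<Rightarrow> ('v, 'a, 'k :: field) symrep \<Rightarrow> bool" where
  "indecomposable_symrep S X \<longleftrightarrow>
     is_symrep S X \<and> nonzero_rep (sym_quiver S) (fst X) \<and>
     \<not> (\<exists>Y Y'. is_symrep S Y \<and> nonzero_rep (sym_quiver S) (fst Y) \<and>
              is_symrep S Y' \<and> nonzero_rep (sym_quiver S) (fst Y') \<and>
              symrep_iso S X (symrep_dsum Y Y'))"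

definition finite_signed_quiver :: "'k :: field itself \<Rightarrow> ('v, 'a) signed_quiver \<Rightarrow> bool" where
  "finite_signed_quiver _ S \<longleftrightarrow>
     finite ({X :: ('v, 'a, 'k) symrep. indecomposable_symrep S X} // {(X, Y). symrep_iso S X Y})"

section \<open>The list of finite signed quivers\<close>

text \<open>\<open>p\<close> is the numbering \<open>1, \<dots>, n\<close> of the vertices.\<close>

definition is_chain :: "('v, 'a) pre_digraph \<Rightarrow> nat \<Rightarrow> (nat \<Rightarrow> 'v) \<Rightarrow> bool" where
  "is_chain Q n p \<longleftrightarrow>
     bij_betw p {1..n} (verts Q) \<and>
     (\<forall>k\<in>{1..<n}. \<exists>!a. a \<in> arcs Q \<and> {tail Q a, head Q a} = {p k, p (k + 1)}) \<and>
     (\<forall>a\<in>arcs Q. \<exists>k\<in>{1..<n}. {tail Q a, head Q a} = {p k, p (k + 1)})"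

definition vertex_signed_chain :: "int \<Rightarrow> nat \<Rightarrow> ('v, 'a) signed_quiver \<Rightarrow> bool" where
  "vertex_signed_chain \<epsilon> n S \<longleftrightarrow>
     n \<ge> 1 \<and>
     (\<exists>p. is_chain (quiver S) n p \<and>
          vsign S (p n) = \<epsilon> \<and> (\<forall>k\<in>{1..<n}. vsign S (p k) = 0) \<and>
          (\<forall>a\<in>arcs (quiver S). asign S a = 0) \<and> twins S = {})"

definition twin_signed_chain :: "int \<Rightarrow> nat \<Rightarrow> ('v, 'a) signed_quiver \<Rightarrow> bool" where
  "twin_signed_chain \<epsilon> n S \<longleftrightarrow>
     n \<ge> 2 \<and>
     (\<exists>p. is_chain (quiver S) n p \<and>
          twins S = {{p (n - 1), p n}} \<and> (\<forall>k\<in>{1..n}. vsign S (p k) = 0) \<and>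
          (\<forall>a\<in>arcs (quiver S). asign S a =
             (if {tail (quiver S) a, head (quiver S) a} = {p (n - 1), p n} then \<epsilon> else 0)))"

definition type_B :: "nat \<Rightarrow> ('v, 'a) signed_quiver \<Rightarrow> bool" where
  "type_B = vertex_signed_chain 1"

definition type_B_plus :: "nat \<Rightarrow> ('v, 'a) signed_quiver \<Rightarrow> bool" where
  "type_B_plus = twin_signed_chain 1"

definition type_C :: "nat \<Rightarrow> ('v, 'a) signed_quiver \<Rightarrow> bool" where
  "type_C = vertex_signed_chain (- 1)"

definition type_C_minus :: "nat \<Rightarrow> ('v, 'a) signed_quiver \<Rightarrow> bool" where
  "type_C_minus = twin_signed_chain (- 1)"

end

theory Submission
  imports Defs "Jordan_Normal_Form.Determinant" "HOL-Library.Function_Algebras"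
begin

text \<open>
  Three independent arguments combine.

  \<^emph>\<open>Symmetric representations against representations.\<close> Over an algebraically closed field of
  characteristic 0 a representation of the symmetric quiver carries at most one symmetric form up to
  isometry: two forms differ by a self-adjoint automorphism, and this has a square root that is a
  polynomial in it and hence self-adjoint (\<open>form_unique\<close>). So symmetric representations are isomorphic
  as soon as the underlying representations are. In one direction, every indecomposable \<open>X\<close> is a
  direct summand of the hyperbolic symmetric representation on \<open>X \<oplus> X\<^sup>*\<close>, hence, its endomorphism ring
  being local, of an indecomposable symmetric representation; each of these has finitely many
  indecomposable summands. In the other direction, let \<open>X\<close> be an indecomposable summand of an
  indecomposable symmetric representation \<open>V\<close>, with projection \<open>e\<close>. The self-adjoint endomorphism
  \<open>e + e\<^sup>\<dagger>\<close> is invertible, since self-adjoint idempotents of \<open>V\<close> are trivial and a nilpotent \<open>e + e\<^sup>\<dagger>\<close> would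
  force \<open>e = 0\<close>; therefore \<open>dim V \<le> dim X + dim X\<^sup>*\<close> (\<open>indecomposable_symrep_dim_le\<close>). Over a quiver of
  finite type this bounds the dimension of \<open>V\<close>, and only finitely many classes remain.

  \<^emph>\<open>The listed quivers are finite.\<close> The symmetric quiver of a signed quiver of one of the four types is
  a chain. Along a chain one can build, vertex by vertex, a rank one idempotent endomorphism: at each
  step it has to preserve a prescribed flag at the last vertex, and the flag is transported along the
  next arrow (\<open>chain_idempotent\<close>). So indecomposables are thin, and up to isomorphism all their maps are
  0 or 1. Without signs and twins the symmetric quiver is the disjoint union of the quiver and its
  opposite.

  \<^emph>\<open>Nothing else is finite.\<close> In a connected quiver of finite type every arrow is a bridge
  (\<open>arc_is_bridge\<close>, a one-dimensional local system on a cycle), and at most three arrows leave a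
  connected set of vertices (\<open>boundary_arcs_le_3\<close>, the cross ratio of four lines in a plane). A signed
  quiver with a sign or a twin pair has a connected symmetric quiver, whose involution doubles the
  arrows that leave a stable set. So at most one arrow of the original quiver leaves a set that
  grows from a signed vertex or from a signed arrow between twins, which makes the quiver a chain. Any
  further sign or twin pair, and a twin pair without an arrow between its members, would close a cycle.
\<close>

section \<open>Matrices\<close>

lemma mat_assoc:
  fixes A :: "'k :: field mat"
  shows "dim_col A = dim_row B \<Longrightarrow> dim_col B = dim_row C \<Longrightarrow> A * B * C = A * (B * C)"
  by (rule assoc_mult_mat[of A "dim_row A" "dim_col A" B "dim_col B" C "dim_col C"]) auto

lemma mat_add_distr:
  fixes A :: "'k :: field mat"
  shows "dim_row A = dim_row B \<Longrightarrow> dim_col A = dim_col B \<Longrightarrow> dim_col A = dim_row C \<Longrightarrow>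
    (A + B) * C = A * C + B * C"
  by (rule add_mult_distrib_mat[of A "dim_row A" "dim_col A" B C "dim_col C"]) auto

lemma mat_add_distl:
  fixes A :: "'k :: field mat"
  shows "dim_row C = dim_row B \<Longrightarrow> dim_col C = dim_col B \<Longrightarrow> dim_col A = dim_row C \<Longrightarrow>
    A * (B + C) = A * B + A * C"
  by (rule mult_add_distrib_mat[of A "dim_row A" "dim_col A" B "dim_col C" C]) auto

lemma mat_minus_distr:
  fixes A :: "'k :: field mat"
  shows "dim_row A = dim_row B \<Longrightarrow> dim_col A = dim_col B \<Longrightarrow> dim_col A = dim_row C \<Longrightarrow>
    (A - B) * C = A * C - B * C"
  by (rule minus_mult_distrib_mat[of A "dim_row A" "dim_col A" B C "dim_col C"]) auto

lemma mat_minus_distl: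
  fixes A :: "'k :: field mat"
  shows "dim_row C = dim_row B \<Longrightarrow> dim_col C = dim_col B \<Longrightarrow> dim_col A = dim_row C \<Longrightarrow>
    A * (B - C) = A * B - A * C"
  by (rule mult_minus_distrib_mat[of A "dim_row A" "dim_col A" B "dim_col C" C]) auto

lemma mat_smult_l:
  fixes A :: "'k :: field mat"
  shows "dim_col A = dim_row B \<Longrightarrow> (c \<cdot>\<^sub>m A) * B = c \<cdot>\<^sub>m (A * B)"
  by (rule mult_smult_assoc_mat[of A "dim_row A" "dim_col A" B "dim_col B"]) auto

lemma mat_smult_r:
  fixes A :: "'k :: field mat"
  shows "dim_col A = dim_row B \<Longrightarrow> A * (c \<cdot>\<^sub>m B) = c \<cdot>\<^sub>m (A * B)"
  by (rule mult_smult_distrib[of A "dim_row A" "dim_col A" B "dim_col B"]) auto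

lemma mat_transpose_mult:
  fixes A :: "'k :: field mat"
  shows "dim_col A = dim_row B \<Longrightarrow> (A * B)\<^sup>T = B\<^sup>T * A\<^sup>T"
  by (rule transpose_mult[of A "dim_row A" "dim_col A" B "dim_col B"]) auto

lemma mat_transpose_smult: "(c \<cdot>\<^sub>m A)\<^sup>T = c \<cdot>\<^sub>m A\<^sup>T"
  by (rule eq_matI) auto

lemma mat_smult_smult: "(c :: 'k :: field) \<cdot>\<^sub>m (d \<cdot>\<^sub>m A) = (c * d) \<cdot>\<^sub>m A"
  by (rule eq_matI) auto

lemma mat_transpose_add: 
  "dim_row A = dim_row B \<Longrightarrow> dim_col A = dim_col B \<Longrightarrow> (A + B)\<^sup>T = A\<^sup>T + B\<^sup>T"
  by (rule eq_matI) auto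

lemma mat_transpose_minus: 
  "dim_row A = dim_row B \<Longrightarrow> dim_col A = dim_col B \<Longrightarrow> (A - B)\<^sup>T = A\<^sup>T - B\<^sup>T"
  by (rule eq_matI) auto

lemma mat_transpose_eq_iff: "A\<^sup>T = B\<^sup>T \<longleftrightarrow> A = B"
  by (metis Matrix.transpose_transpose)

text \<open>A matrix with a right inverse is at least as wide as it is high: padding both factors to squares
  with zeros would otherwise produce a one-sided inverse of a square matrix that is not two-sided.\<close>

lemma right_inverse_dim_le:
  fixes A B :: "'k :: field mat"
  assumes A: "A \<in> carrier_mat n m" and B: "B \<in> carrier_mat m n" and AB: "A * B = 1\<^sub>m n"
  shows "n \<le> m"
proof (rule ccontr)
  assume "\<not> n \<le> m"
  then have nm: "m < n" by simp
  define A' where "A' = mat n n (\<lambda>(i,j). if j < m then A $$ (i,j) else 0)"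
  define B' where "B' = mat n n (\<lambda>(i,j). if i < m then B $$ (i,j) else 0)"
  have c: "A' \<in> carrier_mat n n" "B' \<in> carrier_mat n n" by (auto simp: A'_def B'_def)
  have "A' * B' = A * B"
  proof (rule eq_matI)
    fix i j assume "i < dim_row (A * B)" "j < dim_col (A * B)"
    then have ij: "i < n" "j < n" using A B by auto
    have "(A' * B') $$ (i,j) = (\<Sum>k<n. A' $$ (i,k) * B' $$ (k,j))"
      using ij c by (auto simp: scalar_prod_def atLeast0LessThan)
    also have "\<dots> = (\<Sum>k<m. A' $$ (i,k) * B' $$ (k,j))"
      using nm by (intro sum.mono_neutral_right) (auto simp: A'_def B'_def ij)
    also have "\<dots> = (\<Sum>k<m. A $$ (i,k) * B $$ (k,j))"
      using nm ij by (intro sum.cong) (auto simp: A'_def B'_def)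
    also have "\<dots> = (A * B) $$ (i,j)"
      using ij A B by (auto simp: scalar_prod_def atLeast0LessThan)
    finally show "(A' * B') $$ (i,j) = (A * B) $$ (i,j)" .
  qed (use A B c in auto)
  then have "B' * A' = 1\<^sub>m n" using AB mat_mult_left_right_inverse[OF c] by simp
  then have "(B' * A') $$ (m,m) = 1" using nm by simp
  moreover have "(B' * A') $$ (m,m) = 0"
    using nm by (auto simp: scalar_prod_def A'_def B'_def)
  ultimately show False by simp
qed

lemma invertible_matI:
  fixes A B :: "'k :: field mat"
  assumes A: "A \<in> carrier_mat n m" and B: "B \<in> carrier_mat m n"
    and AB: "A * B = 1\<^sub>m n" and BA: "B * A = 1\<^sub>m m"
  shows "n = m" "invertible_mat A"
proof -
  show nm: "n = m" using right_inverse_dim_le[OF A B AB] right_inverse_dim_le[OF B A BA] by simp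
  show "invertible_mat A"
    unfolding invertible_mat_def inverts_mat_def
    using assms nm by (auto intro!: exI[of _ B])
qed

lemma invertible_matE:
  fixes A :: "'k :: field mat"
  assumes A: "A \<in> carrier_mat n m" and inv: "invertible_mat A"
  obtains B where "n = m" "B \<in> carrier_mat m n" "A * B = 1\<^sub>m n" "B * A = 1\<^sub>m m"
proof -
  from inv A have nm: "n = m" by (auto simp: invertible_mat_def)
  from inv obtain B where AB: "A * B = 1\<^sub>m (dim_row A)" and BA: "B * A = 1\<^sub>m (dim_row B)"
    by (auto simp: invertible_mat_def inverts_mat_def)
  have "dim_col (A * B) = n" using AB A by simp
  moreover have "dim_col (B * A) = dim_row B" using BA by simp
  ultimately have "B \<in> carrier_mat m n" using A by (auto simp: nm)
  then show thesis using that nm AB BA A by auto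
qed

definition hcat :: "'k :: field mat \<Rightarrow> 'k mat \<Rightarrow> 'k mat" where
  "hcat A B = mat (dim_row A) (dim_col A + dim_col B)
     (\<lambda>(i,j). if j < dim_col A then A $$ (i,j) else B $$ (i, j - dim_col A))"

definition vcat :: "'k :: field mat \<Rightarrow> 'k mat \<Rightarrow> 'k mat" where
  "vcat A B = mat (dim_row A + dim_row B) (dim_col A)
     (\<lambda>(i,j). if i < dim_row A then A $$ (i,j) else B $$ (i - dim_row A, j))"

lemma dim_cat [simp]:
  "dim_row (hcat A B) = dim_row A" "dim_col (hcat A B) = dim_col A + dim_col B"
  "dim_row (vcat A B) = dim_row A + dim_row B" "dim_col (vcat A B) = dim_col A"
  by (auto simp: hcat_def vcat_def)

lemma dim_mat_dsum [simp]:
  "dim_row (mat_dsum A B) = dim_row A + dim_row B" "dim_col (mat_dsum A B) = dim_col A + dim_col B"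
  by (auto simp: mat_dsum_def)

lemma transpose_cat:
  "dim_col C = dim_col D \<Longrightarrow> (vcat C D)\<^sup>T = hcat (C\<^sup>T) (D\<^sup>T)"
  "dim_row C = dim_row D \<Longrightarrow> (hcat C D)\<^sup>T = vcat (C\<^sup>T) (D\<^sup>T)"
  by (auto intro!: eq_matI simp: hcat_def vcat_def)

lemma transpose_mat_dsum: "(mat_dsum A B)\<^sup>T = mat_dsum (A\<^sup>T) (B\<^sup>T)"
  by (auto intro!: eq_matI simp: mat_dsum_def)

lemma smult_mat_dsum: "(c :: 'k :: field) \<cdot>\<^sub>m mat_dsum A B = mat_dsum (c \<cdot>\<^sub>m A) (c \<cdot>\<^sub>m B)"
  by (auto intro!: eq_matI simp: mat_dsum_def)

lemma mult_hcat: "dim_col M = dim_row A \<Longrightarrow> dim_row A = dim_row B \<Longrightarrow>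
    M * hcat A B = hcat (M * A) (M * B)"
  by (auto intro!: eq_matI simp: hcat_def scalar_prod_def)

lemma vcat_mult: "dim_row M = dim_col C \<Longrightarrow> dim_col C = dim_col D \<Longrightarrow>
    vcat C D * M = vcat (C * M) (D * M)"
  by (auto intro!: eq_matI simp: vcat_def scalar_prod_def)

lemma hcat_vcat:
  assumes "dim_row A = dim_row B" "dim_col C = dim_col D" "dim_col A = dim_row C" "dim_col B = dim_row D"
  shows "hcat A B * vcat C D = A * C + B * D"
proof (rule eq_matI)
  fix i j assume "i < dim_row (A * C + B * D)" "j < dim_col (A * C + B * D)"
  then have ij: "i < dim_row A" "i < dim_row B" "j < dim_col C" "j < dim_col D" using assms by auto
  have "row (hcat A B) i = row A i @\<^sub>v row B i"
    using ij assms by (auto intro!: eq_vecI simp: hcat_def append_vec_def Let_def)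
  moreover have "col (vcat C D) j = col C j @\<^sub>v col D j"
    using ij assms by (auto intro!: eq_vecI simp: vcat_def append_vec_def Let_def)
  ultimately show "(hcat A B * vcat C D) $$ (i,j) = (A * C + B * D) $$ (i,j)"
    using ij assms scalar_prod_append[of "row A i" "dim_row C" "row B i" "dim_row D" "col C j" "col D j"]
    by (auto simp: carrier_vecI)
qed (use assms in auto)

lemma dsum_vcat:
  assumes "dim_col X = dim_row C" "dim_col Y = dim_row D" "dim_col C = dim_col D"
  shows "mat_dsum X Y * vcat C D = vcat (X * C) (Y * D)"
proof -
  have "mat_dsum X Y = hcat (vcat X (0\<^sub>m (dim_row Y) (dim_col X))) (vcat (0\<^sub>m (dim_row X) (dim_col Y)) Y)"
    by (rule eq_matI) (auto simp: mat_dsum_def hcat_def vcat_def)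
  then have "mat_dsum X Y * vcat C D =
      vcat X (0\<^sub>m (dim_row Y) (dim_col X)) * C + vcat (0\<^sub>m (dim_row X) (dim_col Y)) Y * D"
    using assms by (simp add: hcat_vcat)
  also have "\<dots> = vcat (X * C) (0\<^sub>m (dim_row Y) (dim_col C)) + vcat (0\<^sub>m (dim_row X) (dim_col D)) (Y * D)"
    using assms by (simp add: vcat_mult left_mult_zero_mat' )
  also have "\<dots> = vcat (X * C) (Y * D)"
    using assms by (auto intro!: eq_matI simp: vcat_def)
  finally show ?thesis .
qed

lemma hcat_dsum:
  assumes "dim_col A = dim_row X" "dim_col B = dim_row Y" "dim_row A = dim_row B"
  shows "hcat A B * mat_dsum X Y = hcat (A * X) (B * Y)"
proof -
  have "(hcat A B * mat_dsum X Y)\<^sup>T = (hcat (A * X) (B * Y))\<^sup>T"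
    using assms by (simp add: mat_transpose_mult transpose_cat transpose_mat_dsum dsum_vcat)
  then show ?thesis by (simp add: mat_transpose_eq_iff)
qed

lemma vcat_hcat_diag:
  assumes "C * A = 1\<^sub>m p" "D * B = 1\<^sub>m q" "C * B = 0\<^sub>m p q" "D * A = 0\<^sub>m q p"
    "dim_col C = dim_row A" "dim_col C = dim_col D" "dim_row A = dim_row B"
  shows "vcat C D * hcat A B = 1\<^sub>m (p + q)"
proof -
  have d: "dim_row C = p" "dim_row D = q" "dim_col A = p" "dim_col B = q"
    using assms(1,2) by (metis index_mult_mat(2,3) index_one_mat(2,3))+
  have "vcat C D * hcat A B = hcat (vcat (C * A) (D * A)) (vcat (C * B) (D * B))"
    by (subst mult_hcat) (use assms in \<open>simp_all add: vcat_mult\<close>)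
  also have "\<dots> = 1\<^sub>m (p + q)"
    unfolding assms(1-4) by (rule eq_matI) (auto simp: vcat_def hcat_def)
  finally show ?thesis .
qed

text \<open>A maximal pair \<open>A, B\<close> with \<open>B A = 1\<close> below an idempotent \<open>e\<close> factors \<open>e\<close>: a nonzero remainder
  \<open>e - A B\<close> would supply one more column for \<open>A\<close> and one more row for \<open>B\<close>.\<close>

lemma idempotent_factorization:
  fixes e :: "'k :: field mat"
  assumes e: "e \<in> carrier_mat n n" and ee: "e * e = e"
  obtains r A B where "A \<in> carrier_mat n r" "B \<in> carrier_mat r n" "A * B = e" "B * A = 1\<^sub>m r"
proof -
  define P where "P r = (\<exists>A B. A \<in> carrier_mat n r \<and> B \<in> carrier_mat r n \<and> B * A = 1\<^sub>m r \<and>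
    e * A = A \<and> B * e = B)" for r
  have P0: "P 0" unfolding P_def
    using e by (intro exI[of _ "0\<^sub>m n 0"] exI[of _ "0\<^sub>m 0 n"]) (auto intro!: eq_matI)
  have Pn: "r \<le> n" if "P r" for r
    using that right_inverse_dim_le unfolding P_def by blast
  obtain r where r: "P r" and rmax: "\<And>s. P s \<Longrightarrow> s \<le> r"
    using GreatestI_nat[of P, OF P0] Greatest_le_nat[of P] Pn by metis
  from r obtain A B where A: "A \<in> carrier_mat n r" and B: "B \<in> carrier_mat r n" and BA: "B * A = 1\<^sub>m r"
    and eA: "e * A = A" and Be: "B * e = B" unfolding P_def by auto
  note d = A[THEN carrier_matD(1)] A[THEN carrier_matD(2)] B[THEN carrier_matD(1)] B[THEN carrier_matD(2)]
    e[THEN carrier_matD(1)] e[THEN carrier_matD(2)]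
  define f where "f = e - A * B"
  have f: "f \<in> carrier_mat n n" using A B e by (auto simp: f_def)
  have fA: "f * A = 0\<^sub>m n r"
    using A B e by (simp add: f_def mat_minus_distr eA mat_assoc BA) 
  have Bf: "B * f = 0\<^sub>m r n"
    using A B e by (simp add: f_def mat_minus_distl Be mat_assoc[symmetric] BA) 
  have ef: "e * f = f" 
    using A B e by (simp add: f_def mat_minus_distl mat_assoc[symmetric] ee eA) 
  have fe: "f * e = f" 
    using A B e by (simp add: f_def mat_minus_distr mat_assoc ee Be) 
  have ff: "f * f = f"
  proof -
    have "f * f = f * e - f * (A * B)" using A B e f by (subst (2) f_def) (simp add: mat_minus_distl)
    also have "f * (A * B) = 0\<^sub>m n n" using A B f fA by (simp add: mat_assoc[symmetric])
    finally show ?thesis using f fe by (auto intro!: eq_matI)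
  qed
  have "f = 0\<^sub>m n n"
  proof (rule ccontr)
    assume "f \<noteq> 0\<^sub>m n n"
    then obtain i j where ij: "i < n" "j < n" "f $$ (i,j) \<noteq> 0"
      using f by (metis (no_types, lifting) eq_matI carrier_matD index_zero_mat)
    \<comment> \<open>A column and a row of \<open>f\<close> through a nonzero entry, scaled such that \<open>w v = 1\<close>.\<close>
    define v where "v = mat n 1 (\<lambda>(k,l). f $$ (k,j))"
    define w where "w = mat 1 n (\<lambda>(k,l). f $$ (i,l) / f $$ (i,j))"
    have v: "v \<in> carrier_mat n 1" and w: "w \<in> carrier_mat 1 n" by (auto simp: v_def w_def)
    have mv: "M * v = mat m 1 (\<lambda>(k,l). (M * f) $$ (k,j))" if "M \<in> carrier_mat m n" for M m
      using that f ij by (auto intro!: eq_matI simp: v_def scalar_prod_def)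
    have wm: "w * M = mat 1 m (\<lambda>(k,l). (f * M) $$ (i,l) / f $$ (i,j))" if "M \<in> carrier_mat n m" for M m
      using that f ij by (auto intro!: eq_matI simp: w_def scalar_prod_def sum_divide_distrib)
    have wv: "w * v = 1\<^sub>m 1"
    proof -
      have "(w * v) $$ (0,0) = (f * f) $$ (i,j) / f $$ (i,j)"
        using f ij by (auto simp: v_def w_def scalar_prod_def sum_divide_distrib)
      then show ?thesis using ij ff v w by (auto intro!: eq_matI)
    qed
    have Bv: "B * v = 0\<^sub>m r 1" using mv[OF B] ij by (auto intro!: eq_matI simp: Bf)
    have wA: "w * A = 0\<^sub>m 1 r" using wm[OF A] ij by (auto intro!: eq_matI simp: fA)
    have ev: "e * v = v" using mv[OF e] by (simp add: ef v_def)
    have we: "w * e = w" using wm[OF e] by (simp add: fe w_def)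
    have "P (r + 1)" unfolding P_def
    proof (intro exI conjI)
      show "hcat A v \<in> carrier_mat n (r + 1)" "vcat B w \<in> carrier_mat (r + 1) n"
        using A B v w by auto
      show "vcat B w * hcat A v = 1\<^sub>m (r + 1)"
        by (rule vcat_hcat_diag) (use A B v w BA wv Bv wA in auto)
      show "e * hcat A v = hcat A v" using A v e by (simp add: mult_hcat eA ev)
      show "vcat B w * e = vcat B w" using B w e by (simp add: vcat_mult Be we)
    qed
    from rmax[OF this] show False by simp
  qed
  have "A * B = e"
  proof (rule eq_matI)
    fix i j assume "i < dim_row e" "j < dim_col e"
    then show "(A * B) $$ (i,j) = e $$ (i,j)"
      using arg_cong[OF \<open>f = 0\<^sub>m n n\<close>, of "\<lambda>M. M $$ (i,j)"] A B e by (simp add: f_def)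
  qed (use A B e in auto)
  then show thesis using that A B BA by blast
qed

text \<open>The kernel of \<open>e\<close> is the image of \<open>1 - e\<close>. The factorizations of \<open>e\<close> and \<open>1 - e\<close> glue to mutually
  inverse matrices, so the dimensions add up.\<close>

lemma idempotent_splitting:
  fixes e :: "'k :: field mat"
  assumes e: "e \<in> carrier_mat n n" and ee: "e * e = e"
  obtains r s A B A' B' where "n = r + s"
    "A \<in> carrier_mat n r" "B \<in> carrier_mat r n" "A * B = e" "B * A = 1\<^sub>m r"
    "A' \<in> carrier_mat n s" "B' \<in> carrier_mat s n" "A' * B' = 1\<^sub>m n - e" "B' * A' = 1\<^sub>m s"
    "B * A' = 0\<^sub>m r s" "B' * A = 0\<^sub>m s r"
proof -
  obtain r A B where A: "A \<in> carrier_mat n r" and B: "B \<in> carrier_mat r n" and AB: "A * B = e"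
    and BA: "B * A = 1\<^sub>m r" by (rule idempotent_factorization[OF e ee])
  have c: "1\<^sub>m n - e \<in> carrier_mat n n" using e by auto
  have "(1\<^sub>m n - e) * (1\<^sub>m n - e) = 1\<^sub>m n - e"
    using e by (auto intro!: eq_matI simp: mat_minus_distl mat_minus_distr ee)
  from idempotent_factorization[OF c this] obtain s A' B' where A': "A' \<in> carrier_mat n s"
    and B': "B' \<in> carrier_mat s n" and AB': "A' * B' = 1\<^sub>m n - e" and BA': "B' * A' = 1\<^sub>m s" by metis
  have "e * A' = 0\<^sub>m n s"
  proof -
    have "A' = A' * B' * A'" using A' B' by (simp add: mat_assoc BA')
    also have "\<dots> = A' - e * A'" using A' e by (simp add: AB' mat_minus_distr)
    finally have *: "A' = A' - e * A'" .
    show ?thesis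
    proof (rule eq_matI)
      fix i j assume "i < dim_row (0\<^sub>m n s :: 'k mat)" "j < dim_col (0\<^sub>m n s :: 'k mat)"
      then show "(e * A') $$ (i,j) = 0\<^sub>m n s $$ (i,j)"
        using arg_cong[OF *, of "\<lambda>M. M $$ (i,j)"] A' e by simp
    qed (use A' e in auto)
  qed
  note eA' = this
  have "B * A' = B * (A * B) * A'" using A B A' BA by (simp add: mat_assoc[symmetric])
  also have "\<dots> = B * (e * A')" unfolding AB using A' B e by (simp add: mat_assoc)
  finally have 1: "B * A' = 0\<^sub>m r s" using eA' B by simp
  have eA: "e * A = A" using A B by (simp add: AB[symmetric] mat_assoc BA)
  have "B' * A = B' * (A' * B') * A" using A' B' A BA' by (simp add: mat_assoc[symmetric])
  also have "\<dots> = B' * ((1\<^sub>m n - e) * A)" using A B' e A' by (simp add: AB' mat_assoc)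
  also have "(1\<^sub>m n - e) * A = 0\<^sub>m n r" using A e by (simp add: mat_minus_distr eA)
  finally have 2: "B' * A = 0\<^sub>m s r" using B' by simp
  have "n = r + s"
  proof (rule antisym)
    have "hcat A A' * vcat B B' = 1\<^sub>m n"
      using A B A' B' e by (auto intro!: eq_matI simp: hcat_vcat AB AB')
    then show "n \<le> r + s"
      by (rule right_inverse_dim_le[rotated 2]) (use A B A' B' in auto)
    have "vcat B B' * hcat A A' = 1\<^sub>m (r + s)"
      by (rule vcat_hcat_diag) (use A B A' B' 1 2 BA BA' in auto)
    then show "r + s \<le> n"
      by (rule right_inverse_dim_le[rotated 2]) (use A B A' B' in auto)
  qed
  then show thesis using that A B A' B' AB BA AB' BA' 1 2 by blast
qed

section \<open>Polynomials in a matrix\<close>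

definition peval :: "'k :: field poly \<Rightarrow> 'k mat \<Rightarrow> 'k mat" where
  "peval p A = mat (dim_row A) (dim_row A) (\<lambda>(i,j). \<Sum>k\<le>degree p. coeff p k * (A ^\<^sub>m k) $$ (i,j))"

lemma dim_peval [simp]: "dim_row (peval p A) = dim_row A" "dim_col (peval p A) = dim_row A"
  by (auto simp: peval_def)

lemma peval_index:
  assumes "A \<in> carrier_mat n n" "i < n" "j < n" "degree p \<le> N"
  shows "peval p A $$ (i,j) = (\<Sum>k\<le>N. coeff p k * (A ^\<^sub>m k) $$ (i,j))"
proof -
  have "(\<Sum>k\<le>degree p. coeff p k * (A ^\<^sub>m k) $$ (i,j)) = (\<Sum>k\<le>N. coeff p k * (A ^\<^sub>m k) $$ (i,j))"
    using assms by (intro sum.mono_neutral_left) (auto simp: coeff_eq_0)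
  then show ?thesis using assms by (simp add: peval_def)
qed

lemma peval_0: "A \<in> carrier_mat n n \<Longrightarrow> peval 0 A = 0\<^sub>m n n"
  by (auto intro!: eq_matI simp: peval_def)

lemma peval_pCons:
  assumes A: "A \<in> carrier_mat n n"
  shows "peval (pCons a p) A = a \<cdot>\<^sub>m 1\<^sub>m n + peval p A * A"
proof (rule eq_matI)
  fix i j assume "i < dim_row (a \<cdot>\<^sub>m 1\<^sub>m n + peval p A * A)" "j < dim_col (a \<cdot>\<^sub>m 1\<^sub>m n + peval p A * A)"
  then have ij: "i < n" "j < n" using A by auto
  have pw: "A ^\<^sub>m k \<in> carrier_mat n n" for k using A by simp
  have "peval (pCons a p) A $$ (i,j) = (\<Sum>k\<le>Suc (degree p). coeff (pCons a p) k * (A ^\<^sub>m k) $$ (i,j))"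
    using A ij by (intro peval_index) (auto simp: degree_pCons_le)
  also have "\<dots> = a * (1\<^sub>m n $$ (i,j)) + (\<Sum>k\<le>degree p. coeff p k * (A ^\<^sub>m k * A) $$ (i,j))"
    using A by (subst sum.atMost_Suc_shift) auto
  also have "(\<Sum>k\<le>degree p. coeff p k * (A ^\<^sub>m k * A) $$ (i,j)) =
      (\<Sum>k\<le>degree p. \<Sum>l<n. coeff p k * (A ^\<^sub>m k) $$ (i,l) * A $$ (l,j))"
    using A ij pw by (intro sum.cong refl)
      (auto simp: scalar_prod_def sum_distrib_left mult.assoc atLeast0LessThan)
  also have "\<dots> = (\<Sum>l<n. peval p A $$ (i,l) * A $$ (l,j))"
    using A ij by (subst sum.swap) (auto simp: peval_def sum_distrib_right)
  also have "\<dots> = (peval p A * A) $$ (i,j)"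
    using A ij by (auto simp: scalar_prod_def atLeast0LessThan)
  finally show "peval (pCons a p) A $$ (i,j) = (a \<cdot>\<^sub>m 1\<^sub>m n + peval p A * A) $$ (i,j)"
    using ij A by simp
qed (use A in auto)

lemma peval_1: "A \<in> carrier_mat n n \<Longrightarrow> peval 1 A = 1\<^sub>m n"
  unfolding one_pCons by (subst peval_pCons) (auto simp: peval_0 intro!: eq_matI)

lemma peval_X: "A \<in> carrier_mat n n \<Longrightarrow> peval [:0, 1:] A = A"
  by (subst peval_pCons) (auto simp: peval_1[unfolded one_pCons] intro!: eq_matI)

lemma peval_add:
  assumes A: "A \<in> carrier_mat n n"
  shows "peval (p + q) A = peval p A + peval q A"
proof (rule eq_matI)
  fix i j assume "i < dim_row (peval p A + peval q A)" "j < dim_col (peval p A + peval q A)"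
  then have ij: "i < n" "j < n" using A by auto
  let ?N = "max (degree p) (degree q)"
  show "peval (p + q) A $$ (i,j) = (peval p A + peval q A) $$ (i,j)"
    using A ij peval_index[OF A ij, of _ ?N] degree_add_le_max[of p q]
    by (auto simp: sum.distrib distrib_right)
qed auto

lemma peval_smult:
  assumes A: "A \<in> carrier_mat n n"
  shows "peval (smult c p) A = c \<cdot>\<^sub>m peval p A"
proof (rule eq_matI)
  fix i j assume "i < dim_row (c \<cdot>\<^sub>m peval p A)" "j < dim_col (c \<cdot>\<^sub>m peval p A)"
  then have ij: "i < n" "j < n" using A by auto
  show "peval (smult c p) A $$ (i,j) = (c \<cdot>\<^sub>m peval p A) $$ (i,j)"
    using A ij peval_index[OF A ij, of _ "degree p"] degree_smult_le[of c p]
    by (auto simp: sum_distrib_left mult.assoc)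
qed auto

lemma peval_intertwine:
  fixes A B T :: "'k :: field mat"
  assumes A: "A \<in> carrier_mat n n" and B: "B \<in> carrier_mat m m" and T: "T \<in> carrier_mat n m"
    and AT: "A * T = T * B"
  shows "peval p A * T = T * peval p B"
proof (induction p)
  case 0 then show ?case using A B T by (simp add: peval_0)
next
  case (pCons a p)
  have "peval (pCons a p) A * T = a \<cdot>\<^sub>m T + peval p A * T * B"
    using A B T by (simp add: peval_pCons[OF A] mat_add_distr mat_assoc AT mat_smult_l)
  also have "\<dots> = T * peval (pCons a p) B"
    using A B T by (simp add: peval_pCons[OF B] mat_add_distl pCons.IH mat_assoc mat_smult_r)
  finally show ?case .
qed

lemma peval_commute: "A \<in> carrier_mat n n \<Longrightarrow> A * peval p A = peval p A * A"
  using peval_intertwine[of A n A n A p] by simp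

lemma peval_mult:
  assumes A: "A \<in> carrier_mat n n"
  shows "peval (p * q) A = peval p A * peval q A"
proof (induction p)
  case 0 then show ?case using A by (simp add: peval_0)
next
  case (pCons a p)
  have "peval (pCons a p * q) A = a \<cdot>\<^sub>m peval q A + (peval p A * peval q A * A)"
    using A by (simp add: peval_add peval_smult peval_pCons pCons.IH)
      (auto intro!: eq_matI)
  also have "\<dots> = peval (pCons a p) A * peval q A"
    using A by (simp add: peval_pCons mat_add_distr mat_smult_l mat_assoc peval_commute)
  finally show ?case .
qed

lemma peval_uminus: "A \<in> carrier_mat n n \<Longrightarrow> peval (- p) A = - peval p A"
  by (auto intro!: eq_matI simp: peval_def sum_negf)

lemma peval_diff:
  "A \<in> carrier_mat n n \<Longrightarrow> peval (p - q) A = peval p A - peval q A"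
  unfolding diff_conv_add_uminus[of p q]
  by (subst peval_add) (auto intro!: eq_matI simp: peval_uminus)

lemma peval_X_power: "A \<in> carrier_mat n n \<Longrightarrow> peval ([:0, 1:] ^ k) A = A ^\<^sub>m k"
  by (induction k) (auto simp: peval_1 peval_pCons intro!: eq_matI)

text \<open>The powers of an \<open>n \<times> n\<close> matrix lie in a space of dimension \<open>n\<^sup>2\<close>, so a homogeneous linear
  system with \<open>n\<^sup>2\<close> equations and \<open>n\<^sup>2 + 1\<close> unknowns yields a polynomial that kills it.\<close>

lemma annihilating_poly:
  fixes A :: "'k :: field mat"
  assumes A: "A \<in> carrier_mat n n"
  obtains p where "p \<noteq> 0" "peval p A = 0\<^sub>m n n"
proof -
  let ?N = "n * n + 1"
  \<comment> \<open>Column \<open>k\<close> lists the entries of \<open>A\<^sup>k\<close>; the additional zero row makes \<open>M\<close> square and singular.\<close>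
  define M where "M = mat ?N ?N (\<lambda>(r,k). if r < n * n then (A ^\<^sub>m k) $$ (r div n, r mod n) else 0)"
  have M: "M \<in> carrier_mat ?N ?N" by (simp add: M_def)
  have "det M = 0"
  proof -
    have "det M \<noteq> 0 \<Longrightarrow> False"
    proof -
      assume "det M \<noteq> 0"
      then obtain B where B: "B \<in> carrier_mat ?N ?N" and "M * B = 1\<^sub>m ?N"
        using det_non_zero_imp_unit[OF M, of undefined] unfolding Units_def ring_mat_def by auto
      then have "(M * B) $$ (n * n, n * n) = 1" by simp
      moreover have "(M * B) $$ (n * n, n * n) = 0"
        using B by (auto simp: M_def scalar_prod_def)
      ultimately show False by simp
    qed
    then show ?thesis by blast
  qed
  then obtain v where v: "v \<in> carrier_vec ?N" "v \<noteq> 0\<^sub>v ?N" "M *\<^sub>v v = 0\<^sub>v ?N"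
    using det_0_iff_vec_prod_zero_field[OF M] by auto
  define p where "p = (\<Sum>k<?N. monom (v $ k) k)"
  have cp: "coeff p k = (if k < ?N then v $ k else 0)" for k
    unfolding p_def by (auto simp: coeff_sum if_distrib cong: if_cong)
  have dp: "degree p \<le> n * n" by (rule degree_le) (simp add: cp)
  have "p \<noteq> 0"
  proof
    assume "p = 0"
    then have "v $ k = 0" if "k < ?N" for k using cp[of k] that by simp
    then show False using v by (auto intro!: eq_vecI)
  qed
  moreover have "peval p A = 0\<^sub>m n n"
  proof (rule eq_matI)
    fix i j assume "i < dim_row (0\<^sub>m n n :: 'k mat)" "j < dim_col (0\<^sub>m n n :: 'k mat)"
    then have ij: "i < n" "j < n" by auto
    let ?r = "i * n + j"
    have r: "?r < n * n"
    proof -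
      have "?r < (i + 1) * n" using ij by simp
      also have "\<dots> \<le> n * n" using ij by (intro mult_le_mono1) simp
      finally show ?thesis .
    qed
    have rd: "?r div n = i" "?r mod n = j" using ij by auto
    have "(M *\<^sub>v v) $ ?r = (\<Sum>k<?N. (A ^\<^sub>m k) $$ (i,j) * v $ k)"
      using v(1) r rd by (simp add: M_def scalar_prod_def atLeast0LessThan)
    also have "\<dots> = (\<Sum>k\<le>n * n. coeff p k * (A ^\<^sub>m k) $$ (i,j))"
      by (intro sum.cong) (auto simp: cp mult.commute)
    also have "\<dots> = peval p A $$ (i,j)" using peval_index[OF A ij dp] by simp
    finally show "peval p A $$ (i,j) = 0\<^sub>m n n $$ (i,j)" using v(3) r ij by simp
  qed (use A in auto)
  ultimately show thesis using that by blast
qed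

lemma peval_dvd_0:
  assumes A: "A \<in> carrier_mat n n" and 0: "peval p A = 0\<^sub>m n n" and dvd: "p dvd q"
  shows "peval q A = 0\<^sub>m n n"
  using dvd A 0 by (auto simp: dvd_def peval_mult)

lemma mat_diff_eq_0:
  fixes A B :: "'k :: field mat"
  assumes "A - B = 0\<^sub>m n m" "A \<in> carrier_mat n m" "B \<in> carrier_mat n m"
  shows "A = B"
proof (rule eq_matI)
  fix i j assume "i < dim_row B" "j < dim_col B"
  then show "A $$ (i,j) = B $$ (i,j)"
    using arg_cong[OF assms(1), of "\<lambda>M. M $$ (i,j)"] assms(2,3) by simp
qed (use assms in auto)

lemma peval_dvd_diff_eq:
  assumes "A \<in> carrier_mat n n" "peval c A = 0\<^sub>m n n" "c dvd p - q"
  shows "peval p A = peval q A"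
  by (rule mat_diff_eq_0[of _ _ n n])
    (use peval_dvd_0[OF assms] assms(1) in \<open>auto simp: peval_diff\<close>)

text \<open>Write \<open>c = t\<^sup>m q\<close> with \<open>q(0) \<noteq> 0\<close>. Some multiple \<open>x\<close> of \<open>t\<close> is \<open>1\<close> modulo \<open>q\<close>, so a power of \<open>x\<close>
  is \<open>0\<close> modulo \<open>t\<^sup>m\<close> and \<open>1\<close> modulo \<open>q\<close>: it evaluates to the Fitting projection of a matrix killed
  by \<open>c\<close>.\<close>

lemma fitting_poly:
  fixes c :: "'k :: field poly"
  assumes "c \<noteq> 0"
  obtains p u N where "c dvd p * p - p" "p = u * [:0, 1:]" "c dvd [:0, 1:] ^ N - [:0, 1:] ^ N * p"
proof -
  let ?t = "[:0, 1:] :: 'k poly"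
  obtain q where q: "c = ?t ^ order 0 c * q" "\<not> ?t dvd q"
    using order_decomp[OF assms, of 0] by auto
  \<comment> \<open>With the successor, \<open>t\<close> divides \<open>x\<^sup>N\<close> even if it does not divide \<open>c\<close>.\<close>
  define N where "N = Suc (order 0 c)"
  have q0: "poly q 0 \<noteq> 0" using q(2) by (simp add: poly_eq_0_iff_dvd)
  obtain a q1 where q1: "q = pCons a q1" by (cases q)
  have a: "a \<noteq> 0" using q0 q1 by simp
  have x: "?t * smult (- 1 / a) q1 = 1 - smult (1 / a) q"
    using a by (simp add: q1 one_pCons)
  define x where "x = ?t * smult (- 1 / a) q1"
  have dq: "q dvd 1 - x" unfolding x_def x by (simp add: dvd_smult)
  have "1 - x dvd 1 - x ^ N" by (metis one_diff_power_eq dvd_triv_left)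
  then have q_dvd: "q dvd 1 - x ^ N" using dq dvd_trans by blast
  have c_dvd: "c dvd ?t ^ N * q" unfolding N_def by (subst q(1)) (intro mult_dvd_mono le_imp_power_dvd, auto)
  show thesis
  proof
    have "?t ^ N * q dvd x ^ N * (1 - x ^ N)"
      by (intro mult_dvd_mono dvd_power_same q_dvd) (unfold x_def, rule dvd_triv_left)
    then have "c dvd x ^ N * (1 - x ^ N)" using c_dvd dvd_trans by blast
    then have "c dvd - (x ^ N * (1 - x ^ N))" by (simp only: dvd_minus_iff)
    then show "c dvd x ^ N * x ^ N - x ^ N" by (simp add: algebra_simps)
    show "x ^ N = (x ^ order 0 c * smult (- 1 / a) q1) * ?t"
      by (simp add: N_def x_def mult_ac)
    have "?t ^ N * q dvd ?t ^ N * (1 - x ^ N)" using q_dvd by (rule mult_dvd_mono[OF dvd_refl])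
    with c_dvd have "c dvd ?t ^ N * (1 - x ^ N)" by (rule dvd_trans)
    then show "c dvd ?t ^ N - ?t ^ N * x ^ N" by (simp only: right_diff_distrib mult_1_right)
  qed
qed

text \<open>A square root of \<open>t\<close> modulo \<open>q\<close> is lifted through the roots of \<open>q\<close> one at a time: passing from
  \<open>q'\<close> to \<open>(t - a) q'\<close> replaces \<open>r\<close> by \<open>r + c q'\<close>, where \<open>c\<close> solves an equation over the field that
  is quadratic if \<open>q'(a) \<noteq> 0\<close>, and otherwise linear with slope \<open>2 r(a) \<noteq> 0\<close> since \<open>r(a)\<^sup>2 = a\<close>.\<close>

lemma sqrt_poly:
  fixes q :: "'k :: {alg_closed_field, field_char_0} poly"
  assumes "poly q 0 \<noteq> 0"
  shows "\<exists>r. q dvd r * r - [:0, 1:]"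
  using assms
proof (induction "degree q" arbitrary: q rule: less_induct)
  case less
  show ?case
  proof (cases "degree q = 0")
    case True
    then obtain c where "q = [:c:]" by (rule degree_eq_zeroE)
    then have "is_unit q" using less.prems by (simp add: is_unit_const_poly_iff dvd_field_iff)
    then show ?thesis by (auto intro: unit_imp_dvd)
  next
    case False
    then obtain a where a: "poly q a = 0" using alg_closed_imp_poly_has_root[of q] by auto
    then have a0: "a \<noteq> 0" using less.prems by auto
    from a obtain q' where q': "q = [:- a, 1:] * q'" by (auto simp: poly_eq_0_iff_dvd dvd_def)
    have "q' \<noteq> 0" using less.prems q' by auto
    then have "degree q = Suc (degree q')" unfolding q' by (subst degree_mult_eq) auto
    moreover have "poly q' 0 \<noteq> 0" using less.prems q' by auto
    ultimately obtain r g where g: "r * r - [:0, 1:] = q' * g"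
      using less.hyps[of q'] by (auto simp: dvd_def)
    have ga: "poly r a * poly r a = a + poly q' a * poly g a"
      using arg_cong[OF g, of "\<lambda>p. poly p a"] by (simp add: algebra_simps)
    \<comment> \<open>The cofactor of \<open>q'\<close> in \<open>(r + c q')\<^sup>2 - t\<close> has to vanish at \<open>a\<close>.\<close>
    obtain c where c: "poly g a + 2 * c * poly r a + c * c * poly q' a = 0"
    proof (cases "poly q' a = 0")
      case True
      then have "poly r a \<noteq> 0" using ga a0 by auto
      then have "poly g a + 2 * (- poly g a / (2 * poly r a)) * poly r a = 0" by simp
      then show thesis using that[of "- poly g a / (2 * poly r a)"] True by simp
    next
      case False
      then obtain c where "poly [:poly g a, 2 * poly r a, poly q' a:] c = 0"
        using alg_closed_imp_poly_has_root[of "[:poly g a, 2 * poly r a, poly q' a:]"] by auto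
      then show thesis using that[of c] by (simp add: algebra_simps)
    qed
    let ?G = "g + smult (2 * c) r + smult (c * c) q'"
    have "poly ?G a = 0" using c by (simp add: algebra_simps)
    then have "[:- a, 1:] dvd ?G" by (simp only: poly_eq_0_iff_dvd)
    then have "q dvd q' * ?G" unfolding q' by (metis mult.commute mult_dvd_mono dvd_refl)
    also have "q' * ?G = (r * r - [:0, 1:]) + smult (2 * c) (r * q') + smult (c * c) (q' * q')"
      unfolding g by (simp add: algebra_simps)
    also have "\<dots> = (r + smult c q') * (r + smult c q') - [:0, 1:]"
      unfolding mult_2 smult_add_left by (simp add: algebra_simps)
    finally show ?thesis by blast
  qed
qed

text \<open>The element \<open>c = (e - f)\<^sup>2 = 2 h - h\<^sup>2\<close> is nilpotent along with \<open>h = e + f\<close>, so it suffices that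
  \<open>x c e = 0\<close> implies \<open>x e = 0\<close>. Indeed, \<open>y = x e h\<close> then satisfies \<open>y h = 2 y\<close> and vanishes as \<open>h\<close> is
  nilpotent and 2 is invertible; since \<open>y f = 2 x e f\<close>, also \<open>x e f = 0\<close> and \<open>x e = y - x e f = 0\<close>.\<close>

lemma sum_idempotents_not_nilpotent:
  fixes e f :: "'k :: field_char_0 mat"
  assumes e: "e \<in> carrier_mat n n" and f: "f \<in> carrier_mat n n"
    and ee: "e * e = e" and ff: "f * f = f" and nil: "(e + f) ^\<^sub>m N = 0\<^sub>m n n"
  shows "e = 0\<^sub>m n n"
proof -
  note d = e f
  note ring = mat_assoc mat_add_distl mat_add_distr mat_minus_distl mat_minus_distr
  have ee': "e * (e * X) = e * X" if "X \<in> carrier_mat n n" for X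
    using that e ee by (simp add: mat_assoc[symmetric])
  have ff': "f * (f * X) = f * X" if "X \<in> carrier_mat n n" for X
    using that f ff by (simp add: mat_assoc[symmetric])
  define h where "h = e + f"
  define c where "c = e + f - e * f - f * e"
  have hc: "h \<in> carrier_mat n n" and cc: "c \<in> carrier_mat n n" using d by (auto simp: h_def c_def)
  have c1: "c * e = e - e * (f * e)" and c2: "e * c = e - e * (f * e)"
    and c3: "c * f = f - f * (e * f)" and c4: "f * c = f - f * (e * f)"
    using d unfolding c_def by (auto simp: ring ee ff ee' ff' intro!: eq_matI)
  have ch: "c = peval [:0, 2, - 1:] h"
    using d hc unfolding c_def
    by (simp add: peval_pCons peval_0) (auto simp: h_def ring ee ff intro!: eq_matI)
  have "c ^\<^sub>m k = peval ([:0, 2, - 1:] ^ k) h" for k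
  proof (induction k)
    case 0 then show ?case using hc cc by (simp add: peval_1)
  next
    case (Suc k) then show ?case by (simp only: power_Suc2 peval_mult[OF hc] ch[symmetric] pow_mat.simps)
  qed
  moreover have "[:0, 2, - 1:] ^ N = [:0, 1 :: 'k:] ^ N * [:2, - 1:] ^ N"
    by (subst power_mult_distrib[symmetric]) simp
  ultimately have cN: "c ^\<^sub>m N = 0\<^sub>m n n"
    using hc nil by (simp add: peval_mult peval_X_power h_def[symmetric])
  have step: "x * e = 0\<^sub>m n n"
    if x: "x \<in> carrier_mat n n" and xce: "x * c * e = 0\<^sub>m n n" for x
  proof -
    have xe: "x * e - x * (e * (f * e)) = 0\<^sub>m n n" using x d cc xce by (simp add: mat_assoc c1 mat_minus_distl)
    then have 1: "x * (e * (f * e)) = x * e" using mat_diff_eq_0[OF xe] x d by auto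
    define y where "y = x * e * h"
    have y: "y \<in> carrier_mat n n" using x d hc by (simp add: y_def)
    have "y * h = x * (e * e) + x * (e * f) + (x * (e * (f * e)) + x * (e * (f * f)))"
      using x d unfolding y_def h_def by (simp add: ring) (auto simp: ee ff ee' ff' intro!: eq_matI)
    also have "\<dots> = 2 \<cdot>\<^sub>m y" unfolding 1 ee ff using x d unfolding y_def h_def
      by (auto simp: ring ee intro!: eq_matI)
    finally have yh: "y * h = 2 \<cdot>\<^sub>m y" .
    have "y * h ^\<^sub>m k = 2 ^ k \<cdot>\<^sub>m y" for k
    proof (induction k)
      case 0 then show ?case using y hc by (auto intro!: eq_matI)
    next
      case (Suc k)
      have "y * h ^\<^sub>m Suc k = y * h ^\<^sub>m k * h" using y hc by (simp add: mat_assoc)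
      then show ?case using y hc by (simp add: Suc mat_smult_l yh mat_smult_smult mult.commute)
    qed
    from this[of N] have y2: "2 ^ N \<cdot>\<^sub>m y = 0\<^sub>m n n" using nil y by (simp add: h_def)
    have y0: "y $$ (i,j) = 0" if "i < n" "j < n" for i j
      using arg_cong[OF y2, of "\<lambda>M. M $$ (i,j)"] that y by simp
    have y_eq: "y = x * e + x * (e * f)" using x d unfolding y_def h_def by (simp add: ring ee)
    have "y * f = x * (e * f) + x * (e * f)" using x d unfolding y_eq by (simp add: ring ff)
    moreover have "y = 0\<^sub>m n n" using y y0 by (auto intro!: eq_matI)
    ultimately have xef: "x * (e * f) + x * (e * f) = 0\<^sub>m n n" using f by simp
    have "(x * (e * f)) $$ (i,j) = 0" if "i < n" "j < n" for i j
      using arg_cong[OF xef, of "\<lambda>M. M $$ (i,j)"] that x d by simp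
    then show "x * e = 0\<^sub>m n n"
      using y0 x d unfolding y_eq by (auto intro!: eq_matI)
  qed
  have "c ^\<^sub>m (N - k) * e = 0\<^sub>m n n" if "k \<le> N" for k
    using that
  proof (induction k)
    case 0 then show ?case using cN e by simp
  next
    case (Suc k)
    then have "N - k = Suc (N - Suc k)" by simp
    then have "c ^\<^sub>m (N - k) = c ^\<^sub>m (N - Suc k) * c" by simp
    then show ?case using Suc step[of "c ^\<^sub>m (N - Suc k)"] cc by auto
  qed
  from this[of N] show ?thesis using e cc by simp
qed

section \<open>Separating a vector from a subspace\<close>

definition subsp :: "nat \<Rightarrow> 'k :: field vec set \<Rightarrow> bool" where
  "subsp n U \<longleftrightarrow> U \<subseteq> carrier_vec n \<and> 0\<^sub>v n \<in> U \<and> (\<forall>u\<in>U. \<forall>v\<in>U. u + v \<in> U) \<and> (\<forall>c. \<forall>u\<in>U. c \<cdot>\<^sub>v u \<in> U)"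

text \<open>The functional is built on the space of all functions on the natural numbers, into which the vectors
  embed: there it can be prescribed on an independent set, here a basis of \<open>H\<close> together with \<open>y\<close>.\<close>

lemma separating_functional:
  fixes H :: "'k :: field vec set"
  assumes H: "subsp n H" and y: "y \<in> carrier_vec n" "y \<notin> H"
  obtains \<psi> where "\<psi> \<in> carrier_vec n" "\<psi> \<bullet> y = 1" "\<And>u. u \<in> H \<Longrightarrow> \<psi> \<bullet> u = 0"
proof -
  define sc :: "'k \<Rightarrow> (nat \<Rightarrow> 'k) \<Rightarrow> nat \<Rightarrow> 'k" where "sc c g = (\<lambda>i. c * g i)" for c g
  interpret V: vector_space sc by unfold_locales (auto simp: sc_def algebra_simps fun_eq_iff)
  interpret K: vector_space "(*) :: 'k \<Rightarrow> 'k \<Rightarrow> 'k" by unfold_locales (auto simp: algebra_simps)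
  interpret VK: vector_space_pair sc "(*) :: 'k \<Rightarrow> 'k \<Rightarrow> 'k" ..
  define em :: "'k vec \<Rightarrow> nat \<Rightarrow> 'k" where "em v = (\<lambda>i. if i < n then v $ i else 0)" for v
  have em_inj: "u = v" if "em u = em v" "u \<in> carrier_vec n" "v \<in> carrier_vec n" for u v
    using that by (intro eq_vecI) (auto simp: em_def fun_eq_iff split: if_splits)
  have Hc: "u \<in> carrier_vec n" if "u \<in> H" for u using that H by (auto simp: subsp_def)
  have sub: "V.subspace (em ` H)"
  proof (rule V.subspaceI)
    have "em (0\<^sub>v n) = 0" by (auto simp: em_def fun_eq_iff)
    then show "0 \<in> em ` H" using H unfolding subsp_def by (metis image_eqI)
    fix a b assume "a \<in> em ` H" "b \<in> em ` H"
    then obtain u v where uv: "u \<in> H" "v \<in> H" "a = em u" "b = em v" by auto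
    then have "a + b = em (u + v)" using Hc[OF uv(1)] Hc[OF uv(2)] by (auto simp: em_def fun_eq_iff)
    then show "a + b \<in> em ` H" using uv H unfolding subsp_def by blast
  next
    fix c a assume "a \<in> em ` H"
    then obtain u where u: "u \<in> H" "a = em u" by auto
    then have "sc c a = em (c \<cdot>\<^sub>v u)" using Hc[of u] by (auto simp: em_def sc_def fun_eq_iff)
    then show "sc c a \<in> em ` H" using u H unfolding subsp_def by blast
  qed
  have ny: "em y \<notin> em ` H" using em_inj y Hc by blast
  obtain B where B: "B \<subseteq> em ` H" "V.independent B" "em ` H \<subseteq> V.span B"
    by (rule V.maximal_independent_subset)
  have "V.span B \<subseteq> em ` H" using B(1) sub by (rule V.span_minimal)
  then have "em y \<notin> V.span B" using ny by blast
  then have "V.independent (insert (em y) B)" using B(2) by (rule V.independent_insertI)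
  from VK.linear_independent_extend[OF this, of "\<lambda>x. if x = em y then 1 else 0"]
  obtain g where g: "Vector_Spaces.linear sc (*) g" "\<forall>x\<in>insert (em y) B. g x = (if x = em y then 1 else 0)"
    by blast
  interpret g: Vector_Spaces.linear sc "(*) :: 'k \<Rightarrow> 'k \<Rightarrow> 'k" g by (rule g(1))
  have gB: "g x = 0" if "x \<in> V.span B" for x
  proof -
    have "g b = 0" if "b \<in> B" for b using that g(2) B(1) ny by auto
    then show ?thesis using VK.linear_eq_0_on_span[OF g(1), of B x] that by blast
  qed
  define \<psi> where "\<psi> = vec n (\<lambda>i. g (\<lambda>j. if j = i then 1 else 0))"
  have \<psi>: "\<psi> \<bullet> v = g (em v)" if "v \<in> carrier_vec n" for v
  proof -
    have sum_apply: "(\<Sum>i<m. F i) j = (\<Sum>i<m. F i j)" for F :: "nat \<Rightarrow> nat \<Rightarrow> 'k" and m j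
      by (induction m) auto
    have "em v = (\<Sum>i<n. sc (v $ i) (\<lambda>j. if j = i then 1 else 0))"
      by (rule ext) (auto simp: em_def sc_def sum_apply if_distrib cong: if_cong)
    then have "g (em v) = (\<Sum>i<n. g (sc (v $ i) (\<lambda>j. if j = i then 1 else 0)))"
      by (simp add: g.sum)
    also have "\<dots> = \<psi> \<bullet> v" using that
      by (auto simp: \<psi>_def scalar_prod_def g.scale atLeast0LessThan mult.commute intro!: sum.cong)
    finally show ?thesis by simp
  qed
  show thesis
  proof
    show "\<psi> \<in> carrier_vec n" by (simp add: \<psi>_def)
    show "\<psi> \<bullet> y = 1" using \<psi>[OF y(1)] g(2) by simp
    show "\<psi> \<bullet> u = 0" if "u \<in> H" for u
    proof -
      have "em u \<in> V.span B" using B(3) that by blast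
      then show ?thesis using \<psi>[OF Hc[OF that]] gB by simp
    qed
  qed
qed

section \<open>Homomorphisms and direct summands of representations\<close>

lemma mat_dsum_mult:
  fixes A :: "'k :: field mat"
  assumes "dim_col A = dim_row C" "dim_col B = dim_row D"
  shows "mat_dsum A B * mat_dsum C D = mat_dsum (A * C) (B * D)"
  unfolding mat_dsum_def using assms
  by (subst mult_four_block_mat[where ?nr1.0 = "dim_row A" and ?n1.0 = "dim_col A" and ?n2.0 = "dim_col B"
        and ?nr2.0 = "dim_row B" and ?nc1.0 = "dim_col C" and ?nc2.0 = "dim_col D"])
    (auto intro!: cong_four_block_mat eq_matI)

lemma mat_dsum_one: "mat_dsum (1\<^sub>m n) (1\<^sub>m m) = (1\<^sub>m (n + m) :: 'k :: field mat)"
  by (auto simp: mat_dsum_def)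

lemma one_mat_eq_zero: "(1\<^sub>m n :: 'k :: field mat) = 0\<^sub>m n n \<Longrightarrow> n = 0"
  by (metis index_one_mat(1) index_zero_mat(1) gr0I zero_neq_one)

definition rep_hom ::
    "('v, 'a) pre_digraph \<Rightarrow> ('v, 'a, 'k :: field) qrep \<Rightarrow> ('v, 'a, 'k) qrep \<Rightarrow> ('v \<Rightarrow> 'k mat) \<Rightarrow> bool"
  where
  "rep_hom Q V W g \<longleftrightarrow>
     (\<forall>i\<in>verts Q. g i \<in> carrier_mat (vdim W i) (vdim V i)) \<and>
     (\<forall>a\<in>arcs Q. g (head Q a) * amap V a = amap W a * g (tail Q a))"

definition summand :: "('v, 'a) pre_digraph \<Rightarrow> ('v, 'a, 'k :: field) qrep \<Rightarrow> ('v, 'a, 'k) qrep \<Rightarrow> bool"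
  where
  "summand Q X Y \<longleftrightarrow>
     (\<exists>i p. rep_hom Q X Y i \<and> rep_hom Q Y X p \<and> (\<forall>v\<in>verts Q. p v * i v = 1\<^sub>m (vdim X v)))"

definition total_dim :: "('v, 'a) pre_digraph \<Rightarrow> ('v, 'a, 'k) qrep \<Rightarrow> nat" where
  "total_dim Q V = (\<Sum>i\<in>verts Q. vdim V i)"

definition idem_endo :: "('v, 'a) pre_digraph \<Rightarrow> ('v, 'a, 'k :: field) qrep \<Rightarrow> ('v \<Rightarrow> 'k mat) \<Rightarrow> bool" where
  "idem_endo Q V e \<longleftrightarrow> rep_hom Q V V e \<and> (\<forall>v\<in>verts Q. e v * e v = e v)"

lemma rep_homD:
  assumes "rep_hom Q V W g" "i \<in> verts Q"
  shows "g i \<in> carrier_mat (vdim W i) (vdim V i)" "dim_row (g i) = vdim W i" "dim_col (g i) = vdim V i"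
  using assms by (auto simp: rep_hom_def)

lemma rep_hom_comm: "rep_hom Q V W g \<Longrightarrow> a \<in> arcs Q \<Longrightarrow>
    g (head Q a) * amap V a = amap W a * g (tail Q a)"
  by (auto simp: rep_hom_def)

lemma is_repD:
  assumes "is_rep Q V" "a \<in> arcs Q"
  shows "amap V a \<in> carrier_mat (vdim V (head Q a)) (vdim V (tail Q a))"
    "dim_row (amap V a) = vdim V (head Q a)" "dim_col (amap V a) = vdim V (tail Q a)"
  using assms by (auto simp: is_rep_def)

lemma rep_dsum_sel [simp]:
  "vdim (rep_dsum V W) i = vdim V i + vdim W i" "amap (rep_dsum V W) a = mat_dsum (amap V a) (amap W a)"
  by (auto simp: rep_dsum_def)

lemma total_dim_dsum: "total_dim Q (rep_dsum V W) = total_dim Q V + total_dim Q W"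
  by (simp add: total_dim_def sum.distrib)

context fin_digraph
begin

lemma is_rep_dsum: "is_rep G V \<Longrightarrow> is_rep G W \<Longrightarrow> is_rep G (rep_dsum V W)"
  by (auto simp: is_rep_def[of G "rep_dsum V W"] is_repD intro!: carrier_matI)

lemma total_dim_0_iff: "total_dim G V = 0 \<longleftrightarrow> \<not> nonzero_rep G V"
  by (auto simp: total_dim_def nonzero_rep_def)

lemma vdim_le_total: "i \<in> verts G \<Longrightarrow> vdim V i \<le> total_dim G V"
  unfolding total_dim_def by (intro member_le_sum) auto

lemma rep_hom_one: "is_rep G V \<Longrightarrow> rep_hom G V V (\<lambda>i. 1\<^sub>m (vdim V i))"
  by (auto simp: rep_hom_def is_rep_def)

lemma rep_hom_comp:
  assumes "is_rep G V" "is_rep G W" "is_rep G U" "rep_hom G V W g" "rep_hom G W U h"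
  shows "rep_hom G V U (\<lambda>i. h i * g i)"
  unfolding rep_hom_def
proof (intro conjI ballI)
  fix i assume "i \<in> verts G"
  then show "h i * g i \<in> carrier_mat (vdim U i) (vdim V i)"
    using rep_homD[OF assms(4)] rep_homD[OF assms(5)] by auto
next
  fix a assume a: "a \<in> arcs G"
  note d = is_repD[OF assms(1) a] is_repD[OF assms(2) a] is_repD[OF assms(3) a]
    rep_homD[OF assms(4) head_in_verts[OF a]] rep_homD[OF assms(4) tail_in_verts[OF a]]
    rep_homD[OF assms(5) head_in_verts[OF a]] rep_homD[OF assms(5) tail_in_verts[OF a]]
  have "h (head G a) * g (head G a) * amap V a = h (head G a) * (amap W a * g (tail G a))"
    using d rep_hom_comm[OF assms(4) a] by (simp add: mat_assoc)
  also have "\<dots> = h (head G a) * amap W a * g (tail G a)" using d by (simp add: mat_assoc)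
  also have "\<dots> = amap U a * (h (tail G a) * g (tail G a))"
    using d rep_hom_comm[OF assms(5) a] by (simp add: mat_assoc)
  finally show "h (head G a) * g (head G a) * amap V a = amap U a * (h (tail G a) * g (tail G a))" .
qed

lemma rep_hom_peval:
  assumes "is_rep G V" "rep_hom G V V f"
  shows "rep_hom G V V (\<lambda>i. peval p (f i))"
  unfolding rep_hom_def
proof (intro conjI ballI)
  fix i assume "i \<in> verts G"
  then show "peval p (f i) \<in> carrier_mat (vdim V i) (vdim V i)"
    using rep_homD[OF assms(2)] by auto
next
  fix a assume a: "a \<in> arcs G"
  show "peval p (f (head G a)) * amap V a = amap V a * peval p (f (tail G a))"
    by (rule peval_intertwine[OF rep_homD(1)[OF assms(2)] rep_homD(1)[OF assms(2)] is_repD(1)[OF assms(1)]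
          rep_hom_comm[OF assms(2)]]) (use a in auto)
qed

lemma rep_isomorphismI:
  assumes "is_rep G V" "is_rep G W" "rep_hom G V W g"
    and "\<And>i. i \<in> verts G \<Longrightarrow> h i \<in> carrier_mat (vdim V i) (vdim W i)"
    and "\<And>i. i \<in> verts G \<Longrightarrow> g i * h i = 1\<^sub>m (vdim W i)"
    and "\<And>i. i \<in> verts G \<Longrightarrow> h i * g i = 1\<^sub>m (vdim V i)"
  shows "rep_isomorphism G V W g"
  using assms invertible_matI(2)[OF rep_homD(1)[OF assms(3)] assms(4) assms(5) assms(6)]
  by (auto simp: rep_isomorphism_def rep_hom_def)

lemma rep_isomorphismE:
  assumes "rep_isomorphism G V W g"
  obtains h where "is_rep G V" "is_rep G W" "rep_hom G V W g" "rep_hom G W V h"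
    "\<And>i. i \<in> verts G \<Longrightarrow> g i * h i = 1\<^sub>m (vdim W i)"
    "\<And>i. i \<in> verts G \<Longrightarrow> h i * g i = 1\<^sub>m (vdim V i)"
    "\<And>i. i \<in> verts G \<Longrightarrow> vdim V i = vdim W i"
proof -
  have V: "is_rep G V" and W: "is_rep G W" and g: "rep_hom G V W g"
    using assms by (auto simp: rep_isomorphism_def rep_hom_def)
  have "\<exists>h. vdim W i = vdim V i \<and> h \<in> carrier_mat (vdim V i) (vdim W i) \<and> g i * h = 1\<^sub>m (vdim W i) \<and>
      h * g i = 1\<^sub>m (vdim V i)" if "i \<in> verts G" for i
  proof -
    have "invertible_mat (g i)" using assms that by (auto simp: rep_isomorphism_def)
    from invertible_matE[OF rep_homD(1)[OF g that] this] show ?thesis by metis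
  qed
  then obtain h where "\<And>i. i \<in> verts G \<Longrightarrow> vdim W i = vdim V i \<and>
      h i \<in> carrier_mat (vdim V i) (vdim W i) \<and> g i * h i = 1\<^sub>m (vdim W i) \<and> h i * g i = 1\<^sub>m (vdim V i)"
    by metis
  then have WV: "\<And>i. i \<in> verts G \<Longrightarrow> vdim W i = vdim V i"
    and h: "\<And>i. i \<in> verts G \<Longrightarrow> h i \<in> carrier_mat (vdim V i) (vdim W i)"
      "\<And>i. i \<in> verts G \<Longrightarrow> g i * h i = 1\<^sub>m (vdim W i)"
      "\<And>i. i \<in> verts G \<Longrightarrow> h i * g i = 1\<^sub>m (vdim V i)"
    by blast+
  have "rep_hom G W V h"
    unfolding rep_hom_def
  proof (intro conjI ballI)
    fix a assume a: "a \<in> arcs G"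
    let ?s = "tail G a" and ?t = "head G a"
    note hs = h[OF tail_in_verts[OF a]] and ht = h[OF head_in_verts[OF a]]
    note d = is_repD[OF V a] is_repD[OF W a] rep_homD[OF g head_in_verts[OF a]]
      rep_homD[OF g tail_in_verts[OF a]]
    note dd = d hs(1) ht(1)
    have "h ?t * amap W a = h ?t * (amap W a * (g ?s * h ?s))" unfolding hs(2) using dd by simp
    also have "\<dots> = h ?t * (amap W a * g ?s) * h ?s" using dd by (simp add: mat_assoc)
    also have "\<dots> = h ?t * (g ?t * amap V a) * h ?s" using rep_hom_comm[OF g a] by simp
    also have "\<dots> = (h ?t * g ?t) * (amap V a * h ?s)" using dd by (simp add: mat_assoc)
    also have "\<dots> = amap V a * h ?s" unfolding ht(3) using dd by simp
    finally show "h ?t * amap W a = amap V a * h ?s" .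
  qed (use h in auto)
  then show thesis by (rule that[OF V W g _ h(2) h(3) WV[symmetric]])
qed

lemma rep_iso_refl: "is_rep G V \<Longrightarrow> rep_iso G V V"
  unfolding rep_iso_def
  by (rule exI, rule rep_isomorphismI[where h = "\<lambda>i. 1\<^sub>m (vdim V i)"]) (auto intro: rep_hom_one)

lemma rep_isomorphism_comp:
  assumes "rep_isomorphism G V W g" "rep_isomorphism G W U h"
  shows "rep_isomorphism G V U (\<lambda>i. h i * g i)"
proof -
  obtain g' where g: "is_rep G V" "is_rep G W" "rep_hom G V W g" "rep_hom G W V g'"
    "\<And>i. i \<in> verts G \<Longrightarrow> g i * g' i = 1\<^sub>m (vdim W i)" "\<And>i. i \<in> verts G \<Longrightarrow> g' i * g i = 1\<^sub>m (vdim V i)"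
    by (rule rep_isomorphismE[OF assms(1)]) blast
  obtain h' where h: "is_rep G U" "rep_hom G W U h" "rep_hom G U W h'"
    "\<And>i. i \<in> verts G \<Longrightarrow> h i * h' i = 1\<^sub>m (vdim U i)" "\<And>i. i \<in> verts G \<Longrightarrow> h' i * h i = 1\<^sub>m (vdim W i)"
    by (rule rep_isomorphismE[OF assms(2)]) blast
  show ?thesis
  proof (rule rep_isomorphismI[where h = "\<lambda>i. g' i * h' i"])
    show "rep_hom G V U (\<lambda>i. h i * g i)" by (rule rep_hom_comp) (use g h in auto)
    fix i assume i: "i \<in> verts G"
    note d = rep_homD[OF g(3) i] rep_homD[OF g(4) i] rep_homD[OF h(2) i] rep_homD[OF h(3) i]
    show "g' i * h' i \<in> carrier_mat (vdim V i) (vdim U i)" using d by auto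
    have "h i * g i * (g' i * h' i) = h i * (g i * g' i) * h' i" using d by (simp add: mat_assoc)
    then show "h i * g i * (g' i * h' i) = 1\<^sub>m (vdim U i)" using d g h i by simp
    have "g' i * h' i * (h i * g i) = g' i * (h' i * h i) * g i" using d by (simp add: mat_assoc)
    then show "g' i * h' i * (h i * g i) = 1\<^sub>m (vdim V i)" using d g h i by simp
  qed (use g h in auto)
qed

lemma rep_iso_trans: "rep_iso G V W \<Longrightarrow> rep_iso G W U \<Longrightarrow> rep_iso G V U"
  unfolding rep_iso_def using rep_isomorphism_comp by blast

lemma rep_isomorphism_sym:
  assumes "rep_isomorphism G V W g"
  obtains h where "rep_isomorphism G W V h" "\<And>i. i \<in> verts G \<Longrightarrow> g i * h i = 1\<^sub>m (vdim W i)"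
    "\<And>i. i \<in> verts G \<Longrightarrow> h i * g i = 1\<^sub>m (vdim V i)"
proof -
  obtain h where h: "is_rep G V" "is_rep G W" "rep_hom G V W g" "rep_hom G W V h"
    "\<And>i. i \<in> verts G \<Longrightarrow> g i * h i = 1\<^sub>m (vdim W i)" "\<And>i. i \<in> verts G \<Longrightarrow> h i * g i = 1\<^sub>m (vdim V i)"
    by (rule rep_isomorphismE[OF assms]) blast
  have "rep_isomorphism G W V h"
    by (rule rep_isomorphismI[where h = g]) (use h rep_homD(1)[OF h(3)] in auto)
  then show thesis using that h by blast
qed

lemma rep_iso_sym: "rep_iso G V W \<Longrightarrow> rep_iso G W V"
  unfolding rep_iso_def by (metis rep_isomorphism_sym)

lemma rep_iso_is_rep: "rep_iso G V W \<Longrightarrow> is_rep G V \<and> is_rep G W"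
  by (auto simp: rep_iso_def rep_isomorphism_def)

lemma rep_iso_vdim: "rep_iso G V W \<Longrightarrow> i \<in> verts G \<Longrightarrow> vdim V i = vdim W i"
  by (auto simp: rep_iso_def elim!: rep_isomorphismE)

lemma rep_iso_total_dim: "rep_iso G V W \<Longrightarrow> total_dim G V = total_dim G W"
  unfolding total_dim_def by (rule sum.cong) (auto dest: rep_iso_vdim)

lemma rep_iso_dsum:
  assumes "rep_iso G V V'" "rep_iso G W W'"
  shows "rep_iso G (rep_dsum V W) (rep_dsum V' W')"
proof -
  obtain g g' where g: "is_rep G V" "is_rep G V'" "rep_hom G V V' g" "rep_hom G V' V g'"
    "\<And>i. i \<in> verts G \<Longrightarrow> g i * g' i = 1\<^sub>m (vdim V' i)" "\<And>i. i \<in> verts G \<Longrightarrow> g' i * g i = 1\<^sub>m (vdim V i)"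
    using assms(1) by (auto simp: rep_iso_def elim!: rep_isomorphismE)
  obtain h h' where h: "is_rep G W" "is_rep G W'" "rep_hom G W W' h" "rep_hom G W' W h'"
    "\<And>i. i \<in> verts G \<Longrightarrow> h i * h' i = 1\<^sub>m (vdim W' i)" "\<And>i. i \<in> verts G \<Longrightarrow> h' i * h i = 1\<^sub>m (vdim W i)"
    using assms(2) by (auto simp: rep_iso_def elim!: rep_isomorphismE)
  show ?thesis unfolding rep_iso_def
  proof (rule exI, rule rep_isomorphismI[where h = "\<lambda>i. mat_dsum (g' i) (h' i)"])
    show "rep_hom G (rep_dsum V W) (rep_dsum V' W') (\<lambda>i. mat_dsum (g i) (h i))"
      unfolding rep_hom_def
    proof (intro conjI ballI)
      fix i assume i: "i \<in> verts G"
      show "mat_dsum (g i) (h i) \<in> carrier_mat (vdim (rep_dsum V' W') i) (vdim (rep_dsum V W) i)"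
        using rep_homD[OF g(3) i] rep_homD[OF h(3) i] by auto
    next
      fix a assume a: "a \<in> arcs G"
      note d = is_repD[OF g(1) a] is_repD[OF g(2) a] is_repD[OF h(1) a] is_repD[OF h(2) a]
        rep_homD[OF g(3) head_in_verts[OF a]] rep_homD[OF g(3) tail_in_verts[OF a]]
        rep_homD[OF h(3) head_in_verts[OF a]] rep_homD[OF h(3) tail_in_verts[OF a]]
      show "mat_dsum (g (head G a)) (h (head G a)) * amap (rep_dsum V W) a =
          amap (rep_dsum V' W') a * mat_dsum (g (tail G a)) (h (tail G a))"
        using d rep_hom_comm[OF g(3) a] rep_hom_comm[OF h(3) a] by (simp add: mat_dsum_mult)
    qed
    fix i assume i: "i \<in> verts G"
    note d = rep_homD[OF g(3) i] rep_homD[OF g(4) i] rep_homD[OF h(3) i] rep_homD[OF h(4) i]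
    show "mat_dsum (g' i) (h' i) \<in> carrier_mat (vdim (rep_dsum V W) i) (vdim (rep_dsum V' W') i)"
      using d by auto
    show "mat_dsum (g i) (h i) * mat_dsum (g' i) (h' i) = 1\<^sub>m (vdim (rep_dsum V' W') i)"
      "mat_dsum (g' i) (h' i) * mat_dsum (g i) (h i) = 1\<^sub>m (vdim (rep_dsum V W) i)"
      using d g h i by (simp_all add: mat_dsum_mult mat_dsum_one)
  qed (use is_rep_dsum[OF g(1) h(1)] is_rep_dsum[OF g(2) h(2)] in auto)
qed

lemma dsum_injections:
  fixes V W :: "('a, 'b, 'k :: field) qrep"
  assumes V: "is_rep G V" and W: "is_rep G W"
  shows "rep_hom G V (rep_dsum V W) (\<lambda>i. vcat (1\<^sub>m (vdim V i)) (0\<^sub>m (vdim W i) (vdim V i)))"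
    and "rep_hom G W (rep_dsum V W) (\<lambda>i. vcat (0\<^sub>m (vdim V i) (vdim W i)) (1\<^sub>m (vdim W i)))"
    and "rep_hom G (rep_dsum V W) V (\<lambda>i. hcat (1\<^sub>m (vdim V i)) (0\<^sub>m (vdim V i) (vdim W i)))"
    and "rep_hom G (rep_dsum V W) W (\<lambda>i. hcat (0\<^sub>m (vdim W i) (vdim V i)) (1\<^sub>m (vdim W i)))"
  using assms unfolding rep_hom_def
  by (auto simp: dsum_vcat hcat_dsum mult_hcat vcat_mult is_repD)

lemma summand_dsum:
  fixes V W :: "('a, 'b, 'k :: field) qrep"
  assumes "is_rep G V" "is_rep G W"
  shows "summand G V (rep_dsum V W)" "summand G W (rep_dsum V W)"
  unfolding summand_def
  by (intro exI conjI, rule dsum_injections(1)[OF assms], rule dsum_injections(3)[OF assms],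
      auto simp: hcat_vcat)
    (intro exI conjI, rule dsum_injections(2)[OF assms], rule dsum_injections(4)[OF assms],
      auto simp: hcat_vcat)

lemma summand_trans:
  assumes "is_rep G X" "is_rep G Y" "is_rep G Z" "summand G X Y" "summand G Y Z"
  shows "summand G X Z"
proof -
  obtain i p where ip: "rep_hom G X Y i" "rep_hom G Y X p" "\<And>v. v \<in> verts G \<Longrightarrow> p v * i v = 1\<^sub>m (vdim X v)"
    using assms(4) by (auto simp: summand_def)
  obtain j q where jq: "rep_hom G Y Z j" "rep_hom G Z Y q" "\<And>v. v \<in> verts G \<Longrightarrow> q v * j v = 1\<^sub>m (vdim Y v)"
    using assms(5) by (auto simp: summand_def)
  show ?thesis unfolding summand_def
  proof (intro exI conjI ballI)
    show "rep_hom G X Z (\<lambda>v. j v * i v)" "rep_hom G Z X (\<lambda>v. p v * q v)"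
      using rep_hom_comp assms ip jq by blast+
    fix v assume v: "v \<in> verts G"
    note d = rep_homD[OF ip(1) v] rep_homD[OF ip(2) v] rep_homD[OF jq(1) v] rep_homD[OF jq(2) v]
    have "p v * q v * (j v * i v) = p v * (q v * j v) * i v" using d by (simp add: mat_assoc)
    then show "p v * q v * (j v * i v) = 1\<^sub>m (vdim X v)" using d ip jq v by simp
  qed
qed

lemma rep_iso_summand: "rep_iso G X Y \<Longrightarrow> summand G X Y"
  by (auto simp: rep_iso_def summand_def elim!: rep_isomorphismE)

lemma summand_vdim_le:
  assumes "summand G X Y" "v \<in> verts G"
  shows "vdim X v \<le> vdim Y v"
proof -
  obtain i p where ip: "rep_hom G X Y i" "rep_hom G Y X p" "p v * i v = 1\<^sub>m (vdim X v)"
    using assms by (auto simp: summand_def)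
  show ?thesis by (rule right_inverse_dim_le[OF rep_homD(1)[OF ip(2)] rep_homD(1)[OF ip(1)] ip(3)])
      (use assms in auto)
qed

lemma summand_total_dim_le: "summand G X Y \<Longrightarrow> total_dim G X \<le> total_dim G Y"
  unfolding total_dim_def by (intro sum_mono summand_vdim_le)

text \<open>An idempotent endomorphism splits a representation into the direct sum of its image and its
  kernel; the matrices are those of the splittings at the single vertices.\<close>

lemma idem_endo_splits:
  assumes V: "is_rep G V" and e: "idem_endo G V e"
  obtains W W' A B A' B' where "is_rep G W" "is_rep G W'"
    "rep_hom G W V A" "rep_hom G V W B" "rep_hom G W' V A'" "rep_hom G V W' B'"
    "\<And>i. i \<in> verts G \<Longrightarrow> A i * B i = e i" "\<And>i. i \<in> verts G \<Longrightarrow> B i * A i = 1\<^sub>m (vdim W i)"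
    "\<And>i. i \<in> verts G \<Longrightarrow> A' i * B' i = 1\<^sub>m (vdim V i) - e i" "\<And>i. i \<in> verts G \<Longrightarrow> B' i * A' i = 1\<^sub>m (vdim W' i)"
    "\<And>a. a \<in> arcs G \<Longrightarrow> amap W a = B (head G a) * amap V a * A (tail G a)"
    "\<And>a. a \<in> arcs G \<Longrightarrow> amap W' a = B' (head G a) * amap V a * A' (tail G a)"
    "rep_isomorphism G V (rep_dsum W W') (\<lambda>i. vcat (B i) (B' i))"
proof -
  have eh: "rep_hom G V V e" and ee: "\<And>i. i \<in> verts G \<Longrightarrow> e i * e i = e i"
    using e by (auto simp: idem_endo_def)
  have "\<exists>r s A B A' B'. vdim V i = r + s \<and>
      A \<in> carrier_mat (vdim V i) r \<and> B \<in> carrier_mat r (vdim V i) \<and> A * B = e i \<and> B * A = 1\<^sub>m r \<and>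
      A' \<in> carrier_mat (vdim V i) s \<and> B' \<in> carrier_mat s (vdim V i) \<and> A' * B' = 1\<^sub>m (vdim V i) - e i \<and>
      B' * A' = 1\<^sub>m s \<and> B * A' = 0\<^sub>m r s \<and> B' * A = 0\<^sub>m s r" if "i \<in> verts G" for i
    by (rule idempotent_splitting[OF rep_homD(1)[OF eh that] ee[OF that]]) blast
  then obtain r s A B A' B' where "\<And>i. i \<in> verts G \<Longrightarrow> vdim V i = r i + s i \<and>
      A i \<in> carrier_mat (vdim V i) (r i) \<and> B i \<in> carrier_mat (r i) (vdim V i) \<and> A i * B i = e i \<and>
      B i * A i = 1\<^sub>m (r i) \<and> A' i \<in> carrier_mat (vdim V i) (s i) \<and> B' i \<in> carrier_mat (s i) (vdim V i) \<and>
      A' i * B' i = 1\<^sub>m (vdim V i) - e i \<and> B' i * A' i = 1\<^sub>m (s i) \<and> B i * A' i = 0\<^sub>m (r i) (s i) \<and>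
      B' i * A i = 0\<^sub>m (s i) (r i)"
    by metis
  then have *: "\<And>i. i \<in> verts G \<Longrightarrow> vdim V i = r i + s i"
      "\<And>i. i \<in> verts G \<Longrightarrow> A i \<in> carrier_mat (vdim V i) (r i)"
      "\<And>i. i \<in> verts G \<Longrightarrow> B i \<in> carrier_mat (r i) (vdim V i)"
      "\<And>i. i \<in> verts G \<Longrightarrow> A i * B i = e i" "\<And>i. i \<in> verts G \<Longrightarrow> B i * A i = 1\<^sub>m (r i)"
      "\<And>i. i \<in> verts G \<Longrightarrow> A' i \<in> carrier_mat (vdim V i) (s i)"
      "\<And>i. i \<in> verts G \<Longrightarrow> B' i \<in> carrier_mat (s i) (vdim V i)"
      "\<And>i. i \<in> verts G \<Longrightarrow> A' i * B' i = 1\<^sub>m (vdim V i) - e i"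
      "\<And>i. i \<in> verts G \<Longrightarrow> B' i * A' i = 1\<^sub>m (s i)"
      "\<And>i. i \<in> verts G \<Longrightarrow> B i * A' i = 0\<^sub>m (r i) (s i)"
      "\<And>i. i \<in> verts G \<Longrightarrow> B' i * A i = 0\<^sub>m (s i) (r i)"
    by blast+
  define W where "W = \<lparr>vdim = r, amap = \<lambda>a. B (head G a) * amap V a * A (tail G a)\<rparr>"
  define W' where "W' = \<lparr>vdim = s, amap = \<lambda>a. B' (head G a) * amap V a * A' (tail G a)\<rparr>"
  have W: "is_rep G W" and W': "is_rep G W'"
    by (auto simp: is_rep_def W_def W'_def
      intro!: mult_carrier_mat[OF mult_carrier_mat[OF *(3) is_repD(1)[OF V]] *(2)]
        mult_carrier_mat[OF mult_carrier_mat[OF *(7) is_repD(1)[OF V]] *(6)])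
  have hom: "rep_hom G W V A \<and> rep_hom G V W B \<and> rep_hom G W' V A' \<and> rep_hom G V W' B'"
    unfolding rep_hom_def
  proof (intro conjI ballI)
    fix a assume a: "a \<in> arcs G"
    let ?s = "tail G a" and ?t = "head G a"
    note s = *[OF tail_in_verts[OF a]] and t = *[OF head_in_verts[OF a]]
    note d = is_repD[OF V a] rep_homD[OF eh tail_in_verts[OF a]] rep_homD[OF eh head_in_verts[OF a]]
    have cm: "e ?t * amap V a = amap V a * e ?s" by (rule rep_hom_comm[OF eh a])
    have eA: "e ?s * A ?s = A ?s" using s(2,3) unfolding s(4)[symmetric] by (simp add: mat_assoc s(5))
    have Be: "B ?t * e ?t = B ?t" using t(2,3) unfolding t(4)[symmetric]
      by (simp add: mat_assoc[symmetric] t(5))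
    have eA': "(1\<^sub>m (vdim V ?s) - e ?s) * A' ?s = A' ?s" using s(6,7) unfolding s(8)[symmetric]
      by (simp add: mat_assoc s(9))
    have Be': "B' ?t * (1\<^sub>m (vdim V ?t) - e ?t) = B' ?t" using t(6,7) unfolding t(8)[symmetric]
      by (simp add: mat_assoc[symmetric] t(9))
    have cm': "(1\<^sub>m (vdim V ?t) - e ?t) * amap V a = amap V a * (1\<^sub>m (vdim V ?s) - e ?s)"
      using d cm by (simp add: mat_minus_distl mat_minus_distr)
    note dd = s(2,3,6,7) t(2,3,6,7) d
    have "A ?t * (B ?t * amap V a * A ?s) = (A ?t * B ?t) * amap V a * A ?s"
      using dd by (simp add: mat_assoc)
    also have "\<dots> = amap V a * e ?s * A ?s" unfolding t(4) cm ..
    also have "\<dots> = amap V a * A ?s" using dd by (simp add: mat_assoc eA)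
    finally show "A ?t * amap W a = amap V a * A ?s" by (simp add: W_def)
    have "B ?t * amap V a * A ?s * B ?s = B ?t * (amap V a * (A ?s * B ?s))"
      using dd by (simp add: mat_assoc)
    also have "\<dots> = B ?t * (e ?t * amap V a)" unfolding s(4) cm ..
    also have "\<dots> = B ?t * e ?t * amap V a" using dd by (simp add: mat_assoc)
    finally show "B ?t * amap V a = amap W a * B ?s" by (simp add: W_def Be)
    have "A' ?t * (B' ?t * amap V a * A' ?s) = (A' ?t * B' ?t) * amap V a * A' ?s"
      using dd by (simp add: mat_assoc)
    also have "\<dots> = amap V a * (1\<^sub>m (vdim V ?s) - e ?s) * A' ?s" unfolding t(8) cm' ..
    also have "\<dots> = amap V a * A' ?s" using dd by (subst mat_assoc) (auto simp: eA')
    finally show "A' ?t * amap W' a = amap V a * A' ?s" by (simp add: W'_def)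
    have "B' ?t * amap V a * A' ?s * B' ?s = B' ?t * (amap V a * (A' ?s * B' ?s))"
      using dd by (simp add: mat_assoc)
    also have "\<dots> = B' ?t * ((1\<^sub>m (vdim V ?t) - e ?t) * amap V a)" unfolding s(8) cm' ..
    also have "\<dots> = B' ?t * (1\<^sub>m (vdim V ?t) - e ?t) * amap V a"
      using dd by (subst mat_assoc) auto
    finally show "B' ?t * amap V a = amap W' a * B' ?s" by (simp add: W'_def Be')
  qed (use * in \<open>auto simp: W_def W'_def\<close>)
  have "rep_isomorphism G V (rep_dsum W W') (\<lambda>i. vcat (B i) (B' i))"
  proof (rule rep_isomorphismI[where h = "\<lambda>i. hcat (A i) (A' i)"])
    show "rep_hom G V (rep_dsum W W') (\<lambda>i. vcat (B i) (B' i))"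
      unfolding rep_hom_def
    proof (intro conjI ballI)
      fix i assume "i \<in> verts G"
      then show "vcat (B i) (B' i) \<in> carrier_mat (vdim (rep_dsum W W') i) (vdim V i)"
        using *[of i] by (auto simp: W_def W'_def)
    next
      fix a assume a: "a \<in> arcs G"
      have h: "rep_hom G V W B" "rep_hom G V W' B'" using hom by auto
      note dd = is_repD[OF V a] is_repD[OF W a] is_repD[OF W' a]
        rep_homD[OF h(1) tail_in_verts[OF a]] rep_homD[OF h(1) head_in_verts[OF a]]
        rep_homD[OF h(2) tail_in_verts[OF a]] rep_homD[OF h(2) head_in_verts[OF a]]
      show "vcat (B (head G a)) (B' (head G a)) * amap V a =
          amap (rep_dsum W W') a * vcat (B (tail G a)) (B' (tail G a))"
        using dd by (simp add: vcat_mult dsum_vcat rep_hom_comm[OF h(1) a] rep_hom_comm[OF h(2) a])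
    qed
    fix i assume i: "i \<in> verts G"
    note s = *[OF i]
    show "hcat (A i) (A' i) \<in> carrier_mat (vdim V i) (vdim (rep_dsum W W') i)"
      using s by (auto simp: W_def W'_def)
    show "vcat (B i) (B' i) * hcat (A i) (A' i) = 1\<^sub>m (vdim (rep_dsum W W') i)"
      using s by (simp add: W_def W'_def) (rule vcat_hcat_diag, auto)
    have "hcat (A i) (A' i) * vcat (B i) (B' i) = e i + (1\<^sub>m (vdim V i) - e i)"
      using s by (subst hcat_vcat) auto
    also have "\<dots> = 1\<^sub>m (vdim V i)" using rep_homD[OF eh i] by (auto intro!: eq_matI)
    finally show "hcat (A i) (A' i) * vcat (B i) (B' i) = 1\<^sub>m (vdim V i)" .
  qed (use V is_rep_dsum[OF W W'] in auto)
  then show thesis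
    by (intro that[of W W' A B A' B']) (use W W' hom * in \<open>auto simp: W_def W'_def\<close>)
qed

end

section \<open>Indecomposable representations\<close>

lemma common_annihilating_poly:
  fixes f :: "'i \<Rightarrow> 'k :: field mat"
  assumes "finite I" "\<And>i. i \<in> I \<Longrightarrow> f i \<in> carrier_mat (d i) (d i)"
  shows "\<exists>c. c \<noteq> 0 \<and> (\<forall>i\<in>I. peval c (f i) = 0\<^sub>m (d i) (d i))"
  using assms
proof (induction I rule: finite_induct)
  case empty then show ?case by (auto intro: exI[of _ 1])
next
  case (insert j I)
  then obtain c where c: "c \<noteq> 0" "\<And>i. i \<in> I \<Longrightarrow> peval c (f i) = 0\<^sub>m (d i) (d i)" by auto
  have fj: "f j \<in> carrier_mat (d j) (d j)" using insert.prems by simp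
  obtain p where p: "p \<noteq> 0" "peval p (f j) = 0\<^sub>m (d j) (d j)" by (rule annihilating_poly[OF fj])
  have "peval (p * c) (f i) = 0\<^sub>m (d i) (d i)" if "i \<in> insert j I" for i
  proof (cases "i = j")
    case True then show ?thesis using peval_dvd_0[OF fj p(2), of "p * c"] by simp
  next
    case False
    then show ?thesis using that peval_dvd_0[OF insert.prems[of i] c(2)[of i], of "p * c"] by auto
  qed
  then show ?case using c(1) p(1) by (intro exI[of _ "p * c"]) auto
qed

lemma fitting_family:
  fixes f :: "'i \<Rightarrow> 'k :: field mat"
  assumes "finite I" and f: "\<And>i. i \<in> I \<Longrightarrow> f i \<in> carrier_mat (d i) (d i)"
  obtains p u N where "\<And>i. i \<in> I \<Longrightarrow> peval p (f i) * peval p (f i) = peval p (f i)"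
    "\<And>i. i \<in> I \<Longrightarrow> peval p (f i) = peval u (f i) * f i"
    "\<And>i. i \<in> I \<Longrightarrow> f i ^\<^sub>m N = f i ^\<^sub>m N * peval p (f i)"
proof -
  obtain c where c: "c \<noteq> 0" "\<And>i. i \<in> I \<Longrightarrow> peval c (f i) = 0\<^sub>m (d i) (d i)"
    using common_annihilating_poly[of I f d] assms by blast
  obtain p u N where p: "c dvd p * p - p" "p = u * [:0, 1:]" "c dvd [:0, 1:] ^ N - [:0, 1:] ^ N * p"
    by (rule fitting_poly[OF c(1)])
  show thesis
  proof
    fix i assume i: "i \<in> I"
    show "peval p (f i) * peval p (f i) = peval p (f i)"
      using peval_dvd_diff_eq[OF f[OF i] c(2)[OF i] p(1)] by (simp only: peval_mult[OF f[OF i]])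
    show "peval p (f i) = peval u (f i) * f i"
      unfolding p(2) by (simp only: peval_mult[OF f[OF i]] peval_X[OF f[OF i]])
    show "f i ^\<^sub>m N = f i ^\<^sub>m N * peval p (f i)"
      using peval_dvd_diff_eq[OF f[OF i] c(2)[OF i] p(3)]
      by (simp only: peval_mult[OF f[OF i]] peval_X_power[OF f[OF i]])
  qed
qed

lemma nilpotent_one_minus_inverse:
  fixes f :: "'k :: field mat"
  assumes f: "f \<in> carrier_mat n n" and nil: "f ^\<^sub>m N = 0\<^sub>m n n"
  shows "peval (\<Sum>k<N. [:0, 1:] ^ k) f * (1\<^sub>m n - f) = 1\<^sub>m n"
proof -
  let ?s = "\<Sum>k<N. [:0, 1 :: 'k:] ^ k"
  have "peval ((1 - [:0, 1:]) * ?s) f = (1\<^sub>m n - f) * peval ?s f"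
    by (simp only: peval_mult[OF f] peval_diff[OF f] peval_1[OF f] peval_X[OF f])
  moreover have "peval ((1 - [:0, 1:]) * ?s) f = 1\<^sub>m n - 0\<^sub>m n n"
    by (simp only: one_diff_power_eq[symmetric] peval_diff[OF f] peval_1[OF f] peval_X_power[OF f] nil)
  moreover have "1\<^sub>m n - 0\<^sub>m n n = (1\<^sub>m n :: 'k mat)" by (auto intro!: eq_matI)
  ultimately have "(1\<^sub>m n - f) * peval ?s f = 1\<^sub>m n" by simp
  then show ?thesis using f by (intro mat_mult_left_right_inverse[of "1\<^sub>m n - f" n]) auto
qed

context fin_digraph
begin

lemma trivial_idem_if_indecomposable:
  assumes V: "indecomposable_rep G V" and e: "idem_endo G V e"
  shows "(\<forall>i\<in>verts G. e i = 0\<^sub>m (vdim V i) (vdim V i)) \<or> (\<forall>i\<in>verts G. e i = 1\<^sub>m (vdim V i))"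
proof -
  have rep: "is_rep G V" using V by (auto simp: indecomposable_rep_def)
  have eh: "rep_hom G V V e" using e by (auto simp: idem_endo_def)
  obtain W W' A B A' B' where W: "is_rep G W" "is_rep G W'" and
    h: "rep_hom G W V A" "rep_hom G V W B" "rep_hom G W' V A'" "rep_hom G V W' B'" and
    *: "\<And>i. i \<in> verts G \<Longrightarrow> A i * B i = e i" "\<And>i. i \<in> verts G \<Longrightarrow> A' i * B' i = 1\<^sub>m (vdim V i) - e i"
    and iso: "rep_isomorphism G V (rep_dsum W W') (\<lambda>i. vcat (B i) (B' i))"
    by (rule idem_endo_splits[OF rep e], blast)
  have "\<not> nonzero_rep G W \<or> \<not> nonzero_rep G W'"
    using V W iso unfolding indecomposable_rep_def rep_iso_def by blast
  then show ?thesis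
  proof
    assume "\<not> nonzero_rep G W"
    then have 0: "vdim W i = 0" if "i \<in> verts G" for i using that by (auto simp: nonzero_rep_def)
    have "e i = 0\<^sub>m (vdim V i) (vdim V i)" if i: "i \<in> verts G" for i
      using rep_homD[OF h(1) i] rep_homD[OF h(2) i] 0[OF i]
      by (subst *(1)[OF i, symmetric]) (auto intro!: eq_matI simp: scalar_prod_def)
    then show ?thesis by blast
  next
    assume "\<not> nonzero_rep G W'"
    then have 0: "vdim W' i = 0" if "i \<in> verts G" for i using that by (auto simp: nonzero_rep_def)
    have m: "1\<^sub>m (vdim V i) - e i = 0\<^sub>m (vdim V i) (vdim V i)" if i: "i \<in> verts G" for i
      using rep_homD[OF h(3) i] rep_homD[OF h(4) i] 0[OF i]
      by (subst *(2)[OF i, symmetric]) (auto intro!: eq_matI simp: scalar_prod_def)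
    have "e i = 1\<^sub>m (vdim V i)" if i: "i \<in> verts G" for i
      using mat_diff_eq_0[OF m[OF i]] rep_homD(1)[OF eh i] by simp
    then show ?thesis by blast
  qed
qed

text \<open>A decomposition yields the projection onto its first part, which is zero or the identity only if
  one of the parts is zero.\<close>

lemma indecomposable_if_trivial_idem:
  fixes V :: "('a, 'b, 'k :: field) qrep"
  assumes V: "is_rep G V" "nonzero_rep G V"
    and triv: "\<And>e. idem_endo G V e \<Longrightarrow>
      (\<forall>i\<in>verts G. e i = 0\<^sub>m (vdim V i) (vdim V i)) \<or> (\<forall>i\<in>verts G. e i = 1\<^sub>m (vdim V i))"
  shows "indecomposable_rep G V"
proof (rule ccontr)
  assume "\<not> indecomposable_rep G V"
  then obtain W W' g where W: "is_rep G W" "is_rep G W'" and nz: "nonzero_rep G W" "nonzero_rep G W'"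
    and g: "rep_isomorphism G V (rep_dsum W W') g"
    using V by (auto simp: indecomposable_rep_def rep_iso_def)
  obtain h where gh: "rep_hom G V (rep_dsum W W') g" "rep_hom G (rep_dsum W W') V h"
    "\<And>i. i \<in> verts G \<Longrightarrow> g i * h i = 1\<^sub>m (vdim W i + vdim W' i)"
    "\<And>i. i \<in> verts G \<Longrightarrow> vdim V i = vdim W i + vdim W' i"
    by (rule rep_isomorphismE[OF g]) auto
  have D: "is_rep G (rep_dsum W W')" using W by (rule is_rep_dsum)
  define i1 :: "'a \<Rightarrow> 'k mat" where "i1 = (\<lambda>i. vcat (1\<^sub>m (vdim W i)) (0\<^sub>m (vdim W' i) (vdim W i)))"
  define p1 :: "'a \<Rightarrow> 'k mat" where "p1 = (\<lambda>i. hcat (1\<^sub>m (vdim W i)) (0\<^sub>m (vdim W i) (vdim W' i)))"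
  define i2 :: "'a \<Rightarrow> 'k mat" where "i2 = (\<lambda>i. vcat (0\<^sub>m (vdim W i) (vdim W' i)) (1\<^sub>m (vdim W' i)))"
  define p2 :: "'a \<Rightarrow> 'k mat" where "p2 = (\<lambda>i. hcat (0\<^sub>m (vdim W' i) (vdim W i)) (1\<^sub>m (vdim W' i)))"
  note inj = dsum_injections[OF W, folded i1_def i2_def p1_def p2_def]
  have pi: "p1 i * i1 i = 1\<^sub>m (vdim W i)" "p2 i * i2 i = 1\<^sub>m (vdim W' i)" "p1 i * i2 i = 0\<^sub>m (vdim W i) (vdim W' i)" for i
    by (auto simp: i1_def p1_def i2_def p2_def hcat_vcat)
  define e where "e i = h i * i1 i * (p1 i * g i)" for i
  have eh: "rep_hom G V V e" unfolding e_def
    by (rule rep_hom_comp[OF V(1) W(1) V(1)]; rule rep_hom_comp[OF _ D]) (use V W D gh inj in auto)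
  have cd: "dim_row (g i) = vdim W i + vdim W' i" "dim_col (g i) = vdim V i"
    "dim_row (h i) = vdim V i" "dim_col (h i) = vdim W i + vdim W' i"
    "dim_row (i1 i) = vdim W i + vdim W' i" "dim_col (i1 i) = vdim W i"
    "dim_row (i2 i) = vdim W i + vdim W' i" "dim_col (i2 i) = vdim W' i"
    "dim_col (p1 i) = vdim W i + vdim W' i" "dim_row (p1 i) = vdim W i" if "i \<in> verts G" for i
    using rep_homD[OF gh(1) that] rep_homD[OF gh(2) that] by (auto simp: i1_def p1_def i2_def)
  have ec: "p1 i * g i * (e i * (h i * X)) = p1 i * X" if i: "i \<in> verts G" and X: "dim_row X = vdim W i + vdim W' i" for i X
  proof -
    have "p1 i * g i * (e i * (h i * X)) = p1 i * ((g i * h i) * (i1 i * (p1 i * ((g i * h i) * X))))"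
      using cd[OF i] X unfolding e_def by (simp add: mat_assoc)
    also have "\<dots> = p1 i * (i1 i * (p1 i * X))" using cd[OF i] X by (simp add: gh(3)[OF i])
    also have "\<dots> = (p1 i * i1 i) * (p1 i * X)" using cd[OF i] X by (simp add: mat_assoc)
    also have "\<dots> = p1 i * X" using cd[OF i] by (simp only: pi) simp
    finally show ?thesis .
  qed
  have ee: "e i * e i = e i" if i: "i \<in> verts G" for i
  proof -
    have "e i * e i = h i * i1 i * (p1 i * g i * (e i * 1\<^sub>m (vdim V i)))"
      using cd[OF i] rep_homD[OF eh i] by (subst (1) e_def) (simp add: mat_assoc)
    also have "p1 i * g i * (e i * 1\<^sub>m (vdim V i)) = p1 i * (g i * h i) * (i1 i * (p1 i * g i))"
      using cd[OF i] rep_homD[OF eh i] by (simp add: e_def mat_assoc)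
    also have "\<dots> = (p1 i * i1 i) * (p1 i * g i)" using cd[OF i] by (simp add: gh(3)[OF i] mat_assoc)
    also have "\<dots> = p1 i * g i" using cd[OF i] by (simp only: pi) simp
    finally show ?thesis by (simp add: e_def)
  qed
  from triv[of e] eh ee consider (0) "\<forall>i\<in>verts G. e i = 0\<^sub>m (vdim V i) (vdim V i)"
    | (1) "\<forall>i\<in>verts G. e i = 1\<^sub>m (vdim V i)" by (auto simp: idem_endo_def)
  then show False
  proof cases
    case 0
    have "vdim W i = 0" if i: "i \<in> verts G" for i
    proof -
      have "1\<^sub>m (vdim W i) = p1 i * g i * (e i * (h i * i1 i))" using ec[OF i, of "i1 i"] cd[OF i] pi by simp
      also have "\<dots> = 0\<^sub>m (vdim W i) (vdim W i)" using 0 i cd[OF i] by simp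
      finally show ?thesis by (rule one_mat_eq_zero)
    qed
    then show False using nz by (auto simp: nonzero_rep_def)
  next
    case 1
    have "vdim W' i = 0" if i: "i \<in> verts G" for i
    proof -
      have "g i * (e i * (h i * i2 i)) = (g i * h i) * (i1 i * (p1 i * ((g i * h i) * i2 i)))"
        using cd[OF i] unfolding e_def by (simp add: mat_assoc)
      also have "\<dots> = i1 i * (p1 i * i2 i)" using cd[OF i] by (simp add: gh(3)[OF i])
      also have "\<dots> = 0\<^sub>m (vdim W i + vdim W' i) (vdim W' i)" using cd[OF i] by (simp add: pi)
      also have "g i * (e i * (h i * i2 i)) = (g i * h i) * i2 i" using 1 i cd[OF i] by (simp add: mat_assoc)
      finally have "i2 i = 0\<^sub>m (vdim W i + vdim W' i) (vdim W' i)" using cd[OF i] by (simp add: gh(3)[OF i])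
      then have "1\<^sub>m (vdim W' i) = p2 i * 0\<^sub>m (vdim W i + vdim W' i) (vdim W' i)" using pi(2)[of i] by simp
      then have "1\<^sub>m (vdim W' i) = (0\<^sub>m (vdim W' i) (vdim W' i) :: 'k mat)" by (simp add: p2_def)
      then show ?thesis by (rule one_mat_eq_zero)
    qed
    then show False using nz by (auto simp: nonzero_rep_def)
  qed
qed

lemma indecomposable_rep_cong:
  assumes "rep_iso G V W" "indecomposable_rep G V"
  shows "indecomposable_rep G W"
  using assms rep_iso_is_rep[OF assms(1)] rep_iso_vdim[OF assms(1)] rep_iso_trans[OF assms(1)]
  unfolding indecomposable_rep_def nonzero_rep_def by metis

text \<open>The endomorphism ring of an indecomposable representation is local.\<close>

lemma indecomposable_endo_cases:
  assumes V: "indecomposable_rep G V" and f: "rep_hom G V V f"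
  obtains N where "\<And>i. i \<in> verts G \<Longrightarrow> f i ^\<^sub>m N = 0\<^sub>m (vdim V i) (vdim V i)"
  | u where "\<And>i. i \<in> verts G \<Longrightarrow> peval u (f i) * f i = 1\<^sub>m (vdim V i)"
proof -
  have rep: "is_rep G V" using V by (auto simp: indecomposable_rep_def)
  have fc: "f i \<in> carrier_mat (vdim V i) (vdim V i)" if "i \<in> verts G" for i using rep_homD[OF f that] by simp
  obtain p u N where p: "\<And>i. i \<in> verts G \<Longrightarrow> peval p (f i) * peval p (f i) = peval p (f i)"
    "\<And>i. i \<in> verts G \<Longrightarrow> peval p (f i) = peval u (f i) * f i"
    "\<And>i. i \<in> verts G \<Longrightarrow> f i ^\<^sub>m N = f i ^\<^sub>m N * peval p (f i)"
    using fitting_family[of "verts G" f "vdim V"] fc by auto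
  have "idem_endo G V (\<lambda>i. peval p (f i))"
    using rep_hom_peval[OF rep f] p(1) by (auto simp: idem_endo_def)
  from trivial_idem_if_indecomposable[OF V this] show thesis
  proof
    assume "\<forall>i\<in>verts G. peval p (f i) = 0\<^sub>m (vdim V i) (vdim V i)"
    then have "f i ^\<^sub>m N = 0\<^sub>m (vdim V i) (vdim V i)" if i: "i \<in> verts G" for i
      using p(3)[OF i] fc[OF i] i by simp
    then show thesis using that(1) by blast
  next
    assume "\<forall>i\<in>verts G. peval p (f i) = 1\<^sub>m (vdim V i)"
    then show thesis using that(2)[of u] p(2) by auto
  qed
qed

lemma summandI:
  assumes X: "is_rep G X" and Y: "is_rep G Y" and i: "rep_hom G X Y i" and p: "rep_hom G Y X p"
    and u: "\<And>v. v \<in> verts G \<Longrightarrow> peval u (p v * i v) * (p v * i v) = 1\<^sub>m (vdim X v)"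
  shows "summand G X Y"
  unfolding summand_def
proof (intro exI conjI ballI)
  show "rep_hom G X Y i" by (rule i)
  show "rep_hom G Y X (\<lambda>v. peval u (p v * i v) * p v)"
    by (rule rep_hom_comp[OF Y X X p]) (rule rep_hom_peval[OF X], rule rep_hom_comp[OF X Y X i p])
  fix v assume v: "v \<in> verts G"
  show "peval u (p v * i v) * p v * i v = 1\<^sub>m (vdim X v)"
    using u[OF v] rep_homD[OF i v] rep_homD[OF p v] by (simp add: mat_assoc)
qed

text \<open>The two composites \<open>X \<rightarrow> W \<rightarrow> X\<close> and \<open>X \<rightarrow> W' \<rightarrow> X\<close> add up to the identity, so in the local
  endomorphism ring of \<open>X\<close> one of them is invertible.\<close>

lemma summand_of_dsum:
  assumes X: "indecomposable_rep G X" and W: "is_rep G W" "is_rep G W'" and s: "summand G X (rep_dsum W W')"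
  shows "summand G X W \<or> summand G X W'"
proof -
  have rX: "is_rep G X" using X by (auto simp: indecomposable_rep_def)
  have D: "is_rep G (rep_dsum W W')" using W by (rule is_rep_dsum)
  obtain i p where i: "rep_hom G X (rep_dsum W W') i" and p: "rep_hom G (rep_dsum W W') X p"
    and pi: "\<And>v. v \<in> verts G \<Longrightarrow> p v * i v = 1\<^sub>m (vdim X v)" using s by (auto simp: summand_def)
  note inj = dsum_injections[OF W]
  let ?i1 = "\<lambda>i. vcat (1\<^sub>m (vdim W i)) (0\<^sub>m (vdim W' i) (vdim W i))"
  let ?i2 = "\<lambda>i. vcat (0\<^sub>m (vdim W i) (vdim W' i)) (1\<^sub>m (vdim W' i))"
  let ?p1 = "\<lambda>i. hcat (1\<^sub>m (vdim W i)) (0\<^sub>m (vdim W i) (vdim W' i))"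
  let ?p2 = "\<lambda>i. hcat (0\<^sub>m (vdim W' i) (vdim W i)) (1\<^sub>m (vdim W' i))"
  define f where "f v = (p v * ?i1 v) * (?p1 v * i v)" for v
  have h1: "rep_hom G X W (\<lambda>v. ?p1 v * i v)" "rep_hom G W X (\<lambda>v. p v * ?i1 v)"
    by (rule rep_hom_comp[OF _ D]; use rX W D i p inj in auto)+
  have h2: "rep_hom G X W' (\<lambda>v. ?p2 v * i v)" "rep_hom G W' X (\<lambda>v. p v * ?i2 v)"
    by (rule rep_hom_comp[OF _ D]; use rX W D i p inj in auto)+
  have fh: "rep_hom G X X f" unfolding f_def by (rule rep_hom_comp[OF rX W(1) rX h1])
  have rest: "(p v * ?i2 v) * (?p2 v * i v) = 1\<^sub>m (vdim X v) - f v" if v: "v \<in> verts G" for v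
  proof -
    note d = rep_homD[OF i v] rep_homD[OF p v]
    have one: "?i1 v * ?p1 v + ?i2 v * ?p2 v = 1\<^sub>m (vdim W v + vdim W' v)"
      by (auto simp: vcat_mult mult_hcat intro!: eq_matI) (auto simp: hcat_def vcat_def)
    have "f v + (p v * ?i2 v) * (?p2 v * i v) = p v * ((?i1 v * ?p1 v + ?i2 v * ?p2 v) * i v)"
      using d unfolding f_def by (simp add: mat_assoc mat_add_distl mat_add_distr)
    also have "\<dots> = 1\<^sub>m (vdim X v)" unfolding one using d pi[OF v] by simp
    finally have *: "f v + (p v * ?i2 v) * (?p2 v * i v) = 1\<^sub>m (vdim X v)" .
    show ?thesis unfolding *[symmetric] using d rep_homD[OF fh v] by (auto intro!: eq_matI)
  qed
  show ?thesis
  proof (rule indecomposable_endo_cases[OF X fh])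
    fix u assume "\<And>v. v \<in> verts G \<Longrightarrow> peval u (f v) * f v = 1\<^sub>m (vdim X v)"
    then have "summand G X W" by (intro summandI[OF rX W(1) h1]) (auto simp: f_def)
    then show ?thesis ..
  next
    fix N assume N: "\<And>v. v \<in> verts G \<Longrightarrow> f v ^\<^sub>m N = 0\<^sub>m (vdim X v) (vdim X v)"
    \<comment> \<open>If \<open>f\<close> is nilpotent, the other composite \<open>1 - f\<close> is inverted by the geometric series.\<close>
    let ?s = "\<Sum>k<N. [:0, 1 :: 'c:] ^ k"
    define g where "g v = peval ?s (f v)" for v
    have gh: "rep_hom G X X g" unfolding g_def by (rule rep_hom_peval[OF rX fh])
    have "summand G X W'" unfolding summand_def
    proof (intro exI conjI ballI)
      show "rep_hom G X W' (\<lambda>v. ?p2 v * i v)" by (rule h2)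
      show "rep_hom G W' X (\<lambda>v. g v * (p v * ?i2 v))" by (rule rep_hom_comp[OF W(2) rX rX h2(2) gh])
      fix v assume v: "v \<in> verts G"
      have "g v * (p v * ?i2 v) * (?p2 v * i v) = g v * ((p v * ?i2 v) * (?p2 v * i v))"
        by (rule mat_assoc) (use rep_homD[OF gh v] rep_homD[OF i v] rep_homD[OF p v] in auto)
      also have "\<dots> = 1\<^sub>m (vdim X v)" unfolding rest[OF v] g_def
        by (rule nilpotent_one_minus_inverse) (use rep_homD[OF fh v] N[OF v] in auto)
      finally show "g v * (p v * ?i2 v) * (?p2 v * i v) = 1\<^sub>m (vdim X v)" .
    qed
    then show ?thesis ..
  qed
qed

text \<open>The projection onto the summand is a trivial idempotent, and it is not zero.\<close>

lemma summand_of_indecomposable: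
  assumes X: "is_rep G X" "nonzero_rep G X" and Y: "indecomposable_rep G Y" and s: "summand G X Y"
  shows "rep_iso G X Y"
proof -
  have rY: "is_rep G Y" using Y by (auto simp: indecomposable_rep_def)
  obtain i p where i: "rep_hom G X Y i" and p: "rep_hom G Y X p"
    and pi: "\<And>v. v \<in> verts G \<Longrightarrow> p v * i v = 1\<^sub>m (vdim X v)" using s by (auto simp: summand_def)
  define e where "e v = i v * p v" for v
  have e2: "e v * e v = e v" and pei: "p v * (e v * i v) = 1\<^sub>m (vdim X v)" if v: "v \<in> verts G" for v
  proof -
    note d = rep_homD[OF i v] rep_homD[OF p v]
    have "e v * e v = i v * ((p v * i v) * p v)" using d unfolding e_def by (simp add: mat_assoc)
    then show "e v * e v = e v" using d by (simp add: pi[OF v] e_def)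
    have "p v * (e v * i v) = (p v * i v) * (p v * i v)" using d unfolding e_def by (simp add: mat_assoc)
    then show "p v * (e v * i v) = 1\<^sub>m (vdim X v)" by (simp add: pi[OF v])
  qed
  have "idem_endo G Y e" unfolding idem_endo_def e_def
    using rep_hom_comp[OF rY X(1) rY p i] e2 by (auto simp: e_def)
  from trivial_idem_if_indecomposable[OF Y this] show ?thesis
  proof
    assume 0: "\<forall>v\<in>verts G. e v = 0\<^sub>m (vdim Y v) (vdim Y v)"
    have "vdim X v = 0" if v: "v \<in> verts G" for v
      by (rule one_mat_eq_zero[OF sym]) (use pei[OF v] 0 v rep_homD[OF i v] rep_homD[OF p v] in simp)
    then show ?thesis using X by (auto simp: nonzero_rep_def)
  next
    assume "\<forall>v\<in>verts G. e v = 1\<^sub>m (vdim Y v)"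
    then show ?thesis unfolding rep_iso_def
      by (intro exI[of _ i] rep_isomorphismI[OF X(1) rY i, of p]) (use pi rep_homD[OF p] in \<open>auto simp: e_def\<close>)
  qed
qed

lemma indecomposable_cases:
  assumes "is_rep G V"
  obtains (zero) "\<not> nonzero_rep G V" | (indec) "indecomposable_rep G V"
  | (dsum) W W' where "is_rep G W" "is_rep G W'" "rep_iso G V (rep_dsum W W')"
    "total_dim G W < total_dim G V" "total_dim G W' < total_dim G V"
proof -
  consider "\<not> nonzero_rep G V" | "indecomposable_rep G V" | W W' where "is_rep G W" "nonzero_rep G W"
    "is_rep G W'" "nonzero_rep G W'" "rep_iso G V (rep_dsum W W')"
    using assms unfolding indecomposable_rep_def by blast
  then show thesis
  proof cases
    case (3 W W')
    have "total_dim G V = total_dim G W + total_dim G W'"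
      using rep_iso_total_dim[OF 3(5)] by (simp add: total_dim_dsum)
    moreover have "total_dim G W > 0" "total_dim G W' > 0" using 3(2,4) total_dim_0_iff by auto
    ultimately show thesis using dsum 3 by auto
  qed (use zero indec in auto)
qed

lemma indecomposable_summand_exists:
  assumes "is_rep G V" "nonzero_rep G V"
  obtains X where "indecomposable_rep G X" "summand G X V"
proof -
  have "\<exists>X. indecomposable_rep G X \<and> summand G X V" using assms
  proof (induction "total_dim G V" arbitrary: V rule: less_induct)
    case less
    show ?case
    proof (rule indecomposable_cases[OF less.prems(1)])
      assume "indecomposable_rep G V"
      then show ?thesis using rep_iso_summand[OF rep_iso_refl[OF less.prems(1)]] by blast
    next
      fix W W' assume W: "is_rep G W" "is_rep G W'" "rep_iso G V (rep_dsum W W')"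
        "total_dim G W < total_dim G V" "total_dim G W' < total_dim G V"
      have sum: "total_dim G V = total_dim G W + total_dim G W'"
        using rep_iso_total_dim[OF W(3)] by (simp add: total_dim_dsum)
      have D: "is_rep G (rep_dsum W W')" using W by (intro is_rep_dsum)
      have "nonzero_rep G W" using sum W(5) total_dim_0_iff[of W] by auto
      then obtain X where X: "indecomposable_rep G X" "summand G X W" using less.hyps W by blast
      then have "is_rep G X" by (auto simp: indecomposable_rep_def)
      then have "summand G X V"
        using summand_trans[OF _ W(1) D X(2) summand_dsum(1)] W less.prems
          summand_trans[OF _ D less.prems(1) _ rep_iso_summand[OF rep_iso_sym[OF W(3)]]] by blast
      then show ?thesis using X by blast
    qed (use less.prems in auto)
  qed
  then show thesis using that by blast
qed

text \<open>An indecomposable summand of \<open>W \<oplus> W'\<close> is a summand of \<open>W\<close> or of \<open>W'\<close>, so their number is bounded by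
  induction on the dimension.\<close>

lemma finitely_many_indecomposable_summands:
  fixes Y :: "('a, 'b, 'k :: field) qrep"
  assumes "is_rep G Y"
  shows "\<exists>F. finite F \<and> (\<forall>X. indecomposable_rep G X \<longrightarrow> summand G X Y \<longrightarrow> (\<exists>Z\<in>F. rep_iso G X Z))"
  using assms
proof (induction "total_dim G Y" arbitrary: Y rule: less_induct)
  case less
  have rX: "is_rep G X \<and> nonzero_rep G X" if "indecomposable_rep G X" for X :: "('a, 'b, 'k) qrep"
    using that by (auto simp: indecomposable_rep_def)
  show ?case
  proof (rule indecomposable_cases[OF less.prems])
    assume "\<not> nonzero_rep G Y"
    then have "total_dim G Y = 0" by (simp add: total_dim_0_iff)
    then have "\<not> summand G X Y" if "nonzero_rep G X" for X :: "('a, 'b, 'k) qrep"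
      using that summand_total_dim_le[of X Y] total_dim_0_iff[of X] by auto
    then show ?thesis using rX by (intro exI[of _ "{}"]) auto
  next
    assume "indecomposable_rep G Y"
    then show ?thesis using rX summand_of_indecomposable by (intro exI[of _ "{Y}"]) auto
  next
    fix W W' assume W: "is_rep G W" "is_rep G W'" "rep_iso G Y (rep_dsum W W')"
      "total_dim G W < total_dim G Y" "total_dim G W' < total_dim G Y"
    obtain F where F: "finite F" "\<And>X. indecomposable_rep G X \<Longrightarrow> summand G X W \<Longrightarrow> \<exists>Z\<in>F. rep_iso G X Z"
      using less.hyps[OF W(4,1)] by blast
    obtain F' where F': "finite F'" "\<And>X. indecomposable_rep G X \<Longrightarrow> summand G X W' \<Longrightarrow> \<exists>Z\<in>F'. rep_iso G X Z"
      using less.hyps[OF W(5,2)] by blast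
    have D: "is_rep G (rep_dsum W W')" using W by (intro is_rep_dsum)
    have "\<exists>Z\<in>F \<union> F'. rep_iso G X Z" if X: "indecomposable_rep G X" "summand G X Y" for X
    proof -
      have "summand G X (rep_dsum W W')"
        using summand_trans[OF _ less.prems D X(2) rep_iso_summand[OF W(3)]] rX[OF X(1)] by blast
      then show ?thesis using summand_of_dsum[OF X(1) W(1,2)] F(2) F'(2) X(1) by blast
    qed
    then show ?thesis using F(1) F'(1) by (intro exI[of _ "F \<union> F'"]) auto
  qed
qed

end

section \<open>Finite representation type\<close>

lemma finite_quotient_iff:
  assumes refl: "\<And>x. x \<in> A \<Longrightarrow> r x x" and sym: "\<And>x y. r x y \<Longrightarrow> r y x"
    and trans: "\<And>x y z. r x y \<Longrightarrow> r y z \<Longrightarrow> r x z"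
  shows "finite (A // {(x, y). r x y}) \<longleftrightarrow> (\<exists>F. finite F \<and> F \<subseteq> A \<and> (\<forall>x\<in>A. \<exists>y\<in>F. r x y))"
proof
  let ?R = "{(x, y). r x y}"
  have cls: "?R `` {x} = ?R `` {y}" if "r x y" for x y using that sym trans by blast
  {
    assume "\<exists>F. finite F \<and> F \<subseteq> A \<and> (\<forall>x\<in>A. \<exists>y\<in>F. r x y)"
    then obtain F where F: "finite F" "\<forall>x\<in>A. \<exists>y\<in>F. r x y" by blast
    have "A // ?R \<subseteq> (\<lambda>y. ?R `` {y}) ` F"
    proof
      fix C assume "C \<in> A // ?R"
      then obtain x where x: "x \<in> A" "C = ?R `` {x}" by (auto simp: quotient_def)
      then obtain y where "y \<in> F" "r x y" using F by blast
      then show "C \<in> (\<lambda>y. ?R `` {y}) ` F" using cls x by blast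
    qed
    then show "finite (A // ?R)" using F(1) finite_surj by blast
  }
  assume fin: "finite (A // ?R)"
  define f where "f C = (SOME x. x \<in> A \<and> ?R `` {x} = C)" for C
  have f: "f C \<in> A \<and> ?R `` {f C} = C" if "C \<in> A // ?R" for C
    unfolding f_def by (rule someI_ex) (use that in \<open>auto simp: quotient_def\<close>)
  show "\<exists>F. finite F \<and> F \<subseteq> A \<and> (\<forall>x\<in>A. \<exists>y\<in>F. r x y)"
  proof (intro exI[of _ "f ` (A // ?R)"] conjI ballI)
    fix x assume x: "x \<in> A"
    then have C: "?R `` {x} \<in> A // ?R" by (auto simp: quotient_def)
    have "x \<in> ?R `` {f (?R `` {x})}" using f[OF C] refl[OF x] by blast
    then have "r x (f (?R `` {x}))" using sym by blast
    then show "\<exists>y\<in>f ` (A // ?R). r x y" using C by blast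
  qed (use fin f in auto)
qed

context fin_digraph
begin

lemma finite_quiver_iff:
  "finite_quiver TYPE('k :: field) G \<longleftrightarrow>
    (\<exists>F :: ('a, 'b, 'k) qrep set. finite F \<and> (\<forall>V\<in>F. indecomposable_rep G V) \<and>
      (\<forall>V. indecomposable_rep G V \<longrightarrow> (\<exists>W\<in>F. rep_iso G V W)))"
  unfolding finite_quiver_def
  by (subst finite_quotient_iff)
    (auto intro: rep_iso_refl rep_iso_sym rep_iso_trans simp: indecomposable_rep_def subset_eq)

lemma finite_quiverI:
  fixes F :: "('a, 'b, 'k :: field) qrep set"
  assumes "finite F" "\<And>V. indecomposable_rep G V \<Longrightarrow> \<exists>W\<in>F. rep_iso G V W"
  shows "finite_quiver TYPE('k) G"
  unfolding finite_quiver_iff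
proof (intro exI conjI ballI allI impI)
  let ?F = "{W \<in> F. indecomposable_rep G W}"
  show "finite ?F" using assms(1) by simp
  show "indecomposable_rep G V" if "V \<in> ?F" for V using that by simp
  show "\<exists>W\<in>?F. rep_iso G V W" if "indecomposable_rep G V" for V
    using assms(2)[OF that] indecomposable_rep_cong that by blast
qed

lemma finite_quiver_pigeonhole:
  fixes V :: "'i \<Rightarrow> ('a, 'b, 'k :: field) qrep"
  assumes "finite_quiver TYPE('k) G" "infinite (UNIV :: 'i set)" "\<And>c. indecomposable_rep G (V c)"
  obtains c d where "c \<noteq> d" "rep_iso G (V c) (V d)"
proof -
  obtain F :: "('a, 'b, 'k) qrep set" where F: "finite F"
    "\<And>V. indecomposable_rep G V \<Longrightarrow> \<exists>W\<in>F. rep_iso G V W"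
    using assms(1) unfolding finite_quiver_iff by blast
  have "\<forall>c. \<exists>W. W \<in> F \<and> rep_iso G (V c) W" using F(2) assms(3) by blast
  from choice[OF this] obtain w where w: "\<forall>c. w c \<in> F \<and> rep_iso G (V c) (w c)" ..
  have "\<not> inj w"
  proof
    assume "inj w"
    moreover have "finite (range w)" using finite_subset[of "range w" F] F(1) w by blast
    ultimately show False using assms(2) finite_imageD by blast
  qed
  then obtain c d where "c \<noteq> d" "w c = w d" by (auto simp: inj_def)
  then have "rep_iso G (V c) (V d)" 
    using rep_iso_trans[of "V c" "w c" "V d"] rep_iso_sym[of "V d" "w d"] spec[OF w, of c] spec[OF w, of d]
    by simp
  then show thesis using that \<open>c \<noteq> d\<close> by blast
qed

text \<open>By induction on the bound: a representation is zero, or indecomposable, or a sum of two smaller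
  ones.\<close>

lemma finitely_many_of_bounded_dim:
  fixes M :: nat
  assumes "finite_quiver TYPE('k :: field) G"
  shows "\<exists>F :: ('a, 'b, 'k) qrep set. finite F \<and>
    (\<forall>V. is_rep G V \<longrightarrow> total_dim G V \<le> M \<longrightarrow> (\<exists>W\<in>F. rep_iso G V W))"
proof (induction M)
  case 0
  let ?Z = "\<lparr>vdim = \<lambda>_. 0, amap = \<lambda>_. 0\<^sub>m 0 0\<rparr> :: ('a, 'b, 'k) qrep"
  have "rep_iso G V ?Z" if "is_rep G V" "total_dim G V \<le> 0" for V :: "('a, 'b, 'k) qrep"
  proof -
    have 0: "vdim V i = 0" if "i \<in> verts G" for i using vdim_le_total[OF that, of V] \<open>total_dim G V \<le> 0\<close> by simp
    show ?thesis unfolding rep_iso_def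
    proof (rule exI, rule rep_isomorphismI[where h = "\<lambda>_. 0\<^sub>m 0 0"])
      show "rep_hom G V ?Z (\<lambda>_. 0\<^sub>m 0 0)" unfolding rep_hom_def
        using 0 is_repD[OF that(1)] by (auto intro!: eq_matI)
    qed (use that 0 in \<open>auto simp: is_rep_def intro!: eq_matI\<close>)
  qed
  then show ?case by (intro exI[of _ "{?Z}"]) auto
next
  case (Suc M)
  then obtain F :: "('a, 'b, 'k) qrep set" where F: "finite F"
    "\<And>V. is_rep G V \<Longrightarrow> total_dim G V \<le> M \<Longrightarrow> \<exists>W\<in>F. rep_iso G V W" by blast
  obtain F' :: "('a, 'b, 'k) qrep set" where F': "finite F'"
    "\<And>V. indecomposable_rep G V \<Longrightarrow> \<exists>W\<in>F'. rep_iso G V W"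
    using assms(1) unfolding finite_quiver_iff by blast
  let ?F = "F \<union> F' \<union> (\<lambda>(W, W'). rep_dsum W W') ` (F \<times> F)"
  have "\<exists>W\<in>?F. rep_iso G V W" if V: "is_rep G V" "total_dim G V \<le> Suc M" for V
  proof (rule indecomposable_cases[OF V(1)])
    assume "\<not> nonzero_rep G V"
    then have "total_dim G V \<le> M" using total_dim_0_iff[of V] by simp
    then show ?thesis using F(2) V by blast
  next
    assume "indecomposable_rep G V"
    then show ?thesis using F'(2) by blast
  next
    fix W W' assume W: "is_rep G W" "is_rep G W'" "rep_iso G V (rep_dsum W W')"
      "total_dim G W < total_dim G V" "total_dim G W' < total_dim G V"
    then obtain U U' where U: "U \<in> F" "U' \<in> F" "rep_iso G W U" "rep_iso G W' U'"
      using F(2)[of W] F(2)[of W'] V(2) by auto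
    then have "rep_iso G V (rep_dsum U U')" using W(3) rep_iso_dsum rep_iso_trans by blast
    then show ?thesis using U by blast
  qed
  then show ?case using F(1) F'(1) by (intro exI[of _ ?F]) auto
qed

end

section \<open>The involution of the associated symmetric quiver\<close>

definition twin :: "('v, 'a) signed_quiver \<Rightarrow> 'v \<Rightarrow> 'v" where
  "twin S i = (THE j. {i, j} \<in> twins S)"

text \<open>The sign by which the form at a vertex differs from the transpose of the form at the starred
  vertex; it treats fixed and exchanged vertices alike.\<close>

definition csign :: "('v, 'a) signed_quiver \<Rightarrow> 'v + 'v \<Rightarrow> int" where
  "csign S i = (if sym_vsign S i = -1 then -1 else 1)"

lemma csign_sq: "csign S i * csign S i = 1"
  by (simp add: csign_def)

context signed_quiver
begin

sublocale Q: fin_digraph "quiver S" by (rule fin_digraph)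

lemma twin_props:
  assumes "i \<in> \<Union> (twins S)"
  shows "twin S i \<noteq> i" "{i, twin S i} \<in> twins S" "twin S i \<in> verts (quiver S)"
    "twin S i \<in> \<Union> (twins S)" "vsign S i = 0" "i \<in> verts (quiver S)"
proof -
  obtain P where P: "P \<in> twins S" "i \<in> P" using assms by blast
  have c2: "card P = 2" and sub: "P \<subseteq> verts (quiver S)" using twins_pairs[OF P(1)] by auto
  obtain x y where xy: "P = {x, y}" "x \<noteq> y" using c2 card_2_iff by metis
  obtain j where j: "P = {i, j}" "j \<noteq> i"
  proof (cases "i = x")
    case True then show thesis using that[of y] xy by auto
  next
    case False then show thesis using that[of x] xy P(2) by auto
  qed
  have uniq: "k = j" if "{i, k} \<in> twins S" for k
  proof -
    have "{i, k} = P" using twins_disjoint[OF that P(1)] P(2) by blast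
    then show ?thesis using j by (auto simp: doubleton_eq_iff)
  qed
  have ij: "{i, j} \<in> twins S" using P j by simp
  then have tw: "twin S i = j" unfolding twin_def by (rule the_equality) (rule uniq)
  show "twin S i \<noteq> i" "{i, twin S i} \<in> twins S" unfolding tw using j ij by auto
  show "twin S i \<in> verts (quiver S)" "i \<in> verts (quiver S)" unfolding tw using j(1) sub by auto
  show "twin S i \<in> \<Union> (twins S)" unfolding tw using ij by blast
  show "vsign S i = 0" using twins_unsigned[OF P] .
qed

lemma twin_eqI:
  assumes "{i, j} \<in> twins S"
  shows "twin S i = j"
proof -
  have i: "i \<in> \<Union> (twins S)" using assms by blast
  have "{i, j} = {i, twin S i}" using twins_disjoint[OF assms twin_props(2)[OF i]] by blast
  then show ?thesis using twin_props(1)[OF i] by (auto simp: doubleton_eq_iff)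
qed

lemma twin_twin: "i \<in> \<Union> (twins S) \<Longrightarrow> twin S (twin S i) = i"
  using twin_props(2)[of i] by (intro twin_eqI) (simp add: insert_commute)

lemma vstar_simps:
  "vsign S i \<noteq> 0 \<Longrightarrow> vstar S (Inl i) = Inl i"
  "i \<in> \<Union> (twins S) \<Longrightarrow> vstar S (Inl i) = Inl (twin S i)"
  "vsign S i = 0 \<Longrightarrow> i \<notin> \<Union> (twins S) \<Longrightarrow> vstar S (Inl i) = Inr i"
  using twin_props(5)[of i] by (auto simp: twin_def)

lemma sym_verts:
  "Inl i \<in> verts (sym_quiver S) \<longleftrightarrow> i \<in> verts (quiver S)"
  "Inr i \<in> verts (sym_quiver S) \<longleftrightarrow> i \<in> verts (quiver S) \<and> vsign S i = 0 \<and> i \<notin> \<Union> (twins S)"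
  by (auto simp: sym_quiver_def)

lemma sym_arcs:
  "Inl a \<in> arcs (sym_quiver S) \<longleftrightarrow> a \<in> arcs (quiver S)"
  "Inr a \<in> arcs (sym_quiver S) \<longleftrightarrow> a \<in> arcs (quiver S) \<and> asign S a = 0"
  by (auto simp: sym_quiver_def)

lemma sym_ends:
  "tail (sym_quiver S) (Inl a) = Inl (tail (quiver S) a)"
  "head (sym_quiver S) (Inl a) = Inl (head (quiver S) a)"
  "tail (sym_quiver S) (Inr a) = vstar S (Inl (head (quiver S) a))"
  "head (sym_quiver S) (Inr a) = vstar S (Inl (tail (quiver S) a))"
  by (auto simp: sym_quiver_def)

lemma vstar_Inl_cases:
  obtains "vsign S i \<noteq> 0" "vstar S (Inl i) = Inl i"
  | "i \<in> \<Union> (twins S)" "vsign S i = 0" "vstar S (Inl i) = Inl (twin S i)"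
  | "vsign S i = 0" "i \<notin> \<Union> (twins S)" "vstar S (Inl i) = Inr i"
  using vstar_simps twin_props(5) by metis

lemma vstar_in: "i \<in> verts (sym_quiver S) \<Longrightarrow> vstar S i \<in> verts (sym_quiver S)"
proof (cases i)
  case (Inl j)
  assume "i \<in> verts (sym_quiver S)"
  then show ?thesis unfolding Inl
    by (cases j rule: vstar_Inl_cases) (auto simp: sym_verts twin_props simp del: vstar.simps)
qed (auto simp: sym_verts)

lemma vstar_vstar: "i \<in> verts (sym_quiver S) \<Longrightarrow> vstar S (vstar S i) = i"
proof (cases i)
  case (Inl j)
  show ?thesis unfolding Inl
  proof (cases j rule: vstar_Inl_cases)
    case 2
    show "vstar S (vstar S (Inl j)) = Inl j" unfolding 2(3) vstar_simps(2)[OF twin_props(4)[OF 2(1)]] twin_twin[OF 2(1)] ..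
  qed (simp_all add: vstar.simps(2) del: vstar.simps(1))
qed (auto simp: sym_verts vstar_simps simp del: vstar.simps(1))

lemma sym_vsign_vstar: "i \<in> verts (sym_quiver S) \<Longrightarrow> sym_vsign S (vstar S i) = sym_vsign S i"
proof (cases i)
  case (Inl j)
  then show ?thesis
    by (cases j rule: vstar_Inl_cases)
      (simp_all add: sym_vsign_def twin_props(4,5)[OF twin_props(4)] twin_props(5) del: vstar.simps(1))
qed (auto simp: sym_verts sym_vsign_def)

lemma csign_vstar: "i \<in> verts (sym_quiver S) \<Longrightarrow> csign S (vstar S i) = csign S i"
  by (simp add: csign_def sym_vsign_vstar)

lemma vstar_fixed_iff: "i \<in> verts (sym_quiver S) \<Longrightarrow> vstar S i = i \<longleftrightarrow> sym_vsign S i \<noteq> 0"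
proof (cases i)
  case (Inl j)
  then show ?thesis
    by (cases j rule: vstar_Inl_cases) (simp_all add: sym_vsign_def twin_props(1) del: vstar.simps(1))
qed (auto simp: sym_vsign_def)

lemma sym_vsign_range: "i \<in> verts (sym_quiver S) \<Longrightarrow> sym_vsign S i \<in> {-1, 0, 1}"
  by (cases i) (auto simp: sym_vsign_def sym_verts dest: vsign_range)

lemma signed_arc_ends:
  assumes a: "a \<in> arcs (quiver S)" "asign S a \<noteq> 0"
  shows "vstar S (Inl (tail (quiver S) a)) = Inl (head (quiver S) a)"
    "vstar S (Inl (head (quiver S) a)) = Inl (tail (quiver S) a)"
proof -
  have "vstar S (Inl (tail (quiver S) a)) = Inl (head (quiver S) a) \<and>
    vstar S (Inl (head (quiver S) a)) = Inl (tail (quiver S) a)"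
  proof (cases "tail (quiver S) a = head (quiver S) a")
    case True
    then have "vsign S (tail (quiver S) a) \<noteq> 0" using loop_signed_iff a by auto
    then show ?thesis using True vstar_simps(1) by metis
  next
    case False
    then have t: "{tail (quiver S) a, head (quiver S) a} \<in> twins S" using nonloop_signed_iff a by auto
    then have u: "tail (quiver S) a \<in> \<Union> (twins S)" "head (quiver S) a \<in> \<Union> (twins S)" by blast+
    have "twin S (tail (quiver S) a) = head (quiver S) a" "twin S (head (quiver S) a) = tail (quiver S) a"
      using t by (auto intro!: twin_eqI simp: insert_commute)
    then show ?thesis using vstar_simps(2)[OF u(1)] vstar_simps(2)[OF u(2)] by simp
  qed
  then show "vstar S (Inl (tail (quiver S) a)) = Inl (head (quiver S) a)"
    "vstar S (Inl (head (quiver S) a)) = Inl (tail (quiver S) a)" by auto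
qed

lemma astar_in: "a \<in> arcs (sym_quiver S) \<Longrightarrow> astar S a \<in> arcs (sym_quiver S)"
  by (cases a) (auto simp: sym_arcs)

lemma astar_astar: "a \<in> arcs (sym_quiver S) \<Longrightarrow> astar S (astar S a) = a"
  by (cases a) (auto simp: sym_arcs)

lemma sym_asign_astar: "a \<in> arcs (sym_quiver S) \<Longrightarrow> sym_asign S (astar S a) = sym_asign S a"
  by (cases a) (auto simp: sym_arcs sym_asign_def)

lemma ends_astar:
  assumes "a \<in> arcs (sym_quiver S)"
  shows "tail (sym_quiver S) (astar S a) = vstar S (head (sym_quiver S) a)"
    "head (sym_quiver S) (astar S a) = vstar S (tail (sym_quiver S) a)"
proof -
  have "tail (sym_quiver S) (astar S a) = vstar S (head (sym_quiver S) a) \<and>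
    head (sym_quiver S) (astar S a) = vstar S (tail (sym_quiver S) a)"
  proof (cases a)
    case (Inl b)
    then show ?thesis using assms signed_arc_ends[of b]
      by (cases "asign S b = 0") (simp_all add: sym_arcs sym_ends del: vstar.simps)
  next
    case (Inr b)
    then have "b \<in> arcs (quiver S)" using assms by (simp add: sym_arcs)
    then have "Inl (tail (quiver S) b) \<in> verts (sym_quiver S)" "Inl (head (quiver S) b) \<in> verts (sym_quiver S)"
      by (simp_all add: sym_verts)
    then show ?thesis using Inr vstar_vstar by (simp add: sym_ends del: vstar.simps(1))
  qed
  then show "tail (sym_quiver S) (astar S a) = vstar S (head (sym_quiver S) a)"
    "head (sym_quiver S) (astar S a) = vstar S (tail (sym_quiver S) a)" by auto
qed

sublocale sym: fin_digraph "sym_quiver S"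
proof
  fix e assume e: "e \<in> arcs (sym_quiver S)"
  show "tail (sym_quiver S) e \<in> verts (sym_quiver S)" "head (sym_quiver S) e \<in> verts (sym_quiver S)"
    using e by (cases e; auto simp: sym_arcs sym_ends sym_verts vstar_in simp del: vstar.simps)+
next
  show "finite (verts (sym_quiver S))" "finite (arcs (sym_quiver S))"
    by (auto simp: sym_quiver_def)
qed

lemma dual_sign_astar:
  assumes "a \<in> arcs (sym_quiver S)"
  shows "dual_sign S a * dual_sign S (astar S a) =
    csign S (head (sym_quiver S) a) * csign S (tail (sym_quiver S) a)"
  using assms sym_asign_astar[OF assms] ends_astar[OF assms] sym_vsign_vstar[of "tail (sym_quiver S) a"]
  by (auto simp: dual_sign_def csign_def)

end

section \<open>Symmetric representations\<close>

lemma mat_smult_one: "(1 :: 'k :: field) \<cdot>\<^sub>m M = M"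
  by (auto intro!: eq_matI)

lemma mat_smult_swap: "(c :: 'k :: field) * c = 1 \<Longrightarrow> A = c \<cdot>\<^sub>m B \<longleftrightarrow> B = c \<cdot>\<^sub>m A"
  by (auto simp: mat_smult_smult mat_smult_one)

lemma peval_transpose:
  assumes A: "A \<in> carrier_mat n n"
  shows "peval p (A\<^sup>T) = (peval p A)\<^sup>T"
proof (induction p)
  case 0 then show ?case using A by (auto simp: peval_def intro!: eq_matI)
next
  case (pCons a p)
  have "peval (pCons a p) (A\<^sup>T) = a \<cdot>\<^sub>m 1\<^sub>m n + A\<^sup>T * (peval p A)\<^sup>T"
    using A peval_commute[of "A\<^sup>T" n p] by (simp add: peval_pCons pCons.IH)
  also have "\<dots> = (a \<cdot>\<^sub>m 1\<^sub>m n + peval p A * A)\<^sup>T"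
    using A by (simp add: mat_transpose_add mat_transpose_mult mat_transpose_smult)
  finally show ?case using A by (simp add: peval_pCons)
qed

lemma pow_mat_cancel:
  fixes u :: "'k :: field mat"
  assumes "u \<in> carrier_mat n n" "w \<in> carrier_mat n n" "w * u = 1\<^sub>m n" "X \<in> carrier_mat n n"
    and "u ^\<^sub>m m * X = 0\<^sub>m n n"
  shows "X = 0\<^sub>m n n"
  using assms(4,5)
proof (induction m arbitrary: X)
  case 0 then show ?case using assms(1) by simp
next
  case (Suc m)
  have "u ^\<^sub>m m * (u * X) = 0\<^sub>m n n" using Suc.prems assms(1) by (simp add: mat_assoc)
  then have "u * X = 0\<^sub>m n n" using Suc.IH[of "u * X"] Suc.prems(1) assms(1) by simp
  then have "(w * u) * X = 0\<^sub>m n n" using Suc.prems(1) assms(1,2) by (simp add: mat_assoc)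
  then show ?case using assms(3) Suc.prems(1) by simp
qed

text \<open>One polynomial serves all vertices: divide a common annihilating polynomial by the power of \<open>t\<close> in
  it, which is harmless for invertible matrices, and take a square root of \<open>t\<close> modulo the quotient.\<close>

lemma common_sqrt_poly:
  fixes u :: "'i \<Rightarrow> 'k :: {alg_closed_field, field_char_0} mat"
  assumes "finite I" and u: "\<And>i. i \<in> I \<Longrightarrow> u i \<in> carrier_mat (d i) (d i)"
    and w: "\<And>i. i \<in> I \<Longrightarrow> w i \<in> carrier_mat (d i) (d i)" "\<And>i. i \<in> I \<Longrightarrow> w i * u i = 1\<^sub>m (d i)"
  obtains r where "\<And>i. i \<in> I \<Longrightarrow> peval r (u i) * peval r (u i) = u i"
proof -
  obtain c where c: "c \<noteq> 0" "\<And>i. i \<in> I \<Longrightarrow> peval c (u i) = 0\<^sub>m (d i) (d i)"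
    using common_annihilating_poly[of I u d] assms by blast
  obtain q where q: "c = [:0, 1:] ^ order 0 c * q" "\<not> [:0, 1:] dvd q"
    using order_decomp[OF c(1), of 0] by auto
  have "peval q (u i) = 0\<^sub>m (d i) (d i)" if i: "i \<in> I" for i
  proof (rule pow_mat_cancel[OF u[OF i] w(1)[OF i] w(2)[OF i]])
    have "peval ([:0, 1:] ^ order 0 c * q) (u i) = 0\<^sub>m (d i) (d i)" using c(2)[OF i] q(1) by simp
    then show "u i ^\<^sub>m order 0 c * peval q (u i) = 0\<^sub>m (d i) (d i)"
      by (simp only: peval_mult[OF u[OF i]] peval_X_power[OF u[OF i]])
  qed (use u[OF i] in auto)
  moreover have "poly q 0 \<noteq> 0" using q(2) by (simp add: poly_eq_0_iff_dvd)
  then obtain r where "q dvd r * r - [:0, 1:]" using sqrt_poly by blast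
  ultimately have "peval (r * r) (u i) = u i" if "i \<in> I" for i
    using peval_dvd_diff_eq[OF u[OF that], of q "r * r" "[:0, 1:]"] that peval_X[OF u[OF that]] by simp
  then show thesis using that[of r] peval_mult[OF u] by simp
qed

context signed_quiver
begin

lemma is_symrep_iff:
  fixes V :: "('v + 'v, 'a + 'a, 'k :: field) qrep"
  shows "is_symrep S (V, J) \<longleftrightarrow> is_rep (sym_quiver S) V \<and>
    (\<forall>i\<in>verts (sym_quiver S). J i \<in> carrier_mat (vdim V (vstar S i)) (vdim V i) \<and> invertible_mat (J i) \<and>
       J (vstar S i) = of_int (csign S i) \<cdot>\<^sub>m (J i)\<^sup>T) \<and>
    (\<forall>a\<in>arcs (sym_quiver S). J (head (sym_quiver S) a) * amap V a =
       (of_int (dual_sign S a) \<cdot>\<^sub>m (amap V (astar S a))\<^sup>T) * J (tail (sym_quiver S) a))"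
proof -
  have form: "(if vstar S i = i then (J i)\<^sup>T = of_int (sym_vsign S i) \<cdot>\<^sub>m J i else J (vstar S i) = (J i)\<^sup>T) \<longleftrightarrow>
      J (vstar S i) = of_int (csign S i) \<cdot>\<^sub>m (J i)\<^sup>T" if i: "i \<in> verts (sym_quiver S)" for i
  proof (cases "vstar S i = i")
    case True
    then have "sym_vsign S i = csign S i"
      using sym_vsign_range[OF i] vstar_fixed_iff[OF i] by (auto simp: csign_def)
    then show ?thesis using True mat_smult_swap[of "of_int (csign S i)" "(J i)\<^sup>T" "J i"]
      by (simp add: csign_sq of_int_mult[symmetric] del: of_int_mult)
  next
    case False
    then have "csign S i = 1" using vstar_fixed_iff[OF i] by (simp add: csign_def)
    then show ?thesis using False by (simp add: mat_smult_one)
  qed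
  have dual: "is_rep (sym_quiver S) (dual_rep S V)" if V: "is_rep (sym_quiver S) V"
    unfolding is_rep_def
  proof
    fix a assume a: "a \<in> arcs (sym_quiver S)"
    show "amap (dual_rep S V) a \<in> carrier_mat (vdim (dual_rep S V) (head (sym_quiver S) a))
        (vdim (dual_rep S V) (tail (sym_quiver S) a))"
      using is_repD[OF V astar_in[OF a]] ends_astar[OF a] by (auto simp: dual_rep_def)
  qed
  show ?thesis
    unfolding is_symrep_def signed_form_def rep_isomorphism_def prod.case
    using form dual by (auto simp: dual_rep_def)
qed

end

context signed_quiver
begin

abbreviation "SQ \<equiv> sym_quiver S"

lemma symrepD:
  fixes V :: "('v + 'v, 'a + 'a, 'k :: field) qrep"
  assumes "is_symrep S (V, J)"
  shows "is_rep SQ V"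
    and "\<And>i. i \<in> verts SQ \<Longrightarrow> vdim V (vstar S i) = vdim V i"
    and "\<And>i. i \<in> verts SQ \<Longrightarrow> J i \<in> carrier_mat (vdim V i) (vdim V i)"
    and "\<And>i. i \<in> verts SQ \<Longrightarrow> J (vstar S i) = of_int (csign S i) \<cdot>\<^sub>m (J i)\<^sup>T"
    and "\<And>a. a \<in> arcs SQ \<Longrightarrow> J (head SQ a) * amap V a =
       (of_int (dual_sign S a) \<cdot>\<^sub>m (amap V (astar S a))\<^sup>T) * J (tail SQ a)"
proof -
  note * = assms[unfolded is_symrep_iff]
  have J: "J i \<in> carrier_mat (vdim V (vstar S i)) (vdim V i)" "invertible_mat (J i)" if "i \<in> verts SQ" for i
    using * that by auto
  show d: "vdim V (vstar S i) = vdim V i" if "i \<in> verts SQ" for i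
    using J[OF that] by (auto simp: invertible_mat_def)
  show "J i \<in> carrier_mat (vdim V i) (vdim V i)" if "i \<in> verts SQ" for i
    using J(1)[OF that] d[OF that] by simp
qed (use assms[unfolded is_symrep_iff] in auto)

text \<open>The inverse of the form is what adjoints of endomorphisms are made of.\<close>

lemma symrep_inverse_form:
  fixes V :: "('v + 'v, 'a + 'a, 'k :: field) qrep"
  assumes VJ: "is_symrep S (V, J)"
  obtains K where "\<And>i. i \<in> verts SQ \<Longrightarrow> K i \<in> carrier_mat (vdim V i) (vdim V i)"
    "\<And>i. i \<in> verts SQ \<Longrightarrow> K i * J i = 1\<^sub>m (vdim V i)"
    "\<And>i. i \<in> verts SQ \<Longrightarrow> J i * K i = 1\<^sub>m (vdim V i)"
    "\<And>i. i \<in> verts SQ \<Longrightarrow> K (vstar S i) = of_int (csign S i) \<cdot>\<^sub>m (K i)\<^sup>T"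
    "\<And>a. a \<in> arcs SQ \<Longrightarrow> amap V a * K (tail SQ a) =
       K (head SQ a) * (of_int (dual_sign S a) \<cdot>\<^sub>m (amap V (astar S a))\<^sup>T)"
proof -
  note s = symrepD[OF VJ]
  have inv: "invertible_mat (J i)" if "i \<in> verts SQ" for i using VJ that by (simp add: is_symrep_iff)
  have "\<exists>K. K \<in> carrier_mat (vdim V i) (vdim V i) \<and> K * J i = 1\<^sub>m (vdim V i) \<and> J i * K = 1\<^sub>m (vdim V i)"
    if "i \<in> verts SQ" for i
    by (rule invertible_matE[OF s(3)[OF that] inv[OF that]]) blast
  then obtain K where "\<forall>i\<in>verts SQ. K i \<in> carrier_mat (vdim V i) (vdim V i) \<and>
      K i * J i = 1\<^sub>m (vdim V i) \<and> J i * K i = 1\<^sub>m (vdim V i)" by metis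
  then have K: "\<And>i. i \<in> verts SQ \<Longrightarrow> K i \<in> carrier_mat (vdim V i) (vdim V i)"
    "\<And>i. i \<in> verts SQ \<Longrightarrow> K i * J i = 1\<^sub>m (vdim V i)"
    "\<And>i. i \<in> verts SQ \<Longrightarrow> J i * K i = 1\<^sub>m (vdim V i)" by blast+
  show thesis
  proof (rule that[OF K])
    fix i assume i: "i \<in> verts SQ"
    let ?c = "of_int (csign S i) :: 'k" and ?n = "vdim V i" and ?j = "vstar S i"
    have cc: "?c * ?c = 1" by (simp add: csign_sq flip: of_int_mult)
    have j: "?j \<in> verts SQ" by (rule vstar_in[OF i])
    have Kj: "K ?j \<in> carrier_mat ?n ?n" using K(1)[OF j] s(2)[OF i] by simp
    have "J ?j * (?c \<cdot>\<^sub>m (K i)\<^sup>T) = (?c * ?c) \<cdot>\<^sub>m ((J i)\<^sup>T * (K i)\<^sup>T)"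
      unfolding s(4)[OF i] using s(3)[OF i] K(1)[OF i]
      by (simp add: mat_smult_l mat_smult_r mat_smult_smult)
    also have "\<dots> = (K i * J i)\<^sup>T" unfolding cc using s(3)[OF i] K(1)[OF i]
      by (simp add: mat_transpose_mult mat_smult_one)
    finally have JK: "J ?j * (?c \<cdot>\<^sub>m (K i)\<^sup>T) = 1\<^sub>m ?n" unfolding K(2)[OF i] by simp
    have "K ?j = K ?j * (J ?j * (?c \<cdot>\<^sub>m (K i)\<^sup>T))" unfolding JK using Kj by simp
    also have "\<dots> = (K ?j * J ?j) * (?c \<cdot>\<^sub>m (K i)\<^sup>T)"
      using Kj s(3)[OF j] s(2)[OF i] K(1)[OF i] by (subst mat_assoc) auto
    also have "\<dots> = ?c \<cdot>\<^sub>m (K i)\<^sup>T" unfolding K(2)[OF j] s(2)[OF i] using K(1)[OF i] by simp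
    finally show "K ?j = ?c \<cdot>\<^sub>m (K i)\<^sup>T" .
  next
    fix a assume a: "a \<in> arcs SQ"
    let ?h = "head SQ a" and ?t = "tail SQ a"
    let ?X = "of_int (dual_sign S a) \<cdot>\<^sub>m (amap V (astar S a))\<^sup>T :: 'k mat"
    have h: "?h \<in> verts SQ" and t: "?t \<in> verts SQ" using a by auto
    have X: "?X \<in> carrier_mat (vdim V ?h) (vdim V ?t)"
      using is_repD[OF s(1) astar_in[OF a]] ends_astar[OF a] s(2)[OF h] s(2)[OF t] by auto
    note d = is_repD(1)[OF s(1) a] K(1)[OF h] K(1)[OF t] s(3)[OF h] s(3)[OF t]
    have regroup: "K ?h * (Y * J ?t) * K ?t = K ?h * Y * (J ?t * K ?t)"
      if "Y \<in> carrier_mat (vdim V ?h) (vdim V ?t)" for Y using that d by (simp add: mat_assoc)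
    have "amap V a * K ?t = (K ?h * J ?h) * (amap V a * K ?t)" unfolding K(2)[OF h] using d by simp
    also have "\<dots> = K ?h * (J ?h * amap V a) * K ?t" using d by (simp add: mat_assoc)
    also have "\<dots> = K ?h * (?X * J ?t) * K ?t" unfolding s(5)[OF a] ..
    also have "\<dots> = K ?h * ?X * (J ?t * K ?t)"
      by (rule regroup[OF X])
    also have "\<dots> = K ?h * ?X" unfolding K(3)[OF t]
      by (rule right_mult_one_mat, rule mult_carrier_mat[OF K(1)[OF h] X])
    finally show "amap V a * K ?t = K ?h * ?X" .
  qed
qed

text \<open>A symmetric form pulls back along every homomorphism on whose source it stays nondegenerate.\<close>

lemma symrep_pullback:
  fixes V W :: "('v + 'v, 'a + 'a, 'k :: field) qrep"
  assumes VJ: "is_symrep S (V, J)" and W: "is_rep SQ W" and A: "rep_hom SQ W V A"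
    and dim: "\<And>i. i \<in> verts SQ \<Longrightarrow> vdim W (vstar S i) = vdim W i"
    and L: "\<And>i. i \<in> verts SQ \<Longrightarrow> L i \<in> carrier_mat (vdim W i) (vdim W i)"
    and inv: "\<And>i. i \<in> verts SQ \<Longrightarrow> L i * ((A (vstar S i))\<^sup>T * J i * A i) = 1\<^sub>m (vdim W i)"
  shows "is_symrep S (W, \<lambda>i. (A (vstar S i))\<^sup>T * J i * A i)"
  unfolding is_symrep_iff
proof (intro conjI ballI)
  note s = symrepD[OF VJ]
  show "is_rep SQ W" by (rule W)
  have Ad: "A i \<in> carrier_mat (vdim V i) (vdim W i)" "A (vstar S i) \<in> carrier_mat (vdim V i) (vdim W i)"
    if "i \<in> verts SQ" for i
    using rep_homD(1)[OF A that] rep_homD(1)[OF A vstar_in[OF that]] s(2)[OF that] dim[OF that] by auto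
  fix i assume i: "i \<in> verts SQ"
  note d = Ad[OF i] s(3)[OF i]
  show c: "(A (vstar S i))\<^sup>T * J i * A i \<in> carrier_mat (vdim W (vstar S i)) (vdim W i)"
    using d dim[OF i] by simp
  have c': "(A (vstar S i))\<^sup>T * J i * A i \<in> carrier_mat (vdim W i) (vdim W i)" using c dim[OF i] by simp
  show "invertible_mat ((A (vstar S i))\<^sup>T * J i * A i)"
    by (rule invertible_matI(2)[OF c' L[OF i] mat_mult_left_right_inverse[OF L[OF i] c' inv[OF i]] inv[OF i]])
  show "(A (vstar S (vstar S i)))\<^sup>T * J (vstar S i) * A (vstar S i) =
      of_int (csign S i) \<cdot>\<^sub>m ((A (vstar S i))\<^sup>T * J i * A i)\<^sup>T"
    unfolding vstar_vstar[OF i] s(4)[OF i] using d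
    by (simp add: mat_transpose_mult mat_smult_l mat_smult_r mat_assoc)
next
  note s = symrepD[OF VJ]
  fix a assume a: "a \<in> arcs SQ"
  let ?h = "head SQ a" and ?t = "tail SQ a" and ?b = "astar S a" and ?s = "of_int (dual_sign S a) :: 'k"
  have h: "?h \<in> verts SQ" and t: "?t \<in> verts SQ" using a by auto
  have b: "?b \<in> arcs SQ" by (rule astar_in[OF a])
  have Ad: "A i \<in> carrier_mat (vdim V i) (vdim W i)" "A (vstar S i) \<in> carrier_mat (vdim V i) (vdim W i)"
    if "i \<in> verts SQ" for i
    using rep_homD(1)[OF A that] rep_homD(1)[OF A vstar_in[OF that]] s(2)[OF that] dim[OF that] by auto
  have Vb: "amap V ?b \<in> carrier_mat (vdim V ?t) (vdim V ?h)" "amap W ?b \<in> carrier_mat (vdim W ?t) (vdim W ?h)"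
    using is_repD(1)[OF s(1) b] is_repD(1)[OF W b] ends_astar[OF a] s(2)[OF h] s(2)[OF t] dim[OF h] dim[OF t]
    by auto
  note d = Ad[OF h] Ad[OF t] Vb is_repD(1)[OF s(1) a] is_repD(1)[OF W a] s(3)[OF h] s(3)[OF t]
  have cb: "A (vstar S ?t) * amap W ?b = amap V ?b * A (vstar S ?h)"
    using rep_hom_comm[OF A b] ends_astar[OF a] by simp
  have "(A (vstar S ?h))\<^sup>T * J ?h * A ?h * amap W a = (A (vstar S ?h))\<^sup>T * (J ?h * (A ?h * amap W a))"
    using d by (simp add: mat_assoc)
  also have "\<dots> = (A (vstar S ?h))\<^sup>T * (J ?h * amap V a * A ?t)"
    unfolding rep_hom_comm[OF A a] using d by (simp add: mat_assoc)
  also have "\<dots> = ?s \<cdot>\<^sub>m (((A (vstar S ?h))\<^sup>T * (amap V ?b)\<^sup>T) * (J ?t * A ?t))"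
    unfolding s(5)[OF a] using d by (simp add: mat_assoc mat_smult_l mat_smult_r)
  also have "(A (vstar S ?h))\<^sup>T * (amap V ?b)\<^sup>T = (A (vstar S ?t) * amap W ?b)\<^sup>T"
    unfolding cb using d by (simp add: mat_transpose_mult)
  also have "?s \<cdot>\<^sub>m ((A (vstar S ?t) * amap W ?b)\<^sup>T * (J ?t * A ?t)) =
      (?s \<cdot>\<^sub>m (amap W ?b)\<^sup>T) * ((A (vstar S ?t))\<^sup>T * J ?t * A ?t)"
    using d by (simp add: mat_transpose_mult mat_assoc mat_smult_l)
  finally show "(A (vstar S ?h))\<^sup>T * J ?h * A ?h * amap W a =
      (?s \<cdot>\<^sub>m (amap W ?b)\<^sup>T) * ((A (vstar S ?t))\<^sup>T * J ?t * A ?t)" .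
qed

text \<open>Over an algebraically closed field of characteristic 0 a representation carries at most one
  symmetric form up to isometry: two forms \<open>J, J'\<close> differ by the automorphism \<open>u = J'\<^sup>-\<^sup>1 J\<close>, which is
  self-adjoint, and a square root of \<open>u\<close> that is a polynomial in \<open>u\<close> is self-adjoint too and carries
  one form to the other.\<close>

lemma form_unique:
  fixes V :: "('v + 'v, 'a + 'a, 'k :: {alg_closed_field, field_char_0}) qrep"
  assumes VJ: "is_symrep S (V, J)" and VJ': "is_symrep S (V, J')"
  obtains g where "rep_isomorphism SQ V V g"
    "\<And>i. i \<in> verts SQ \<Longrightarrow> J i = (g (vstar S i))\<^sup>T * J' i * g i"
proof -
  note s = symrepD[OF VJ] and s' = symrepD[OF VJ']
  obtain K where K: "\<And>i. i \<in> verts SQ \<Longrightarrow> K i \<in> carrier_mat (vdim V i) (vdim V i)"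
    "\<And>i. i \<in> verts SQ \<Longrightarrow> K i * J i = 1\<^sub>m (vdim V i)" "\<And>i. i \<in> verts SQ \<Longrightarrow> J i * K i = 1\<^sub>m (vdim V i)"
    by (rule symrep_inverse_form[OF VJ], blast)
  obtain K' where K': "\<And>i. i \<in> verts SQ \<Longrightarrow> K' i \<in> carrier_mat (vdim V i) (vdim V i)"
    "\<And>i. i \<in> verts SQ \<Longrightarrow> K' i * J' i = 1\<^sub>m (vdim V i)" "\<And>i. i \<in> verts SQ \<Longrightarrow> J' i * K' i = 1\<^sub>m (vdim V i)"
    "\<And>i. i \<in> verts SQ \<Longrightarrow> K' (vstar S i) = of_int (csign S i) \<cdot>\<^sub>m (K' i)\<^sup>T"
    "\<And>a. a \<in> arcs SQ \<Longrightarrow> amap V a * K' (tail SQ a) =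
       K' (head SQ a) * (of_int (dual_sign S a) \<cdot>\<^sub>m (amap V (astar S a))\<^sup>T)"
    by (rule symrep_inverse_form[OF VJ'], blast)
  define u where "u i = K' i * J i" for i
  have u: "u i \<in> carrier_mat (vdim V i) (vdim V i)" if "i \<in> verts SQ" for i
    using K'(1)[OF that] s(3)[OF that] by (simp add: u_def)
  have uh: "rep_hom SQ V V u"
    unfolding rep_hom_def
  proof (intro conjI ballI)
    fix a assume a: "a \<in> arcs SQ"
    let ?h = "head SQ a" and ?t = "tail SQ a"
    let ?X = "of_int (dual_sign S a) \<cdot>\<^sub>m (amap V (astar S a))\<^sup>T :: 'k mat"
    have h: "?h \<in> verts SQ" and t: "?t \<in> verts SQ" using a by auto
    have X: "?X \<in> carrier_mat (vdim V ?h) (vdim V ?t)"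
      using is_repD[OF s(1) astar_in[OF a]] ends_astar[OF a] s(2)[OF h] s(2)[OF t] by auto
    note d = X is_repD(1)[OF s(1) a] K'(1)[OF h] K'(1)[OF t] s(3)[OF h] s(3)[OF t]
    have "u ?h * amap V a = K' ?h * (J ?h * amap V a)" using d by (simp add: u_def mat_assoc)
    also have "\<dots> = (K' ?h * ?X) * J ?t"
      unfolding s(5)[OF a] using d by (subst mat_assoc) (auto simp del: transpose_carrier_mat)
    also have "\<dots> = amap V a * u ?t" unfolding K'(5)[OF a, symmetric] using d by (simp add: u_def mat_assoc)
    finally show "u ?h * amap V a = amap V a * u ?t" .
  qed (use u in auto)
  have w: "K i * J' i \<in> carrier_mat (vdim V i) (vdim V i)" "K i * J' i * u i = 1\<^sub>m (vdim V i)"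
    if i: "i \<in> verts SQ" for i
  proof -
    note d = K(1)[OF i] K'(1)[OF i] s(3)[OF i] s'(3)[OF i]
    show "K i * J' i \<in> carrier_mat (vdim V i) (vdim V i)" using d by simp
    have "K i * J' i * u i = K i * ((J' i * K' i) * J i)" using d by (simp add: u_def mat_assoc)
    also have "\<dots> = 1\<^sub>m (vdim V i)" unfolding K'(3)[OF i] using d K(2)[OF i] by simp
    finally show "K i * J' i * u i = 1\<^sub>m (vdim V i)" .
  qed
  obtain r where r: "\<And>i. i \<in> verts SQ \<Longrightarrow> peval r (u i) * peval r (u i) = u i"
    using common_sqrt_poly[of "verts SQ" u "vdim V" "\<lambda>i. K i * J' i"] u w by auto
  define g where "g i = peval r (u i)" for i
  have g: "g i \<in> carrier_mat (vdim V i) (vdim V i)" if "i \<in> verts SQ" for i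
    using u[OF that] by (auto simp: g_def)
  have gh: "rep_hom SQ V V g" unfolding g_def by (rule sym.rep_hom_peval[OF s(1) uh])
  have inv: "K i * J' i * g i * g i = 1\<^sub>m (vdim V i)" if i: "i \<in> verts SQ" for i
  proof -
    have "K i * J' i * g i * g i = K i * J' i * (g i * g i)"
      using w(1)[OF i] g[OF i] by (intro mat_assoc) auto
    then show ?thesis using r[OF i] w(2)[OF i] by (simp add: g_def)
  qed
  show thesis
  proof (rule that)
    show "rep_isomorphism SQ V V g"
    proof (rule sym.rep_isomorphismI[OF s(1) s(1) gh, of "\<lambda>i. K i * J' i * g i"])
      fix i assume i: "i \<in> verts SQ"
      show c: "K i * J' i * g i \<in> carrier_mat (vdim V i) (vdim V i)" using w(1)[OF i] g[OF i] by simp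
      show "K i * J' i * g i * g i = 1\<^sub>m (vdim V i)" by (rule inv[OF i])
      show "g i * (K i * J' i * g i) = 1\<^sub>m (vdim V i)"
        by (rule mat_mult_left_right_inverse[OF c g[OF i] inv[OF i]])
    qed
    fix i assume i: "i \<in> verts SQ"
    let ?c = "of_int (csign S i) :: 'k"
    have cc: "?c * ?c = 1" by (simp add: csign_sq flip: of_int_mult)
    note d = K'(1)[OF i] s(3)[OF i] s'(3)[OF i] u[OF i] g[OF i]
    have us: "u (vstar S i) \<in> carrier_mat (vdim V i) (vdim V i)" using u[OF vstar_in[OF i]] s(2)[OF i] by simp
    have "(u (vstar S i))\<^sup>T = (?c * ?c) \<cdot>\<^sub>m (J i * K' i)"
      unfolding u_def K'(4)[OF i] s(4)[OF i] using d
      by (simp add: mat_smult_l mat_smult_r mat_smult_smult mat_transpose_smult mat_transpose_mult)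
    then have ut: "(u (vstar S i))\<^sup>T = J i * K' i" unfolding cc by (simp add: mat_smult_one)
    have "(u (vstar S i))\<^sup>T * J' i = J i * (K' i * J' i)" unfolding ut using d by (simp add: mat_assoc)
    then have 1: "(u (vstar S i))\<^sup>T * J' i = J i" unfolding K'(2)[OF i] using d by simp
    have "J' i * u i = (J' i * K' i) * J i" unfolding u_def using d by (simp add: mat_assoc)
    then have 2: "J' i * u i = J i" unfolding K'(3)[OF i] using d by simp
    have "(g (vstar S i))\<^sup>T * J' i = J' i * g i"
      unfolding g_def peval_transpose[OF us, symmetric]
      by (rule peval_intertwine[of _ "vdim V i" _ "vdim V i"]) (use us d 1 2 in auto)
    then have "(g (vstar S i))\<^sup>T * J' i * g i = J' i * g i * g i" by simp
    also have "\<dots> = J' i * (g i * g i)" using d by (simp add: mat_assoc)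
    also have "\<dots> = J i" using r[OF i] 2 by (simp add: g_def)
    finally show "J i = (g (vstar S i))\<^sup>T * J' i * g i" ..
  qed
qed

text \<open>By uniqueness of the form, an isomorphism of the underlying representations can be corrected to an
  isometry.\<close>

lemma symrep_iso_iff:
  fixes V :: "('v + 'v, 'a + 'a, 'k :: {alg_closed_field, field_char_0}) qrep"
  shows "symrep_iso S (V, J) (V', J') \<longleftrightarrow> is_symrep S (V, J) \<and> is_symrep S (V', J') \<and> rep_iso SQ V V'"
proof
  assume "symrep_iso S (V, J) (V', J')"
  then show "is_symrep S (V, J) \<and> is_symrep S (V', J') \<and> rep_iso SQ V V'"
    by (auto simp: symrep_iso_def rep_iso_def)
next
  assume a: "is_symrep S (V, J) \<and> is_symrep S (V', J') \<and> rep_iso SQ V V'"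
  then have VJ: "is_symrep S (V, J)" and VJ': "is_symrep S (V', J')" by auto
  note s = symrepD[OF VJ] and s' = symrepD[OF VJ']
  obtain g where g: "rep_isomorphism SQ V V' g" using a by (auto simp: rep_iso_def)
  obtain h where gh: "rep_hom SQ V V' g" "rep_hom SQ V' V h"
    "\<And>i. i \<in> verts SQ \<Longrightarrow> g i * h i = 1\<^sub>m (vdim V' i)" "\<And>i. i \<in> verts SQ \<Longrightarrow> h i * g i = 1\<^sub>m (vdim V i)"
    "\<And>i. i \<in> verts SQ \<Longrightarrow> vdim V i = vdim V' i"
    by (rule sym.rep_isomorphismE[OF g], blast)
  obtain K where K: "\<And>i. i \<in> verts SQ \<Longrightarrow> K i \<in> carrier_mat (vdim V' i) (vdim V' i)"
    "\<And>i. i \<in> verts SQ \<Longrightarrow> K i * J' i = 1\<^sub>m (vdim V' i)"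
    by (rule symrep_inverse_form[OF VJ'], blast)
  define J'' where "J'' i = (g (vstar S i))\<^sup>T * J' i * g i" for i
  have "is_symrep S (V, J'')" unfolding J''_def
  proof (rule symrep_pullback[OF VJ' s(1) gh(1) s(2), of "\<lambda>i. h i * K i * (h (vstar S i))\<^sup>T"])
    fix i assume i: "i \<in> verts SQ"
    have j: "vstar S i \<in> verts SQ" by (rule vstar_in[OF i])
    note d = rep_homD(1)[OF gh(1) i] rep_homD(1)[OF gh(2) i] rep_homD(1)[OF gh(1) j, unfolded s(2)[OF i] s'(2)[OF i]]
      rep_homD(1)[OF gh(2) j, unfolded s(2)[OF i] s'(2)[OF i]] K(1)[OF i] s'(3)[OF i]
    show "h i * K i * (h (vstar S i))\<^sup>T \<in> carrier_mat (vdim V i) (vdim V i)" using d gh(5)[OF i] by simp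
    have "h i * K i * (h (vstar S i))\<^sup>T * ((g (vstar S i))\<^sup>T * J' i * g i) =
        h i * (K i * ((g (vstar S i) * h (vstar S i))\<^sup>T * (J' i * g i)))"
      using d by (simp add: mat_assoc mat_transpose_mult)
    also have "\<dots> = h i * (K i * (J' i * g i))" unfolding gh(3)[OF j] s'(2)[OF i] using d by simp
    also have "\<dots> = h i * ((K i * J' i) * g i)" using d by (simp add: mat_assoc)
    also have "\<dots> = 1\<^sub>m (vdim V i)" unfolding K(2)[OF i] using d gh(4)[OF i] by simp
    finally show "h i * K i * (h (vstar S i))\<^sup>T * ((g (vstar S i))\<^sup>T * J' i * g i) = 1\<^sub>m (vdim V i)" .
  qed auto
  then obtain r where r: "rep_isomorphism SQ V V r" "\<And>i. i \<in> verts SQ \<Longrightarrow> J i = (r (vstar S i))\<^sup>T * J'' i * r i"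
    using form_unique[OF VJ] by blast
  have rh: "rep_hom SQ V V r" by (rule sym.rep_isomorphismE[OF r(1)])
  have "J i = (g (vstar S i) * r (vstar S i))\<^sup>T * J' i * (g i * r i)" if i: "i \<in> verts SQ" for i
  proof -
    have j: "vstar S i \<in> verts SQ" by (rule vstar_in[OF i])
    note d = rep_homD(1)[OF gh(1) i] rep_homD(1)[OF gh(1) j, unfolded s(2)[OF i] s'(2)[OF i]]
      rep_homD(1)[OF rh i] rep_homD(1)[OF rh j, unfolded s(2)[OF i]] s'(3)[OF i]
    show ?thesis unfolding r(2)[OF i] J''_def using d by (simp add: mat_assoc mat_transpose_mult)
  qed
  moreover have "rep_isomorphism SQ V V' (\<lambda>i. g i * r i)" by (rule sym.rep_isomorphism_comp[OF r(1) g])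
  ultimately show "symrep_iso S (V, J) (V', J')"
    unfolding symrep_iso_def prod.case using VJ VJ' by blast
qed

lemma symrep_iso_iff':
  fixes X Y :: "('v, 'a, 'k :: {alg_closed_field, field_char_0}) symrep"
  shows "symrep_iso S X Y \<longleftrightarrow> is_symrep S X \<and> is_symrep S Y \<and> rep_iso SQ (fst X) (fst Y)"
  using symrep_iso_iff[of "fst X" "snd X" "fst Y" "snd Y"] by simp

lemma is_symrep_dsum:
  fixes V W :: "('v + 'v, 'a + 'a, 'k :: field) qrep"
  assumes VJ: "is_symrep S (V, J)" and WL: "is_symrep S (W, L)"
  shows "is_symrep S (symrep_dsum (V, J) (W, L))"
proof -
  note s = symrepD[OF VJ] and s' = symrepD[OF WL]
  obtain K where K: "\<And>i. i \<in> verts SQ \<Longrightarrow> K i \<in> carrier_mat (vdim V i) (vdim V i)"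
    "\<And>i. i \<in> verts SQ \<Longrightarrow> K i * J i = 1\<^sub>m (vdim V i)" "\<And>i. i \<in> verts SQ \<Longrightarrow> J i * K i = 1\<^sub>m (vdim V i)"
    by (rule symrep_inverse_form[OF VJ], blast)
  obtain K' where K': "\<And>i. i \<in> verts SQ \<Longrightarrow> K' i \<in> carrier_mat (vdim W i) (vdim W i)"
    "\<And>i. i \<in> verts SQ \<Longrightarrow> K' i * L i = 1\<^sub>m (vdim W i)" "\<And>i. i \<in> verts SQ \<Longrightarrow> L i * K' i = 1\<^sub>m (vdim W i)"
    by (rule symrep_inverse_form[OF WL], blast)
  show ?thesis unfolding symrep_dsum_def prod.case is_symrep_iff
  proof (intro conjI ballI)
    show "is_rep SQ (rep_dsum V W)" by (rule sym.is_rep_dsum[OF s(1) s'(1)])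
    fix i assume i: "i \<in> verts SQ"
    note d = s(3)[OF i] s'(3)[OF i] K(1)[OF i] K'(1)[OF i]
    show c: "mat_dsum (J i) (L i) \<in> carrier_mat (vdim (rep_dsum V W) (vstar S i)) (vdim (rep_dsum V W) i)"
      using d s(2)[OF i] s'(2)[OF i] by (intro carrier_matI) auto
    show "invertible_mat (mat_dsum (J i) (L i))"
    proof (rule invertible_matI(2))
      show "mat_dsum (J i) (L i) \<in> carrier_mat (vdim V i + vdim W i) (vdim V i + vdim W i)"
        "mat_dsum (K i) (K' i) \<in> carrier_mat (vdim V i + vdim W i) (vdim V i + vdim W i)"
        using d by (intro carrier_matI; simp)+
      show "mat_dsum (J i) (L i) * mat_dsum (K i) (K' i) = 1\<^sub>m (vdim V i + vdim W i)"
        using d by (simp add: mat_dsum_mult K(3)[OF i] K'(3)[OF i] mat_dsum_one)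
      show "mat_dsum (K i) (K' i) * mat_dsum (J i) (L i) = 1\<^sub>m (vdim V i + vdim W i)"
        using d by (simp add: mat_dsum_mult K(2)[OF i] K'(2)[OF i] mat_dsum_one)
    qed
    show "mat_dsum (J (vstar S i)) (L (vstar S i)) = of_int (csign S i) \<cdot>\<^sub>m (mat_dsum (J i) (L i))\<^sup>T"
      unfolding s(4)[OF i] s'(4)[OF i] by (simp add: transpose_mat_dsum smult_mat_dsum)
  next
    fix a assume a: "a \<in> arcs SQ"
    let ?h = "head SQ a" and ?t = "tail SQ a" and ?b = "astar S a"
    have h: "?h \<in> verts SQ" and t: "?t \<in> verts SQ" using a by auto
    have b: "?b \<in> arcs SQ" by (rule astar_in[OF a])
    have Vb: "amap V ?b \<in> carrier_mat (vdim V ?t) (vdim V ?h)" "amap W ?b \<in> carrier_mat (vdim W ?t) (vdim W ?h)"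
      using is_repD(1)[OF s(1) b] is_repD(1)[OF s'(1) b] ends_astar[OF a] s(2)[OF h] s(2)[OF t] s'(2)[OF h] s'(2)[OF t]
      by auto
    note d = Vb is_repD(1)[OF s(1) a] is_repD(1)[OF s'(1) a] s(3)[OF h] s(3)[OF t] s'(3)[OF h] s'(3)[OF t]
    show "mat_dsum (J ?h) (L ?h) * amap (rep_dsum V W) a =
        (of_int (dual_sign S a) \<cdot>\<^sub>m (amap (rep_dsum V W) ?b)\<^sup>T) * mat_dsum (J ?t) (L ?t)"
      using d by (simp add: mat_dsum_mult s(5)[OF a] s'(5)[OF a] transpose_mat_dsum smult_mat_dsum)
  qed
qed

lemma is_symrep_dsum':
  "is_symrep S Y \<Longrightarrow> is_symrep S Y' \<Longrightarrow> is_symrep S (symrep_dsum Y Y')"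
  "fst (symrep_dsum Y Y') = rep_dsum (fst Y) (fst Y')"
  using is_symrep_dsum[of "fst Y" "snd Y" "fst Y'" "snd Y'"]
  by (auto simp: symrep_dsum_def split: prod.splits)

text \<open>The image of a self-adjoint idempotent is orthogonal to its kernel, so the form stays nondegenerate
  on the image; the inverse is obtained by compressing the inverse form.\<close>

lemma symrep_image:
  fixes V :: "('v + 'v, 'a + 'a, 'k :: field) qrep"
  assumes VJ: "is_symrep S (V, J)" and W: "is_rep SQ W" and A: "rep_hom SQ W V A" and B: "rep_hom SQ V W B"
    and AB: "\<And>i. i \<in> verts SQ \<Longrightarrow> A i * B i = e i" and BA: "\<And>i. i \<in> verts SQ \<Longrightarrow> B i * A i = 1\<^sub>m (vdim W i)"
    and sa: "\<And>i. i \<in> verts SQ \<Longrightarrow> (e (vstar S i))\<^sup>T * J i = J i * e i"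
  shows "\<exists>L. is_symrep S (W, L)"
proof -
  note s = symrepD[OF VJ]
  obtain K where K: "\<And>i. i \<in> verts SQ \<Longrightarrow> K i \<in> carrier_mat (vdim V i) (vdim V i)"
    "\<And>i. i \<in> verts SQ \<Longrightarrow> K i * J i = 1\<^sub>m (vdim V i)" "\<And>i. i \<in> verts SQ \<Longrightarrow> J i * K i = 1\<^sub>m (vdim V i)"
    by (rule symrep_inverse_form[OF VJ], blast)
  define L where "L i = B i * K i * (B (vstar S i))\<^sup>T" for i
  define F where "F i = (A (vstar S i))\<^sup>T * J i * A i" for i
  have main: "L i * F i = 1\<^sub>m (vdim W i)" "F i * L i = 1\<^sub>m (vdim W (vstar S i))"
    "L i \<in> carrier_mat (vdim W i) (vdim W (vstar S i))" "F i \<in> carrier_mat (vdim W (vstar S i)) (vdim W i)"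
    if i: "i \<in> verts SQ" for i
  proof -
    let ?j = "vstar S i"
    have j: "?j \<in> verts SQ" by (rule vstar_in[OF i])
    note d = rep_homD(1)[OF A i] rep_homD(1)[OF B i] rep_homD(1)[OF A j, unfolded s(2)[OF i]]
      rep_homD(1)[OF B j, unfolded s(2)[OF i]] K(1)[OF i] s(3)[OF i]
    have ec: "e i \<in> carrier_mat (vdim V i) (vdim V i)" "e ?j \<in> carrier_mat (vdim V i) (vdim V i)"
      using d unfolding AB[OF i, symmetric] AB[OF j, symmetric] by auto
    show "L i \<in> carrier_mat (vdim W i) (vdim W ?j)" "F i \<in> carrier_mat (vdim W ?j) (vdim W i)"
      using d by (auto simp: L_def F_def)
    have eA: "e i * A i = A i" unfolding AB[OF i, symmetric] using d BA[OF i] by (simp add: mat_assoc)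
    have "L i * F i = B i * (K i * ((A ?j * B ?j)\<^sup>T * J i)) * A i"
      using d unfolding L_def F_def by (simp add: mat_assoc mat_transpose_mult)
    also have "\<dots> = B i * (K i * (J i * e i)) * A i" unfolding AB[OF j] sa[OF i] ..
    also have "\<dots> = B i * ((K i * J i) * (e i * A i))" using d ec by (simp add: mat_assoc)
    also have "\<dots> = 1\<^sub>m (vdim W i)" unfolding eA K(2)[OF i] using d BA[OF i] by simp
    finally show "L i * F i = 1\<^sub>m (vdim W i)" .
    have "F i * L i = (A ?j)\<^sup>T * (J i * (A i * B i)) * (K i * (B ?j)\<^sup>T)"
      using d unfolding L_def F_def by (simp add: mat_assoc)
    also have "\<dots> = (A ?j)\<^sup>T * ((e ?j)\<^sup>T * J i) * (K i * (B ?j)\<^sup>T)" unfolding AB[OF i] sa[OF i] ..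
    also have "\<dots> = (A ?j)\<^sup>T * (e ?j)\<^sup>T * ((J i * K i) * (B ?j)\<^sup>T)" using d ec by (simp add: mat_assoc)
    also have "\<dots> = (A ?j)\<^sup>T * (e ?j)\<^sup>T * (B ?j)\<^sup>T" unfolding K(3)[OF i] using d by simp
    also have "\<dots> = (B ?j * (e ?j * A ?j))\<^sup>T" using d ec by (simp add: mat_transpose_mult mat_assoc)
    also have "B ?j * (e ?j * A ?j) = (B ?j * A ?j) * (B ?j * A ?j)"
      unfolding AB[OF j, symmetric] using d by (simp add: mat_assoc)
    also have "\<dots> = 1\<^sub>m (vdim W ?j)" unfolding BA[OF j] by simp
    finally show "F i * L i = 1\<^sub>m (vdim W ?j)" by simp
  qed
  have dim: "vdim W (vstar S i) = vdim W i" if i: "i \<in> verts SQ" for i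
    using invertible_matI(1)[OF main(4,3,2,1)] i by simp
  have "is_symrep S (W, \<lambda>i. (A (vstar S i))\<^sup>T * J i * A i)"
    by (rule symrep_pullback[OF VJ W A dim, of L]) (use main dim in \<open>auto simp: F_def\<close>)
  then show ?thesis by blast
qed

text \<open>A self-adjoint idempotent splits a symmetric representation into its image and its kernel, which are
  orthogonal to each other.\<close>

lemma selfadjoint_idem_trivial:
  fixes V :: "('v + 'v, 'a + 'a, 'k :: {alg_closed_field, field_char_0}) qrep"
  assumes VJ: "indecomposable_symrep S (V, J)" and e: "idem_endo SQ V e"
    and sa: "\<And>i. i \<in> verts SQ \<Longrightarrow> (e (vstar S i))\<^sup>T * J i = J i * e i"
  shows "(\<forall>i\<in>verts SQ. e i = 0\<^sub>m (vdim V i) (vdim V i)) \<or> (\<forall>i\<in>verts SQ. e i = 1\<^sub>m (vdim V i))"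
proof -
  have sym: "is_symrep S (V, J)" using VJ by (auto simp: indecomposable_symrep_def)
  note s = symrepD[OF sym]
  have eh: "rep_hom SQ V V e" using e by (auto simp: idem_endo_def)
  obtain W W' A B A' B' where W: "is_rep SQ W" "is_rep SQ W'" and
    h: "rep_hom SQ W V A" "rep_hom SQ V W B" "rep_hom SQ W' V A'" "rep_hom SQ V W' B'" and
    *: "\<And>i. i \<in> verts SQ \<Longrightarrow> A i * B i = e i" "\<And>i. i \<in> verts SQ \<Longrightarrow> B i * A i = 1\<^sub>m (vdim W i)"
      "\<And>i. i \<in> verts SQ \<Longrightarrow> A' i * B' i = 1\<^sub>m (vdim V i) - e i" "\<And>i. i \<in> verts SQ \<Longrightarrow> B' i * A' i = 1\<^sub>m (vdim W' i)"
    and iso: "rep_isomorphism SQ V (rep_dsum W W') (\<lambda>i. vcat (B i) (B' i))"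
    by (rule sym.idem_endo_splits[OF s(1) e], blast)
  have sa': "(1\<^sub>m (vdim V (vstar S i)) - e (vstar S i))\<^sup>T * J i = J i * (1\<^sub>m (vdim V i) - e i)"
    if i: "i \<in> verts SQ" for i
    using rep_homD(1)[OF eh i] rep_homD(1)[OF eh vstar_in[OF i]] s(3)[OF i] sa[OF i] s(2)[OF i]
    by (simp add: mat_transpose_minus mat_minus_distl mat_minus_distr)
  obtain L where L: "is_symrep S (W, L)" using symrep_image[OF sym W(1) h(1,2) *(1,2) sa] by blast
  obtain L' where L': "is_symrep S (W', L')" using symrep_image[OF sym W(2) h(3,4) *(3,4) sa'] by blast
  have "symrep_iso S (V, J) (symrep_dsum (W, L) (W', L'))"
    unfolding symrep_iso_iff' is_symrep_dsum'(2) fst_conv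
    using sym is_symrep_dsum'(1)[OF L L'] iso by (auto simp: rep_iso_def)
  then have "\<not> nonzero_rep SQ W \<or> \<not> nonzero_rep SQ W'"
    using VJ L L' unfolding indecomposable_symrep_def by fastforce
  then show ?thesis
  proof
    assume "\<not> nonzero_rep SQ W"
    then have 0: "vdim W i = 0" if "i \<in> verts SQ" for i using that by (auto simp: nonzero_rep_def)
    have "e i = 0\<^sub>m (vdim V i) (vdim V i)" if i: "i \<in> verts SQ" for i
      using rep_homD[OF h(1) i] rep_homD[OF h(2) i] 0[OF i]
      by (subst *(1)[OF i, symmetric]) (auto intro!: eq_matI simp: scalar_prod_def)
    then show ?thesis by blast
  next
    assume "\<not> nonzero_rep SQ W'"
    then have 0: "vdim W' i = 0" if "i \<in> verts SQ" for i using that by (auto simp: nonzero_rep_def)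
    have m: "1\<^sub>m (vdim V i) - e i = 0\<^sub>m (vdim V i) (vdim V i)" if i: "i \<in> verts SQ" for i
      using rep_homD[OF h(3) i] rep_homD[OF h(4) i] 0[OF i]
      by (subst *(3)[OF i, symmetric]) (auto intro!: eq_matI simp: scalar_prod_def)
    have "e i = 1\<^sub>m (vdim V i)" if i: "i \<in> verts SQ" for i
      using mat_diff_eq_0[OF m[OF i]] rep_homD(1)[OF eh i] by simp
    then show ?thesis by blast
  qed
qed

end

section \<open>Finite signed type is finite type of the symmetric quiver\<close>

definition anti_mat :: "'k :: field mat \<Rightarrow> 'k mat \<Rightarrow> 'k mat" where
  "anti_mat P Q = four_block_mat (0\<^sub>m (dim_row P) (dim_col Q)) P Q (0\<^sub>m (dim_row Q) (dim_col P))"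

lemma dim_anti_mat [simp]:
  "dim_row (anti_mat P Q) = dim_row P + dim_row Q" "dim_col (anti_mat P Q) = dim_col Q + dim_col P"
  by (auto simp: anti_mat_def)

lemma anti_mat_mult:
  fixes P :: "'k :: field mat"
  assumes "dim_col P = dim_row Q'" "dim_col Q = dim_row P'"
  shows "anti_mat P Q * anti_mat P' Q' = mat_dsum (P * Q') (Q * P')"
  unfolding anti_mat_def mat_dsum_def using assms
  by (subst mult_four_block_mat[where ?nr1.0 = "dim_row P" and ?n1.0 = "dim_col Q" and ?n2.0 = "dim_col P"
        and ?nr2.0 = "dim_row Q" and ?nc1.0 = "dim_col Q'" and ?nc2.0 = "dim_col P'"])
    (auto intro!: cong_four_block_mat eq_matI)

lemma anti_mat_dsum:
  fixes P :: "'k :: field mat"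
  assumes "dim_col Q = dim_row X" "dim_col P = dim_row Y"
  shows "anti_mat P Q * mat_dsum X Y = anti_mat (P * Y) (Q * X)"
  unfolding anti_mat_def mat_dsum_def using assms
  by (subst mult_four_block_mat[where ?nr1.0 = "dim_row P" and ?n1.0 = "dim_col Q" and ?n2.0 = "dim_col P"
        and ?nr2.0 = "dim_row Q" and ?nc1.0 = "dim_col X" and ?nc2.0 = "dim_col Y"])
    (auto intro!: cong_four_block_mat eq_matI)

lemma dsum_anti_mat:
  fixes P :: "'k :: field mat"
  assumes "dim_col X = dim_row P" "dim_col Y = dim_row Q"
  shows "mat_dsum X Y * anti_mat P Q = anti_mat (X * P) (Y * Q)"
  unfolding anti_mat_def mat_dsum_def using assms
  by (subst mult_four_block_mat[where ?nr1.0 = "dim_row X" and ?n1.0 = "dim_col X" and ?n2.0 = "dim_col Y"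
        and ?nr2.0 = "dim_row Y" and ?nc1.0 = "dim_col Q" and ?nc2.0 = "dim_col P"])
    (auto intro!: cong_four_block_mat eq_matI)

lemma transpose_anti_mat: "(anti_mat P Q)\<^sup>T = anti_mat (Q\<^sup>T) (P\<^sup>T)"
  by (auto intro!: eq_matI simp: anti_mat_def)

lemma smult_anti_mat: "c \<cdot>\<^sub>m anti_mat P Q = anti_mat (c \<cdot>\<^sub>m P) (c \<cdot>\<^sub>m Q)"
  by (auto intro!: eq_matI simp: anti_mat_def)

context signed_quiver
begin

text \<open>The Fitting projection of a self-adjoint endomorphism is a polynomial in it, hence self-adjoint.\<close>

lemma indecomposable_symrep_selfadjoint_cases:
  fixes V :: "('v + 'v, 'a + 'a, 'k :: {alg_closed_field, field_char_0}) qrep"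
  assumes VJ: "indecomposable_symrep S (V, J)" and f: "rep_hom SQ V V f"
    and sa: "\<And>i. i \<in> verts SQ \<Longrightarrow> (f (vstar S i))\<^sup>T * J i = J i * f i"
  obtains N where "\<And>i. i \<in> verts SQ \<Longrightarrow> f i ^\<^sub>m N = 0\<^sub>m (vdim V i) (vdim V i)"
  | u where "\<And>i. i \<in> verts SQ \<Longrightarrow> peval u (f i) * f i = 1\<^sub>m (vdim V i)"
proof -
  have sym: "is_symrep S (V, J)" using VJ by (auto simp: indecomposable_symrep_def)
  note s = symrepD[OF sym]
  have fc: "f i \<in> carrier_mat (vdim V i) (vdim V i)" if "i \<in> verts SQ" for i using rep_homD[OF f that] by simp
  obtain p u N where p: "\<And>i. i \<in> verts SQ \<Longrightarrow> peval p (f i) * peval p (f i) = peval p (f i)"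
    "\<And>i. i \<in> verts SQ \<Longrightarrow> peval p (f i) = peval u (f i) * f i"
    "\<And>i. i \<in> verts SQ \<Longrightarrow> f i ^\<^sub>m N = f i ^\<^sub>m N * peval p (f i)"
    using fitting_family[of "verts SQ" f "vdim V"] fc by auto
  have "idem_endo SQ V (\<lambda>i. peval p (f i))"
    using sym.rep_hom_peval[OF s(1) f] p(1) by (auto simp: idem_endo_def)
  moreover have "(peval p (f (vstar S i)))\<^sup>T * J i = J i * peval p (f i)" if i: "i \<in> verts SQ" for i
  proof -
    have fs: "f (vstar S i) \<in> carrier_mat (vdim V i) (vdim V i)" using fc[OF vstar_in[OF i]] s(2)[OF i] by simp
    show ?thesis unfolding peval_transpose[OF fs, symmetric]
      by (rule peval_intertwine[of _ "vdim V i" _ "vdim V i"]) (use fs fc[OF i] s(3)[OF i] sa[OF i] in auto)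
  qed
  ultimately have "(\<forall>i\<in>verts SQ. peval p (f i) = 0\<^sub>m (vdim V i) (vdim V i)) \<or>
      (\<forall>i\<in>verts SQ. peval p (f i) = 1\<^sub>m (vdim V i))"
    by (rule selfadjoint_idem_trivial[OF VJ])
  then show thesis
  proof
    assume "\<forall>i\<in>verts SQ. peval p (f i) = 0\<^sub>m (vdim V i) (vdim V i)"
    then have "f i ^\<^sub>m N = 0\<^sub>m (vdim V i) (vdim V i)" if i: "i \<in> verts SQ" for i
      using p(3)[OF i] fc[OF i] i by simp
    then show thesis using that(1) by blast
  next
    assume "\<forall>i\<in>verts SQ. peval p (f i) = 1\<^sub>m (vdim V i)"
    then show thesis using that(2)[of u] p(2) by auto
  qed
qed

text \<open>Let \<open>e\<close> be the projection onto a direct summand \<open>X\<close> of an indecomposable symmetric representation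
  and \<open>f = e\<^sup>\<dagger>\<close> its adjoint. The self-adjoint endomorphism \<open>e + f\<close> is nilpotent or invertible, and the
  former would give \<open>e = 0\<close>; so the whole representation is spanned by the images of \<open>e\<close> and \<open>f\<close>, which are
  isomorphic to \<open>X\<close> and its dual.\<close>

lemma indecomposable_symrep_dim_le:
  fixes V :: "('v + 'v, 'a + 'a, 'k :: {alg_closed_field, field_char_0}) qrep"
  assumes VJ: "indecomposable_symrep S (V, J)" and X: "is_rep SQ X" "nonzero_rep SQ X" and sm: "summand SQ X V"
    and v: "v \<in> verts SQ"
  shows "vdim V v \<le> vdim X v + vdim X (vstar S v)"
proof -
  have sym: "is_symrep S (V, J)" using VJ by (auto simp: indecomposable_symrep_def)
  note s = symrepD[OF sym]
  obtain K where K: "\<And>i. i \<in> verts SQ \<Longrightarrow> K i \<in> carrier_mat (vdim V i) (vdim V i)"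
    "\<And>i. i \<in> verts SQ \<Longrightarrow> K i * J i = 1\<^sub>m (vdim V i)" "\<And>i. i \<in> verts SQ \<Longrightarrow> J i * K i = 1\<^sub>m (vdim V i)"
    "\<And>i. i \<in> verts SQ \<Longrightarrow> K (vstar S i) = of_int (csign S i) \<cdot>\<^sub>m (K i)\<^sup>T"
    "\<And>a. a \<in> arcs SQ \<Longrightarrow> amap V a * K (tail SQ a) =
       K (head SQ a) * (of_int (dual_sign S a) \<cdot>\<^sub>m (amap V (astar S a))\<^sup>T)"
    by (rule symrep_inverse_form[OF sym], blast)
  obtain m p where m: "rep_hom SQ X V m" and p: "rep_hom SQ V X p"
    and pm: "\<And>i. i \<in> verts SQ \<Longrightarrow> p i * m i = 1\<^sub>m (vdim X i)" using sm by (auto simp: summand_def)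
  define e where "e i = m i * p i" for i
  have eh: "rep_hom SQ V V e" unfolding e_def by (rule sym.rep_hom_comp[OF s(1) X(1) s(1) p m])
  have ec: "e i \<in> carrier_mat (vdim V i) (vdim V i)" "e (vstar S i) \<in> carrier_mat (vdim V i) (vdim V i)"
    if "i \<in> verts SQ" for i
    using rep_homD(1)[OF eh that] rep_homD(1)[OF eh vstar_in[OF that]] s(2)[OF that] by auto
  have ee: "e i * e i = e i" if i: "i \<in> verts SQ" for i
  proof -
    note d = rep_homD(1)[OF m i] rep_homD(1)[OF p i]
    have "e i * e i = m i * ((p i * m i) * p i)" using d by (simp add: e_def mat_assoc)
    then show ?thesis unfolding pm[OF i] using d by (simp add: e_def)
  qed
  \<comment> \<open>The adjoint of \<open>e\<close> with respect to the form.\<close>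
  define f where "f i = K i * (e (vstar S i))\<^sup>T * J i" for i
  have fc: "f i \<in> carrier_mat (vdim V i) (vdim V i)" if "i \<in> verts SQ" for i
    using K(1)[OF that] ec[OF that] s(3)[OF that] by (simp add: f_def)
  have ff: "f i * f i = f i" if i: "i \<in> verts SQ" for i
  proof -
    have j: "vstar S i \<in> verts SQ" by (rule vstar_in[OF i])
    note d = K(1)[OF i] ec[OF i] s(3)[OF i]
    have "f i * f i = K i * ((e (vstar S i))\<^sup>T * ((J i * K i) * (e (vstar S i))\<^sup>T)) * J i"
      using d by (simp add: f_def mat_assoc)
    also have "\<dots> = K i * (e (vstar S i) * e (vstar S i))\<^sup>T * J i"
      unfolding K(3)[OF i] using d by (simp add: mat_transpose_mult)
    finally show ?thesis unfolding ee[OF j] by (simp add: f_def)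
  qed
  have fh: "rep_hom SQ V V f" unfolding rep_hom_def
  proof (intro conjI ballI)
    fix a assume a: "a \<in> arcs SQ"
    let ?h = "head SQ a" and ?t = "tail SQ a" and ?b = "astar S a" and ?s = "of_int (dual_sign S a) :: 'k"
    have h: "?h \<in> verts SQ" and t: "?t \<in> verts SQ" using a by auto
    have b: "?b \<in> arcs SQ" by (rule astar_in[OF a])
    have Vb: "amap V ?b \<in> carrier_mat (vdim V ?t) (vdim V ?h)"
      using is_repD(1)[OF s(1) b] ends_astar[OF a] s(2)[OF h] s(2)[OF t] by auto
    note d = K(1)[OF h] K(1)[OF t] ec[OF h] ec[OF t] s(3)[OF h] s(3)[OF t] Vb is_repD(1)[OF s(1) a]
    have cb: "e (vstar S ?t) * amap V ?b = amap V ?b * e (vstar S ?h)"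
      using rep_hom_comm[OF eh b] ends_astar[OF a] by simp
    have "f ?h * amap V a = K ?h * (e (vstar S ?h))\<^sup>T * (J ?h * amap V a)" using d by (simp add: f_def mat_assoc)
    also have "\<dots> = ?s \<cdot>\<^sub>m (K ?h * (((e (vstar S ?h))\<^sup>T * (amap V ?b)\<^sup>T) * J ?t))"
      unfolding s(5)[OF a] using d by (simp add: mat_assoc mat_smult_l mat_smult_r)
    also have "(e (vstar S ?h))\<^sup>T * (amap V ?b)\<^sup>T = (amap V ?b)\<^sup>T * (e (vstar S ?t))\<^sup>T"
      using arg_cong[OF cb, of transpose_mat] d by (simp add: mat_transpose_mult)
    also have "?s \<cdot>\<^sub>m (K ?h * ((amap V ?b)\<^sup>T * (e (vstar S ?t))\<^sup>T * J ?t)) =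
        (K ?h * (?s \<cdot>\<^sub>m (amap V ?b)\<^sup>T)) * ((e (vstar S ?t))\<^sup>T * J ?t)"
      using d by (simp add: mat_assoc mat_smult_l mat_smult_r)
    also have "\<dots> = amap V a * f ?t" unfolding K(5)[OF a, symmetric] using d by (simp add: f_def mat_assoc)
    finally show "f ?h * amap V a = amap V a * f ?t" .
  qed (use fc in auto)
  define h where "h i = e i + f i" for i
  have hh: "rep_hom SQ V V h" unfolding rep_hom_def
  proof (intro conjI ballI)
    fix a assume a: "a \<in> arcs SQ"
    have *: "head SQ a \<in> verts SQ" "tail SQ a \<in> verts SQ" using a by auto
    show "h (head SQ a) * amap V a = amap V a * h (tail SQ a)"
      using ec[OF *(1)] ec[OF *(2)] fc[OF *(1)] fc[OF *(2)] is_repD(1)[OF s(1) a]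
      by (simp add: h_def mat_add_distr mat_add_distl rep_hom_comm[OF eh a] rep_hom_comm[OF fh a])
  qed (use ec fc in \<open>auto simp: h_def\<close>)
  have sa: "(h (vstar S i))\<^sup>T * J i = J i * h i" if i: "i \<in> verts SQ" for i
  proof -
    let ?j = "vstar S i" and ?c = "of_int (csign S i) :: 'k"
    have cc: "?c * ?c = 1" by (simp add: csign_sq flip: of_int_mult)
    have j: "?j \<in> verts SQ" by (rule vstar_in[OF i])
    note d = K(1)[OF i] ec[OF i] s(3)[OF i] fc[OF i] fc[OF j, unfolded s(2)[OF i]]
    have "f ?j = (?c * ?c) \<cdot>\<^sub>m ((K i)\<^sup>T * (e i)\<^sup>T * (J i)\<^sup>T)"
      unfolding f_def vstar_vstar[OF i] K(4)[OF i] s(4)[OF i] using d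
      by (simp add: mat_smult_l mat_smult_r mat_smult_smult)
    then have "(f ?j)\<^sup>T = J i * (e i * K i)"
      unfolding cc using d by (simp add: mat_smult_one mat_transpose_mult mat_assoc)
    then have "(f ?j)\<^sup>T * J i = J i * (e i * (K i * J i))" using d by (simp add: mat_assoc)
    then have 1: "(f ?j)\<^sup>T * J i = J i * e i" unfolding K(2)[OF i] using d by simp
    have "J i * f i = (J i * K i) * ((e ?j)\<^sup>T * J i)" unfolding f_def using d by (simp add: mat_assoc)
    then have 2: "J i * f i = (e ?j)\<^sup>T * J i" unfolding K(3)[OF i] using d by simp
    show ?thesis unfolding h_def using d 1 2
      by (simp add: mat_transpose_add mat_add_distl mat_add_distr) (auto intro!: eq_matI)
  qed
  show ?thesis
  proof (rule indecomposable_symrep_selfadjoint_cases[OF VJ hh sa])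
    fix N assume N: "\<And>i. i \<in> verts SQ \<Longrightarrow> h i ^\<^sub>m N = 0\<^sub>m (vdim V i) (vdim V i)"
    obtain w where w: "w \<in> verts SQ" "vdim X w \<noteq> 0" using X(2) by (auto simp: nonzero_rep_def)
    have "e w = 0\<^sub>m (vdim V w) (vdim V w)"
      by (rule sum_idempotents_not_nilpotent[OF ec(1)[OF w(1)] fc[OF w(1)] ee[OF w(1)] ff[OF w(1)]])
        (use N[OF w(1)] in \<open>simp add: h_def\<close>)
    moreover have "p w * (e w * m w) = (p w * m w) * (p w * m w)"
      unfolding e_def using rep_homD(1)[OF m w(1)] rep_homD(1)[OF p w(1)] by (simp add: mat_assoc)
    ultimately have "1\<^sub>m (vdim X w) = (0\<^sub>m (vdim X w) (vdim X w) :: 'k mat)"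
      using pm[OF w(1)] rep_homD(1)[OF m w(1)] rep_homD(1)[OF p w(1)] by simp
    then show ?thesis using one_mat_eq_zero[of "vdim X w"] w(2) by blast
  next
    fix u assume u: "\<And>i. i \<in> verts SQ \<Longrightarrow> peval u (h i) * h i = 1\<^sub>m (vdim V i)"
    let ?j = "vstar S v" and ?u = "peval u (h v)"
    have j: "?j \<in> verts SQ" by (rule vstar_in[OF v])
    have hc: "h v \<in> carrier_mat (vdim V v) (vdim V v)" using rep_homD(1)[OF hh v] .
    have uc: "?u \<in> carrier_mat (vdim V v) (vdim V v)" using hc by auto
    note d = K(1)[OF v] s(3)[OF v] rep_homD(1)[OF m v] rep_homD(1)[OF p v] uc hc
      rep_homD(1)[OF m j, unfolded s(2)[OF v]] rep_homD(1)[OF p j, unfolded s(2)[OF v]] ec[OF v] fc[OF v]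
    \<comment> \<open>The identity \<open>1 = e u + f u\<close> factors through \<open>X\<close> at \<open>v\<close> plus the dual of \<open>X\<close> at \<open>v\<^sup>*\<close>.\<close>
    have "hcat (m v) (K v * (p ?j)\<^sup>T) * vcat (p v * ?u) ((m ?j)\<^sup>T * J v * ?u) =
        m v * (p v * ?u) + K v * (p ?j)\<^sup>T * ((m ?j)\<^sup>T * J v * ?u)"
      using d by (subst hcat_vcat) auto
    also have "m v * (p v * ?u) = e v * ?u" using d by (simp add: e_def mat_assoc)
    also have "K v * (p ?j)\<^sup>T * ((m ?j)\<^sup>T * J v * ?u) = f v * ?u"
      using d by (simp add: f_def e_def mat_assoc mat_transpose_mult)
    also have "e v * ?u + f v * ?u = h v * ?u" unfolding h_def using d by (simp add: mat_add_distr)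
    also have "\<dots> = 1\<^sub>m (vdim V v)" by (rule mat_mult_left_right_inverse[OF uc hc u[OF v]])
    finally have one: "hcat (m v) (K v * (p ?j)\<^sup>T) * vcat (p v * ?u) ((m ?j)\<^sup>T * J v * ?u) = 1\<^sub>m (vdim V v)" .
    show ?thesis
      by (rule right_inverse_dim_le[OF _ _ one]; intro carrier_matI) (use d in auto)
  qed
qed

text \<open>The hyperbolic form pairs a representation with its dual. The sign of its lower block is forced by
  the symmetry at the fixed vertices, and compatibility with the arrows then amounts to
  \<open>s\<^sub>\<phi> s\<^sub>\<phi>\<^sub>* = c\<^sub>h c\<^sub>t\<close> for the signs \<open>c\<close> of the head and the tail of \<open>\<phi>\<close>.\<close>

lemma hyperbolic_symrep:
  fixes X :: "('v + 'v, 'a + 'a, 'k :: field) qrep"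
  assumes X: "is_rep SQ X"
  obtains V J where "is_symrep S (V, J)" "summand SQ X V"
proof -
  let ?D = "dual_rep S X"
  let ?c = "\<lambda>i. of_int (csign S i) :: 'k"
  have cc: "?c i * ?c i = 1" for i by (simp add: csign_sq flip: of_int_mult)
  define J where "J i = anti_mat (1\<^sub>m (vdim X (vstar S i))) (?c i \<cdot>\<^sub>m 1\<^sub>m (vdim X i))" for i
  have D: "is_rep SQ ?D"
    unfolding is_rep_def
  proof
    fix a assume a: "a \<in> arcs SQ"
    show "amap ?D a \<in> carrier_mat (vdim ?D (head SQ a)) (vdim ?D (tail SQ a))"
      using is_repD[OF X astar_in[OF a]] ends_astar[OF a] by (auto simp: dual_rep_def)
  qed
  have vD: "vdim ?D i = vdim X (vstar S i)" for i by (simp add: dual_rep_def)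
  have "is_symrep S (rep_dsum X ?D, J)"
    unfolding is_symrep_iff
  proof (intro conjI ballI)
    show "is_rep SQ (rep_dsum X ?D)" by (rule sym.is_rep_dsum[OF X D])
    fix i assume i: "i \<in> verts SQ"
    let ?n = "vdim X i" and ?m = "vdim X (vstar S i)"
    show "J i \<in> carrier_mat (vdim (rep_dsum X ?D) (vstar S i)) (vdim (rep_dsum X ?D) i)"
      by (rule carrier_matI) (simp_all add: J_def vD vstar_vstar[OF i])
    show "invertible_mat (J i)"
    proof (rule invertible_matI(2))
      show "J i \<in> carrier_mat (?m + ?n) (?n + ?m)" by (rule carrier_matI) (simp_all add: J_def)
      show "anti_mat (?c i \<cdot>\<^sub>m 1\<^sub>m ?n) (1\<^sub>m ?m) \<in> carrier_mat (?n + ?m) (?m + ?n)" by (rule carrier_matI) simp_all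
      show "J i * anti_mat (?c i \<cdot>\<^sub>m 1\<^sub>m ?n) (1\<^sub>m ?m) = 1\<^sub>m (?m + ?n)"
        "anti_mat (?c i \<cdot>\<^sub>m 1\<^sub>m ?n) (1\<^sub>m ?m) * J i = 1\<^sub>m (?n + ?m)"
        by (simp_all add: J_def anti_mat_mult mat_smult_l mat_smult_smult cc mat_smult_one mat_dsum_one)
    qed
    show "J (vstar S i) = ?c i \<cdot>\<^sub>m (J i)\<^sup>T"
      by (simp add: J_def vstar_vstar[OF i] csign_vstar[OF i] transpose_anti_mat smult_anti_mat
          mat_transpose_smult mat_smult_smult cc mat_smult_one)
  next
    fix a assume a: "a \<in> arcs SQ"
    let ?h = "head SQ a" and ?t = "tail SQ a" and ?b = "astar S a"
    let ?s = "of_int (dual_sign S a) :: 'k" and ?s' = "of_int (dual_sign S (astar S a)) :: 'k"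
    have h: "?h \<in> verts SQ" and t: "?t \<in> verts SQ" using a by auto
    have b: "?b \<in> arcs SQ" by (rule astar_in[OF a])
    have ss: "?s * ?s' = ?c ?h * ?c ?t" using dual_sign_astar[OF a] by (simp flip: of_int_mult)
    have Xb: "amap X ?b \<in> carrier_mat (vdim X (vstar S ?t)) (vdim X (vstar S ?h))"
      using is_repD(1)[OF X b] ends_astar[OF a] by simp
    note d = Xb is_repD(1)[OF X a]
    have Da: "amap ?D a = ?s \<cdot>\<^sub>m (amap X ?b)\<^sup>T" by (simp add: dual_rep_def)
    have Db: "amap ?D ?b = ?s' \<cdot>\<^sub>m (amap X a)\<^sup>T" by (simp add: dual_rep_def astar_astar[OF a])
    have "J ?h * amap (rep_dsum X ?D) a = anti_mat (?s \<cdot>\<^sub>m (amap X ?b)\<^sup>T) (?c ?h \<cdot>\<^sub>m amap X a)"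
      unfolding rep_dsum_sel Da J_def using d by (subst anti_mat_dsum) (simp_all add: mat_smult_l)
    moreover have "(?s \<cdot>\<^sub>m (amap (rep_dsum X ?D) ?b)\<^sup>T) * J ?t =
        anti_mat (?s \<cdot>\<^sub>m (amap X ?b)\<^sup>T) ((?s * ?s' * ?c ?t) \<cdot>\<^sub>m amap X a)"
      unfolding rep_dsum_sel Db J_def transpose_mat_dsum smult_mat_dsum mat_transpose_smult using d
      by (subst dsum_anti_mat) (simp_all add: mat_smult_l mat_smult_r mat_smult_smult mult_ac)
    moreover have "?s * ?s' * ?c ?t = ?c ?h" unfolding ss using cc[of ?t] by (simp add: mult.assoc)
    ultimately show "J ?h * amap (rep_dsum X ?D) a = (?s \<cdot>\<^sub>m (amap (rep_dsum X ?D) ?b)\<^sup>T) * J ?t" by simp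
  qed
  then show thesis using that sym.summand_dsum(1)[OF X D] by blast
qed

text \<open>Split off symmetric summands until the one that contains \<open>X\<close> is indecomposable.\<close>

lemma summand_of_indecomposable_symrep:
  fixes X :: "('v + 'v, 'a + 'a, 'k :: field) qrep"
  assumes X: "indecomposable_rep SQ X" and Y: "is_symrep S Y" "summand SQ X (fst Y)"
  obtains Z where "indecomposable_symrep S Z" "summand SQ X (fst Z)"
proof -
  have rX: "is_rep SQ X" "nonzero_rep SQ X" using X by (auto simp: indecomposable_rep_def)
  have "\<exists>Z. indecomposable_symrep S Z \<and> summand SQ X (fst Z)" using Y
  proof (induction "total_dim SQ (fst Y)" arbitrary: Y rule: less_induct)
    case less
    show ?case
    proof (cases "indecomposable_symrep S Y")
      case False
      have rep: "is_rep SQ (fst U)" if "is_symrep S U" for U :: "('v, 'a, 'k) symrep"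
        using that symrepD(1)[of "fst U" "snd U"] by simp
      have "nonzero_rep SQ (fst Y)"
      proof (rule ccontr)
        assume "\<not> nonzero_rep SQ (fst Y)"
        then have "total_dim SQ (fst Y) = 0" by (simp add: sym.total_dim_0_iff)
        then have "total_dim SQ X = 0" using sym.summand_total_dim_le[OF less.prems(2)] by simp
        then show False using rX(2) by (simp add: sym.total_dim_0_iff)
      qed
      then obtain U U' where U: "is_symrep S U" "nonzero_rep SQ (fst U)" "is_symrep S U'" "nonzero_rep SQ (fst U')"
        "symrep_iso S Y (symrep_dsum U U')"
        using False less.prems(1) unfolding indecomposable_symrep_def by blast
      have D: "is_rep SQ (rep_dsum (fst U) (fst U'))" using sym.is_rep_dsum rep U by blast
      have "\<exists>g. rep_isomorphism SQ (fst Y) (fst (symrep_dsum U U')) g"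
        using U(5) by (auto simp: symrep_iso_def split: prod.splits)
      then have iso: "rep_iso SQ (fst Y) (rep_dsum (fst U) (fst U'))"
        unfolding is_symrep_dsum'(2) by (simp add: rep_iso_def)
      have tot: "total_dim SQ (fst Y) = total_dim SQ (fst U) + total_dim SQ (fst U')"
        using sym.rep_iso_total_dim[OF iso] by (simp add: total_dim_dsum)
      have pos: "total_dim SQ (fst U) > 0" "total_dim SQ (fst U') > 0"
        using U(2,4) by (metis sym.total_dim_0_iff gr0I)+
      have "summand SQ X (rep_dsum (fst U) (fst U'))"
        by (rule sym.summand_trans[OF rX(1) rep[OF less.prems(1)] D less.prems(2) sym.rep_iso_summand[OF iso]])
      then have "summand SQ X (fst U) \<or> summand SQ X (fst U')"
        by (rule sym.summand_of_dsum[OF X rep[OF U(1)] rep[OF U(3)]])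
      then show ?thesis using less.hyps[of U] less.hyps[of U'] U(1,3) tot pos by fastforce
    qed (use less.prems in blast)
  qed
  then show thesis using that by blast
qed

text \<open>Since the form is unique, the classes can be counted by the underlying representations.\<close>

lemma finite_signed_quiver_iff:
  "finite_signed_quiver TYPE('k :: {alg_closed_field, field_char_0}) S \<longleftrightarrow>
    (\<exists>F :: ('v, 'a, 'k) symrep set. finite F \<and> (\<forall>X\<in>F. indecomposable_symrep S X) \<and>
      (\<forall>X. indecomposable_symrep S X \<longrightarrow> (\<exists>Y\<in>F. rep_iso SQ (fst X) (fst Y))))"
proof -
  have rep: "is_rep SQ (fst X)" if "is_symrep S X" for X :: "('v, 'a, 'k) symrep"
    using that symrepD(1)[of "fst X" "snd X"] by simp
  have eq: "symrep_iso S X Y \<longleftrightarrow> rep_iso SQ (fst X) (fst Y)"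
    if "indecomposable_symrep S X" "indecomposable_symrep S Y" for X Y :: "('v, 'a, 'k) symrep"
    using that by (simp add: symrep_iso_iff' indecomposable_symrep_def)
  let ?A = "{X :: ('v, 'a, 'k) symrep. indecomposable_symrep S X}"
  have "finite (?A // {(X, Y). symrep_iso S X Y}) \<longleftrightarrow>
      (\<exists>F. finite F \<and> F \<subseteq> ?A \<and> (\<forall>X\<in>?A. \<exists>Y\<in>F. symrep_iso S X Y))"
  proof (rule finite_quotient_iff)
    show "symrep_iso S X X" if "X \<in> ?A" for X
      using that sym.rep_iso_refl[OF rep, of X] by (simp add: symrep_iso_iff' indecomposable_symrep_def)
    show "symrep_iso S Y X" if "symrep_iso S X Y" for X Y :: "('v, 'a, 'k) symrep"
      using that sym.rep_iso_sym[of "fst X" "fst Y"] by (simp add: symrep_iso_iff')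
    show "symrep_iso S X Z" if "symrep_iso S X Y" "symrep_iso S Y Z" for X Y Z :: "('v, 'a, 'k) symrep"
      using that sym.rep_iso_trans[of "fst X" "fst Y" "fst Z"] by (simp add: symrep_iso_iff')
  qed
  also have "\<dots> \<longleftrightarrow> (\<exists>F :: ('v, 'a, 'k) symrep set. finite F \<and> (\<forall>X\<in>F. indecomposable_symrep S X) \<and>
      (\<forall>X. indecomposable_symrep S X \<longrightarrow> (\<exists>Y\<in>F. rep_iso SQ (fst X) (fst Y))))"
  proof (rule ex_cong1)
    fix F :: "('v, 'a, 'k) symrep set"
    show "finite F \<and> F \<subseteq> ?A \<and> (\<forall>X\<in>?A. \<exists>Y\<in>F. symrep_iso S X Y) \<longleftrightarrow>
        finite F \<and> (\<forall>X\<in>F. indecomposable_symrep S X) \<and>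
        (\<forall>X. indecomposable_symrep S X \<longrightarrow> (\<exists>Y\<in>F. rep_iso SQ (fst X) (fst Y)))"
    proof (cases "F \<subseteq> ?A")
      case True
      then have "(\<exists>Y\<in>F. symrep_iso S X Y) \<longleftrightarrow> (\<exists>Y\<in>F. rep_iso SQ (fst X) (fst Y))"
        if "indecomposable_symrep S X" for X
        using eq[OF that] by (intro bex_cong) auto
      then show ?thesis using True by auto
    qed auto
  qed
  finally show ?thesis unfolding finite_signed_quiver_def .
qed

text \<open>Every indecomposable is a summand of its hyperbolic representation, hence of an indecomposable
  symmetric representation, and each of these has finitely many indecomposable summands.\<close>

lemma finite_quiver_if_finite_signed:
  assumes "finite_signed_quiver TYPE('k :: {alg_closed_field, field_char_0}) S"
  shows "finite_quiver TYPE('k) SQ"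
proof -
  obtain F :: "('v, 'a, 'k) symrep set" where F: "finite F" "\<And>X. X \<in> F \<Longrightarrow> indecomposable_symrep S X"
    "\<And>X. indecomposable_symrep S X \<Longrightarrow> \<exists>Y\<in>F. rep_iso SQ (fst X) (fst Y)"
    using assms unfolding finite_signed_quiver_iff by blast
  have rep: "is_rep SQ (fst X)" if "indecomposable_symrep S X" for X :: "('v, 'a, 'k) symrep"
    using that symrepD(1)[of "fst X" "snd X"] by (simp add: indecomposable_symrep_def)
  have "\<forall>Y\<in>F. \<exists>E. finite E \<and>
      (\<forall>X. indecomposable_rep SQ X \<longrightarrow> summand SQ X (fst Y) \<longrightarrow> (\<exists>Z\<in>E. rep_iso SQ X Z))"
    using sym.finitely_many_indecomposable_summands rep F(2) by blast
  from bchoice[OF this] obtain E where E: "\<forall>Y\<in>F. finite (E Y) \<and>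
      (\<forall>X. indecomposable_rep SQ X \<longrightarrow> summand SQ X (fst Y) \<longrightarrow> (\<exists>Z\<in>E Y. rep_iso SQ X Z))" ..
  show ?thesis
  proof (rule sym.finite_quiverI)
    show "finite (\<Union>Y\<in>F. E Y)" using F(1) E by blast
    fix X :: "('v + 'v, 'a + 'a, 'k) qrep" assume X: "indecomposable_rep SQ X"
    then have rX: "is_rep SQ X" by (auto simp: indecomposable_rep_def)
    obtain V J where VJ: "is_symrep S (V, J)" "summand SQ X V" by (rule hyperbolic_symrep[OF rX])
    obtain Z where Z: "indecomposable_symrep S Z" "summand SQ X (fst Z)"
      by (rule summand_of_indecomposable_symrep[OF X VJ(1)]) (use VJ(2) in auto)
    obtain Y where Y: "Y \<in> F" "rep_iso SQ (fst Z) (fst Y)" using F(3)[OF Z(1)] by blast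
    have "summand SQ X (fst Y)"
      by (rule sym.summand_trans[OF rX rep[OF Z(1)] rep[OF F(2)[OF Y(1)]] Z(2) sym.rep_iso_summand[OF Y(2)]])
    then show "\<exists>W\<in>\<Union>Y\<in>F. E Y. rep_iso SQ X W" using E X Y(1) by blast
  qed
qed

text \<open>The dimension bound leaves finitely many underlying representations, and each of them carries at
  most one form.\<close>

lemma finite_signed_if_finite_quiver:
  assumes fin: "finite_quiver TYPE('k :: {alg_closed_field, field_char_0}) SQ"
  shows "finite_signed_quiver TYPE('k) S"
proof -
  obtain F :: "('v + 'v, 'a + 'a, 'k) qrep set" where F: "finite F"
    "\<And>V. indecomposable_rep SQ V \<Longrightarrow> \<exists>W\<in>F. rep_iso SQ V W"
    using fin unfolding sym.finite_quiver_iff by blast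
  define M where "M = Max (insert 0 (total_dim SQ ` F))"
  define B where "B = card (verts SQ) * (2 * M)"
  obtain E :: "('v + 'v, 'a + 'a, 'k) qrep set" where E: "finite E"
    "\<And>V. is_rep SQ V \<Longrightarrow> total_dim SQ V \<le> B \<Longrightarrow> \<exists>W\<in>E. rep_iso SQ V W"
    using sym.finitely_many_of_bounded_dim[OF fin, of B] by blast
  have cls: "\<exists>W\<in>E. rep_iso SQ V W" if VJ: "indecomposable_symrep S (V, J)" for V J
  proof -
    have V: "is_rep SQ V" "nonzero_rep SQ V"
      using VJ symrepD(1)[of V J] by (auto simp: indecomposable_symrep_def)
    obtain X where X: "indecomposable_rep SQ X" "summand SQ X V" by (rule sym.indecomposable_summand_exists[OF V])
    then have rX: "is_rep SQ X" "nonzero_rep SQ X" by (auto simp: indecomposable_rep_def)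
    obtain W where W: "W \<in> F" "rep_iso SQ X W" using F(2)[OF X(1)] by blast
    have XM: "total_dim SQ X \<le> M"
      unfolding sym.rep_iso_total_dim[OF W(2)] M_def using F(1) W(1) by (intro Max_ge) auto
    have "vdim V v \<le> 2 * M" if v: "v \<in> verts SQ" for v
      using indecomposable_symrep_dim_le[OF VJ rX X(2) v] XM sym.vdim_le_total[OF v, of X]
        sym.vdim_le_total[OF vstar_in[OF v], of X] by linarith
    then have "total_dim SQ V \<le> B" unfolding total_dim_def B_def by (rule sum_bounded_above[of _ _ "2 * M", simplified])
    then show ?thesis using E(2)[OF V(1)] by blast
  qed
  \<comment> \<open>The forms are chosen on representatives of the underlying representations.\<close>
  define pick where "pick W = (SOME X :: ('v, 'a, 'k) symrep. indecomposable_symrep S X \<and> rep_iso SQ (fst X) W)" for W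
  define E' where "E' = {W \<in> E. \<exists>X. indecomposable_symrep S X \<and> rep_iso SQ (fst X) W}"
  have pick: "indecomposable_symrep S (pick W) \<and> rep_iso SQ (fst (pick W)) W" if "W \<in> E'" for W
    unfolding pick_def by (rule someI_ex) (use that in \<open>simp add: E'_def\<close>)
  show ?thesis unfolding finite_signed_quiver_iff
  proof (intro exI conjI ballI allI impI)
    show "finite (pick ` E')" using E(1) by (simp add: E'_def)
    show "indecomposable_symrep S X" if "X \<in> pick ` E'" for X using that pick by blast
    fix X :: "('v, 'a, 'k) symrep" assume X: "indecomposable_symrep S X"
    obtain W where W: "W \<in> E" "rep_iso SQ (fst X) W" using cls[of "fst X" "snd X"] X by auto
    then have "W \<in> E'" unfolding E'_def using X by blast
    then show "\<exists>Y\<in>pick ` E'. rep_iso SQ (fst X) (fst Y)"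
      using pick W(2) sym.rep_iso_trans sym.rep_iso_sym by blast
  qed
qed

end

section \<open>Quivers of infinite representation type\<close>

definition edges :: "('v, 'a) pre_digraph \<Rightarrow> 'a set \<Rightarrow> ('v \<times> 'v) set" where
  "edges Q F = (\<Union>a\<in>F. {(tail Q a, head Q a), (head Q a, tail Q a)})"

abbreviation linked :: "('v, 'a) pre_digraph \<Rightarrow> 'a set \<Rightarrow> 'v \<Rightarrow> 'v \<Rightarrow> bool" where
  "linked Q F x y \<equiv> (x, y) \<in> (edges Q F)\<^sup>*"

lemma linked_sym: "linked Q F x y \<Longrightarrow> linked Q F y x"
proof -
  have "sym (edges Q F)" by (auto simp: sym_def edges_def)
  then show "linked Q F x y \<Longrightarrow> linked Q F y x" by (meson sym_rtrancl symD)
qed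

lemma linked_mono: "linked Q F x y \<Longrightarrow> F \<subseteq> F' \<Longrightarrow> linked Q F' x y"
  by (rule subsetD[OF rtrancl_mono]) (auto simp: edges_def)

lemma linked_arc: "a \<in> F \<Longrightarrow> linked Q F (tail Q a) (head Q a)"
  by (rule r_into_rtrancl) (auto simp: edges_def)

lemma linked_invariant:
  assumes "linked Q F x y" "\<And>a. a \<in> F \<Longrightarrow> P (tail Q a) \<longleftrightarrow> P (head Q a)"
  shows "P x \<longleftrightarrow> P y"
  using assms(1) by (induction rule: rtrancl_induct) (auto simp: edges_def assms(2))

lemma connected_linked:
  assumes "Digraph_Component.connected Q" "x \<in> verts Q" "y \<in> verts Q"
  shows "linked Q (arcs Q) x y"
proof -
  have "x \<rightarrow>\<^sup>*\<^bsub>with_proj (mk_symmetric Q)\<^esub> y"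
    using assms by (auto simp: connected_def strongly_connected_def mk_symmetric_def)
  then have "(x, y) \<in> (arcs_ends (with_proj (mk_symmetric Q)))\<^sup>*"
    unfolding reachable_def by (rule rtrancl_on_rtranclI)
  moreover have "arcs_ends (with_proj (mk_symmetric Q)) = edges Q (arcs Q)"
    by (auto simp: arcs_ends_def arc_to_ends_def mk_symmetric_def edges_def image_iff)
  ultimately show ?thesis by simp
qed

lemma index_mult_1:
  fixes A :: "'k :: field mat"
  assumes "A \<in> carrier_mat n 1" "B \<in> carrier_mat 1 m" "i < n" "j < m"
  shows "(A * B) $$ (i, j) = A $$ (i, 0) * B $$ (0, j)"
  using assms by (auto simp: scalar_prod_def)

lemma index_mult_2:
  fixes A :: "'k :: field mat"
  assumes "A \<in> carrier_mat n 2" "B \<in> carrier_mat 2 m" "i < n" "j < m"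
  shows "(A * B) $$ (i, j) = A $$ (i, 0) * B $$ (0, j) + A $$ (i, 1) * B $$ (1, j)"
  using assms by (auto simp: scalar_prod_def numeral_2_eq_2)

lemma scalar_idem_mat:
  fixes m :: "'k :: field"
  assumes "(m \<cdot>\<^sub>m 1\<^sub>m n) * (m \<cdot>\<^sub>m 1\<^sub>m n) = m \<cdot>\<^sub>m (1\<^sub>m n :: 'k mat)" "n > 0"
  shows "m = 0 \<or> m = 1"
proof -
  have "(m * m) \<cdot>\<^sub>m 1\<^sub>m n = m \<cdot>\<^sub>m (1\<^sub>m n :: 'k mat)"
    using assms(1) by (simp add: mat_smult_l mat_smult_r mat_smult_smult)
  from arg_cong[OF this, of "\<lambda>M. M $$ (0,0)"] show ?thesis using assms(2) by simp
qed

context fin_digraph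
begin

text \<open>If every homomorphism between members of a one-parameter family is scalar, with the scalar
  killed by the difference of the parameters, then the family consists of pairwise nonisomorphic
  indecomposables.\<close>

lemma infinite_of_scalar_family:
  fixes V :: "'k :: {field, ring_char_0} \<Rightarrow> ('a, 'b, 'k) qrep"
  assumes rep: "\<And>c. is_rep G (V c)" and x: "x \<in> verts G" "\<And>c. vdim (V c) x > 0"
    and scal: "\<And>c d g. rep_hom G (V c) (V d) g \<Longrightarrow>
      \<exists>m. g x = m \<cdot>\<^sub>m 1\<^sub>m (vdim (V c) x) \<and> m * c = m * d \<and>
        (c = d \<longrightarrow> (\<forall>i\<in>verts G. g i = m \<cdot>\<^sub>m 1\<^sub>m (vdim (V c) i)))"
  shows "\<not> finite_quiver TYPE('k) G"
proof
  assume fin: "finite_quiver TYPE('k) G"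
  have "indecomposable_rep G (V c)" for c
  proof (rule indecomposable_if_trivial_idem[OF rep])
    show "nonzero_rep G (V c)" using x(1) x(2)[of c] by (auto simp: nonzero_rep_def)
    fix e assume e: "idem_endo G (V c) e"
    then obtain m where m: "\<forall>i\<in>verts G. e i = m \<cdot>\<^sub>m 1\<^sub>m (vdim (V c) i)"
      using scal[of c c e] by (auto simp: idem_endo_def)
    have "e x * e x = e x" using e x(1) by (simp add: idem_endo_def)
    then have "m = 0 \<or> m = 1" using m x scalar_idem_mat[of m "vdim (V c) x"] by auto
    then show "(\<forall>i\<in>verts G. e i = 0\<^sub>m (vdim (V c) i) (vdim (V c) i)) \<or> (\<forall>i\<in>verts G. e i = 1\<^sub>m (vdim (V c) i))"
      using m by (auto intro!: eq_matI)
  qed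
  then obtain c d where cd: "c \<noteq> d" "rep_iso G (V c) (V d)"
    using finite_quiver_pigeonhole[OF fin infinite_UNIV_char_0, of V] by blast
  obtain g where g: "rep_isomorphism G (V c) (V d) g" using cd(2) by (auto simp: rep_iso_def)
  obtain h where gh: "rep_hom G (V c) (V d) g" "h x * g x = 1\<^sub>m (vdim (V c) x)" "rep_hom G (V d) (V c) h"
    by (rule rep_isomorphismE[OF g]) (use x(1) in blast)
  obtain m where m: "g x = m \<cdot>\<^sub>m 1\<^sub>m (vdim (V c) x)" "m * c = m * d" using scal[OF gh(1)] by blast
  have "m \<noteq> 0"
  proof
    assume "m = 0"
    then have "g x = 0\<^sub>m (vdim (V c) x) (vdim (V c) x)" using m(1) by (auto intro!: eq_matI)
    moreover have "vdim (V d) x = vdim (V c) x" using rep_iso_vdim[OF cd(2) x(1)] by simp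
    ultimately have "1\<^sub>m (vdim (V c) x) = (0\<^sub>m (vdim (V c) x) (vdim (V c) x) :: 'k mat)"
      using gh(2) rep_homD(1)[OF gh(3) x(1)] by simp
    then show False using one_mat_eq_zero[of "vdim (V c) x"] x(2)[of c] by simp
  qed
  then show False using m(2) cd(1) by simp
qed

text \<open>On a cycle the monodromy of a one-dimensional local system is an invariant.\<close>

lemma arc_is_bridge:
  assumes fin: "finite_quiver TYPE('k :: {field, ring_char_0}) G" and a: "a \<in> arcs G"
    and conn: "\<And>x y. x \<in> verts G \<Longrightarrow> y \<in> verts G \<Longrightarrow> linked G (arcs G) x y"
  shows "\<not> linked G (arcs G - {a}) (tail G a) (head G a)"
proof
  assume cyc: "linked G (arcs G - {a}) (tail G a) (head G a)"
  define V :: "'k \<Rightarrow> ('a, 'b, 'k) qrep"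
    where "V c = \<lparr>vdim = \<lambda>_. 1, amap = \<lambda>b. if b = a then c \<cdot>\<^sub>m 1\<^sub>m 1 else 1\<^sub>m 1\<rparr>" for c
  have "\<not> finite_quiver TYPE('k) G"
  proof (rule infinite_of_scalar_family[of V "tail G a"])
    show "is_rep G (V c)" for c by (auto simp: is_rep_def V_def)
    show "tail G a \<in> verts G" using a by simp
    show "vdim (V c) (tail G a) > 0" for c by (simp add: V_def)
    fix c d g assume g: "rep_hom G (V c) (V d) g"
    have g1: "g i \<in> carrier_mat 1 1" if "i \<in> verts G" for i using rep_homD(1)[OF g that] by (simp add: V_def)
    have step: "g (head G b) = g (tail G b)" if "b \<in> arcs G - {a}" for b
    proof -
      have "b \<in> arcs G" "b \<noteq> a" using that by auto
      then show ?thesis using rep_hom_comm[OF g, of b] g1[of "head G b"] g1[of "tail G b"] by (simp add: V_def)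
    qed
    have ends: "g (tail G a) = g (head G a)"
      using linked_invariant[OF cyc, of "\<lambda>i. g i = g (tail G a)"] step by simp
    define m where "m = g (tail G a) $$ (0,0)"
    have gt: "g (tail G a) = m \<cdot>\<^sub>m 1\<^sub>m 1" using g1[of "tail G a"] a by (auto intro!: eq_matI simp: m_def)
    have "g (head G a) * (c \<cdot>\<^sub>m 1\<^sub>m 1) = (d \<cdot>\<^sub>m 1\<^sub>m 1) * g (tail G a)"
      using rep_hom_comm[OF g a] by (simp add: V_def)
    then have "(m * c) \<cdot>\<^sub>m 1\<^sub>m 1 = (m * d) \<cdot>\<^sub>m (1\<^sub>m 1 :: 'k mat)"
      unfolding ends[symmetric] gt by (simp add: mat_smult_l mat_smult_r mat_smult_smult mult.commute)
    from arg_cong[OF this, of "\<lambda>M. M $$ (0,0)"] have mcd: "m * c = m * d" by simp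
    have all: "g i = m \<cdot>\<^sub>m 1\<^sub>m 1" if i: "i \<in> verts G" for i
    proof -
      have "g (tail G b) = g (tail G a) \<longleftrightarrow> g (head G b) = g (tail G a)" if "b \<in> arcs G" for b
        using step[of b] ends that by (cases "b = a") auto
      then show ?thesis
        using linked_invariant[OF conn[OF _ i], of "tail G a" "\<lambda>j. g j = g (tail G a)"] a gt by simp
    qed
    show "\<exists>m. g (tail G a) = m \<cdot>\<^sub>m 1\<^sub>m (vdim (V c) (tail G a)) \<and> m * c = m * d \<and>
        (c = d \<longrightarrow> (\<forall>i\<in>verts G. g i = m \<cdot>\<^sub>m 1\<^sub>m (vdim (V c) i)))"
      using gt mcd all by (intro exI[of _ m]) (simp add: V_def)
  qed
  then show False using fin by blast
qed

text \<open>Four arcs leaving a connected set \<open>C\<close> of vertices give a family: put the plane on \<open>C\<close>, a line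
  on every other vertex, and let the four arcs mark the lines spanned by
  \<open>(1,0), (0,1), (1,1), (1,c)\<close> in the plane. The cross ratio \<open>c\<close> is an invariant.\<close>

lemma boundary_arcs_le_3:
  assumes fin: "finite_quiver TYPE('k :: {field, ring_char_0}) G"
    and conn: "\<And>x y. x \<in> verts G \<Longrightarrow> y \<in> verts G \<Longrightarrow> linked G (arcs G) x y"
    and C: "C \<subseteq> verts G" "\<And>x y. x \<in> C \<Longrightarrow> y \<in> C \<Longrightarrow> linked G {a \<in> arcs G. tail G a \<in> C \<and> head G a \<in> C} x y"
  shows "card {a \<in> arcs G. (tail G a \<in> C) \<noteq> (head G a \<in> C)} \<le> 3"
proof (rule ccontr)
  let ?B = "{a \<in> arcs G. (tail G a \<in> C) \<noteq> (head G a \<in> C)}"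
  assume "\<not> card ?B \<le> 3"
  then have "4 \<le> card ?B" by simp
  then obtain F where F: "F \<subseteq> ?B" "card F = 4" by (meson obtain_subset_with_card_n)
  then obtain f where "bij_betw f {0..<4::nat} F"
    using ex_bij_betw_nat_finite[of F] by (metis card.infinite zero_neq_numeral)
  then have f_inj: "inj_on f {0..<4}" and f_img: "f ` {0..<4} = F" by (auto simp: bij_betw_def)
  define f0 f1 f2 f3 where "f0 = f 0" and "f1 = f 1" and "f2 = f 2" and "f3 = f 3"
  have fB: "f0 \<in> ?B" "f1 \<in> ?B" "f2 \<in> ?B" "f3 \<in> ?B"
  proof -
    have "f i \<in> ?B" if "i \<in> {0..<4}" for i using imageI[OF that, of f] F(1) unfolding f_img by blast
    then show "f0 \<in> ?B" "f1 \<in> ?B" "f2 \<in> ?B" "f3 \<in> ?B" unfolding f0_def f1_def f2_def f3_def by simp_all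
  qed
  have dist: "f1 \<noteq> f0" "f2 \<noteq> f0" "f2 \<noteq> f1" "f3 \<noteq> f0" "f3 \<noteq> f1" "f3 \<noteq> f2"
    unfolding f0_def f1_def f2_def f3_def by (simp_all add: inj_on_eq_iff[OF f_inj])
  \<comment> \<open>The arc \<open>b\<close> marks the line of \<open>(P b, L c b)\<close>: an arc into \<open>C\<close> by the inclusion of the line, an arc out
    of \<open>C\<close> by a functional with this kernel. Arcs other than the four mark the line of \<open>(1, 0)\<close>.\<close>
  define P where "P b = (if b = f1 then 0 else 1 :: 'k)" for b
  define L where "L c b = (if b = f1 \<or> b = f2 then 1 else if b = f3 then c else 0 :: 'k)" for c b
  define V :: "'k \<Rightarrow> ('a, 'b, 'k) qrep" where "V c =
    \<lparr>vdim = \<lambda>x. if x \<in> C then 2 else 1,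
     amap = \<lambda>b. if tail G b \<in> C \<and> head G b \<in> C then 1\<^sub>m 2
       else if head G b \<in> C then mat 2 1 (\<lambda>(i, j). if i = 0 then P b else L c b)
       else if tail G b \<in> C then mat 1 2 (\<lambda>(i, j). if j = 0 then L c b else - P b)
       else 1\<^sub>m 1\<rparr>" for c
  obtain x where x: "x \<in> C" using fB(1) by blast
  have PL: "P b \<noteq> 0 \<or> L c b \<noteq> 0" for b c by (simp add: P_def L_def)
  have "\<not> finite_quiver TYPE('k) G"
  proof (rule infinite_of_scalar_family[of V x])
    show "is_rep G (V c)" for c by (auto simp: is_rep_def V_def)
    show "x \<in> verts G" using x C(1) by blast
    show "vdim (V c) x > 0" for c by (simp add: V_def)
    fix c d g assume g: "rep_hom G (V c) (V d) g"
    have g2: "g i \<in> carrier_mat 2 2" if "i \<in> C" for i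
      using rep_homD(1)[OF g, of i] that C(1) by (auto simp: V_def)
    have g1: "g i \<in> carrier_mat 1 1" if "i \<in> verts G" "i \<notin> C" for i
      using rep_homD(1)[OF g, of i] that by (simp add: V_def)
    have inC: "g y = g x" if y: "y \<in> C" for y
    proof -
      have step: "g (head G b) = g (tail G b)" if "b \<in> {a \<in> arcs G. tail G a \<in> C \<and> head G a \<in> C}" for b
        using rep_hom_comm[OF g, of b] g2[of "head G b"] g2[of "tail G b"] that by (simp add: V_def)
      show ?thesis using linked_invariant[OF C(2)[OF x y], of "\<lambda>j. g j = g x"] step by simp
    qed
    define m where "m i j = g x $$ (i, j)" for i j
    have M: "g x \<in> carrier_mat 2 2" using g2[OF x] .
    have into: "m 0 0 * P b + m 0 1 * L c b = P b * g (tail G b) $$ (0,0)"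
      "m 1 0 * P b + m 1 1 * L c b = L d b * g (tail G b) $$ (0,0)"
      if b: "b \<in> arcs G" "head G b \<in> C" "tail G b \<notin> C" for b
    proof -
      let ?l = "mat 2 1 (\<lambda>(i, j). if i = 0 then P b else L c b)" and ?l' = "mat 2 1 (\<lambda>(i, j). if i = 0 then P b else L d b)"
      have t: "g (tail G b) \<in> carrier_mat 1 1" using g1 b by simp
      have "g x * ?l = ?l' * g (tail G b)"
        using rep_hom_comm[OF g b(1)] b(2,3) inC[OF b(2)] by (simp add: V_def)
      then have "(g x * ?l) $$ (i, 0) = (?l' * g (tail G b)) $$ (i, 0)" for i by simp
      from this[of 0] this[of 1] show "m 0 0 * P b + m 0 1 * L c b = P b * g (tail G b) $$ (0,0)"
        "m 1 0 * P b + m 1 1 * L c b = L d b * g (tail G b) $$ (0,0)"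
        using index_mult_2[OF M, of ?l 1 0 0] index_mult_2[OF M, of ?l 1 1 0]
          index_mult_1[OF _ t, of ?l' 2 0 0] index_mult_1[OF _ t, of ?l' 2 1 0] by (simp_all add: m_def)
    qed
    have out: "g (head G b) $$ (0,0) * L c b = L d b * m 0 0 - P b * m 1 0"
      "- (g (head G b) $$ (0,0) * P b) = L d b * m 0 1 - P b * m 1 1"
      if b: "b \<in> arcs G" "head G b \<notin> C" "tail G b \<in> C" for b
    proof -
      let ?l = "mat 1 2 (\<lambda>(i, j). if j = 0 then L c b else - P b)" and ?l' = "mat 1 2 (\<lambda>(i, j). if j = 0 then L d b else - P b)"
      have t: "g (head G b) \<in> carrier_mat 1 1" using g1 b by simp
      have "g (head G b) * ?l = ?l' * g x"
        using rep_hom_comm[OF g b(1)] b(2,3) inC[OF b(3)] by (simp add: V_def)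
      then have "(g (head G b) * ?l) $$ (0, i) = (?l' * g x) $$ (0, i)" for i by simp
      from this[of 0] this[of 1] show "g (head G b) $$ (0,0) * L c b = L d b * m 0 0 - P b * m 1 0"
        "- (g (head G b) $$ (0,0) * P b) = L d b * m 0 1 - P b * m 1 1"
        using index_mult_2[OF _ M, of ?l' 1 0 0] index_mult_2[OF _ M, of ?l' 1 0 1]
          index_mult_1[OF t, of ?l 2 0 0] index_mult_1[OF t, of ?l 2 0 1] by (simp_all add: m_def)
    qed
    \<comment> \<open>The matrix \<open>m\<close> maps each marked line of \<open>V c\<close> into the corresponding marked line of \<open>V d\<close>.\<close>
    have line: "(m 0 0 * P b + m 0 1 * L c b) * L d b = (m 1 0 * P b + m 1 1 * L c b) * P b" if "b \<in> ?B" for b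
    proof (cases "head G b \<in> C")
      case True
      then show ?thesis using into[of b] that by simp
    next
      case False
      have b': "b \<in> arcs G" and b'': "tail G b \<in> C" using that False by auto
      have "P b * (L d b * m 0 0 - P b * m 1 0) + L c b * (L d b * m 0 1 - P b * m 1 1) = 0"
        unfolding out(1)[OF b' False b'', symmetric] out(2)[OF b' False b'', symmetric] by simp
      then show ?thesis by (simp add: algebra_simps)
    qed
    have m10: "m 1 0 = 0" using line[OF fB(1)] dist by (simp add: P_def L_def)
    have m01: "m 0 1 = 0" using line[OF fB(2)] dist by (simp add: P_def L_def)
    have m11: "m 1 1 = m 0 0" using line[OF fB(3)] dist m10 m01 by (simp add: P_def L_def)
    have mcd: "m 0 0 * c = m 0 0 * d" using line[OF fB(4)] dist m10 m01 m11 by (auto simp: P_def L_def)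
    have gx: "g x = m 0 0 \<cdot>\<^sub>m 1\<^sub>m 2"
    proof (rule eq_matI)
      fix i j assume "i < dim_row (m 0 0 \<cdot>\<^sub>m 1\<^sub>m 2 :: 'k mat)" "j < dim_col (m 0 0 \<cdot>\<^sub>m 1\<^sub>m 2 :: 'k mat)"
      then have "i = 0 \<or> i = 1" "j = 0 \<or> j = 1" "i < 2" "j < 2" by auto
      then show "g x $$ (i, j) = (m 0 0 \<cdot>\<^sub>m 1\<^sub>m 2) $$ (i, j)"
        using m10 m01 m11 by (auto simp: m_def)
    qed (use M in auto)
    have all: "g i = m 0 0 \<cdot>\<^sub>m 1\<^sub>m (vdim (V c) i)" if cd: "c = d" and i: "i \<in> verts G" for i
    proof -
      let ?R = "\<lambda>j. g j = m 0 0 \<cdot>\<^sub>m 1\<^sub>m (vdim (V c) j)"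
      have RC: "?R y" if "y \<in> C" for y using inC[OF that] gx that by (simp add: V_def)
      have one: "g y = m 0 0 \<cdot>\<^sub>m 1\<^sub>m 1" if "y \<in> verts G" "y \<notin> C" "g y $$ (0,0) = m 0 0" for y
        using g1[OF that(1,2)] that(3) by (auto intro!: eq_matI)
      have inv: "?R (tail G b) \<longleftrightarrow> ?R (head G b)" if b: "b \<in> arcs G" for b
      proof -
        consider "tail G b \<in> C" "head G b \<in> C" | "tail G b \<in> C" "head G b \<notin> C"
          | "tail G b \<notin> C" "head G b \<in> C" | "tail G b \<notin> C" "head G b \<notin> C" by blast
        then show ?thesis
        proof cases
          case 1 then show ?thesis using RC by blast
        next
          case 2
          have "g (head G b) $$ (0,0) = m 0 0"
            using out[OF b 2(2,1)] PL[of b c] m01 m10 m11 cd by auto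
          then have "g (head G b) = m 0 0 \<cdot>\<^sub>m 1\<^sub>m 1" using one 2 b by simp
          then show ?thesis using RC[OF 2(1)] 2(2) by (simp add: V_def)
        next
          case 3
          have "g (tail G b) $$ (0,0) = m 0 0"
            using into[OF b 3(2,1)] PL[of b c] m01 m10 m11 cd by auto
          then have "g (tail G b) = m 0 0 \<cdot>\<^sub>m 1\<^sub>m 1" using one 3 b by simp
          then show ?thesis using RC[OF 3(2)] 3(1) by (simp add: V_def)
        next
          case 4
          then have "g (head G b) = g (tail G b)"
            using rep_hom_comm[OF g b] g1[of "head G b"] g1[of "tail G b"] b by (simp add: V_def)
          then show ?thesis using 4 by (simp add: V_def)
        qed
      qed
      show ?thesis
        using linked_invariant[OF conn[OF _ i], of x ?R] inv RC[OF x] x C(1) by blast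
    qed
    show "\<exists>m. g x = m \<cdot>\<^sub>m 1\<^sub>m (vdim (V c) x) \<and> m * c = m * d \<and>
        (c = d \<longrightarrow> (\<forall>i\<in>verts G. g i = m \<cdot>\<^sub>m 1\<^sub>m (vdim (V c) i)))"
      using gx mcd all x by (intro exI[of _ "m 0 0"]) (simp add: V_def)
  qed
  then show False using fin by blast
qed

end

section \<open>Chains have finite representation type\<close>

text \<open>The data of an idempotent \<open>v \<phi>\<^sup>T\<close> of rank at most one.\<close>

definition dual_pair :: "nat \<Rightarrow> 'k :: field vec \<Rightarrow> 'k vec \<Rightarrow> bool" where
  "dual_pair n v \<phi> \<longleftrightarrow> v \<in> carrier_vec n \<and> \<phi> \<in> carrier_vec n \<and> (\<phi> \<bullet> v = 1 \<or> v = 0\<^sub>v n \<and> \<phi> = 0\<^sub>v n)"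

text \<open>For a subspace \<open>U\<close>, this says that \<open>v \<phi>\<^sup>T\<close> maps \<open>U\<close> into itself.\<close>

definition preserves :: "'k :: field vec \<Rightarrow> 'k vec \<Rightarrow> 'k vec set \<Rightarrow> bool" where
  "preserves v \<phi> U \<longleftrightarrow> v \<in> U \<or> (\<forall>u\<in>U. \<phi> \<bullet> u = 0)"

text \<open>Either alternative makes \<open>f\<close> commute with the idempotents \<open>v \<phi>\<^sup>T\<close> on its source and \<open>w \<psi>\<^sup>T\<close> on its
  target: both composites are then \<open>w \<phi>\<^sup>T\<close>, or both are zero.\<close>

definition commutes_with :: "'k :: field mat \<Rightarrow> 'k vec \<Rightarrow> 'k vec \<Rightarrow> 'k vec \<Rightarrow> 'k vec \<Rightarrow> bool" where
  "commutes_with f v \<phi> w \<psi> \<longleftrightarrow> f *\<^sub>v v = w \<and> f\<^sup>T *\<^sub>v \<psi> = \<phi> \<or>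
     f *\<^sub>v v = 0\<^sub>v (dim_row f) \<and> f\<^sup>T *\<^sub>v \<psi> = 0\<^sub>v (dim_col f)"

definition flag :: "nat \<Rightarrow> 'k :: field vec set set \<Rightarrow> bool" where
  "flag n \<F> \<longleftrightarrow> finite \<F> \<and> (\<forall>U\<in>\<F>. subsp n U) \<and> (\<forall>U\<in>\<F>. \<forall>U'\<in>\<F>. U \<subseteq> U' \<or> U' \<subseteq> U)"

lemma subspD:
  assumes "subsp n U"
  shows "u \<in> U \<Longrightarrow> u \<in> carrier_vec n" "0\<^sub>v n \<in> U" "u \<in> U \<Longrightarrow> v \<in> U \<Longrightarrow> u + v \<in> U" "u \<in> U \<Longrightarrow> c \<cdot>\<^sub>v u \<in> U"
    "u \<in> U \<Longrightarrow> v \<in> U \<Longrightarrow> u - v \<in> U"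
proof -
  show 1: "u \<in> U \<Longrightarrow> u \<in> carrier_vec n" for u using assms by (auto simp: subsp_def)
  show "0\<^sub>v n \<in> U" "u \<in> U \<Longrightarrow> v \<in> U \<Longrightarrow> u + v \<in> U" "u \<in> U \<Longrightarrow> c \<cdot>\<^sub>v u \<in> U"
    using assms by (auto simp: subsp_def)
  assume u: "u \<in> U" and v: "v \<in> U"
  have "u - v = u + (- 1) \<cdot>\<^sub>v v" using 1[OF u] 1[OF v] by (auto intro!: eq_vecI)
  moreover have "u + (- 1) \<cdot>\<^sub>v v \<in> U" using u v assms by (auto simp: subsp_def)
  ultimately show "u - v \<in> U" by simp
qed

lemma subsp_zero: "subsp n {0\<^sub>v n}"
  by (auto simp: subsp_def)

lemma subsp_carrier: "subsp n (carrier_vec n)"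
  by (auto simp: subsp_def)

lemma subsp_preimage:
  fixes f :: "'k :: field mat"
  assumes f: "f \<in> carrier_mat d n" and U: "subsp d U"
  shows "subsp n {x \<in> carrier_vec n. f *\<^sub>v x \<in> U}"
proof -
  have "f *\<^sub>v 0\<^sub>v n = 0\<^sub>v d" using f by (auto intro!: eq_vecI)
  moreover have "f *\<^sub>v (x + y) = f *\<^sub>v x + f *\<^sub>v y" if "x \<in> carrier_vec n" "y \<in> carrier_vec n" for x y
    using mult_add_distrib_mat_vec[OF f that] .
  moreover have "f *\<^sub>v (c \<cdot>\<^sub>v x) = c \<cdot>\<^sub>v (f *\<^sub>v x)" if "x \<in> carrier_vec n" for x c
    using mult_mat_vec[OF f that] .
  ultimately show ?thesis using subspD[OF U] by (auto simp: subsp_def)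
qed

lemma subsp_image:
  fixes f :: "'k :: field mat"
  assumes f: "f \<in> carrier_mat d n" and U: "subsp n U"
  shows "subsp d ((\<lambda>x. f *\<^sub>v x) ` U)"
  unfolding subsp_def
proof (intro conjI ballI allI)
  note s = subspD[OF U]
  show "(\<lambda>x. f *\<^sub>v x) ` U \<subseteq> carrier_vec d" using f s(1) by auto
  have "f *\<^sub>v 0\<^sub>v n = 0\<^sub>v d" using f by (auto intro!: eq_vecI)
  then show "0\<^sub>v d \<in> (\<lambda>x. f *\<^sub>v x) ` U" using s(2) by (metis image_eqI)
  fix a b assume "a \<in> (\<lambda>x. f *\<^sub>v x) ` U" "b \<in> (\<lambda>x. f *\<^sub>v x) ` U"
  then obtain x y where xy: "x \<in> U" "y \<in> U" "a = f *\<^sub>v x" "b = f *\<^sub>v y" by blast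
  have "a + b = f *\<^sub>v (x + y)" using xy mult_add_distrib_mat_vec[OF f s(1)[OF xy(1)] s(1)[OF xy(2)]] by simp
  then show "a + b \<in> (\<lambda>x. f *\<^sub>v x) ` U" using s(3)[OF xy(1,2)] by blast
next
  note s = subspD[OF U]
  fix c a assume "a \<in> (\<lambda>x. f *\<^sub>v x) ` U"
  then obtain x where x: "x \<in> U" "a = f *\<^sub>v x" by blast
  have "c \<cdot>\<^sub>v a = f *\<^sub>v (c \<cdot>\<^sub>v x)" using x mult_mat_vec[OF f s(1)[OF x(1)]] by simp
  then show "c \<cdot>\<^sub>v a \<in> (\<lambda>x. f *\<^sub>v x) ` U" using s(4)[OF x(1)] by blast
qed

lemma flag_insert_zero: "flag n \<F> \<Longrightarrow> flag n (insert {0\<^sub>v n} \<F>)"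
  unfolding flag_def using subsp_zero subspD(2) by (auto simp: Ball_def)

lemma flag_insert_carrier: "flag n \<F> \<Longrightarrow> flag n (insert (carrier_vec n) \<F>)"
  unfolding flag_def using subsp_carrier by (auto simp: subsp_def Ball_def)

lemma flag_preimage:
  fixes f :: "'k :: field mat"
  assumes f: "f \<in> carrier_mat d n" and F: "flag d \<F>"
  shows "flag n ((\<lambda>U. {x \<in> carrier_vec n. f *\<^sub>v x \<in> U}) ` \<F>)"
  unfolding flag_def
proof (intro conjI ballI)
  fix A assume "A \<in> (\<lambda>U. {x \<in> carrier_vec n. f *\<^sub>v x \<in> U}) ` \<F>"
  then obtain U where U: "U \<in> \<F>" "A = {x \<in> carrier_vec n. f *\<^sub>v x \<in> U}" by blast
  then show "subsp n A" using subsp_preimage[OF f] F by (auto simp: flag_def)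
  fix B assume "B \<in> (\<lambda>U. {x \<in> carrier_vec n. f *\<^sub>v x \<in> U}) ` \<F>"
  then obtain U' where U': "U' \<in> \<F>" "B = {x \<in> carrier_vec n. f *\<^sub>v x \<in> U'}" by blast
  have "U \<subseteq> U' \<or> U' \<subseteq> U" using F U(1) U'(1) by (auto simp: flag_def)
  then show "A \<subseteq> B \<or> B \<subseteq> A" unfolding U(2) U'(2) by blast
qed (use F in \<open>simp add: flag_def\<close>)

lemma flag_image:
  fixes f :: "'k :: field mat"
  assumes f: "f \<in> carrier_mat d n" and F: "flag n \<F>"
  shows "flag d ((\<lambda>U. (\<lambda>x. f *\<^sub>v x) ` U) ` \<F>)"
  unfolding flag_def
proof (intro conjI ballI)
  fix A assume "A \<in> (\<lambda>U. (\<lambda>x. f *\<^sub>v x) ` U) ` \<F>"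
  then obtain U where U: "U \<in> \<F>" "A = (\<lambda>x. f *\<^sub>v x) ` U" by blast
  then show "subsp d A" using subsp_image[OF f] F by (auto simp: flag_def)
  fix B assume "B \<in> (\<lambda>U. (\<lambda>x. f *\<^sub>v x) ` U) ` \<F>"
  then obtain U' where U': "U' \<in> \<F>" "B = (\<lambda>x. f *\<^sub>v x) ` U'" by blast
  have "U \<subseteq> U' \<or> U' \<subseteq> U" using F U(1) U'(1) by (auto simp: flag_def)
  then show "A \<subseteq> B \<or> B \<subseteq> A" unfolding U(2) U'(2) by blast
qed (use F in \<open>simp add: flag_def\<close>)

lemma flag_greatest:
  assumes "flag n \<F>" "A \<subseteq> \<F>" "A \<noteq> {}"
  obtains M where "M \<in> A" "\<And>U. U \<in> A \<Longrightarrow> U \<subseteq> M"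
proof -
  have "finite A" using assms by (auto simp: flag_def intro: finite_subset)
  then obtain M where M: "M \<in> A" "\<forall>U\<in>A. M \<subseteq> U \<longrightarrow> M = U"
    using finite_has_maximal[of A] assms(3) by blast
  have "U \<subseteq> M" if U: "U \<in> A" for U
  proof -
    have "U \<in> \<F>" "M \<in> \<F>" using assms(2) M(1) U by auto
    then have "U \<subseteq> M \<or> M \<subseteq> U" using assms(1) unfolding flag_def by simp
    then show ?thesis using M(2) U by auto
  qed
  with M(1) show thesis by (rule that)
qed

lemma flag_least:
  assumes "flag n \<F>" "A \<subseteq> \<F>" "A \<noteq> {}"
  obtains M where "M \<in> A" "\<And>U. U \<in> A \<Longrightarrow> M \<subseteq> U"
proof -
  have "finite A" using assms by (auto simp: flag_def intro: finite_subset)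
  then obtain M where M: "M \<in> A" "\<forall>U\<in>A. U \<subseteq> M \<longrightarrow> M = U"
    using finite_has_minimal[of A] assms(3) by blast
  have "M \<subseteq> U" if U: "U \<in> A" for U
  proof -
    have "U \<in> \<F>" "M \<in> \<F>" using assms(2) M(1) U by auto
    then have "U \<subseteq> M \<or> M \<subseteq> U" using assms(1) unfolding flag_def by simp
    then show ?thesis using M(2) U by auto
  qed
  with M(1) show thesis by (rule that)
qed

lemma zero_pair:
  assumes "f \<in> carrier_mat d n"
  shows "(f :: 'k :: field mat) *\<^sub>v 0\<^sub>v n = 0\<^sub>v d" "f\<^sup>T *\<^sub>v 0\<^sub>v d = 0\<^sub>v n"
  using assms by (auto intro!: eq_vecI)

text \<open>A rank one idempotent on the source of \<open>f\<close> that preserves the preimage of a flag continues to one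
  on the target that preserves the flag. If \<open>f v \<noteq> 0\<close>, the functional \<open>\<phi>\<close> has to be extended along
  \<open>f\<close> so as to vanish on the largest member of the flag that does not contain \<open>f v\<close>.\<close>

lemma extend_forward:
  fixes f :: "'k :: field mat"
  assumes f: "f \<in> carrier_mat d n" and F: "flag d \<F>" and vp: "dual_pair n v \<phi>"
    and pres: "\<And>U. U \<in> insert {0\<^sub>v d} \<F> \<Longrightarrow> preserves v \<phi> {x \<in> carrier_vec n. f *\<^sub>v x \<in> U}"
  obtains w \<psi> where "dual_pair d w \<psi>" "commutes_with f v \<phi> w \<psi>" "\<And>U. U \<in> \<F> \<Longrightarrow> preserves w \<psi> U"
proof -
  have vc: "v \<in> carrier_vec n" "\<phi> \<in> carrier_vec n" using vp by (auto simp: dual_pair_def)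
  have fsub: "subsp d U" if "U \<in> \<F>" for U using F that by (auto simp: flag_def)
  show thesis
  proof (cases "f *\<^sub>v v = 0\<^sub>v d")
    case True
    show thesis
    proof (rule that[of "0\<^sub>v d" "0\<^sub>v d"])
      show "commutes_with f v \<phi> (0\<^sub>v d) (0\<^sub>v d)" using f True zero_pair[OF f] by (simp add: commutes_with_def)
      show "preserves (0\<^sub>v d) (0\<^sub>v d) U" if "U \<in> \<F>" for U
        using subspD(2)[OF fsub[OF that]] by (simp add: preserves_def)
    qed (simp add: dual_pair_def)
  next
    case False
    have "\<phi> \<bullet> v = 1"
    proof (rule ccontr)
      assume "\<phi> \<bullet> v \<noteq> 1"
      then have "v = 0\<^sub>v n" using vp by (simp add: dual_pair_def)
      then show False using False zero_pair[OF f] by simp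
    qed
    \<comment> \<open>The zero subspace is added so that there is a largest member without \<open>f v\<close>.\<close>
    let ?A = "{U \<in> insert {0\<^sub>v d} \<F>. f *\<^sub>v v \<notin> U}"
    obtain M where M: "M \<in> ?A" "\<And>U. U \<in> ?A \<Longrightarrow> U \<subseteq> M"
      by (rule flag_greatest[OF flag_insert_zero[OF F], of ?A]) (use False in auto)
    have sM: "subsp d M" using M(1) fsub subsp_zero by auto
    have pM: "\<phi> \<bullet> x = 0" if "x \<in> carrier_vec n" "f *\<^sub>v x \<in> M" for x
      using pres[of M] M(1) that vc by (auto simp: preserves_def)
    \<comment> \<open>The sum of \<open>f (ker \<phi>)\<close> and \<open>M\<close>, on which \<open>\<psi>\<close> is to vanish.\<close>
    let ?H = "{f *\<^sub>v x + u | x u. x \<in> carrier_vec n \<and> \<phi> \<bullet> x = 0 \<and> u \<in> M}"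
    have H: "subsp d ?H"
      unfolding subsp_def
    proof (intro conjI ballI allI)
      show "?H \<subseteq> carrier_vec d" using f subspD(1)[OF sM] by auto
      have "0\<^sub>v d = f *\<^sub>v 0\<^sub>v n + 0\<^sub>v d" using zero_pair[OF f] by simp
      then show "0\<^sub>v d \<in> ?H" using subspD(2)[OF sM] vc by (intro CollectI exI[of _ "0\<^sub>v n"] exI[of _ "0\<^sub>v d"]) simp
      fix a b assume "a \<in> ?H" "b \<in> ?H"
      then obtain x u y t where *: "a = f *\<^sub>v x + u" "b = f *\<^sub>v y + t" "x \<in> carrier_vec n" "y \<in> carrier_vec n"
        "\<phi> \<bullet> x = 0" "\<phi> \<bullet> y = 0" "u \<in> M" "t \<in> M" by blast
      have "a + b = f *\<^sub>v (x + y) + (u + t)"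
        unfolding *(1,2) mult_add_distrib_mat_vec[OF f *(3,4)]
        using f *(3,4) subspD(1)[OF sM *(7)] subspD(1)[OF sM *(8)] by (auto intro!: eq_vecI)
      moreover have "\<phi> \<bullet> (x + y) = 0" using scalar_prod_add_distrib[OF vc(2) *(3,4)] *(5,6) by simp
      ultimately show "a + b \<in> ?H" using subspD(3)[OF sM *(7,8)] *(3,4) by (intro CollectI exI[of _ "x + y"] exI[of _ "u + t"]) simp
    next
      fix c a assume "a \<in> ?H"
      then obtain x u where *: "a = f *\<^sub>v x + u" "x \<in> carrier_vec n" "\<phi> \<bullet> x = 0" "u \<in> M" by blast
      have "c \<cdot>\<^sub>v a = f *\<^sub>v (c \<cdot>\<^sub>v x) + c \<cdot>\<^sub>v u"
        unfolding *(1) mult_mat_vec[OF f *(2)]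
        using f *(2) subspD(1)[OF sM *(4)] by (auto intro!: eq_vecI simp: algebra_simps)
      moreover have "\<phi> \<bullet> (c \<cdot>\<^sub>v x) = 0" using vc(2) *(2,3) by simp
      ultimately show "c \<cdot>\<^sub>v a \<in> ?H" using subspD(4)[OF sM *(4)] *(2) by (intro CollectI exI[of _ "c \<cdot>\<^sub>v x"] exI[of _ "c \<cdot>\<^sub>v u"]) simp
    qed
    have "f *\<^sub>v v \<notin> ?H"
    proof
      assume "f *\<^sub>v v \<in> ?H"
      then obtain x u where *: "f *\<^sub>v v = f *\<^sub>v x + u" "x \<in> carrier_vec n" "\<phi> \<bullet> x = 0" "u \<in> M" by blast
      have "f *\<^sub>v (v - x) = f *\<^sub>v v - f *\<^sub>v x" by (rule mult_minus_distrib_mat_vec[OF f vc(1) *(2)])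
      also have "\<dots> = u" unfolding *(1) using f *(2) subspD(1)[OF sM *(4)] by (auto intro!: eq_vecI)
      finally have "\<phi> \<bullet> (v - x) = 0" using pM[of "v - x"] *(2,4) vc by simp
      then show False using \<open>\<phi> \<bullet> v = 1\<close> *(3) scalar_prod_minus_distrib[OF vc(2,1) *(2)] by simp
    qed
    then obtain \<psi> where \<psi>: "\<psi> \<in> carrier_vec d" "\<psi> \<bullet> (f *\<^sub>v v) = 1" "\<And>h. h \<in> ?H \<Longrightarrow> \<psi> \<bullet> h = 0"
      using separating_functional[OF H, of "f *\<^sub>v v"] f vc by auto
    have ker: "\<psi> \<bullet> (f *\<^sub>v x) = 0" if "x \<in> carrier_vec n" "\<phi> \<bullet> x = 0" for x
    proof (rule \<psi>(3))
      show "f *\<^sub>v x \<in> ?H" using that f subspD(2)[OF sM] by (intro CollectI exI[of _ x] exI[of _ "0\<^sub>v d"]) simp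
    qed
    have ext: "\<psi> \<bullet> (f *\<^sub>v x) = \<phi> \<bullet> x" if x: "x \<in> carrier_vec n" for x
    proof -
      let ?y = "x - (\<phi> \<bullet> x) \<cdot>\<^sub>v v"
      have "\<phi> \<bullet> ?y = 0" using x vc \<open>\<phi> \<bullet> v = 1\<close> by (subst scalar_prod_minus_distrib[of _ n]) auto
      then have "\<psi> \<bullet> (f *\<^sub>v ?y) = 0" using ker[of ?y] x vc by simp
      also have "f *\<^sub>v ?y = f *\<^sub>v x - (\<phi> \<bullet> x) \<cdot>\<^sub>v (f *\<^sub>v v)"
        using x vc mult_minus_distrib_mat_vec[OF f x, of "(\<phi> \<bullet> x) \<cdot>\<^sub>v v"] mult_mat_vec[OF f vc(1)] by simp
      finally show ?thesis using f \<psi>(1,2) x vc by (subst (asm) scalar_prod_minus_distrib[of _ d]) auto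
    qed
    have "f\<^sup>T *\<^sub>v \<psi> = \<phi>"
    proof (rule eq_vecI)
      fix i assume "i < dim_vec \<phi>"
      then have i: "i < n" using vc by simp
      have "(f\<^sup>T *\<^sub>v \<psi>) $ i = (f\<^sup>T *\<^sub>v \<psi>) \<bullet> unit_vec n i"
        using f \<psi>(1) i by (subst scalar_prod_right_unit) auto
      also have "\<dots> = \<psi> \<bullet> (f *\<^sub>v unit_vec n i)" using f \<psi>(1) by (intro transpose_vec_mult_scalar) auto
      also have "\<dots> = \<phi> \<bullet> unit_vec n i" by (rule ext) simp
      also have "\<dots> = \<phi> $ i" using vc i by (intro scalar_prod_right_unit) auto
      finally show "(f\<^sup>T *\<^sub>v \<psi>) $ i = \<phi> $ i" .
    qed (use f vc in auto)
    then show thesis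
    proof (intro that[of "f *\<^sub>v v" \<psi>])
      show "dual_pair d (f *\<^sub>v v) \<psi>" using \<psi>(1,2) f vc by (auto simp: dual_pair_def)
      show "commutes_with f v \<phi> (f *\<^sub>v v) \<psi>" if "f\<^sup>T *\<^sub>v \<psi> = \<phi>" using that by (simp add: commutes_with_def)
      fix U assume U: "U \<in> \<F>"
      show "preserves (f *\<^sub>v v) \<psi> U"
      proof (cases "f *\<^sub>v v \<in> U")
        case False
        then have UM: "U \<subseteq> M" using M(2) U by blast
        have "\<psi> \<bullet> u = 0" if u: "u \<in> U" for u
        proof (rule \<psi>(3))
          have "u = f *\<^sub>v 0\<^sub>v n + u" using zero_pair[OF f] subspD(1)[OF fsub[OF U] u] by simp
          then show "u \<in> ?H" using u UM vc by (intro CollectI exI[of _ "0\<^sub>v n"] exI[of _ u]) auto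
        qed
        then show ?thesis by (simp add: preserves_def)
      qed (simp add: preserves_def)
    qed
  qed
qed

text \<open>Here the functional is simply pulled back; it is the vector \<open>v\<close> that has to be lifted along \<open>f\<close>,
  to the smallest member of the flag whose image contains it.\<close>

lemma extend_backward:
  fixes f :: "'k :: field mat"
  assumes f: "f \<in> carrier_mat n d" and F: "flag d \<F>" and vp: "dual_pair n v \<phi>"
    and pres: "\<And>U. U \<in> insert (carrier_vec d) \<F> \<Longrightarrow> preserves v \<phi> ((\<lambda>x. f *\<^sub>v x) ` U)"
  obtains w \<psi> where "dual_pair d w \<psi>" "commutes_with f w \<psi> v \<phi>" "\<And>U. U \<in> \<F> \<Longrightarrow> preserves w \<psi> U"
proof -
  have vc: "v \<in> carrier_vec n" "\<phi> \<in> carrier_vec n" using vp by (auto simp: dual_pair_def)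
  have fsub: "subsp d U" if "U \<in> \<F>" for U using F that by (auto simp: flag_def)
  have tr: "(f\<^sup>T *\<^sub>v \<phi>) \<bullet> x = \<phi> \<bullet> (f *\<^sub>v x)" if "x \<in> carrier_vec d" for x
    using transpose_vec_mult_scalar[OF f that vc(2)] .
  show thesis
  proof (cases "\<phi> \<bullet> v = 1 \<and> v \<in> (\<lambda>x. f *\<^sub>v x) ` carrier_vec d")
    case False
    \<comment> \<open>The image of \<open>f\<close> is preserved but does not contain \<open>v\<close>, or the pair is zero: the idempotent extends by
      zero.\<close>
    have "f\<^sup>T *\<^sub>v \<phi> = 0\<^sub>v d"
    proof (cases "\<phi> \<bullet> v = 1")
      case True
      then have 0: "\<phi> \<bullet> (f *\<^sub>v x) = 0" if "x \<in> carrier_vec d" for x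
        using pres[of "carrier_vec d"] False that by (auto simp: preserves_def)
      show ?thesis
      proof (rule eq_vecI)
        fix i assume "i < dim_vec (0\<^sub>v d :: 'k vec)"
        then have i: "i < d" by simp
        have "(f\<^sup>T *\<^sub>v \<phi>) $ i = (f\<^sup>T *\<^sub>v \<phi>) \<bullet> unit_vec d i"
          using f vc i by (subst scalar_prod_right_unit) auto
        then show "(f\<^sup>T *\<^sub>v \<phi>) $ i = 0\<^sub>v d $ i" using tr[of "unit_vec d i"] 0[of "unit_vec d i"] i by simp
      qed (use f in auto)
    next
      case False
      then show ?thesis using vp zero_pair[OF f] by (simp add: dual_pair_def)
    qed
    then show thesis
    proof (intro that[of "0\<^sub>v d" "0\<^sub>v d"])
      show "commutes_with f (0\<^sub>v d) (0\<^sub>v d) v \<phi>" if "f\<^sup>T *\<^sub>v \<phi> = 0\<^sub>v d"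
        using f that zero_pair[OF f] by (simp add: commutes_with_def)
      show "preserves (0\<^sub>v d) (0\<^sub>v d) U" if "U \<in> \<F>" for U
        using subspD(2)[OF fsub[OF that]] by (simp add: preserves_def)
    qed (simp add: dual_pair_def)
  next
    case True
    let ?A = "{U \<in> insert (carrier_vec d) \<F>. v \<in> (\<lambda>x. f *\<^sub>v x) ` U}"
    obtain M where M: "M \<in> ?A" "\<And>U. U \<in> ?A \<Longrightarrow> M \<subseteq> U"
      by (rule flag_least[OF flag_insert_carrier[OF F], of ?A]) (use True in auto)
    then obtain w where w: "w \<in> M" "v = f *\<^sub>v w" by blast
    have wc: "w \<in> carrier_vec d" using w(1) M(1) fsub subspD(1) by auto
    show thesis
    proof (rule that[of w "f\<^sup>T *\<^sub>v \<phi>"])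
      show "dual_pair d w (f\<^sup>T *\<^sub>v \<phi>)" using wc f vc True tr[OF wc] w(2) by (auto simp: dual_pair_def)
      show "commutes_with f w (f\<^sup>T *\<^sub>v \<phi>) v \<phi>" using w(2) by (simp add: commutes_with_def)
      fix U assume U: "U \<in> \<F>"
      show "preserves w (f\<^sup>T *\<^sub>v \<phi>) U"
      proof (cases "w \<in> U")
        case False
        then have "v \<notin> (\<lambda>x. f *\<^sub>v x) ` U" using M(2)[of U] U w(1) by blast
        then have "\<phi> \<bullet> (f *\<^sub>v u) = 0" if "u \<in> U" for u using pres[of U] U that by (auto simp: preserves_def)
        then show ?thesis using tr subspD(1)[OF fsub[OF U]] by (simp add: preserves_def)
      qed (simp add: preserves_def)
    qed
  qed
qed

text \<open>A nonzero vector in the smallest nonzero member of the flag lies in all nonzero members.\<close>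

lemma flag_preserving_pair_exists:
  assumes F: "flag d (\<F> :: 'k :: field vec set set)" and d: "d > 0"
  obtains w \<psi> where "dual_pair d w \<psi>" "\<psi> \<bullet> w = 1" "\<And>U. U \<in> \<F> \<Longrightarrow> preserves w \<psi> U"
proof -
  have fsub: "subsp d U" if "U \<in> insert (carrier_vec d) \<F>" for U using F that subsp_carrier by (auto simp: flag_def)
  let ?A = "{U \<in> insert (carrier_vec d) \<F>. U \<noteq> {0\<^sub>v d}}"
  have "unit_vec d 0 \<in> carrier_vec d" "unit_vec d 0 \<noteq> (0\<^sub>v d :: 'k vec)"
    using d by (auto dest!: arg_cong[of _ _ "\<lambda>v. v $ 0"])
  then have "carrier_vec d \<noteq> {0\<^sub>v d :: 'k vec}" by blast
  then obtain M where M: "M \<in> ?A" "\<And>U. U \<in> ?A \<Longrightarrow> M \<subseteq> U"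
    by (rule_tac flag_least[OF flag_insert_carrier[OF F], of ?A]) auto
  have sM: "subsp d M" using M(1) fsub by blast
  obtain w where w: "w \<in> M" "w \<noteq> 0\<^sub>v d" using M(1) subspD(2)[OF sM] by blast
  have wc: "w \<in> carrier_vec d" using subspD(1)[OF sM w(1)] .
  obtain \<psi> where \<psi>: "\<psi> \<in> carrier_vec d" "\<psi> \<bullet> w = 1"
    using separating_functional[OF subsp_zero wc] w(2) by blast
  show thesis
  proof (rule that[of w \<psi>])
    show "dual_pair d w \<psi>" using wc \<psi> by (simp add: dual_pair_def)
    show "\<psi> \<bullet> w = 1" by (rule \<psi>(2))
    fix U assume U: "U \<in> \<F>"
    show "preserves w \<psi> U"
    proof (cases "U = {0\<^sub>v d}")
      case True then show ?thesis using \<psi>(1) by (simp add: preserves_def)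
    next
      case False then show ?thesis using M(2)[of U] U w(1) by (auto simp: preserves_def)
    qed
  qed
qed

text \<open>Going along the chain, the flag at the last vertex is pulled back or pushed forward along the last
  arrow, whichever its direction, and a rank one idempotent that preserves the new flag is extended by
  one more vertex.\<close>

lemma chain_idempotent:
  fixes V :: "('v, 'a, 'k :: field) qrep"
  assumes "wf_digraph G" and V: "is_rep G V" and chain: "is_chain G N p"
    and "1 \<le> m" "m \<le> N" "flag (vdim V (p m)) \<F>" "\<exists>k\<in>{1..m}. vdim V (p k) > 0"
  shows "\<exists>v \<phi>. (\<forall>k\<in>{1..m}. dual_pair (vdim V (p k)) (v (p k)) (\<phi> (p k))) \<and>
    (\<exists>k\<in>{1..m}. \<phi> (p k) \<bullet> v (p k) = 1) \<and>
    (\<forall>a\<in>arcs G. \<forall>k\<in>{1..<m}. {tail G a, head G a} = {p k, p (k + 1)} \<longrightarrow>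
       commutes_with (amap V a) (v (tail G a)) (\<phi> (tail G a)) (v (head G a)) (\<phi> (head G a))) \<and>
    (\<forall>U\<in>\<F>. preserves (v (p m)) (\<phi> (p m)) U)"
  using assms(4-7)
proof (induction m arbitrary: \<F> rule: nat_induct_at_least)
  case base
  then have d: "vdim V (p 1) > 0" by auto
  obtain w \<psi> where w: "dual_pair (vdim V (p 1)) w \<psi>" "\<psi> \<bullet> w = 1" "\<And>U. U \<in> \<F> \<Longrightarrow> preserves w \<psi> U"
    using flag_preserving_pair_exists[OF base(2) d] by metis
  show ?case by (rule exI[of _ "\<lambda>_. w"], rule exI[of _ "\<lambda>_. \<psi>"]) (use w in auto)
next
  case (Suc m)
  let ?x = "p (Suc m)"
  have inj: "inj_on p {1..N}" using chain by (auto simp: is_chain_def bij_betw_def)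
  have px: "p k \<noteq> ?x" if "k \<in> {1..m}" for k
    using inj_onD[OF inj, of k "Suc m"] that Suc.prems(1) by auto
  have mN: "m \<in> {1..<N}" using Suc.hyps Suc.prems(1) by auto
  have ex1: "\<exists>!a. a \<in> arcs G \<and> {tail G a, head G a} = {p m, ?x}"
    using bspec[OF chain[unfolded is_chain_def, THEN conjunct2, THEN conjunct1] mN] by simp
  then obtain b where b: "b \<in> arcs G" "{tail G b, head G b} = {p m, ?x}" by (elim ex1E conjE)
  have uniq: "a = b" if "a \<in> arcs G" "{tail G a, head G a} = {p m, ?x}" for a
    using ex1 b that by (elim ex1E) metis
  have old: "tail G a \<noteq> ?x \<and> head G a \<noteq> ?x"
    if "k \<in> {1..<m}" "{tail G a, head G a} = {p k, p (k + 1)}" for a k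
    using px[of k] px[of "k + 1"] that by (auto simp: doubleton_eq_iff)
  note bc = is_repD(1)[OF V b(1)]
  show ?case
  proof (cases "\<exists>k\<in>{1..m}. vdim V (p k) > 0")
    case True
    have extend: ?thesis
      if v: "\<forall>k\<in>{1..m}. dual_pair (vdim V (p k)) (v (p k)) (\<phi> (p k))" "\<exists>k\<in>{1..m}. \<phi> (p k) \<bullet> v (p k) = 1"
        "\<forall>a\<in>arcs G. \<forall>k\<in>{1..<m}. {tail G a, head G a} = {p k, p (k + 1)} \<longrightarrow>
          commutes_with (amap V a) (v (tail G a)) (\<phi> (tail G a)) (v (head G a)) (\<phi> (head G a))"
        and w: "dual_pair (vdim V ?x) w \<psi>" "\<And>U. U \<in> \<F> \<Longrightarrow> preserves w \<psi> U"
        and comp: "commutes_with (amap V b) ((v(?x := w)) (tail G b)) ((\<phi>(?x := \<psi>)) (tail G b))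
          ((v(?x := w)) (head G b)) ((\<phi>(?x := \<psi>)) (head G b))"
      for v \<phi> w \<psi>
    proof (rule exI[of _ "v(?x := w)"], rule exI[of _ "\<phi>(?x := \<psi>)"], intro conjI ballI impI)
      fix k assume "k \<in> {1..Suc m}"
      then show "dual_pair (vdim V (p k)) ((v(?x := w)) (p k)) ((\<phi>(?x := \<psi>)) (p k))"
        using v(1) w(1) px[of k] by (cases "k = Suc m") auto
    next
      obtain k where k: "k \<in> {1..m}" "\<phi> (p k) \<bullet> v (p k) = 1" using v(2) by blast
      then show "\<exists>k\<in>{1..Suc m}. (\<phi>(?x := \<psi>)) (p k) \<bullet> (v(?x := w)) (p k) = 1"
        using px[OF k(1)] by (intro bexI[of _ k]) auto
    next
      fix a k assume a: "a \<in> arcs G" and k: "k \<in> {1..<Suc m}" and e: "{tail G a, head G a} = {p k, p (k + 1)}"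
      show "commutes_with (amap V a) ((v(?x := w)) (tail G a)) ((\<phi>(?x := \<psi>)) (tail G a))
          ((v(?x := w)) (head G a)) ((\<phi>(?x := \<psi>)) (head G a))"
      proof (cases "k = m")
        case True
        then have "a = b" using uniq[OF a] e by simp
        then show ?thesis using comp by blast
      next
        case False
        then have k': "k \<in> {1..<m}" using k by auto
        have "commutes_with (amap V a) (v (tail G a)) (\<phi> (tail G a)) (v (head G a)) (\<phi> (head G a))"
          using v(3) a k' e by blast
        then show ?thesis using old[OF k' e] by simp
      qed
    next
      show "preserves ((v(?x := w)) ?x) ((\<phi>(?x := \<psi>)) ?x) U" if "U \<in> \<F>" for U using w(2)[OF that] by simp
    qed
    have pm: "p m \<noteq> ?x" using px[of m] Suc.hyps by simp
    from b(2) consider (fwd) "tail G b = p m" "head G b = ?x" | (bwd) "tail G b = ?x" "head G b = p m"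
      by (auto simp: doubleton_eq_iff)
    then show ?thesis
    proof cases
      case fwd
      have f: "amap V b \<in> carrier_mat (vdim V ?x) (vdim V (p m))" using bc fwd by simp
      obtain v \<phi> where v: "\<forall>k\<in>{1..m}. dual_pair (vdim V (p k)) (v (p k)) (\<phi> (p k))"
          "\<exists>k\<in>{1..m}. \<phi> (p k) \<bullet> v (p k) = 1"
        "\<forall>a\<in>arcs G. \<forall>k\<in>{1..<m}. {tail G a, head G a} = {p k, p (k + 1)} \<longrightarrow>
          commutes_with (amap V a) (v (tail G a)) (\<phi> (tail G a)) (v (head G a)) (\<phi> (head G a))"
        "\<forall>U\<in>(\<lambda>U. {x \<in> carrier_vec (vdim V (p m)). amap V b *\<^sub>v x \<in> U}) ` insert {0\<^sub>v (vdim V ?x)} \<F>.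
          preserves (v (p m)) (\<phi> (p m)) U"
        using Suc.IH[OF _ flag_preimage[OF f flag_insert_zero[OF Suc.prems(2)]] True] Suc.prems(1) by auto
      have vm: "dual_pair (vdim V (p m)) (v (p m)) (\<phi> (p m))" using v(1) Suc.hyps by simp
      obtain w \<psi> where w: "dual_pair (vdim V ?x) w \<psi>" "commutes_with (amap V b) (v (p m)) (\<phi> (p m)) w \<psi>"
        "\<And>U. U \<in> \<F> \<Longrightarrow> preserves w \<psi> U"
        by (rule extend_forward[OF f Suc.prems(2) vm]) (use v(4) in blast)+
      show ?thesis by (rule extend[OF v(1-3) w(1,3)]) (use w(2) fwd pm in simp_all)
    next
      case bwd
      have f: "amap V b \<in> carrier_mat (vdim V (p m)) (vdim V ?x)" using bc bwd by simp
      obtain v \<phi> where v: "\<forall>k\<in>{1..m}. dual_pair (vdim V (p k)) (v (p k)) (\<phi> (p k))"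
          "\<exists>k\<in>{1..m}. \<phi> (p k) \<bullet> v (p k) = 1"
        "\<forall>a\<in>arcs G. \<forall>k\<in>{1..<m}. {tail G a, head G a} = {p k, p (k + 1)} \<longrightarrow>
          commutes_with (amap V a) (v (tail G a)) (\<phi> (tail G a)) (v (head G a)) (\<phi> (head G a))"
        "\<forall>U\<in>(\<lambda>U. (\<lambda>x. amap V b *\<^sub>v x) ` U) ` insert (carrier_vec (vdim V ?x)) \<F>.
          preserves (v (p m)) (\<phi> (p m)) U"
        using Suc.IH[OF _ flag_image[OF f flag_insert_carrier[OF Suc.prems(2)]] True] Suc.prems(1) by auto
      have vm: "dual_pair (vdim V (p m)) (v (p m)) (\<phi> (p m))" using v(1) Suc.hyps by simp
      obtain w \<psi> where w: "dual_pair (vdim V ?x) w \<psi>" "commutes_with (amap V b) w \<psi> (v (p m)) (\<phi> (p m))"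
        "\<And>U. U \<in> \<F> \<Longrightarrow> preserves w \<psi> U"
        by (rule extend_backward[OF f Suc.prems(2) vm]) (use v(4) in blast)+
      show ?thesis by (rule extend[OF v(1-3) w(1,3)]) (use w(2) bwd pm in simp_all)
    qed
  next
    case False
    \<comment> \<open>All earlier spaces are zero, so the idempotent starts at the last vertex.\<close>
    then have 0: "vdim V (p k) = 0" if "k \<in> {1..m}" for k using that by auto
    have d: "vdim V ?x > 0" using Suc.prems(3) 0 by (metis atLeastAtMost_iff le_Suc_eq less_numeral_extra(3))
    obtain w \<psi> where w: "dual_pair (vdim V ?x) w \<psi>" "\<psi> \<bullet> w = 1" "\<And>U. U \<in> \<F> \<Longrightarrow> preserves w \<psi> U"
      using flag_preserving_pair_exists[OF Suc.prems(2) d] by metis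
    have wc: "w \<in> carrier_vec (vdim V ?x)" "\<psi> \<in> carrier_vec (vdim V ?x)" using w(1) by (auto simp: dual_pair_def)
    define v where "v y = (if y = ?x then w else 0\<^sub>v (vdim V y))" for y
    define \<phi> where "\<phi> y = (if y = ?x then \<psi> else 0\<^sub>v (vdim V y))" for y
    show ?thesis
    proof (rule exI[of _ v], rule exI[of _ \<phi>], intro conjI ballI impI)
      fix k assume "k \<in> {1..Suc m}"
      then show "dual_pair (vdim V (p k)) (v (p k)) (\<phi> (p k))"
        using w(1) by (auto simp: v_def \<phi>_def dual_pair_def)
    next
      show "\<exists>k\<in>{1..Suc m}. \<phi> (p k) \<bullet> v (p k) = 1"
        using w(2) by (intro bexI[of _ "Suc m"]) (auto simp: v_def \<phi>_def)
    next
      fix a k assume a: "a \<in> arcs G" and k: "k \<in> {1..<Suc m}" and e: "{tail G a, head G a} = {p k, p (k + 1)}"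
      have ac: "amap V a \<in> carrier_mat (vdim V (head G a)) (vdim V (tail G a))" by (rule is_repD(1)[OF V a])
      have z: "vdim V (tail G a) = 0 \<or> vdim V (head G a) = 0"
        using e 0[of k] k by (auto simp: doubleton_eq_iff)
      have "amap V a *\<^sub>v v (tail G a) = 0\<^sub>v (vdim V (head G a))"
      proof (cases "tail G a = ?x")
        case True
        then have "vdim V (head G a) = 0" using z d by simp
        then show ?thesis using ac by (auto intro!: eq_vecI)
      qed (use zero_pair[OF ac] in \<open>simp add: v_def\<close>)
      moreover have "(amap V a)\<^sup>T *\<^sub>v \<phi> (head G a) = 0\<^sub>v (vdim V (tail G a))"
      proof (cases "head G a = ?x")
        case True
        then have "vdim V (tail G a) = 0" using z d by simp
        then show ?thesis using ac by (auto intro!: eq_vecI)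
      qed (use zero_pair[OF ac] in \<open>simp add: \<phi>_def\<close>)
      ultimately show "commutes_with (amap V a) (v (tail G a)) (\<phi> (tail G a)) (v (head G a)) (\<phi> (head G a))"
        using ac by (simp add: commutes_with_def)
    next
      show "preserves (v ?x) (\<phi> ?x) U" if "U \<in> \<F>" for U using w(3)[OF that] by (simp add: v_def \<phi>_def)
    qed
  qed
qed

definition outer :: "nat \<Rightarrow> 'k :: field vec \<Rightarrow> 'k vec \<Rightarrow> 'k mat" where
  "outer n v \<phi> = mat n n (\<lambda>(i, j). v $ i * \<phi> $ j)"

lemma outer_mult:
  fixes M :: "'k :: field mat"
  assumes M: "M \<in> carrier_mat d n"
  shows "\<psi> \<in> carrier_vec d \<Longrightarrow> outer d w \<psi> * M = mat d n (\<lambda>(i, j). w $ i * (M\<^sup>T *\<^sub>v \<psi>) $ j)"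
    and "v \<in> carrier_vec n \<Longrightarrow> M * outer n v \<phi> = mat d n (\<lambda>(i, j). (M *\<^sub>v v) $ i * \<phi> $ j)"
  using M by (auto intro!: eq_matI simp: outer_def scalar_prod_def sum_distrib_left sum_distrib_right mult_ac)

lemma outer_idem:
  assumes "dual_pair n v \<phi>"
  shows "outer n v \<phi> * outer n v \<phi> = outer n v (\<phi> :: 'k :: field vec)"
proof (rule eq_matI)
  have c: "v \<in> carrier_vec n" "\<phi> \<in> carrier_vec n" using assms by (auto simp: dual_pair_def)
  fix i j assume "i < dim_row (outer n v \<phi>)" "j < dim_col (outer n v \<phi>)"
  then have ij: "i < n" "j < n" by (auto simp: outer_def)
  have "(outer n v \<phi> * outer n v \<phi>) $$ (i, j) = v $ i * ((\<phi> \<bullet> v) * \<phi> $ j)"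
    using ij c by (auto simp: outer_def scalar_prod_def sum_distrib_left sum_distrib_right mult_ac)
  also have "\<dots> = v $ i * \<phi> $ j" using assms ij by (auto simp: dual_pair_def)
  finally show "(outer n v \<phi> * outer n v \<phi>) $$ (i, j) = outer n v \<phi> $$ (i, j)" using ij by (simp add: outer_def)
qed (auto simp: outer_def)

text \<open>These representations form a finite set that contains a copy of every indecomposable of a chain.\<close>

definition thin_rep :: "('v, 'a) pre_digraph \<Rightarrow> 'v set \<Rightarrow> 'a set \<Rightarrow> ('v, 'a, 'k :: field) qrep" where
  "thin_rep Q R E = \<lparr>vdim = \<lambda>x. of_bool (x \<in> R),
     amap = \<lambda>a. mat (of_bool (head Q a \<in> R)) (of_bool (tail Q a \<in> R)) (\<lambda>_. if a \<in> E then 1 else 0)\<rparr>"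

context fin_digraph
begin

text \<open>The idempotent built along the chain is nonzero, hence the identity of the indecomposable \<open>V\<close>. So \<open>V\<close> is
  thin, the vectors \<open>v x\<close> form bases, and the maps are 0 or 1 in these bases.\<close>

lemma chain_finite:
  assumes chain: "is_chain G N p"
  shows "finite_quiver TYPE('k :: field) G"
proof (rule finite_quiverI)
  let ?F = "(\<lambda>(R, E). thin_rep G R E) ` (Pow (verts G) \<times> Pow (arcs G)) :: ('a, 'b, 'k) qrep set"
  show "finite ?F" by simp
  fix V :: "('a, 'b, 'k) qrep" assume V: "indecomposable_rep G V"
  then have rep: "is_rep G V" and nz: "nonzero_rep G V" by (auto simp: indecomposable_rep_def)
  have vp: "p ` {1..N} = verts G" using chain by (auto simp: is_chain_def bij_betw_def)
  obtain i0 where i0: "i0 \<in> verts G" "vdim V i0 > 0" using nz by (auto simp: nonzero_rep_def)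
  then have "i0 \<in> p ` {1..N}" unfolding vp by simp
  then obtain k0 where k0: "k0 \<in> {1..N}" "vdim V (p k0) > 0" using i0(2) by blast
  have N: "1 \<le> N" using k0 by auto
  have fl: "flag (vdim V (p N)) ({} :: 'k vec set set)" by (simp add: flag_def)
  have ex: "\<exists>k\<in>{1..N}. vdim V (p k) > 0" using k0 by blast
  obtain v \<phi> where v: "\<forall>k\<in>{1..N}. dual_pair (vdim V (p k)) (v (p k)) (\<phi> (p k))"
    "\<exists>k\<in>{1..N}. \<phi> (p k) \<bullet> v (p k) = 1"
    "\<forall>a\<in>arcs G. \<forall>k\<in>{1..<N}. {tail G a, head G a} = {p k, p (k + 1)} \<longrightarrow>
       commutes_with (amap V a) (v (tail G a)) (\<phi> (tail G a)) (v (head G a)) (\<phi> (head G a))"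
    using chain_idempotent[OF wf_digraph_axioms rep chain N order_refl fl ex] by auto
  have dp: "dual_pair (vdim V x) (v x) (\<phi> x)" if "x \<in> verts G" for x
  proof -
    have "x \<in> p ` {1..N}" using vp that by simp
    then show ?thesis using v(1) by blast
  qed
  have vc: "v x \<in> carrier_vec (vdim V x)" "\<phi> x \<in> carrier_vec (vdim V x)" if "x \<in> verts G" for x
    using dp[OF that] by (auto simp: dual_pair_def)
  have comp: "commutes_with (amap V a) (v (tail G a)) (\<phi> (tail G a)) (v (head G a)) (\<phi> (head G a))"
    if a: "a \<in> arcs G" for a
  proof -
    obtain k where "k \<in> {1..<N}" "{tail G a, head G a} = {p k, p (k + 1)}"
      using chain a unfolding is_chain_def by blast
    then show ?thesis using v(3) a by blast
  qed
  define e where "e x = outer (vdim V x) (v x) (\<phi> x)" for x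
  have "idem_endo G V e"
    unfolding idem_endo_def rep_hom_def
  proof (intro conjI ballI)
    fix a assume a: "a \<in> arcs G"
    have h: "head G a \<in> verts G" and t: "tail G a \<in> verts G" using a by auto
    note ac = is_repD(1)[OF rep a]
    show "e (head G a) * amap V a = amap V a * e (tail G a)"
      unfolding e_def outer_mult(1)[OF ac vc(2)[OF h]] outer_mult(2)[OF ac vc(1)[OF t]]
      using comp[OF a] ac vc[OF h] vc[OF t] by (auto intro!: eq_matI simp: commutes_with_def)
  qed (use dp outer_idem in \<open>auto simp: e_def outer_def\<close>)
  moreover obtain k1 where k1: "k1 \<in> {1..N}" "\<phi> (p k1) \<bullet> v (p k1) = 1" using v(2) by blast
  have "e (p k1) \<noteq> 0\<^sub>m (vdim V (p k1)) (vdim V (p k1))"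
  proof
    assume 0: "e (p k1) = 0\<^sub>m (vdim V (p k1)) (vdim V (p k1))"
    have c: "p k1 \<in> verts G" using k1(1) vp by blast
    have 0: "v (p k1) $ i * \<phi> (p k1) $ i = 0" if "i < vdim V (p k1)" for i
      using arg_cong[OF 0, of "\<lambda>M. M $$ (i, i)"] that by (simp add: e_def outer_def)
    have "\<phi> (p k1) \<bullet> v (p k1) = 0"
      using vc[OF c] 0 by (auto simp: scalar_prod_def mult.commute intro!: sum.neutral)
    then show False using k1(2) by simp
  qed
  moreover have "p k1 \<in> verts G" using k1(1) vp by blast
  ultimately have e1: "e x = 1\<^sub>m (vdim V x)" if "x \<in> verts G" for x
    using trivial_idem_if_indecomposable[OF V] that by blast
  define R where "R = {x \<in> verts G. \<phi> x \<bullet> v x = 1}"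
  define E where "E = {a \<in> arcs G. amap V a *\<^sub>v v (tail G a) = v (head G a) \<and>
    (amap V a)\<^sup>T *\<^sub>v \<phi> (head G a) = \<phi> (tail G a)}"
  define A where "A x = mat (vdim V x) (of_bool (x \<in> R)) (\<lambda>(i, j). v x $ i)" for x
  define B where "B x = mat (of_bool (x \<in> R)) (vdim V x) (\<lambda>(i, j). \<phi> x $ j)" for x
  have zero: "v x = 0\<^sub>v (vdim V x)" "\<phi> x = 0\<^sub>v (vdim V x)" if "x \<in> verts G" "x \<notin> R" for x
    using dp[OF that(1)] that by (auto simp: dual_pair_def R_def)
  have "rep_iso G V (thin_rep G R E)"
    unfolding rep_iso_def
  proof (rule exI, rule rep_isomorphismI[of V "thin_rep G R E" B A])
    show "is_rep G V" by (rule rep)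
    show "is_rep G (thin_rep G R E)" by (auto simp: is_rep_def thin_rep_def)
    show "rep_hom G V (thin_rep G R E) B"
      unfolding rep_hom_def
    proof (intro conjI ballI)
      fix a assume a: "a \<in> arcs G"
      have h: "head G a \<in> verts G" and t: "tail G a \<in> verts G" using a by auto
      note ac = is_repD(1)[OF rep a]
      have dims: "dim_row (amap V a) = vdim V (head G a)" "dim_col (amap V a) = vdim V (tail G a)" using ac by auto
      show "B (head G a) * amap V a = amap (thin_rep G R E) a * B (tail G a)"
      proof (rule eq_matI)
        fix i j assume "i < dim_row (amap (thin_rep G R E) a * B (tail G a))"
          "j < dim_col (amap (thin_rep G R E) a * B (tail G a))"
        then have i: "head G a \<in> R" "i = 0" and j: "j < vdim V (tail G a)"
          by (auto simp: thin_rep_def B_def of_bool_def split: if_splits)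
        have "(B (head G a) * amap V a) $$ (i, j) = ((amap V a)\<^sup>T *\<^sub>v \<phi> (head G a)) $ j"
          using i j dims vc[OF h] by (auto simp: B_def scalar_prod_def mult.commute)
        also have "(amap V a)\<^sup>T *\<^sub>v \<phi> (head G a) = (if a \<in> E then \<phi> (tail G a) else 0\<^sub>v (vdim V (tail G a)))"
          using comp[OF a] a dims by (auto simp: commutes_with_def E_def)
        also have "\<dots> $ j = (if a \<in> E then \<phi> (tail G a) $ j else 0)" using j by simp
        also have "\<dots> = (amap (thin_rep G R E) a * B (tail G a)) $$ (i, j)"
          using i j zero(2)[OF t] by (auto simp: thin_rep_def B_def scalar_prod_def)
        finally show "(B (head G a) * amap V a) $$ (i, j) = (amap (thin_rep G R E) a * B (tail G a)) $$ (i, j)" .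
      qed (use dims in \<open>auto simp: thin_rep_def B_def\<close>)
    qed (auto simp: thin_rep_def B_def)
    fix x assume x: "x \<in> verts G"
    show "A x \<in> carrier_mat (vdim V x) (vdim (thin_rep G R E) x)" by (auto simp: thin_rep_def A_def)
    show "B x * A x = 1\<^sub>m (vdim (thin_rep G R E) x)"
      using x vc[OF x] by (auto intro!: eq_matI simp: A_def B_def thin_rep_def R_def scalar_prod_def)
    have "A x * B x = e x"
      using zero[OF x] by (cases "x \<in> R") (auto intro!: eq_matI simp: A_def B_def e_def outer_def scalar_prod_def)
    then show "A x * B x = 1\<^sub>m (vdim V x)" using e1[OF x] by simp
  qed
  moreover have "thin_rep G R E \<in> ?F" by (rule image_eqI[of _ _ "(R, E)"]) (auto simp: R_def E_def)
  ultimately show "\<exists>W\<in>?F. rep_iso G V W" by blast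
qed

end

section \<open>Signed quivers without signs and twins\<close>

lemma invertible_mat_transpose:
  fixes A :: "'k :: field mat"
  assumes A: "A \<in> carrier_mat n m" and inv: "invertible_mat A"
  shows "invertible_mat (A\<^sup>T)"
proof -
  obtain B where B: "B \<in> carrier_mat m n" "A * B = 1\<^sub>m n" "B * A = 1\<^sub>m m" by (rule invertible_matE[OF A inv])
  have "A\<^sup>T * B\<^sup>T = 1\<^sub>m m" "B\<^sup>T * A\<^sup>T = 1\<^sub>m n"
    using A B(1) arg_cong[OF B(2), of transpose_mat] arg_cong[OF B(3), of transpose_mat]
    by (simp_all add: mat_transpose_mult)
  then show ?thesis using invertible_matI(2)[of "A\<^sup>T" m n "B\<^sup>T"] A B(1) by simp
qed

lemma invertible_mat_empty: "invertible_mat (0\<^sub>m 0 0 :: 'k :: field mat)"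
  by (rule invertible_matI(2)[of _ 0 0 "0\<^sub>m 0 0"]) (auto intro!: eq_matI)

context signed_quiver
begin

lemma unsigned_ends:
  assumes uns: "unsigned_quiver S"
  shows "i \<in> verts (quiver S) \<Longrightarrow> vstar S (Inl i) = Inr i"
    and "Inr i \<in> verts SQ \<longleftrightarrow> i \<in> verts (quiver S)"
    and "Inr a \<in> arcs SQ \<longleftrightarrow> a \<in> arcs (quiver S)"
    and "a \<in> arcs (quiver S) \<Longrightarrow> tail SQ (Inr a) = Inr (head (quiver S) a)"
    and "a \<in> arcs (quiver S) \<Longrightarrow> head SQ (Inr a) = Inr (tail (quiver S) a)"
  using uns by (auto simp: unsigned_quiver_def sym_verts sym_arcs sym_ends)

text \<open>Extension by zero to the new vertices keeps a representation indecomposable, and restriction to the old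
  vertices recovers it.\<close>

lemma finite_quiver_if_finite_sym:
  assumes uns: "unsigned_quiver S" and fin: "finite_quiver TYPE('k :: field) SQ"
  shows "finite_quiver TYPE('k) (quiver S)"
proof -
  obtain F :: "('v + 'v, 'a + 'a, 'k) qrep set" where F: "finite F"
    "\<And>V. indecomposable_rep SQ V \<Longrightarrow> \<exists>W\<in>F. rep_iso SQ V W"
    using fin unfolding sym.finite_quiver_iff by blast
  define res :: "('v + 'v, 'a + 'a, 'k) qrep \<Rightarrow> ('v, 'a, 'k) qrep"
    where "res V = \<lparr>vdim = \<lambda>i. vdim V (Inl i), amap = \<lambda>a. amap V (Inl a)\<rparr>" for V
  show ?thesis
  proof (rule Q.finite_quiverI)
    show "finite (res ` F)" using F(1) by simp
    fix X :: "('v, 'a, 'k) qrep" assume X: "indecomposable_rep (quiver S) X"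
    then have rX: "is_rep (quiver S) X" "nonzero_rep (quiver S) X" by (auto simp: indecomposable_rep_def)
    define V :: "('v + 'v, 'a + 'a, 'k) qrep" where "V = \<lparr>vdim = case_sum (vdim X) (\<lambda>_. 0), amap = case_sum (amap X) (\<lambda>_. 0\<^sub>m 0 0)\<rparr>"
    have V: "indecomposable_rep SQ V"
    proof (rule sym.indecomposable_if_trivial_idem)
      show "is_rep SQ V" unfolding is_rep_def
      proof
        fix a assume "a \<in> arcs SQ"
        then show "amap V a \<in> carrier_mat (vdim V (head SQ a)) (vdim V (tail SQ a))"
          using rX(1) unsigned_ends[OF uns] by (cases a) (auto simp: V_def is_rep_def sym_arcs sym_ends)
      qed
      show "nonzero_rep SQ V" using rX(2) by (auto simp: nonzero_rep_def V_def sym_verts intro!: bexI[of _ "Inl _"])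
      fix e assume e: "idem_endo SQ V e"
      have eh: "rep_hom SQ V V e" using e by (simp add: idem_endo_def)
      have "idem_endo (quiver S) X (\<lambda>i. e (Inl i))"
        unfolding idem_endo_def rep_hom_def
      proof (intro conjI ballI)
        fix i assume i: "i \<in> verts (quiver S)"
        show "e (Inl i) \<in> carrier_mat (vdim X i) (vdim X i)"
          using rep_homD(1)[OF eh, of "Inl i"] i by (simp add: V_def sym_verts)
        show "e (Inl i) * e (Inl i) = e (Inl i)" using e i by (simp add: idem_endo_def sym_verts)
      next
        fix a assume a: "a \<in> arcs (quiver S)"
        show "e (Inl (head (quiver S) a)) * amap X a = amap X a * e (Inl (tail (quiver S) a))"
          using rep_hom_comm[OF eh, of "Inl a"] a by (simp add: V_def sym_arcs sym_ends)
      qed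
      then have triv: "(\<forall>i\<in>verts (quiver S). e (Inl i) = 0\<^sub>m (vdim X i) (vdim X i)) \<or>
          (\<forall>i\<in>verts (quiver S). e (Inl i) = 1\<^sub>m (vdim X i))"
        by (rule Q.trivial_idem_if_indecomposable[OF X])
      have r: "e (Inr i) = 0\<^sub>m 0 0" "e (Inr i) = 1\<^sub>m 0" if "Inr i \<in> verts SQ" for i
        using rep_homD(1)[OF eh that] by (auto simp: V_def intro!: eq_matI)
      from triv show "(\<forall>i\<in>verts SQ. e i = 0\<^sub>m (vdim V i) (vdim V i)) \<or> (\<forall>i\<in>verts SQ. e i = 1\<^sub>m (vdim V i))"
      proof
        assume *: "\<forall>i\<in>verts (quiver S). e (Inl i) = 0\<^sub>m (vdim X i) (vdim X i)"
        have "e i = 0\<^sub>m (vdim V i) (vdim V i)" if "i \<in> verts SQ" for i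
          using that * r(1) by (cases i) (auto simp: V_def sym_verts)
        then show ?thesis by blast
      next
        assume *: "\<forall>i\<in>verts (quiver S). e (Inl i) = 1\<^sub>m (vdim X i)"
        have "e i = 1\<^sub>m (vdim V i)" if "i \<in> verts SQ" for i
          using that * r(2) by (cases i) (auto simp: V_def sym_verts)
        then show ?thesis by blast
      qed
    qed
    obtain W where W: "W \<in> F" "rep_iso SQ V W" using F(2)[OF V] by blast
    obtain g where g: "rep_isomorphism SQ V W g" using W(2) by (auto simp: rep_iso_def)
    have "rep_isomorphism (quiver S) X (res W) (\<lambda>i. g (Inl i))"
      unfolding rep_isomorphism_def
    proof (intro conjI ballI)
      show "is_rep (quiver S) X" by (rule rX)
      show "is_rep (quiver S) (res W)"
        unfolding is_rep_def
      proof
        fix a assume "a \<in> arcs (quiver S)"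
        then show "amap (res W) a \<in> carrier_mat (vdim (res W) (head (quiver S) a)) (vdim (res W) (tail (quiver S) a))"
          using g is_repD(1)[of SQ W "Inl a"] by (simp add: rep_isomorphism_def res_def sym_arcs sym_ends)
      qed
      fix i assume i: "i \<in> verts (quiver S)"
      then have "Inl i \<in> verts SQ" by (simp add: sym_verts)
      then have "g (Inl i) \<in> carrier_mat (vdim W (Inl i)) (vdim V (Inl i)) \<and> invertible_mat (g (Inl i))"
        using g unfolding rep_isomorphism_def by blast
      then show "g (Inl i) \<in> carrier_mat (vdim (res W) i) (vdim X i)" "invertible_mat (g (Inl i))"
        by (simp_all add: res_def V_def)
    next
      fix a assume "a \<in> arcs (quiver S)"
      then have "Inl a \<in> arcs SQ" by (simp add: sym_arcs)
      then have "g (head SQ (Inl a)) * amap V (Inl a) = amap W (Inl a) * g (tail SQ (Inl a))"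
        using g unfolding rep_isomorphism_def by blast
      then show "g (Inl (head (quiver S) a)) * amap X a = amap (res W) a * g (Inl (tail (quiver S) a))"
        by (simp add: res_def V_def sym_ends)
    qed
    then show "\<exists>Y\<in>res ` F. rep_iso (quiver S) X Y" using W(1) by (auto simp: rep_iso_def)
  qed
qed

text \<open>The projection onto the part over the old vertices is a central idempotent. An indecomposable is
  thus supported on the old vertices, where it is a representation of the quiver, or on the new ones,
  where its transpose is.\<close>

lemma finite_sym_if_finite_quiver:
  assumes uns: "unsigned_quiver S" and fin: "finite_quiver TYPE('k :: field) (quiver S)"
  shows "finite_quiver TYPE('k) SQ"
proof -
  note ue = unsigned_ends[OF uns]
  obtain F :: "('v, 'a, 'k) qrep set" where F: "finite F"
    "\<And>X. indecomposable_rep (quiver S) X \<Longrightarrow> \<exists>W\<in>F. rep_iso (quiver S) X W"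
    using fin unfolding Q.finite_quiver_iff by blast
  define extL :: "('v, 'a, 'k) qrep \<Rightarrow> ('v + 'v, 'a + 'a, 'k) qrep"
    where "extL W = \<lparr>vdim = case_sum (vdim W) (\<lambda>_. 0), amap = case_sum (amap W) (\<lambda>_. 0\<^sub>m 0 0)\<rparr>" for W
  define extR :: "('v, 'a, 'k) qrep \<Rightarrow> ('v + 'v, 'a + 'a, 'k) qrep"
    where "extR W = \<lparr>vdim = case_sum (\<lambda>_. 0) (vdim W), amap = case_sum (\<lambda>_. 0\<^sub>m 0 0) (\<lambda>a. (amap W a)\<^sup>T)\<rparr>" for W
  show ?thesis
  proof (rule sym.finite_quiverI)
    show "finite (extL ` F \<union> extR ` F)" using F(1) by simp
    fix V :: "('v + 'v, 'a + 'a, 'k) qrep" assume V: "indecomposable_rep SQ V"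
    then have rep: "is_rep SQ V" and nz: "nonzero_rep SQ V" by (auto simp: indecomposable_rep_def)
    have VL: "amap V (Inl a) \<in> carrier_mat (vdim V (Inl (head (quiver S) a))) (vdim V (Inl (tail (quiver S) a)))"
      if "a \<in> arcs (quiver S)" for a
      using is_repD(1)[OF rep, of "Inl a"] that by (simp add: sym_arcs sym_ends)
    have VR: "amap V (Inr a) \<in> carrier_mat (vdim V (Inr (tail (quiver S) a))) (vdim V (Inr (head (quiver S) a)))"
      if "a \<in> arcs (quiver S)" for a
      using is_repD(1)[OF rep, of "Inr a"] that ue by simp
    define c where "c = case_sum (\<lambda>i. 1\<^sub>m (vdim V (Inl i))) (\<lambda>i. 0\<^sub>m (vdim V (Inr i)) (vdim V (Inr i)) :: 'k mat)"
    have "idem_endo SQ V c"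
      unfolding idem_endo_def rep_hom_def
    proof (intro conjI ballI)
      fix i assume "i \<in> verts SQ"
      show "c i \<in> carrier_mat (vdim V i) (vdim V i)" "c i * c i = c i" by (cases i; simp add: c_def)+
    next
      fix a assume a: "a \<in> arcs SQ"
      show "c (head SQ a) * amap V a = amap V a * c (tail SQ a)"
      proof (cases a)
        case (Inl b)
        then show ?thesis using VL[of b] a by (simp add: c_def sym_arcs sym_ends)
      next
        case (Inr b)
        then show ?thesis using VR[of b] a ue(3,4,5) by (simp add: c_def)
      qed
    qed
    from sym.trivial_idem_if_indecomposable[OF V this]
    consider (R) "\<forall>i\<in>verts SQ. c i = 0\<^sub>m (vdim V i) (vdim V i)" | (L) "\<forall>i\<in>verts SQ. c i = 1\<^sub>m (vdim V i)" by blast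
    then show "\<exists>W\<in>extL ` F \<union> extR ` F. rep_iso SQ V W"
    proof cases
      case L
      have 0: "vdim V (Inr i) = 0" if "i \<in> verts (quiver S)" for i
      proof (rule one_mat_eq_zero)
        show "1\<^sub>m (vdim V (Inr i)) = (0\<^sub>m (vdim V (Inr i)) (vdim V (Inr i)) :: 'k mat)"
          using bspec[OF L, of "Inr i"] that ue(2) by (simp add: c_def)
      qed
      define X where "X = \<lparr>vdim = \<lambda>i. vdim V (Inl i), amap = \<lambda>a. amap V (Inl a)\<rparr>"
      have X: "indecomposable_rep (quiver S) X"
      proof (rule Q.indecomposable_if_trivial_idem)
        show "is_rep (quiver S) X" using VL by (simp add: is_rep_def X_def)
        obtain j where j: "j \<in> verts SQ" "vdim V j \<noteq> 0" using nz by (auto simp: nonzero_rep_def)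
        then show "nonzero_rep (quiver S) X" using 0 ue(2)
          by (cases j) (auto simp: nonzero_rep_def X_def sym_verts(1))
        fix e assume e: "idem_endo (quiver S) X e"
        have eh: "rep_hom (quiver S) X X e" using e by (simp add: idem_endo_def)
        have "idem_endo SQ V (case_sum e (\<lambda>_. 0\<^sub>m 0 0))"
          unfolding idem_endo_def rep_hom_def
        proof (intro conjI ballI)
          fix i assume i: "i \<in> verts SQ"
          show "case_sum e (\<lambda>_. 0\<^sub>m 0 0) i \<in> carrier_mat (vdim V i) (vdim V i)"
            using i 0 rep_homD(1)[OF eh] ue(2) by (cases i) (auto simp: X_def sym_verts(1))
          show "case_sum e (\<lambda>_. 0\<^sub>m 0 0) i * case_sum e (\<lambda>_. 0\<^sub>m 0 0) i = case_sum e (\<lambda>_. 0\<^sub>m 0 0) i"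
            using i e by (cases i) (auto simp: idem_endo_def sym_verts(1))
        next
          fix a assume a: "a \<in> arcs SQ"
          show "case_sum e (\<lambda>_. 0\<^sub>m 0 0) (head SQ a) * amap V a = amap V a * case_sum e (\<lambda>_. 0\<^sub>m 0 0) (tail SQ a)"
          proof (cases a)
            case (Inl b)
            then show ?thesis using rep_hom_comm[OF eh, of b] a by (simp add: X_def sym_arcs sym_ends)
          next
            case (Inr b)
            then have b: "b \<in> arcs (quiver S)" using a ue(3) by simp
            then show ?thesis using Inr VR[OF b] ue(4,5)[OF b] 0 by (auto intro!: eq_matI)
          qed
        qed
        from sym.trivial_idem_if_indecomposable[OF V this]
        show "(\<forall>i\<in>verts (quiver S). e i = 0\<^sub>m (vdim X i) (vdim X i)) \<or> (\<forall>i\<in>verts (quiver S). e i = 1\<^sub>m (vdim X i))"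
        proof
          assume *: "\<forall>i\<in>verts SQ. case_sum e (\<lambda>_. 0\<^sub>m 0 0) i = 0\<^sub>m (vdim V i) (vdim V i)"
          have "e i = 0\<^sub>m (vdim X i) (vdim X i)" if "i \<in> verts (quiver S)" for i
            using bspec[OF *, of "Inl i"] that by (simp add: X_def sym_verts(1))
          then show ?thesis by blast
        next
          assume *: "\<forall>i\<in>verts SQ. case_sum e (\<lambda>_. 0\<^sub>m 0 0) i = 1\<^sub>m (vdim V i)"
          have "e i = 1\<^sub>m (vdim X i)" if "i \<in> verts (quiver S)" for i
            using bspec[OF *, of "Inl i"] that by (simp add: X_def sym_verts(1))
          then show ?thesis by blast
        qed
      qed
      obtain W where W: "W \<in> F" "rep_iso (quiver S) X W" using F(2)[OF X] by blast
      obtain g where g: "rep_isomorphism (quiver S) X W g" using W(2) by (auto simp: rep_iso_def)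
      have rW: "is_rep (quiver S) W" using g by (simp add: rep_isomorphism_def)
      have "rep_isomorphism SQ V (extL W) (case_sum g (\<lambda>_. 0\<^sub>m 0 0))"
        unfolding rep_isomorphism_def
      proof (intro conjI ballI)
        show "is_rep SQ V" by (rule rep)
        show "is_rep SQ (extL W)" unfolding is_rep_def
        proof
          fix a assume "a \<in> arcs SQ"
          then show "amap (extL W) a \<in> carrier_mat (vdim (extL W) (head SQ a)) (vdim (extL W) (tail SQ a))"
            using rW ue(3,4,5) by (cases a) (auto simp: extL_def is_rep_def sym_arcs(1) sym_ends(1,2))
        qed
        fix i assume i: "i \<in> verts SQ"
        show "case_sum g (\<lambda>_. 0\<^sub>m 0 0) i \<in> carrier_mat (vdim (extL W) i) (vdim V i)"
          using i g 0 ue(2) by (cases i) (auto simp: rep_isomorphism_def extL_def X_def sym_verts(1))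
        show "invertible_mat (case_sum g (\<lambda>_. 0\<^sub>m 0 0) i)"
          using i g by (cases i) (auto simp: rep_isomorphism_def sym_verts(1) invertible_mat_empty)
      next
        fix a assume a: "a \<in> arcs SQ"
        show "case_sum g (\<lambda>_. 0\<^sub>m 0 0) (head SQ a) * amap V a = amap (extL W) a * case_sum g (\<lambda>_. 0\<^sub>m 0 0) (tail SQ a)"
        proof (cases a)
          case (Inl b)
          then show ?thesis using a g by (simp add: rep_isomorphism_def extL_def X_def sym_arcs sym_ends)
        next
          case (Inr b)
          then have b: "b \<in> arcs (quiver S)" using a ue(3) by simp
          then show ?thesis using Inr VR[OF b] ue(4,5)[OF b] 0 by (auto intro!: eq_matI simp: extL_def)
        qed
      qed
      then show ?thesis using W(1) by (auto simp: rep_iso_def)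
    next
      case R
      have 0: "vdim V (Inl i) = 0" if "i \<in> verts (quiver S)" for i
      proof (rule one_mat_eq_zero)
        show "1\<^sub>m (vdim V (Inl i)) = (0\<^sub>m (vdim V (Inl i)) (vdim V (Inl i)) :: 'k mat)"
          using bspec[OF R, of "Inl i"] that by (simp add: c_def sym_verts(1))
      qed
      define X where "X = \<lparr>vdim = \<lambda>i. vdim V (Inr i), amap = \<lambda>a. (amap V (Inr a))\<^sup>T\<rparr>"
      have X: "indecomposable_rep (quiver S) X"
      proof (rule Q.indecomposable_if_trivial_idem)
        show "is_rep (quiver S) X" using VR by (simp add: is_rep_def X_def)
        obtain j where j: "j \<in> verts SQ" "vdim V j \<noteq> 0" using nz by (auto simp: nonzero_rep_def)
        then show "nonzero_rep (quiver S) X" using 0 ue(2)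
          by (cases j) (auto simp: nonzero_rep_def X_def sym_verts(1))
        fix e assume e: "idem_endo (quiver S) X e"
        have eh: "rep_hom (quiver S) X X e" using e by (simp add: idem_endo_def)
        let ?e = "case_sum (\<lambda>_. 0\<^sub>m 0 0) (\<lambda>i. (e i)\<^sup>T)"
        have "idem_endo SQ V ?e"
          unfolding idem_endo_def rep_hom_def
        proof (intro conjI ballI)
          fix i assume i: "i \<in> verts SQ"
          show "?e i \<in> carrier_mat (vdim V i) (vdim V i)"
            using i 0 rep_homD(1)[OF eh] ue(2) by (cases i) (auto simp: X_def sym_verts(1))
          show "?e i * ?e i = ?e i"
          proof (cases i)
            case (Inr j)
            then have j: "j \<in> verts (quiver S)" using i ue(2) by simp
            have "(e j)\<^sup>T * (e j)\<^sup>T = (e j * e j)\<^sup>T" using rep_homD(1)[OF eh j] by (simp add: mat_transpose_mult)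
            then show ?thesis using Inr e j by (simp add: idem_endo_def)
          qed simp
        next
          fix a assume a: "a \<in> arcs SQ"
          show "?e (head SQ a) * amap V a = amap V a * ?e (tail SQ a)"
          proof (cases a)
            case (Inl b)
            then have b: "b \<in> arcs (quiver S)" using a by (simp add: sym_arcs)
            then show ?thesis using Inl VL[OF b] 0 by (auto intro!: eq_matI simp: sym_ends)
          next
            case (Inr b)
            then have b: "b \<in> arcs (quiver S)" using a ue(3) by simp
            have h: "head (quiver S) b \<in> verts (quiver S)" and t: "tail (quiver S) b \<in> verts (quiver S)" using b by auto
            have "e (head (quiver S) b) * (amap V (Inr b))\<^sup>T = (amap V (Inr b))\<^sup>T * e (tail (quiver S) b)"
              using rep_hom_comm[OF eh b] by (simp add: X_def)
            from arg_cong[OF this, of transpose_mat] show ?thesis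
              using Inr ue(4,5)[OF b] VR[OF b] rep_homD(1)[OF eh h] rep_homD(1)[OF eh t]
              by (simp add: mat_transpose_mult X_def)
          qed
        qed
        from sym.trivial_idem_if_indecomposable[OF V this]
        show "(\<forall>i\<in>verts (quiver S). e i = 0\<^sub>m (vdim X i) (vdim X i)) \<or> (\<forall>i\<in>verts (quiver S). e i = 1\<^sub>m (vdim X i))"
        proof
          assume *: "\<forall>i\<in>verts SQ. ?e i = 0\<^sub>m (vdim V i) (vdim V i)"
          have "e i = 0\<^sub>m (vdim X i) (vdim X i)" if "i \<in> verts (quiver S)" for i
            using bspec[OF *, of "Inr i"] that ue(2) arg_cong[of "(e i)\<^sup>T" _ transpose_mat]
            by (simp add: X_def) (metis Matrix.transpose_transpose zero_transpose_mat)
          then show ?thesis by blast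
        next
          assume *: "\<forall>i\<in>verts SQ. ?e i = 1\<^sub>m (vdim V i)"
          have "e i = 1\<^sub>m (vdim X i)" if "i \<in> verts (quiver S)" for i
            using bspec[OF *, of "Inr i"] that ue(2)
            by (simp add: X_def) (metis Matrix.transpose_transpose transpose_one)
          then show ?thesis by blast
        qed
      qed
      obtain W where W: "W \<in> F" "rep_iso (quiver S) X W" using F(2)[OF X] by blast
      obtain g where g: "rep_isomorphism (quiver S) W X g"
        using Q.rep_iso_sym[OF W(2)] by (auto simp: rep_iso_def)
      have rW: "is_rep (quiver S) W" using g by (simp add: rep_isomorphism_def)
      have gc: "g i \<in> carrier_mat (vdim V (Inr i)) (vdim W i)" "invertible_mat (g i)" if "i \<in> verts (quiver S)" for i
        using g that by (auto simp: rep_isomorphism_def X_def)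
      let ?g = "case_sum (\<lambda>_. 0\<^sub>m 0 0) (\<lambda>i. (g i)\<^sup>T)"
      have "rep_isomorphism SQ V (extR W) ?g"
        unfolding rep_isomorphism_def
      proof (intro conjI ballI)
        show "is_rep SQ V" by (rule rep)
        show "is_rep SQ (extR W)" unfolding is_rep_def
        proof
          fix a assume "a \<in> arcs SQ"
          then show "amap (extR W) a \<in> carrier_mat (vdim (extR W) (head SQ a)) (vdim (extR W) (tail SQ a))"
            using rW ue(3,4,5) by (cases a) (auto simp: extR_def is_rep_def sym_arcs(1) sym_ends(1,2))
        qed
        fix i assume i: "i \<in> verts SQ"
        show "?g i \<in> carrier_mat (vdim (extR W) i) (vdim V i)"
          using i gc(1) 0 ue(2) by (cases i) (auto simp: extR_def sym_verts(1))
        show "invertible_mat (?g i)"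
          using i gc invertible_mat_transpose[OF gc] ue(2)
          by (cases i) (auto simp: sym_verts(1) invertible_mat_empty)
      next
        fix a assume a: "a \<in> arcs SQ"
        show "?g (head SQ a) * amap V a = amap (extR W) a * ?g (tail SQ a)"
        proof (cases a)
          case (Inl b)
          then have b: "b \<in> arcs (quiver S)" using a by (simp add: sym_arcs)
          then show ?thesis using Inl VL[OF b] 0 by (auto intro!: eq_matI simp: sym_ends extR_def)
        next
          case (Inr b)
          then have b: "b \<in> arcs (quiver S)" using a ue(3) by simp
          have h: "head (quiver S) b \<in> verts (quiver S)" and t: "tail (quiver S) b \<in> verts (quiver S)" using b by auto
          have "g (head (quiver S) b) * amap W b = (amap V (Inr b))\<^sup>T * g (tail (quiver S) b)"
            using g b by (simp add: rep_isomorphism_def X_def)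
          from arg_cong[OF this, of transpose_mat] show ?thesis
            using Inr ue(4,5)[OF b] VR[OF b] gc(1)[OF h] gc(1)[OF t] is_repD(1)[OF rW b]
            by (simp add: mat_transpose_mult extR_def)
        qed
      qed
      then show ?thesis using W(1) by (auto simp: rep_iso_def)
    qed
  qed
qed

section \<open>The symmetric quivers of the listed types are chains\<close>

text \<open>The chain \<open>p\<close> is unfolded along its signed end: the involution reverses the numbering \<open>q\<close> of
  the symmetric quiver, whose length \<open>N\<close> is \<open>2n - 1\<close> for a signed vertex and \<open>2n - 2\<close> for a twin pair. The first \<open>N - n\<close> vertices
  and the first \<open>N - n\<close> arrows are the ones that acquire mirror images.\<close>

lemma sym_quiver_chain:
  assumes chain: "is_chain (quiver S) n p" and N: "1 \<le> n" "n \<le> N" "N \<le> 2 * n - 1"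
    and star: "\<And>k. k \<in> {1..n} \<Longrightarrow> vstar S (Inl (p k)) = (if k \<le> N - n then Inr (p k) else Inl (p (N + 1 - k)))"
    and sgn: "\<And>a k. a \<in> arcs (quiver S) \<Longrightarrow> k \<in> {1..<n} \<Longrightarrow>
      {tail (quiver S) a, head (quiver S) a} = {p k, p (k + 1)} \<Longrightarrow> asign S a = 0 \<longleftrightarrow> k \<le> N - n"
  shows "\<exists>q. is_chain SQ N q"
proof -
  have inj: "inj_on p {1..n}" and img: "p ` {1..n} = verts (quiver S)"
    using chain by (auto simp: is_chain_def bij_betw_def)
  define q where "q k = (if k \<le> n then Inl (p k) else Inr (p (N + 1 - k)))" for k
  have qstar: "vstar S (Inl (p k)) = q (N + 1 - k)" if "k \<in> {1..n}" for k
    using star[OF that] that N by (auto simp: q_def)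
  have pin: "p k \<in> verts (quiver S)" if "k \<in> {1..n}" for k using img that by blast
  have pidx: "\<exists>k\<in>{1..n}. i = p k" if "i \<in> verts (quiver S)" for i using img that by blast
  have Inr_iff: "Inr (p k) \<in> verts SQ \<longleftrightarrow> k \<le> N - n" if k: "k \<in> {1..n}" for k
  proof -
    have "Inr (p k) \<in> verts SQ \<longleftrightarrow> vstar S (Inl (p k)) = Inr (p k)"
      using pin[OF k] by (cases "p k" rule: vstar_Inl_cases) (auto simp: sym_verts simp del: vstar.simps)
    then show ?thesis using star[OF k] by (auto split: if_splits)
  qed
  have injq: "inj_on q {1..N}"
  proof (rule inj_onI)
    fix k l assume k: "k \<in> {1..N}" and l: "l \<in> {1..N}" and kl: "q k = q l"
    show "k = l"
    proof (cases "k \<le> n")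
      case True
      then have "l \<le> n" "p k = p l" using kl by (auto simp: q_def split: if_splits)
      then show ?thesis using inj_onD[OF inj, of k l] True k l by auto
    next
      case False
      then have ln: "\<not> l \<le> n" and pp: "p (N + 1 - k) = p (N + 1 - l)" using kl by (auto simp: q_def split: if_splits)
      have "N + 1 - k \<in> {1..n}" "N + 1 - l \<in> {1..n}" using False ln k l N by auto
      then have "N + 1 - k = N + 1 - l" using inj_onD[OF inj pp] by blast
      then show ?thesis using k l by auto
    qed
  qed
  have imgq: "q ` {1..N} = verts SQ"
  proof (intro equalityI subsetI)
    fix i assume "i \<in> q ` {1..N}"
    then obtain k where k: "k \<in> {1..N}" "i = q k" by blast
    show "i \<in> verts SQ"
    proof (cases "k \<le> n")
      case True then show ?thesis using k pin[of k] by (auto simp: q_def sym_verts(1))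
    next
      case False
      have "N + 1 - k \<in> {1..n}" "N + 1 - k \<le> N - n" using False k N by auto
      then show ?thesis using k(2) False Inr_iff[of "N + 1 - k"] by (simp add: q_def)
    qed
  next
    fix i assume i: "i \<in> verts SQ"
    show "i \<in> q ` {1..N}"
    proof (cases i)
      case (Inl j)
      then obtain k where "k \<in> {1..n}" "j = p k" using i pidx[of j] by (auto simp: sym_verts(1))
      then show ?thesis using Inl N by (intro image_eqI[of _ _ k]) (auto simp: q_def)
    next
      case (Inr j)
      then have "j \<in> verts (quiver S)" using i by (simp add: sym_verts)
      then obtain k where k: "k \<in> {1..n}" "j = p k" using pidx[of j] by blast
      then have "k \<le> N - n" using Inr_iff[OF k(1)] i Inr by simp
      then show ?thesis using Inr k N by (intro image_eqI[of _ _ "N + 1 - k"]) (auto simp: q_def)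
    qed
  qed
  have pair_index: "k = l" if "k \<in> {1..<N}" "l \<in> {1..<N}" "{q k, q (k + 1)} = {q l, q (l + 1)}" for k l
  proof -
    have *: "k \<in> {1..N}" "k + 1 \<in> {1..N}" "l \<in> {1..N}" "l + 1 \<in> {1..N}" using that(1,2) by auto
    have "q k = q l \<or> q k = q (l + 1) \<and> q (k + 1) = q l" using that(3) by (auto simp: doubleton_eq_iff)
    then show ?thesis
      using inj_onD[OF injq _ *(1) *(3)] inj_onD[OF injq _ *(1) *(4)] inj_onD[OF injq _ *(2) *(3)] by auto
  qed
  have arcL: "{tail SQ (Inl b), head SQ (Inl b)} = {q k, q (k + 1)}"
    if "k \<in> {1..<n}" "{tail (quiver S) b, head (quiver S) b} = {p k, p (k + 1)}" for b k
    using that by (auto simp: sym_ends q_def doubleton_eq_iff)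
  have arcR: "{tail SQ (Inr b), head SQ (Inr b)} = {q (N - k), q (N - k + 1)}"
    if k: "k \<in> {1..<n}" and e: "{tail (quiver S) b, head (quiver S) b} = {p k, p (k + 1)}" for b k
  proof -
    have k1: "k \<in> {1..n}" "k + 1 \<in> {1..n}" using k by auto
    have i: "N + 1 - k = N - k + 1" "N + 1 - (k + 1) = N - k" using k N by auto
    show ?thesis using e qstar[OF k1(1)] qstar[OF k1(2)] unfolding i
      by (auto simp: sym_ends doubleton_eq_iff simp del: vstar.simps)
  qed
  have Qidx: "\<exists>k\<in>{1..<n}. {tail (quiver S) b, head (quiver S) b} = {p k, p (k + 1)}" if "b \<in> arcs (quiver S)" for b
    using chain that by (simp add: is_chain_def)
  have Quniq: "b = c" if "b \<in> arcs (quiver S)" "c \<in> arcs (quiver S)" "k \<in> {1..<n}"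
    "{tail (quiver S) b, head (quiver S) b} = {p k, p (k + 1)}" "{tail (quiver S) c, head (quiver S) c} = {p k, p (k + 1)}"
    for b c k
    using chain that unfolding is_chain_def by blast
  have idx: "\<exists>k\<in>{1..<N}. {tail SQ a, head SQ a} = {q k, q (k + 1)} \<and>
      (\<exists>b l. l \<in> {1..<n} \<and> b \<in> arcs (quiver S) \<and> {tail (quiver S) b, head (quiver S) b} = {p l, p (l + 1)} \<and>
        (a = Inl b \<and> k = l \<or> a = Inr b \<and> k = N - l \<and> l \<le> N - n))" if a: "a \<in> arcs SQ" for a
  proof (cases a)
    case (Inl b)
    then have b: "b \<in> arcs (quiver S)" using a by (simp add: sym_arcs)
    obtain k where k: "k \<in> {1..<n}" "{tail (quiver S) b, head (quiver S) b} = {p k, p (k + 1)}" using Qidx[OF b] by blast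
    have "k \<in> {1..<N}" using k(1) N by auto
    then show ?thesis using arcL[OF k] k b Inl by blast
  next
    case (Inr b)
    then have b: "b \<in> arcs (quiver S)" "asign S b = 0" using a by (simp_all add: sym_arcs)
    obtain k where k: "k \<in> {1..<n}" "{tail (quiver S) b, head (quiver S) b} = {p k, p (k + 1)}" using Qidx[OF b(1)] by blast
    have kN: "k \<le> N - n" using sgn[OF b(1) k] b(2) by simp
    then have "N - k \<in> {1..<N}" using k(1) N by auto
    then show ?thesis using arcR[OF k] k b Inr kN by blast
  qed
  have "is_chain SQ N q"
    unfolding is_chain_def
  proof (intro conjI ballI)
    show "bij_betw q {1..N} (verts SQ)" using injq imgq by (simp add: bij_betw_def)
    fix k assume k: "k \<in> {1..<N}"
    have ex: "\<exists>a. a \<in> arcs SQ \<and> {tail SQ a, head SQ a} = {q k, q (k + 1)}"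
    proof (cases "k < n")
      case True
      then have k': "k \<in> {1..<n}" using k by auto
      obtain b where b: "b \<in> arcs (quiver S)" "{tail (quiver S) b, head (quiver S) b} = {p k, p (k + 1)}"
        using chain k' unfolding is_chain_def by blast
      then show ?thesis using arcL[OF k' b(2)] by (intro exI[of _ "Inl b"]) (simp add: sym_arcs)
    next
      case False
      then have k': "N - k \<in> {1..<n}" "N - k \<le> N - n" "N - (N - k) = k" using k N by auto
      obtain b where b: "b \<in> arcs (quiver S)" "{tail (quiver S) b, head (quiver S) b} = {p (N - k), p (N - k + 1)}"
        using chain k'(1) unfolding is_chain_def by blast
      have "asign S b = 0" using sgn[OF b(1) k'(1) b(2)] k'(2) by simp
      then show ?thesis using arcR[OF k'(1) b(2)] b(1) unfolding k'(3) by (intro exI[of _ "Inr b"]) (simp add: sym_arcs)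
    qed
    have uniq: "a = c" if a: "a \<in> arcs SQ" "{tail SQ a, head SQ a} = {q k, q (k + 1)}"
      and c: "c \<in> arcs SQ" "{tail SQ c, head SQ c} = {q k, q (k + 1)}" for a c
    proof -
      obtain i b l where i: "i \<in> {1..<N}" "{tail SQ a, head SQ a} = {q i, q (i + 1)}" "l \<in> {1..<n}" "b \<in> arcs (quiver S)"
        "{tail (quiver S) b, head (quiver S) b} = {p l, p (l + 1)}"
        "a = Inl b \<and> i = l \<or> a = Inr b \<and> i = N - l \<and> l \<le> N - n" using idx[OF a(1)] by blast
      obtain j d m where j: "j \<in> {1..<N}" "{tail SQ c, head SQ c} = {q j, q (j + 1)}" "m \<in> {1..<n}" "d \<in> arcs (quiver S)"
        "{tail (quiver S) d, head (quiver S) d} = {p m, p (m + 1)}"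
        "c = Inl d \<and> j = m \<or> c = Inr d \<and> j = N - m \<and> m \<le> N - n" using idx[OF c(1)] by blast
      have "i = k" by (rule pair_index[OF i(1) k]) (use i(2) a(2) in simp)
      moreover have "j = k" by (rule pair_index[OF j(1) k]) (use j(2) c(2) in simp)
      ultimately have "i = j" by simp
      then have "(a = Inl b \<and> c = Inl d \<or> a = Inr b \<and> c = Inr d) \<and> l = m"
        using i(3,6) j(3,6) N by auto
      then show ?thesis using Quniq[OF i(4) j(4) i(3) i(5)] j(5) by auto
    qed
    show "\<exists>!a. a \<in> arcs SQ \<and> {tail SQ a, head SQ a} = {q k, q (k + 1)}" using ex uniq by (intro ex_ex1I) auto
  next
    fix a assume "a \<in> arcs SQ"
    then show "\<exists>k\<in>{1..<N}. {tail SQ a, head SQ a} = {q k, q (k + 1)}" using idx by blast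
  qed
  then show ?thesis by blast
qed

lemma vertex_signed_chain_finite:
  assumes ch: "vertex_signed_chain \<epsilon> n S" and \<epsilon>: "\<epsilon> \<noteq> 0"
  shows "finite_quiver TYPE('k :: field) SQ"
proof -
  obtain p where n: "n \<ge> 1" and p: "is_chain (quiver S) n p" "vsign S (p n) = \<epsilon>" "\<And>k. k \<in> {1..<n} \<Longrightarrow> vsign S (p k) = 0"
    "\<And>a. a \<in> arcs (quiver S) \<Longrightarrow> asign S a = 0" "twins S = {}"
    using ch by (auto simp: vertex_signed_chain_def)
  have "\<exists>q. is_chain SQ (2 * n - 1) q"
  proof (rule sym_quiver_chain[OF p(1) n])
    fix k assume k: "k \<in> {1..n}"
    show "vstar S (Inl (p k)) = (if k \<le> 2 * n - 1 - n then Inr (p k) else Inl (p (2 * n - 1 + 1 - k)))"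
    proof (cases "k = n")
      case True
      then show ?thesis using p(2) \<epsilon> n by (auto simp: mult_2)
    next
      case False
      then have "k \<in> {1..<n}" using k by auto
      then show ?thesis using p(3)[of k] p(5) by auto
    qed
  next
    fix a k assume "a \<in> arcs (quiver S)" "k \<in> {1..<n}"
    then show "asign S a = 0 \<longleftrightarrow> k \<le> 2 * n - 1 - n" using p(4)[of a] by auto
  qed (use n in auto)
  then show ?thesis using sym.chain_finite by blast
qed

lemma twin_signed_chain_finite:
  assumes ch: "twin_signed_chain \<epsilon> n S" and \<epsilon>: "\<epsilon> \<noteq> 0"
  shows "finite_quiver TYPE('k :: field) SQ"
proof -
  obtain p where n: "n \<ge> 2" and p: "is_chain (quiver S) n p" "twins S = {{p (n - 1), p n}}"
    "\<And>k. k \<in> {1..n} \<Longrightarrow> vsign S (p k) = 0"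
    "\<And>a. a \<in> arcs (quiver S) \<Longrightarrow> asign S a = (if {tail (quiver S) a, head (quiver S) a} = {p (n - 1), p n} then \<epsilon> else 0)"
    using ch by (auto simp: twin_signed_chain_def)
  have inj: "inj_on p {1..n}" using p(1) by (auto simp: is_chain_def bij_betw_def)
  have p_eq: "p k = p l \<longleftrightarrow> k = l" if "k \<in> {1..n}" "l \<in> {1..n}" for k l using inj_on_eq_iff[OF inj that] .
  have tw: "twin S (p (n - 1)) = p n" "twin S (p n) = p (n - 1)"
    using p(2) by (auto intro!: twin_eqI simp: insert_commute)
  have "\<exists>q. is_chain SQ (2 * n - 2) q"
  proof (rule sym_quiver_chain[OF p(1)])
    fix k assume k: "k \<in> {1..n}"
    consider "k = n" | "k = n - 1" | "k \<le> n - 2" "k \<noteq> n" "k \<noteq> n - 1"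
      using k n by (cases "k = n"; cases "k = n - 1") auto
    then show "vstar S (Inl (p k)) = (if k \<le> 2 * n - 2 - n then Inr (p k) else Inl (p (2 * n - 2 + 1 - k)))"
    proof cases
      case 1
      have "p n \<in> \<Union> (twins S)" using p(2) by auto
      moreover have "2 * n - 2 + 1 - n = n - 1" "\<not> n \<le> 2 * n - 2 - n" using n by auto
      ultimately show ?thesis unfolding 1 using vstar_simps(2)[of "p n"] tw by simp
    next
      case 2
      have "p (n - 1) \<in> \<Union> (twins S)" using p(2) by auto
      moreover have "2 * n - 2 + 1 - (n - 1) = n" "\<not> n - 1 \<le> 2 * n - 2 - n" using n by auto
      ultimately show ?thesis unfolding 2 using vstar_simps(2)[of "p (n - 1)"] tw by simp
    next
      case 3
      have "p k \<notin> \<Union> (twins S)" using p(2) p_eq[OF k, of n] p_eq[OF k, of "n - 1"] 3 n by auto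
      moreover have "k \<le> 2 * n - 2 - n" using 3 n by auto
      ultimately show ?thesis using vstar_simps(3)[of "p k"] p(3)[OF k] by simp
    qed
  next
    fix a k assume a: "a \<in> arcs (quiver S)" and k: "k \<in> {1..<n}"
      and e: "{tail (quiver S) a, head (quiver S) a} = {p k, p (k + 1)}"
    have "{p k, p (k + 1)} = {p (n - 1), p n} \<longleftrightarrow> k = n - 1"
    proof
      have r: "k \<in> {1..n}" "n - 1 \<in> {1..n}" "n \<in> {1..n}" using k n by auto
      assume "{p k, p (k + 1)} = {p (n - 1), p n}"
      then have "p k = p (n - 1) \<or> p k = p n" by (auto simp: doubleton_eq_iff)
      then have "k = n - 1 \<or> k = n" unfolding p_eq[OF r(1,2)] p_eq[OF r(1,3)] .
      then show "k = n - 1" using k by auto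
    next
      assume "k = n - 1"
      then have "k + 1 = n" using n by simp
      then show "{p k, p (k + 1)} = {p (n - 1), p n}" using \<open>k = n - 1\<close> by simp
    qed
    then have "asign S a = 0 \<longleftrightarrow> k \<noteq> n - 1" using p(4)[OF a] \<epsilon> unfolding e by auto
    then show "asign S a = 0 \<longleftrightarrow> k \<le> 2 * n - 2 - n" using k n by auto
  qed (use n in auto)
  then show ?thesis using sym.chain_finite by blast
qed

end

section \<open>Signed quivers with finite symmetric quiver\<close>

text \<open>A walk that uses \<open>a\<close> is cut before its first and after its last use of \<open>a\<close>.\<close>

lemma linked_remove_arc:
  assumes "linked Q F x y"
  shows "linked Q (F - {a}) x y \<or> linked Q (F - {a}) x (tail Q a) \<and> linked Q (F - {a}) (head Q a) y \<or>
    linked Q (F - {a}) x (head Q a) \<and> linked Q (F - {a}) (tail Q a) y"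
  using assms
proof (induction rule: rtrancl_induct)
  case base then show ?case by blast
next
  case (step y z)
  from step.hyps(2) obtain b where b: "b \<in> F" "(y = tail Q b \<and> z = head Q b) \<or> (y = head Q b \<and> z = tail Q b)"
    by (auto simp: edges_def)
  show ?case
  proof (cases "b = a")
    case True
    then show ?thesis using step.IH b(2) by auto
  next
    case False
    then have "(y, z) \<in> edges Q (F - {a})" using b by (auto simp: edges_def)
    then show ?thesis using step.IH by (meson rtrancl.rtrancl_into_rtrancl)
  qed
qed

text \<open>An arc of a minimal subset of \<open>F\<close> that still joins \<open>x\<close> and \<open>y\<close> lies on a cycle, which closes up
  through \<open>F'\<close>.\<close>

lemma two_disjoint_links:
  assumes "finite F" "linked Q F x y" "linked Q F' x y" "x \<noteq> y" "F \<inter> F' = {}"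
  shows "\<exists>a\<in>F. linked Q (F \<union> F' - {a}) (tail Q a) (head Q a)"
  using assms
proof (induction F rule: finite_psubset_induct)
  case (psubset F)
  show ?case
  proof (cases "\<exists>a\<in>F. linked Q (F - {a}) x y")
    case True
    then obtain a where a: "a \<in> F" "linked Q (F - {a}) x y" by blast
    have "F - {a} \<subset> F" "(F - {a}) \<inter> F' = {}" using a(1) psubset.prems(4) by auto
    then obtain b where b: "b \<in> F - {a}" "linked Q (F - {a} \<union> F' - {b}) (tail Q b) (head Q b)"
      using psubset.IH[of "F - {a}"] a(2) psubset.prems(2,3) by blast
    then have "linked Q (F \<union> F' - {b}) (tail Q b) (head Q b)" by (elim linked_mono) auto
    then show ?thesis using b(1) by blast
  next
    case False
    have "F \<noteq> {}" using psubset.prems(1,3) by (auto simp: edges_def)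
    then obtain a where a: "a \<in> F" by blast
    have sub: "F - {a} \<subseteq> F \<union> F' - {a}" "F' \<subseteq> F \<union> F' - {a}" using a psubset.prems(4) by auto
    have xy: "linked Q (F \<union> F' - {a}) x y" by (rule linked_mono[OF psubset.prems(2) sub(2)])
    from linked_remove_arc[OF psubset.prems(1), of a] False a
    have "linked Q (F - {a}) x (tail Q a) \<and> linked Q (F - {a}) (head Q a) y \<or>
        linked Q (F - {a}) x (head Q a) \<and> linked Q (F - {a}) (tail Q a) y" by blast
    then have "linked Q (F \<union> F' - {a}) (tail Q a) (head Q a)"
    proof
      assume *: "linked Q (F - {a}) x (tail Q a) \<and> linked Q (F - {a}) (head Q a) y"
      have "linked Q (F \<union> F' - {a}) (tail Q a) x" using linked_sym[OF linked_mono[OF conjunct1[OF *] sub(1)]] .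
      moreover have "linked Q (F \<union> F' - {a}) y (head Q a)" using linked_sym[OF linked_mono[OF conjunct2[OF *] sub(1)]] .
      ultimately show ?thesis using xy by (meson rtrancl_trans)
    next
      assume *: "linked Q (F - {a}) x (head Q a) \<and> linked Q (F - {a}) (tail Q a) y"
      have "linked Q (F \<union> F' - {a}) (tail Q a) y" using linked_mono[OF conjunct2[OF *] sub(1)] .
      moreover have "linked Q (F \<union> F' - {a}) x (head Q a)" using linked_mono[OF conjunct1[OF *] sub(1)] .
      ultimately show ?thesis using linked_sym[OF xy] by (meson rtrancl_trans)
    qed
    then show ?thesis using a by blast
  qed
qed

context signed_quiver
begin

lemma linked_Inl: "linked (quiver S) F x y \<Longrightarrow> linked SQ (Inl ` F) (Inl x) (Inl y)"
proof (induction rule: rtrancl_induct)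
  case (step y z)
  have "(Inl y, Inl z) \<in> edges SQ (Inl ` F)" using step.hyps(2) by (auto simp: edges_def sym_ends)
  then show ?case using step.IH by (rule rtrancl.rtrancl_into_rtrancl[rotated])
qed simp

lemma linked_star:
  assumes "linked SQ F x y" "F \<subseteq> arcs SQ"
  shows "linked SQ (astar S ` F) (vstar S x) (vstar S y)"
  using assms(1)
proof (induction rule: rtrancl_induct)
  case (step y z)
  from step.hyps(2) obtain b where b: "b \<in> F" "(y = tail SQ b \<and> z = head SQ b) \<or> (y = head SQ b \<and> z = tail SQ b)"
    by (auto simp: edges_def)
  have "b \<in> arcs SQ" using b(1) assms(2) by blast
  then have "(vstar S y, vstar S z) \<in> edges SQ (astar S ` F)"
    unfolding edges_def using b ends_astar[of b] by (intro UN_I[of "astar S b"]) auto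
  then show ?case using step.IH by (rule rtrancl.rtrancl_into_rtrancl[rotated])
qed simp

lemma not_unsigned_cases:
  assumes "\<not> unsigned_quiver S"
  obtains i where "i \<in> verts (quiver S)" "vsign S i \<noteq> 0" | i where "i \<in> \<Union> (twins S)"
proof (cases "(\<exists>i\<in>verts (quiver S). vsign S i \<noteq> 0) \<or> (\<exists>i. i \<in> \<Union> (twins S))")
  case True then show thesis using that by blast
next
  case False
  have tw: "twins S = {}"
  proof (rule ccontr)
    assume "twins S \<noteq> {}"
    then obtain P where P: "P \<in> twins S" by blast
    then have "P \<noteq> {}" using twins_pairs[OF P] by auto
    then show False using False P by blast
  qed
  have "asign S a = 0" if "a \<in> arcs (quiver S)" for a
  proof (cases "tail (quiver S) a = head (quiver S) a")
    case True
    then show ?thesis using loop_signed_iff[OF that True] False Q.tail_in_verts[OF that] by auto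
  qed (use nonloop_signed_iff[OF that] tw in auto)
  then have "unsigned_quiver S" using False tw by (auto simp: unsigned_quiver_def)
  then show thesis using assms by blast
qed

end

text \<open>The parameter \<open>ty\<close> fixes the ground field of the finiteness hypothesis.\<close>

locale finite_signed = signed_quiver +
  fixes ty :: "'k :: {field, ring_char_0} itself"
  assumes conn: "Digraph_Component.connected (quiver S)"
    and not_unsigned: "\<not> unsigned_quiver S"
    and fin: "finite_quiver TYPE('k) SQ"
begin

lemma Q_linked: "x \<in> verts (quiver S) \<Longrightarrow> y \<in> verts (quiver S) \<Longrightarrow> linked (quiver S) (arcs (quiver S)) x y"
  by (rule connected_linked[OF conn])

lemma Inl_linked:
  "x \<in> verts (quiver S) \<Longrightarrow> y \<in> verts (quiver S) \<Longrightarrow> linked SQ (Inl ` arcs (quiver S)) (Inl x) (Inl y)"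
  by (rule linked_Inl[OF Q_linked])

lemma Inl_arcs_sub: "Inl ` arcs (quiver S) \<subseteq> arcs SQ"
  by (auto simp: sym_arcs)

text \<open>The old vertices and their mirror images are joined at a signed vertex or at a twin.\<close>

lemma sym_linked:
  assumes "x \<in> verts SQ" "y \<in> verts SQ"
  shows "linked SQ (arcs SQ) x y"
proof -
  obtain i j where i: "i \<in> verts (quiver S)" and j: "j \<in> verts (quiver S)" and ij: "vstar S (Inl i) = Inl j"
  proof (rule not_unsigned_cases[OF not_unsigned])
    fix i assume "i \<in> verts (quiver S)" "vsign S i \<noteq> 0"
    then show thesis using that[of i i] by simp
  next
    fix i assume "i \<in> \<Union> (twins S)"
    then show thesis using that[of i "twin S i"] twin_props[of i] vstar_simps(2)[of i] by blast
  qed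
  have L: "linked SQ (arcs SQ) (Inl k) (Inl i)" if "k \<in> verts (quiver S)" for k
    by (rule linked_mono[OF Inl_linked[OF that i] Inl_arcs_sub])
  have all: "linked SQ (arcs SQ) z (Inl i)" if z: "z \<in> verts SQ" for z
  proof (cases z)
    case (Inl k)
    then show ?thesis using z L by (simp add: sym_verts)
  next
    case (Inr k)
    have k: "k \<in> verts (quiver S)" "vstar S (Inl k) = Inr k"
      using z Inr vstar_simps(3)[of k] by (auto simp: sym_verts)
    have "linked SQ (astar S ` arcs SQ) (vstar S (Inl k)) (vstar S (Inl i))"
      by (rule linked_star[OF L[OF k(1)]]) simp
    then have "linked SQ (arcs SQ) (Inr k) (Inl j)"
      unfolding k(2) ij by (rule linked_mono) (use astar_in in auto)
    then show ?thesis using L[OF j] Inr by (meson rtrancl_trans)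
  qed
  show ?thesis using all[OF assms(1)] linked_sym[OF all[OF assms(2)]] by (meson rtrancl_trans)
qed

lemma bridge: "a \<in> arcs SQ \<Longrightarrow> \<not> linked SQ (arcs SQ - {a}) (tail SQ a) (head SQ a)"
  by (rule sym.arc_is_bridge[OF fin]) (auto intro: sym_linked)

lemma Q_no_loop: "a \<in> arcs (quiver S) \<Longrightarrow> tail (quiver S) a \<noteq> head (quiver S) a"
  using bridge[of "Inl a"] by (auto simp: sym_arcs sym_ends)

lemma Q_no_parallel:
  assumes a: "a \<in> arcs (quiver S)" and b: "b \<in> arcs (quiver S)"
    and e: "{tail (quiver S) a, head (quiver S) a} = {tail (quiver S) b, head (quiver S) b}"
  shows "a = b"
proof (rule ccontr)
  assume "a \<noteq> b"
  then have "Inl b \<in> arcs SQ - {Inl a}" using b by (simp add: sym_arcs)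
  from linked_arc[OF this, of SQ] have "linked SQ (arcs SQ - {Inl a}) (Inl (tail (quiver S) b)) (Inl (head (quiver S) b))"
    by (simp add: sym_ends)
  then have "linked SQ (arcs SQ - {Inl a}) (tail SQ (Inl a)) (head SQ (Inl a))"
    using e linked_sym by (auto simp: sym_ends doubleton_eq_iff)
  then show False using bridge[of "Inl a"] a by (simp add: sym_arcs)
qed

text \<open>A partial chain \<open>x\<^sub>0, \<dots>, x\<^sub>m\<close> that starts with the signed vertex (\<open>s = 0\<close>) or with a twin pair joined
  by an arrow (\<open>s = 1\<close>).\<close>

definition core_chain :: "nat \<Rightarrow> (nat \<Rightarrow> 'a) \<Rightarrow> nat \<Rightarrow> bool" where
  "core_chain s x m \<longleftrightarrow> s \<le> m \<and> inj_on x {0..m} \<and> x ` {0..m} \<subseteq> verts (quiver S) \<and>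
    (\<forall>k<m. \<exists>a\<in>arcs (quiver S). {tail (quiver S) a, head (quiver S) a} = {x k, x (Suc k)}) \<and>
    (\<forall>k\<in>{Suc s..m}. vsign S (x k) = 0 \<and> x k \<notin> \<Union> (twins S)) \<and>
    (\<forall>k\<le>s. vstar S (Inl (x k)) = Inl (x (s - k)))"

text \<open>Every arrow inside the partial chain joins consecutive vertices, and every arrow that leaves it does
  so at the last vertex: this is what lets the chain be continued.\<close>

definition closed_chain :: "(nat \<Rightarrow> 'a) \<Rightarrow> nat \<Rightarrow> bool" where
  "closed_chain x m \<longleftrightarrow>
    (\<forall>a\<in>arcs (quiver S). tail (quiver S) a \<in> x ` {0..m} \<longrightarrow> head (quiver S) a \<in> x ` {0..m} \<longrightarrow>
       (\<exists>k<m. {tail (quiver S) a, head (quiver S) a} = {x k, x (Suc k)})) \<and>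
    (\<forall>a\<in>arcs (quiver S). (tail (quiver S) a \<in> x ` {0..m}) \<noteq> (head (quiver S) a \<in> x ` {0..m}) \<longrightarrow>
       x m \<in> {tail (quiver S) a, head (quiver S) a})"

context
  fixes s x m
  assumes cc: "core_chain s x m"
begin

text \<open>The partial chain, its union \<open>C\<close> with its mirror image, and the arrows inside \<open>C\<close>.\<close>

definition "D = x ` {0..m}"
definition "C = Inl ` D \<union> vstar S ` Inl ` D"
definition "I = {a \<in> arcs SQ. tail SQ a \<in> C \<and> head SQ a \<in> C}"

lemma D_sub: "D \<subseteq> verts (quiver S)"
  using cc by (auto simp: core_chain_def D_def)

lemma C_sub: "C \<subseteq> verts SQ"
  using D_sub vstar_in by (auto simp: C_def sym_verts simp del: vstar.simps)

lemma vstar_core: "k \<le> s \<Longrightarrow> vstar S (Inl (x k)) = Inl (x (s - k))"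
  using cc by (simp add: core_chain_def)

lemma vstar_C_iff: "i \<in> verts SQ \<Longrightarrow> vstar S i \<in> C \<longleftrightarrow> i \<in> C"
proof -
  have 1: "vstar S i \<in> C" if "i \<in> C" for i
  proof -
    have "vstar S (vstar S (Inl d)) = Inl d" if "d \<in> D" for d
      using vstar_vstar[of "Inl d"] that D_sub by (auto simp: sym_verts(1) simp del: vstar.simps)
    then show ?thesis using that by (auto simp: C_def simp del: vstar.simps)
  qed
  assume "i \<in> verts SQ"
  then show ?thesis using 1[of i] 1[of "vstar S i"] vstar_vstar by auto
qed

lemma Inl_C_iff: "Inl y \<in> C \<longleftrightarrow> y \<in> D"
proof
  assume "Inl y \<in> C"
  then consider "y \<in> D" | k where "k \<le> m" "Inl y = vstar S (Inl (x k))"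
    by (auto simp: C_def D_def simp del: vstar.simps)
  then show "y \<in> D"
  proof cases
    case (2 k)
    show ?thesis
    proof (cases "k \<le> s")
      case True
      then have "y = x (s - k)" "s - k \<le> m" using 2 vstar_core[OF True] cc by (auto simp: core_chain_def simp del: vstar.simps)
      then show ?thesis by (auto simp: D_def)
    next
      case False
      then have "k \<in> {Suc s..m}" using 2(1) by auto
      then have "vsign S (x k) = 0" "x k \<notin> \<Union> (twins S)" using cc unfolding core_chain_def by blast+
      then show ?thesis using 2(2) vstar_simps(3)[of "x k"] by simp
    qed
  qed
qed (simp add: C_def)

text \<open>The mirror image of the partial chain meets it at \<open>x\<^sub>s\<close>, the star of \<open>x\<^sub>0\<close>.\<close>

lemma C_linked:
  assumes "u \<in> C" "w \<in> C"
  shows "linked SQ I u w"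
proof -
  have xk: "linked SQ I (Inl (x 0)) (Inl (x k))" if "k \<le> m" for k
    using that
  proof (induction k)
    case (Suc k)
    obtain a where a: "a \<in> arcs (quiver S)" "{tail (quiver S) a, head (quiver S) a} = {x k, x (Suc k)}"
      using cc Suc.prems unfolding core_chain_def by (meson Suc_le_lessD)
    have "x k \<in> D" "x (Suc k) \<in> D" using Suc.prems by (auto simp: D_def)
    then have "Inl a \<in> I" using a by (auto simp: I_def sym_arcs sym_ends Inl_C_iff doubleton_eq_iff)
    from linked_arc[OF this, of SQ] have "linked SQ I (Inl (tail (quiver S) a)) (Inl (head (quiver S) a))"
      by (simp add: sym_ends)
    then have "linked SQ I (Inl (x k)) (Inl (x (Suc k)))"
      using a(2) linked_sym by (auto simp: doubleton_eq_iff)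
    then show ?case using Suc by (meson Suc_leD rtrancl_trans)
  qed simp
  have I_star: "astar S ` I \<subseteq> I"
  proof
    fix b assume "b \<in> astar S ` I"
    then obtain a where a: "a \<in> I" "b = astar S a" by blast
    then have "a \<in> arcs SQ" by (simp add: I_def)
    then show "b \<in> I" using a astar_in[of a] ends_astar[of a] vstar_C_iff by (auto simp: I_def)
  qed
  have core: "vstar S (Inl (x 0)) = Inl (x s)" and sm: "s \<le> m"
    using cc vstar_core[of 0] by (auto simp: core_chain_def)
  have star: "linked SQ I (Inl (x 0)) (vstar S (Inl (x k)))" if "k \<le> m" for k
  proof -
    have "linked SQ (astar S ` I) (vstar S (Inl (x 0))) (vstar S (Inl (x k)))"
      by (rule linked_star[OF xk[OF that]]) (auto simp: I_def)
    then have "linked SQ I (Inl (x s)) (vstar S (Inl (x k)))" unfolding core by (rule linked_mono[OF _ I_star])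
    then show ?thesis using xk[OF sm] by (meson rtrancl_trans)
  qed
  have "linked SQ I (Inl (x 0)) z" if "z \<in> C" for z
    using that xk star by (auto simp: C_def D_def simp del: vstar.simps)
  then show ?thesis using assms linked_sym by (meson rtrancl_trans)
qed

lemma boundary_unsigned:
  assumes b: "b \<in> arcs (quiver S)" "(tail (quiver S) b \<in> D) \<noteq> (head (quiver S) b \<in> D)"
  shows "asign S b = 0"
proof (rule ccontr)
  assume "asign S b \<noteq> 0"
  note e = signed_arc_ends[OF b(1) this]
  have "Inl (tail (quiver S) b) \<in> verts SQ" using b(1) by (simp add: sym_verts)
  then show False using vstar_C_iff[of "Inl (tail (quiver S) b)"] b(2) Inl_C_iff by (simp add: e del: vstar.simps)
qed

lemma star_arc_ends_C:
  assumes b: "b \<in> arcs (quiver S)"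
  shows "tail SQ (Inr b) \<in> C \<longleftrightarrow> head (quiver S) b \<in> D" "head SQ (Inr b) \<in> C \<longleftrightarrow> tail (quiver S) b \<in> D"
proof -
  have "Inl (tail (quiver S) b) \<in> verts SQ" "Inl (head (quiver S) b) \<in> verts SQ" using b by (auto simp: sym_verts)
  then show "tail SQ (Inr b) \<in> C \<longleftrightarrow> head (quiver S) b \<in> D" "head SQ (Inr b) \<in> C \<longleftrightarrow> tail (quiver S) b \<in> D"
    using vstar_C_iff Inl_C_iff by (simp_all add: sym_ends del: vstar.simps)
qed

text \<open>Every arrow that leaves the partial chain comes with its mirror image, and at most three arrows
  leave a connected set of vertices of a quiver of finite type.\<close>

lemma boundary_unique:
  assumes b: "b \<in> arcs (quiver S)" "(tail (quiver S) b \<in> D) \<noteq> (head (quiver S) b \<in> D)"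
    and c: "c \<in> arcs (quiver S)" "(tail (quiver S) c \<in> D) \<noteq> (head (quiver S) c \<in> D)"
  shows "b = c"
proof (rule ccontr)
  assume "b \<noteq> c"
  let ?B = "{a \<in> arcs SQ. (tail SQ a \<in> C) \<noteq> (head SQ a \<in> C)}"
  have L: "Inl a \<in> ?B" "Inr a \<in> ?B"
    if a: "a \<in> arcs (quiver S)" "(tail (quiver S) a \<in> D) \<noteq> (head (quiver S) a \<in> D)" for a
  proof -
    show "Inl a \<in> ?B" using a by (simp add: sym_arcs sym_ends Inl_C_iff)
    have "Inr a \<in> arcs SQ" using a boundary_unsigned[OF a] by (simp add: sym_arcs)
    then show "Inr a \<in> ?B" using a star_arc_ends_C[OF a(1)] by simp
  qed
  have "{Inl b, Inl c, Inr b, Inr c} \<subseteq> ?B" using L[OF b] L[OF c] by blast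
  then have "card {Inl b, Inl c, Inr b, Inr c} \<le> card ?B" by (intro card_mono) auto
  moreover have "card {Inl b, Inl c, Inr b, Inr c} = 4" using \<open>b \<noteq> c\<close> by simp
  moreover have "card ?B \<le> 3"
    by (rule sym.boundary_arcs_le_3[OF fin sym_linked C_sub]) (use C_linked in \<open>simp_all add: I_def\<close>)
  ultimately show False by simp
qed

text \<open>If the star of the new vertex \<open>y\<close> were an old vertex, it would be joined to the partial chain inside
  the old quiver, and the mirror image of \<open>b\<close> would close a cycle.\<close>

lemma boundary_end_plain:
  assumes b: "b \<in> arcs (quiver S)" and e: "{tail (quiver S) b, head (quiver S) b} = {d, y}" and d: "d \<in> D" and y: "y \<notin> D"
  shows "vsign S y = 0" "y \<notin> \<Union> (twins S)"
proof -
  have bd: "(tail (quiver S) b \<in> D) \<noteq> (head (quiver S) b \<in> D)" using e d y by (auto simp: doubleton_eq_iff)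
  have Rb: "Inr b \<in> arcs SQ" using b boundary_unsigned[OF b bd] by (simp add: sym_arcs)
  have yv: "y \<in> verts (quiver S)" and dv: "d \<in> verts (quiver S)" using b e by (auto simp: doubleton_eq_iff)
  have no: False if y': "y' \<in> verts (quiver S)" "vstar S (Inl y) = Inl y'" for y'
  proof -
    let ?E = "arcs SQ - {Inr b}"
    have "Inl ` arcs (quiver S) \<subseteq> ?E" using Inl_arcs_sub by auto
    then have 1: "linked SQ ?E (Inl y') (Inl d)" using linked_mono[OF Inl_linked[OF y'(1) dv]] by blast
    have "Inr b \<notin> I" using star_arc_ends_C[OF b] bd by (auto simp: I_def)
    then have "I \<subseteq> ?E" by (auto simp: I_def)
    moreover have "Inl d \<in> C" "vstar S (Inl d) \<in> C" using d by (auto simp: C_def simp del: vstar.simps)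
    ultimately have 2: "linked SQ ?E (Inl d) (vstar S (Inl d))" using linked_mono[OF C_linked] by blast
    have 3: "linked SQ ?E (Inl y') (vstar S (Inl d))" using 1 2 by (rule rtrancl_trans)
    have "(tail SQ (Inr b) = Inl y' \<and> head SQ (Inr b) = vstar S (Inl d)) \<or>
        (head SQ (Inr b) = Inl y' \<and> tail SQ (Inr b) = vstar S (Inl d))"
      using e y'(2) by (auto simp: sym_ends doubleton_eq_iff simp del: vstar.simps)
    then have "linked SQ ?E (tail SQ (Inr b)) (head SQ (Inr b))" using 3 linked_sym[OF 3] by auto
    then show False using bridge[OF Rb] by blast
  qed
  show "vsign S y = 0" using no[OF yv] vstar_simps(1)[of y] by blast
  show "y \<notin> \<Union> (twins S)" using no[of "twin S y"] twin_props(3)[of y] vstar_simps(2)[of y] by blast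
qed

end

text \<open>By connectedness some arrow leaves the partial chain, only one does so, and it starts at the last
  vertex; its other end is plain and continues the chain.\<close>

lemma chain_extends:
  assumes cc: "core_chain s x m" and cl: "closed_chain x m" and ne: "x ` {0..m} \<noteq> verts (quiver S)"
  shows "\<exists>x'. core_chain s x' (Suc m) \<and> closed_chain x' (Suc m)"
proof -
  let ?D = "x ` {0..m}"
  note D = D_def[OF cc]
  have Dv: "?D \<subseteq> verts (quiver S)" using D_sub[OF cc] unfolding D .
  then obtain y0 where y0: "y0 \<in> verts (quiver S)" "y0 \<notin> ?D" using ne by blast
  have x0: "x 0 \<in> ?D" "x 0 \<in> verts (quiver S)" using Dv by auto
  have "\<exists>b\<in>arcs (quiver S). (tail (quiver S) b \<in> ?D) \<noteq> (head (quiver S) b \<in> ?D)"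
    using linked_invariant[OF Q_linked[OF x0(2) y0(1)], of "\<lambda>i. i \<in> ?D"] x0(1) y0(2) by blast
  then obtain b where b: "b \<in> arcs (quiver S)" "(tail (quiver S) b \<in> ?D) \<noteq> (head (quiver S) b \<in> ?D)" by blast
  have "x m \<in> {tail (quiver S) b, head (quiver S) b}" using cl b unfolding closed_chain_def by blast
  moreover have xm: "x m \<in> ?D" by simp
  ultimately obtain y where y: "{tail (quiver S) b, head (quiver S) b} = {x m, y}" "y \<notin> ?D"
    using b(2) by (cases "tail (quiver S) b = x m") auto
  have yv: "y \<in> verts (quiver S)" using b(1) y(1) by (auto simp: doubleton_eq_iff)
  have plain: "vsign S y = 0" "y \<notin> \<Union> (twins S)"
    using boundary_end_plain[OF cc b(1) y(1)] xm y(2) unfolding D by auto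
  have uniq: "a = b" if "a \<in> arcs (quiver S)" "(tail (quiver S) a \<in> ?D) \<noteq> (head (quiver S) a \<in> ?D)" for a
    using boundary_unique[OF cc, unfolded D, OF that b] .
  define x' where "x' = x(Suc m := y)"
  have x'k: "x' k = x k" if "k \<le> m" for k using that by (simp add: x'_def)
  have x'y: "x' (Suc m) = y" by (simp add: x'_def)
  have D': "x' ` {0..Suc m} = insert y ?D"
    unfolding atLeast0AtMost atMost_Suc image_insert x'y using x'k by (auto simp: image_iff)
  have "core_chain s x' (Suc m)"
    unfolding core_chain_def
  proof (intro conjI allI impI ballI)
    show "s \<le> Suc m" using cc by (simp add: core_chain_def)
    have "inj_on x {0..m}" using cc by (simp add: core_chain_def)
    then have "inj_on x' {0..m}" using x'k by (simp add: inj_on_def)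
    moreover have "x' (Suc m) \<notin> x' ` {0..m}" using y(2) x'k x'y by (auto simp: image_iff)
    moreover have "{0..Suc m} = insert (Suc m) {0..m}" by auto
    ultimately show "inj_on x' {0..Suc m}" by simp
    show "x' ` {0..Suc m} \<subseteq> verts (quiver S)" unfolding D' using yv Dv by blast
    show "\<exists>a\<in>arcs (quiver S). {tail (quiver S) a, head (quiver S) a} = {x' k, x' (Suc k)}" if "k < Suc m" for k
    proof (cases "k = m")
      case True then show ?thesis using b(1) y(1) x'k[of m] x'y by auto
    next
      case False
      then have "k < m" using that by simp
      then show ?thesis using cc x'k[of k] x'k[of "Suc k"] by (simp add: core_chain_def)
    qed
    show "vstar S (Inl (x' k)) = Inl (x' (s - k))" if "k \<le> s" for k
    proof -
      have "s \<le> m" using cc by (simp add: core_chain_def)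
      then have "k \<le> m" "s - k \<le> m" using that by auto
      then show ?thesis using vstar_core[OF cc that] x'k by simp
    qed
    fix k assume k: "k \<in> {Suc s..Suc m}"
    have "vsign S (x' k) = 0 \<and> x' k \<notin> \<Union> (twins S)"
    proof (cases "k = Suc m")
      case True then show ?thesis using plain x'y by simp
    next
      case False
      then have "k \<in> {Suc s..m}" using k by auto
      then show ?thesis using cc x'k[of k] by (simp add: core_chain_def)
    qed
    then show "vsign S (x' k) = 0" "x' k \<notin> \<Union> (twins S)" by auto
  qed
  moreover have "closed_chain x' (Suc m)"
    unfolding closed_chain_def D'
  proof (intro conjI ballI impI)
    fix a assume a: "a \<in> arcs (quiver S)" "tail (quiver S) a \<in> insert y ?D" "head (quiver S) a \<in> insert y ?D"
    show "\<exists>k<Suc m. {tail (quiver S) a, head (quiver S) a} = {x' k, x' (Suc k)}"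
    proof (cases "tail (quiver S) a \<in> ?D \<and> head (quiver S) a \<in> ?D")
      case True
      then obtain k where "k < m" "{tail (quiver S) a, head (quiver S) a} = {x k, x (Suc k)}"
        using cl a(1) unfolding closed_chain_def by blast
      then show ?thesis using x'k[of k] x'k[of "Suc k"] by (intro exI[of _ k]) auto
    next
      case False
      then have "(tail (quiver S) a \<in> ?D) \<noteq> (head (quiver S) a \<in> ?D)"
        using a(2,3) Q_no_loop[OF a(1)] y(2) by auto
      then have "a = b" by (rule uniq[OF a(1)])
      then show ?thesis using y(1) x'k[of m] x'y by (intro exI[of _ m]) auto
    qed
  next
    fix a assume a: "a \<in> arcs (quiver S)" "(tail (quiver S) a \<in> insert y ?D) \<noteq> (head (quiver S) a \<in> insert y ?D)"
    show "x' (Suc m) \<in> {tail (quiver S) a, head (quiver S) a}"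
    proof (rule ccontr)
      assume n: "x' (Suc m) \<notin> {tail (quiver S) a, head (quiver S) a}"
      then have "(tail (quiver S) a \<in> ?D) \<noteq> (head (quiver S) a \<in> ?D)" using a(2) x'y by auto
      then have "a = b" by (rule uniq[OF a(1)])
      then show False using n y(1) x'y by (auto simp: doubleton_eq_iff)
    qed
  qed
  ultimately show ?thesis by blast
qed

lemma full_chain_exists:
  assumes "core_chain s x m" "closed_chain x m"
  shows "\<exists>x m. core_chain s x m \<and> closed_chain x m \<and> x ` {0..m} = verts (quiver S)"
proof (rule ccontr)
  assume no: "\<not> ?thesis"
  have "\<exists>x. core_chain s x (m + n) \<and> closed_chain x (m + n)" for n
  proof (induction n)
    case 0 then show ?case using assms by auto
  next
    case (Suc n)
    then obtain z where z: "core_chain s z (m + n)" "closed_chain z (m + n)" by blast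
    then have "z ` {0..m + n} \<noteq> verts (quiver S)" using no by blast
    from chain_extends[OF z this] show ?case by simp
  qed
  then obtain z where "core_chain s z (m + card (verts (quiver S)))" by blast
  then have z: "inj_on z {0..m + card (verts (quiver S))}" "z ` {0..m + card (verts (quiver S))} \<subseteq> verts (quiver S)"
    by (auto simp: core_chain_def)
  have "card {0..m + card (verts (quiver S))} \<le> card (verts (quiver S))"
    using card_inj_on_le[OF z] by simp
  then show False by simp
qed

text \<open>The numbering is reversed: the partial chains grow away from the signs, while the listed types carry
  them at the last vertices.\<close>

lemma full_chain_is_chain:
  assumes cc: "core_chain s x m" and cl: "closed_chain x m" and full: "x ` {0..m} = verts (quiver S)"
  shows "is_chain (quiver S) (Suc m) (\<lambda>k. x (Suc m - k))"
  unfolding is_chain_def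
proof (intro conjI ballI)
  have "bij_betw (\<lambda>k. Suc m - k) {1..Suc m} {0..m}"
    by (rule bij_betwI[where g = "\<lambda>k. Suc m - k"]) auto
  moreover have "bij_betw x {0..m} (verts (quiver S))" using cc full by (simp add: core_chain_def bij_betw_def)
  ultimately show "bij_betw (\<lambda>k. x (Suc m - k)) {1..Suc m} (verts (quiver S))"
    using bij_betw_trans[of "\<lambda>k. Suc m - k" "{1..Suc m}" "{0..m}" x] by (simp add: comp_def)
  fix k assume k: "k \<in> {1..<Suc m}"
  have i: "Suc m - k = Suc (m - k)" "Suc m - (k + 1) = m - k" "m - k < m" using k by auto
  obtain a where a: "a \<in> arcs (quiver S)" "{tail (quiver S) a, head (quiver S) a} = {x (m - k), x (Suc (m - k))}"
    using cc i(3) unfolding core_chain_def by blast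
  show "\<exists>!a. a \<in> arcs (quiver S) \<and> {tail (quiver S) a, head (quiver S) a} = {x (Suc m - k), x (Suc m - (k + 1))}"
    unfolding i(1,2)
  proof (rule ex1I[of _ a])
    show "a \<in> arcs (quiver S) \<and> {tail (quiver S) a, head (quiver S) a} = {x (Suc (m - k)), x (m - k)}"
      using a by (auto simp: insert_commute)
    fix c assume c: "c \<in> arcs (quiver S) \<and> {tail (quiver S) c, head (quiver S) c} = {x (Suc (m - k)), x (m - k)}"
    show "c = a" by (rule Q_no_parallel) (use a c in \<open>auto simp: insert_commute\<close>)
  qed
next
  fix a assume a: "a \<in> arcs (quiver S)"
  then have "tail (quiver S) a \<in> x ` {0..m}" "head (quiver S) a \<in> x ` {0..m}" unfolding full by auto
  then obtain k where k: "k < m" "{tail (quiver S) a, head (quiver S) a} = {x k, x (Suc k)}"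
    using cl a unfolding closed_chain_def by blast
  have "Suc m - (m - k) = Suc k" "Suc m - (m - k + 1) = k" "m - k \<in> {1..<Suc m}" using k(1) by auto
  then show "\<exists>k\<in>{1..<Suc m}. {tail (quiver S) a, head (quiver S) a} = {x (Suc m - k), x (Suc m - (k + 1))}"
    using k(2) by (intro bexI[of _ "m - k"]) (auto simp: insert_commute)
qed

text \<open>The chain that grows from a signed vertex covers the quiver. Beyond its first vertex it is plain, and
  without twins and loops no arrow is signed.\<close>

lemma signed_vertex_type:
  assumes i: "i \<in> verts (quiver S)" "vsign S i \<noteq> 0"
  shows "\<exists>n. type_B n S \<or> type_C n S"
proof -
  have "core_chain 0 (\<lambda>_. i) 0" using i by (auto simp: core_chain_def)
  moreover have "closed_chain (\<lambda>_. i) 0"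
    unfolding closed_chain_def
  proof (intro conjI ballI impI)
    fix a assume a: "a \<in> arcs (quiver S)"
    assume "tail (quiver S) a \<in> (\<lambda>_. i) ` {0..0}" "head (quiver S) a \<in> (\<lambda>_. i) ` {0..0}"
    then have "tail (quiver S) a = head (quiver S) a" by auto
    then show "\<exists>k<0. {tail (quiver S) a, head (quiver S) a} = {i, i}" using Q_no_loop[OF a] by blast
  qed auto
  ultimately obtain x m where cc: "core_chain 0 x m" and cl: "closed_chain x m" and full: "x ` {0..m} = verts (quiver S)"
    using full_chain_exists by blast
  have x0: "vstar S (Inl (x 0)) = Inl (x 0)" using vstar_core[OF cc, of 0] by simp
  have x0v: "x 0 \<in> verts (quiver S)" unfolding full[symmetric] by simp
  have s0: "vsign S (x 0) \<noteq> 0"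
    using vstar_fixed_iff[of "Inl (x 0)"] x0 x0v by (simp add: sym_verts(1) sym_vsign_def del: vstar.simps)
  have plain: "vsign S (x k) = 0" "x k \<notin> \<Union> (twins S)" if "k \<in> {1..m}" for k
    using cc that unfolding core_chain_def by auto
  have tw: "twins S = {}"
  proof (rule ccontr)
    assume "twins S \<noteq> {}"
    then obtain P where P: "P \<in> twins S" by blast
    then have "P \<noteq> {}" using twins_pairs[OF P] by auto
    then obtain j where j: "j \<in> \<Union> (twins S)" using P by blast
    then have "j \<in> x ` {0..m}" unfolding full by (rule twin_props(6))
    then obtain k where k: "k \<le> m" "j = x k" by auto
    show False
    proof (cases "k = 0")
      case True then show ?thesis using twin_props(5)[OF j] s0 k(2) by simp
    next
      case False then show ?thesis using plain(2)[of k] k j by simp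
    qed
  qed
  have as: "asign S a = 0" if "a \<in> arcs (quiver S)" for a
    using nonloop_signed_iff[OF that Q_no_loop[OF that]] tw by simp
  have "vertex_signed_chain (vsign S (x 0)) (Suc m) S"
    unfolding vertex_signed_chain_def
  proof (intro conjI exI[of _ "\<lambda>k. x (Suc m - k)"])
    show "is_chain (quiver S) (Suc m) (\<lambda>k. x (Suc m - k))" by (rule full_chain_is_chain[OF cc cl full])
    show "\<forall>k\<in>{1..<Suc m}. vsign S (x (Suc m - k)) = 0"
    proof
      fix k assume "k \<in> {1..<Suc m}"
      then have "Suc m - k \<in> {1..m}" by auto
      then show "vsign S (x (Suc m - k)) = 0" by (rule plain(1))
    qed
  qed (use as tw in auto)
  moreover have "vsign S (x 0) = 1 \<or> vsign S (x 0) = -1" using vsign_range[OF x0v] s0 by auto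
  ultimately show ?thesis unfolding type_B_def type_C_def by metis
qed

text \<open>At most one arrow leaves the twin pair. The twin at which it starts has to come last in the initial
  chain, which decides the numbering of the pair. Beyond the pair the chain is plain.\<close>

lemma signed_arc_type:
  assumes a0: "a0 \<in> arcs (quiver S)" "asign S a0 \<noteq> 0"
  shows "\<exists>n. type_B_plus n S \<or> type_C_minus n S"
proof -
  let ?t = "tail (quiver S) a0" and ?h = "head (quiver S) a0"
  have th: "?t \<noteq> ?h" by (rule Q_no_loop[OF a0(1)])
  have v: "?t \<in> verts (quiver S)" "?h \<in> verts (quiver S)" using a0(1) by auto
  note st = signed_arc_ends[OF a0]
  have core: "core_chain 1 z 1" if z: "z 0 = ?t \<and> z 1 = ?h \<or> z 0 = ?h \<and> z 1 = ?t" for z :: "nat \<Rightarrow> 'a"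
    unfolding core_chain_def
  proof (intro conjI allI impI ballI)
    have 01: "{0..1::nat} = {0, 1}" by auto
    show "inj_on z {0..1}" "z ` {0..1} \<subseteq> verts (quiver S)" unfolding 01 using z th v by auto
    show "\<exists>a\<in>arcs (quiver S). {tail (quiver S) a, head (quiver S) a} = {z k, z (Suc k)}" if "k < 1" for k
      using that z a0(1) by (intro bexI[of _ a0]) auto
    show "vstar S (Inl (z k)) = Inl (z (1 - k))" if "k \<le> 1" for k
    proof -
      have "k = 0 \<or> k = 1" using that by auto
      then show ?thesis using z st by (auto simp del: vstar.simps)
    qed
  qed auto
  define z0 where "z0 = (\<lambda>k::nat. if k = 0 then ?t else ?h)"
  define z1 where "z1 = (\<lambda>k::nat. if k = 0 then ?h else ?t)"
  have c0: "core_chain 1 z0 1" and c1: "core_chain 1 z1 1" by (rule core; simp add: z0_def z1_def)+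
  have img: "z0 ` {0..1} = {?t, ?h}" "z1 ` {0..1} = {?t, ?h}"
    by (auto simp: z0_def z1_def image_iff intro: bexI[of _ 0] bexI[of _ 1])
  have inner: "{tail (quiver S) a, head (quiver S) a} = {?t, ?h}"
    if "a \<in> arcs (quiver S)" "tail (quiver S) a \<in> {?t, ?h}" "head (quiver S) a \<in> {?t, ?h}" for a
    using that Q_no_loop[OF that(1)] by auto
  have "closed_chain z0 1 \<or> closed_chain z1 1"
  proof (rule ccontr)
    assume n: "\<not> (closed_chain z0 1 \<or> closed_chain z1 1)"
    \<comment> \<open>If neither numbering worked, an arrow would leave the pair at each of the two twins.\<close>
    have key: "\<exists>a\<in>arcs (quiver S). (tail (quiver S) a \<in> {?t, ?h}) \<noteq> (head (quiver S) a \<in> {?t, ?h}) \<and>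
        z 1 \<notin> {tail (quiver S) a, head (quiver S) a}"
      if nz: "\<not> closed_chain z 1" and zi: "z ` {0..1} = {?t, ?h}" and z01: "{z 0, z 1} = {?t, ?h}" for z
    proof -
      have "\<exists>k<1. {tail (quiver S) a, head (quiver S) a} = {z k, z (Suc k)}"
        if "a \<in> arcs (quiver S)" "tail (quiver S) a \<in> {?t, ?h}" "head (quiver S) a \<in> {?t, ?h}" for a
        using inner[OF that] z01 by (intro exI[of _ "0 :: nat"]) simp
      then show ?thesis using nz unfolding closed_chain_def zi by blast
    qed
    have "{z0 0, z0 1} = {?t, ?h}" "z0 1 = ?h" by (simp_all add: z0_def)
    then obtain a where a: "a \<in> arcs (quiver S)" "(tail (quiver S) a \<in> {?t, ?h}) \<noteq> (head (quiver S) a \<in> {?t, ?h})"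
      "?h \<notin> {tail (quiver S) a, head (quiver S) a}"
      using key[of z0] n img(1) by metis
    have "{z1 0, z1 1} = {?t, ?h}" "z1 1 = ?t" by (simp_all add: z1_def insert_commute)
    then obtain b where b: "b \<in> arcs (quiver S)" "(tail (quiver S) b \<in> {?t, ?h}) \<noteq> (head (quiver S) b \<in> {?t, ?h})"
      "?t \<notin> {tail (quiver S) b, head (quiver S) b}"
      using key[of z1] n img(2) by metis
    have "a = b" using boundary_unique[OF c0, unfolded D_def[OF c0] img, OF a(1,2) b(1,2)] .
    then show False using a b by auto
  qed
  then obtain z where "core_chain 1 z 1" "closed_chain z 1" using c0 c1 by blast
  then obtain x m where cc: "core_chain 1 x m" and cl: "closed_chain x m" and full: "x ` {0..m} = verts (quiver S)"
    using full_chain_exists by blast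
  have m: "1 \<le> m" and inj: "inj_on x {0..m}" using cc by (auto simp: core_chain_def)
  have x01: "x 0 \<noteq> x 1" using inj_onD[OF inj, of 0 1] m by auto
  have xs: "vstar S (Inl (x 0)) = Inl (x 1)" using vstar_core[OF cc, of 0] by simp
  have x0t: "x 0 \<in> \<Union> (twins S)" "twin S (x 0) = x 1"
    using xs x01 by (cases "x 0" rule: vstar_Inl_cases; simp del: vstar.simps)+
  have xt: "{x 0, x 1} \<in> twins S" using twin_props(2)[OF x0t(1)] x0t(2) by simp
  have plain: "vsign S (x k) = 0" "x k \<notin> \<Union> (twins S)" if "k \<in> {2..m}" for k
    using cc that unfolding core_chain_def by (auto simp: numeral_2_eq_2)
  have tw: "twins S = {{x 0, x 1}}"
  proof (rule ccontr)
    assume "twins S \<noteq> {{x 0, x 1}}"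
    then obtain P where P: "P \<in> twins S" "P \<noteq> {x 0, x 1}" using xt by blast
    then have d: "P \<inter> {x 0, x 1} = {}" using twins_disjoint[OF _ xt] by blast
    have "P \<noteq> {}" using twins_pairs[OF P(1)] by auto
    then obtain j where j: "j \<in> P" by blast
    then have jt: "j \<in> \<Union> (twins S)" using P(1) by blast
    then have "j \<in> x ` {0..m}" unfolding full by (rule twin_props(6))
    then obtain k where k: "k \<le> m" "j = x k" by auto
    then have "k \<noteq> 0" using d j by (cases "k = 0") auto
    moreover have "k \<noteq> 1" using d j k(2) by (cases "k = 1") auto
    ultimately have "k \<in> {2..m}" using k(1) by auto
    then show False using plain(2)[of k] k(2) jt by simp
  qed
  have vs: "vsign S (x k) = 0" if "k \<le> m" for k
  proof (cases "k \<le> 1")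
    case True
    then have "k = 0 \<or> k = 1" by auto
    then show ?thesis using twins_unsigned[OF xt, of "x k"] by auto
  next
    case False then show ?thesis using plain(1)[of k] that by simp
  qed
  obtain a1 where a1: "a1 \<in> arcs (quiver S)" "{tail (quiver S) a1, head (quiver S) a1} = {x 0, x 1}"
    using cc m unfolding core_chain_def by (metis One_nat_def Suc_le_lessD)
  have as: "asign S a = (if {tail (quiver S) a, head (quiver S) a} = {x 1, x 0} then asign S a1 else 0)"
    if a: "a \<in> arcs (quiver S)" for a
  proof (cases "{tail (quiver S) a, head (quiver S) a} = {x 0, x 1}")
    case True
    then have "a = a1" using Q_no_parallel[OF a a1(1)] a1(2) by simp
    then show ?thesis using True by (simp add: insert_commute)
  next
    case False
    then have "asign S a = 0" using nonloop_signed_iff[OF a Q_no_loop[OF a]] tw by auto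
    then show ?thesis using False by (simp add: insert_commute)
  qed
  have "asign S a1 \<noteq> 0" using nonloop_signed_iff[OF a1(1) Q_no_loop[OF a1(1)]] a1(2) xt by simp
  then have e: "asign S a1 = 1 \<or> asign S a1 = -1" using asign_range[OF a1(1)] by auto
  have "twin_signed_chain (asign S a1) (Suc m) S"
    unfolding twin_signed_chain_def
  proof (intro conjI exI[of _ "\<lambda>k. x (Suc m - k)"])
    show "2 \<le> Suc m" using m by simp
    show "is_chain (quiver S) (Suc m) (\<lambda>k. x (Suc m - k))" by (rule full_chain_is_chain[OF cc cl full])
    have i: "Suc m - (Suc m - 1) = 1" "Suc m - Suc m = 0" using m by auto
    show "twins S = {{x (Suc m - (Suc m - 1)), x (Suc m - Suc m)}}" unfolding i using tw by (simp add: insert_commute)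
    show "\<forall>k\<in>{1..Suc m}. vsign S (x (Suc m - k)) = 0" using vs by auto
    show "\<forall>a\<in>arcs (quiver S). asign S a =
        (if {tail (quiver S) a, head (quiver S) a} = {x (Suc m - (Suc m - 1)), x (Suc m - Suc m)} then asign S a1 else 0)"
      unfolding i using as by blast
  qed
  then show ?thesis using e unfolding type_B_plus_def type_C_minus_def by metis
qed

text \<open>A twin pair in a quiver whose arrows are all unsigned is joined by a path of old arrows and also
  by the mirror image of that path, which is made of new arrows.\<close>

lemma signed_type: "\<exists>n. type_B n S \<or> type_B_plus n S \<or> type_C n S \<or> type_C_minus n S"
proof -
  consider (v) i where "i \<in> verts (quiver S)" "vsign S i \<noteq> 0" | (a) a where "a \<in> arcs (quiver S)" "asign S a \<noteq> 0"
    | (t) i where "i \<in> \<Union> (twins S)" "\<forall>a\<in>arcs (quiver S). asign S a = 0"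
    using not_unsigned_cases[OF not_unsigned] by metis
  then show ?thesis
  proof cases
    case v then show ?thesis using signed_vertex_type by blast
  next
    case a then show ?thesis using signed_arc_type by blast
  next
    case t
    let ?j = "twin S i"
    note tp = twin_props[OF t(1)]
    have L: "linked SQ (Inl ` arcs (quiver S)) (Inl i) (Inl ?j)" by (rule Inl_linked[OF tp(6,3)])
    have img: "astar S ` Inl ` arcs (quiver S) = Inr ` arcs (quiver S)" using t(2) by (auto simp: image_iff)
    have "linked SQ (astar S ` Inl ` arcs (quiver S)) (vstar S (Inl i)) (vstar S (Inl ?j))"
      by (rule linked_star[OF L Inl_arcs_sub])
    then have "linked SQ (Inr ` arcs (quiver S)) (Inl ?j) (Inl i)"
      unfolding img using vstar_simps(2)[OF t(1)] vstar_simps(2)[OF tp(4)] twin_twin[OF t(1)] by simp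
    then have R: "linked SQ (Inr ` arcs (quiver S)) (Inl i) (Inl ?j)" by (rule linked_sym)
    have disj: "Inl ` arcs (quiver S) \<inter> Inr ` arcs (quiver S) = ({} :: ('b + 'b) set)" by auto
    have fin': "finite (Inl ` arcs (quiver S) :: ('b + 'b) set)" by simp
    have ne: "(Inl i :: 'a + 'a) \<noteq> Inl ?j" using tp(1) by simp
    obtain a where a: "a \<in> Inl ` arcs (quiver S)"
      "linked SQ (Inl ` arcs (quiver S) \<union> Inr ` arcs (quiver S) - {a}) (tail SQ a) (head SQ a)"
      using two_disjoint_links[OF fin' L R ne disj] by blast
    have "Inl ` arcs (quiver S) \<union> Inr ` arcs (quiver S) \<subseteq> arcs SQ" using t(2) by (auto simp: sym_arcs)
    then have "linked SQ (arcs SQ - {a}) (tail SQ a) (head SQ a)" by (intro linked_mono[OF a(2)]) blast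
    then show ?thesis using bridge[of a] a(1) Inl_arcs_sub by blast
  qed
qed

end

section \<open>The classification\<close>

theorem theorem7p2:
  fixes S :: "('v, 'a) signed_quiver"
  assumes "signed_quiver S"
    and "Digraph_Component.connected (quiver S)"
  shows "(finite_signed_quiver TYPE('k :: {alg_closed_field, field_char_0}) S \<longleftrightarrow>
            finite_quiver TYPE('k) (sym_quiver S)) \<and>
         (finite_quiver TYPE('k) (sym_quiver S) \<longleftrightarrow>
            unsigned_quiver S \<and> finite_quiver TYPE('k) (quiver S) \<or>
            (\<exists>n. type_B n S \<or> type_B_plus n S \<or> type_C n S \<or> type_C_minus n S))"
proof (intro conjI iffI)
  interpret signed_quiver S by (rule assms(1))
  show "finite_signed_quiver TYPE('k) S \<Longrightarrow> finite_quiver TYPE('k) (sym_quiver S)"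
    by (rule finite_quiver_if_finite_signed)
  show "finite_quiver TYPE('k) (sym_quiver S) \<Longrightarrow> finite_signed_quiver TYPE('k) S"
    by (rule finite_signed_if_finite_quiver)
  show "unsigned_quiver S \<and> finite_quiver TYPE('k) (quiver S) \<or>
      (\<exists>n. type_B n S \<or> type_B_plus n S \<or> type_C n S \<or> type_C_minus n S)"
    if fin: "finite_quiver TYPE('k) (sym_quiver S)"
  proof (cases "unsigned_quiver S")
    case True
    then show ?thesis using finite_quiver_if_finite_sym[OF True fin] by blast
  next
    case False
    interpret finite_signed S "TYPE('k)"
      by unfold_locales (use assms(2) False fin in auto)
    show ?thesis using signed_type by blast
  qed
  show "finite_quiver TYPE('k) (sym_quiver S)"
    if "unsigned_quiver S \<and> finite_quiver TYPE('k) (quiver S) \<or>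
      (\<exists>n. type_B n S \<or> type_B_plus n S \<or> type_C n S \<or> type_C_minus n S)"
    using that finite_sym_if_finite_quiver vertex_signed_chain_finite[of 1] vertex_signed_chain_finite[of "- 1"]
      twin_signed_chain_finite[of 1] twin_signed_chain_finite[of "- 1"]
    unfolding type_B_def type_C_def type_B_plus_def type_C_minus_def by force
qed

end
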